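(* Let $G$ be an $\mathcal{A}_3$-group having an $\mathcal{A}_1$-subgroup of index $p$. Then $G$ has an abelian subgroup of index $p$ and $d(G)=2$ if and only if $G$ is isomorphic to one of the following pairwise non-isomorphic groups: (Ai) $c(G)=3$ and $G'\cong C_4$ (so $p=2$). (A1) $\langle a,b;c\mid a^4=b^2=c^4=1,[a,b]=c,[c,a]=[c,b]=c^2\rangle$; here $|G|=2^5$, $\Phi(G)=\langle a^2,c\rangle\cong C_4\times C_2$, $G'=\langle c\rangle$, $Z(G)=\langle a^2,c^2\rangle\cong C_2^2$. (A2) $\langle a,b;c\mid a^4=b^4=1,c^2=a^2,[a,b]=c,[c,a]=[c,b]=c^2\rangle$; here $|G|=2^5$, $\Phi(G)=\langle b^2,c\rangle\cong C_4\times C_2$, $G'=\langle c\rangle$, $Z(G)=\langle b^2,c^2\rangle\cong C_2^2$. (A3) $\langle a,b;c\mid a^8=b^2=1,c^2=a^4,[a,b]=c,[c,a]=[c,b]=c^2\rangle$; here $|G|=2^5$, $\Phi(G)=\langle a^2,c\rangle\cong C_4\times C_2$, $G'=\langle c\rangle$, $Z(G)=\langle a^2\rangle\cong C_4$. (Aii) $c(G)=3$ and $G'\cong C_p^2$, where $p>2$. (A4) $\langle a,b;c\mid a^{p^3}=b^p=c^p=1,[a,b]=c,[c,a]=1,[c,b]=a^{\nu p^2}\rangle$, where $\nu=1$ or a fixed quadratic non-residue modulo $p$; here $|G|=p^5$, $\Phi(G)=\langle a^p,c\rangle\cong C_{p^2}\times C_p$, $G'=\langle a^{p^2},c\rangle$,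 $Z(G)=\langle a^p\rangle\cong C_{p^2}$. (A5) $\langle a,b;c\mid a^{p^2}=b^{p^2}=c^p=1,[a,b]=c,[c,a]=1,[c,b]=b^p\rangle$; here $|G|=p^5$, $\Phi(G)=\langle a^p,b^p,c\rangle\cong C_p^3$, $G'=\langle b^p,c\rangle$, $Z(G)=\langle a^p,b^p\rangle\cong C_p^2$. (A6) $\langle a,b;c,d\mid a^{p^2}=b^p=c^p=d^p=1,[a,b]=c,[c,a]=1,[c,b]=d,[d,a]=[d,b]=1\rangle$; here $|G|=p^5$, $\Phi(G)=\langle a^p,c,d\rangle\cong C_p^3$, $G'=\langle c,d\rangle$, $Z(G)=\langle a^p,d\rangle\cong C_p^2$. Moreover, for all these groups $(\mu_0,\mu_1,\mu_2)=(1,p-1,1)$ and $\alpha_1(G)=p^2+p-1$.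
   Context: All groups are finite $p$-groups, $p$ a prime. An $\mathcal{A}_0$-group is an abelian group; for $t\ge1$ a finite $p$-group is an $\mathcal{A}_t$-group if all its subgroups of index $p^t$ are abelian and at least one subgroup of index $p^{t-1}$ is non-abelian. An $\mathcal{A}_i$-subgroup is a subgroup that is an $\mathcal{A}_i$-group. $\mu_i$ is the number of subgroups of index $p$ of $G$ that are $\mathcal{A}_i$-groups; $\alpha_1(G)$ is the number of $\mathcal{A}_1$-subgroups of $G$. $d(G)$ is the minimal number of generators, $c(G)$ the nilpotency class, $\Phi(G)$ the Frattini subgroup, $G'$ the derived subgroup, $Z(G)$ the centre. $C_n$ is the cyclic group of order $n$ and $C_n^k$ the direct product of $k$ copies of it. $[x,y]=x^{-1}y^{-1}xy$. In a presentation all letters listed before the bar (before or after a semicolon) are generators. "$\nu=1$ or a fixed quadratic non-residue modulo $p$" means $\nu\in\{1,\eta\}$ for one fixed non-residue $\eta$; different values of parameters give different groups in the list. *)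

theory Defs
  imports "HOL-Algebra.Elementary_Groups" "HOL-Algebra.Generated_Groups"
    "HOL-Number_Theory.Residues"
begin

section \<open>Groups given by generators and relations\<close>

text \<open>A letter \<open>(x, True)\<close> of a word stands for the generator \<open>x\<close>, and \<open>(x, False)\<close> for its
  inverse. The free group on \<open>X\<close> consists of the words modulo insertion and deletion of
  adjacent mutually inverse letters.\<close>

definition words :: "'g set \<Rightarrow> ('g \<times> bool) list set" where
  "words X = lists (X \<times> UNIV)"

definition cancellation :: "'g set \<Rightarrow> (('g \<times> bool) list \<times> ('g \<times> bool) list) set" where
  "cancellation X = {(u @ [(x, e), (x, \<not> e)] @ v, u @ v) | u v x e.
     u \<in> words X \<and> v \<in> words X \<and> x \<in> X}"

definition word_equiv :: "'g set \<Rightarrow> (('g \<times> bool) list \<times> ('g \<times> bool) list) set" where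
  "word_equiv X = (cancellation X \<union> (cancellation X)\<inverse>)\<^sup>* \<inter> (words X \<times> words X)"

definition free_group :: "'g set \<Rightarrow> ('g \<times> bool) list set monoid" where
  "free_group X = \<lparr>carrier = words X // word_equiv X,
     monoid.mult = (\<lambda>U V. word_equiv X `` {u @ v | u v. u \<in> U \<and> v \<in> V}),
     one = word_equiv X `` {[]}\<rparr>"

definition free_gen :: "'g set \<Rightarrow> 'g \<Rightarrow> ('g \<times> bool) list set" where
  "free_gen X x = word_equiv X `` {[(x, True)]}"

definition normal_closure :: "('a, 'b) monoid_scheme \<Rightarrow> 'a set \<Rightarrow> 'a set" where
  "normal_closure G S = \<Inter>{N. N \<lhd> G \<and> S \<subseteq> N}"

text \<open>A pair \<open>(u, v)\<close> in a set of relations stands for \<open>u = v\<close>. The relations are written as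
  a function of a group and a choice of elements in it for the letters.\<close>

definition relator_closure ::
  "'g set \<Rightarrow> (('g \<times> bool) list set monoid \<Rightarrow> ('g \<Rightarrow> ('g \<times> bool) list set) \<Rightarrow>
     (('g \<times> bool) list set \<times> ('g \<times> bool) list set) set) \<Rightarrow> ('g \<times> bool) list set set" where
  "relator_closure X R = normal_closure (free_group X)
     {u \<otimes>\<^bsub>free_group X\<^esub> inv\<^bsub>free_group X\<^esub> v | u v. (u, v) \<in> R (free_group X) (free_gen X)}"

definition presented_group ::
  "'g set \<Rightarrow> (('g \<times> bool) list set monoid \<Rightarrow> ('g \<Rightarrow> ('g \<times> bool) list set) \<Rightarrow>
     (('g \<times> bool) list set \<times> ('g \<times> bool) list set) set) \<Rightarrow> ('g \<times> bool) list set set monoid" where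
  "presented_group X R = free_group X Mod relator_closure X R"

definition presented_gen ::
  "'g set \<Rightarrow> (('g \<times> bool) list set monoid \<Rightarrow> ('g \<Rightarrow> ('g \<times> bool) list set) \<Rightarrow>
     (('g \<times> bool) list set \<times> ('g \<times> bool) list set) set) \<Rightarrow> 'g \<Rightarrow> ('g \<times> bool) list set set" where
  "presented_gen X R x = relator_closure X R #>\<^bsub>free_group X\<^esub> free_gen X x"


section \<open>Group-theoretic invariants\<close>

abbreviation subgroup_as_group :: "('a, 'b) monoid_scheme \<Rightarrow> 'a set \<Rightarrow> ('a, 'b) monoid_scheme" where
  "subgroup_as_group G H \<equiv> G\<lparr>carrier := H\<rparr>"

definition subgroup_index :: "('a, 'b) monoid_scheme \<Rightarrow> 'a set \<Rightarrow> nat" where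
  "subgroup_index G H = card (rcosets\<^bsub>G\<^esub> H)"

definition commutator :: "('a, 'b) monoid_scheme \<Rightarrow> 'a \<Rightarrow> 'a \<Rightarrow> 'a" where
  "commutator G x y = inv\<^bsub>G\<^esub> x \<otimes>\<^bsub>G\<^esub> inv\<^bsub>G\<^esub> y \<otimes>\<^bsub>G\<^esub> x \<otimes>\<^bsub>G\<^esub> y"

definition min_gens :: "('a, 'b) monoid_scheme \<Rightarrow> nat" where
  "min_gens G = (LEAST n. \<exists>S \<subseteq> carrier G. finite S \<and> card S = n \<and> generate G S = carrier G)"

text \<open>The index is shifted: \<open>lower_central G n\<close> is the term usually called
  \<open>\<gamma>\<close> with subscript \<open>n + 1\<close>.\<close>

primrec lower_central :: "('a, 'b) monoid_scheme \<Rightarrow> nat \<Rightarrow> 'a set" where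
  "lower_central G 0 = carrier G"
| "lower_central G (Suc n) =
     generate G {commutator G x y | x y. x \<in> lower_central G n \<and> y \<in> carrier G}"

definition nilpotency_class :: "('a, 'b) monoid_scheme \<Rightarrow> nat" where
  "nilpotency_class G = (LEAST n. lower_central G n = {\<one>\<^bsub>G\<^esub>})"

definition maximal_subgroup :: "'a set \<Rightarrow> ('a, 'b) monoid_scheme \<Rightarrow> bool" where
  "maximal_subgroup M G \<longleftrightarrow> subgroup M G \<and> M \<noteq> carrier G \<and>
     (\<forall>K. subgroup K G \<and> M \<subseteq> K \<longrightarrow> K = M \<or> K = carrier G)"

definition frattini :: "('a, 'b) monoid_scheme \<Rightarrow> 'a set" where
  "frattini G = carrier G \<inter> \<Inter>{M. maximal_subgroup M G}"

definition group_center :: "('a, 'b) monoid_scheme \<Rightarrow> 'a set" where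
  "group_center G = {z \<in> carrier G. \<forall>x \<in> carrier G. z \<otimes>\<^bsub>G\<^esub> x = x \<otimes>\<^bsub>G\<^esub> z}"

abbreviation derived_subgroup :: "('a, 'b) monoid_scheme \<Rightarrow> 'a set" where
  "derived_subgroup G \<equiv> derived G (carrier G)"


section \<open>The classes of finite p-groups\<close>

definition finite_p_group :: "nat \<Rightarrow> ('a, 'b) monoid_scheme \<Rightarrow> bool" where
  "finite_p_group p G \<longleftrightarrow> prime p \<and> group G \<and> finite (carrier G) \<and> (\<exists>n. order G = p ^ n)"

definition A_group :: "nat \<Rightarrow> nat \<Rightarrow> ('a, 'b) monoid_scheme \<Rightarrow> bool" where
  "A_group p t G \<longleftrightarrow> finite_p_group p G \<and>
     (if t = 0 then comm_group G
      else (\<forall>H. subgroup H G \<and> subgroup_index G H = p ^ t \<longrightarrow> comm_group (subgroup_as_group G H)) \<and>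
           (\<exists>H. subgroup H G \<and> subgroup_index G H = p ^ (t - 1) \<and>
                \<not> comm_group (subgroup_as_group G H)))"

definition A_subgroup :: "nat \<Rightarrow> nat \<Rightarrow> 'a set \<Rightarrow> ('a, 'b) monoid_scheme \<Rightarrow> bool" where
  "A_subgroup p i H G \<longleftrightarrow> subgroup H G \<and> A_group p i (subgroup_as_group G H)"

definition mu :: "nat \<Rightarrow> nat \<Rightarrow> ('a, 'b) monoid_scheme \<Rightarrow> nat" where
  "mu p i G = card {H. A_subgroup p i H G \<and> subgroup_index G H = p}"

definition alpha1 :: "nat \<Rightarrow> ('a, 'b) monoid_scheme \<Rightarrow> nat" where
  "alpha1 p G = card {H. A_subgroup p 1 H G}"


section \<open>The listed groups\<close>

datatype letter = La | Lb | Lc | Ld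

text \<open>The argument of \<open>A4\<close> is the parameter \<open>\<nu>\<close>.\<close>

datatype label = A1 | A2 | A3 | A4 nat | A5 | A6

fun alphabet :: "label \<Rightarrow> letter set" where
  "alphabet A6 = {La, Lb, Lc, Ld}"
| "alphabet _ = {La, Lb, Lc}"

fun relations ::
  "nat \<Rightarrow> label \<Rightarrow> ('a, 'b) monoid_scheme \<Rightarrow> (letter \<Rightarrow> 'a) \<Rightarrow> ('a \<times> 'a) set" where
  "relations p A1 G g = (let a = g La; b = g Lb; c = g Lc in
     {(a [^]\<^bsub>G\<^esub> (4::nat), \<one>\<^bsub>G\<^esub>), (b [^]\<^bsub>G\<^esub> (2::nat), \<one>\<^bsub>G\<^esub>), (c [^]\<^bsub>G\<^esub> (4::nat), \<one>\<^bsub>G\<^esub>),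
      (commutator G a b, c),
      (commutator G c a, c [^]\<^bsub>G\<^esub> (2::nat)), (commutator G c b, c [^]\<^bsub>G\<^esub> (2::nat))})"
| "relations p A2 G g = (let a = g La; b = g Lb; c = g Lc in
     {(a [^]\<^bsub>G\<^esub> (4::nat), \<one>\<^bsub>G\<^esub>), (b [^]\<^bsub>G\<^esub> (4::nat), \<one>\<^bsub>G\<^esub>),
      (c [^]\<^bsub>G\<^esub> (2::nat), a [^]\<^bsub>G\<^esub> (2::nat)),
      (commutator G a b, c),
      (commutator G c a, c [^]\<^bsub>G\<^esub> (2::nat)), (commutator G c b, c [^]\<^bsub>G\<^esub> (2::nat))})"
| "relations p A3 G g = (let a = g La; b = g Lb; c = g Lc in
     {(a [^]\<^bsub>G\<^esub> (8::nat), \<one>\<^bsub>G\<^esub>), (b [^]\<^bsub>G\<^esub> (2::nat), \<one>\<^bsub>G\<^esub>),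
      (c [^]\<^bsub>G\<^esub> (2::nat), a [^]\<^bsub>G\<^esub> (4::nat)),
      (commutator G a b, c),
      (commutator G c a, c [^]\<^bsub>G\<^esub> (2::nat)), (commutator G c b, c [^]\<^bsub>G\<^esub> (2::nat))})"
| "relations p (A4 \<nu>) G g = (let a = g La; b = g Lb; c = g Lc in
     {(a [^]\<^bsub>G\<^esub> (p ^ 3), \<one>\<^bsub>G\<^esub>), (b [^]\<^bsub>G\<^esub> p, \<one>\<^bsub>G\<^esub>), (c [^]\<^bsub>G\<^esub> p, \<one>\<^bsub>G\<^esub>),
      (commutator G a b, c),
      (commutator G c a, \<one>\<^bsub>G\<^esub>), (commutator G c b, a [^]\<^bsub>G\<^esub> (\<nu> * p ^ 2))})"
| "relations p A5 G g = (let a = g La; b = g Lb; c = g Lc in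
     {(a [^]\<^bsub>G\<^esub> (p ^ 2), \<one>\<^bsub>G\<^esub>), (b [^]\<^bsub>G\<^esub> (p ^ 2), \<one>\<^bsub>G\<^esub>), (c [^]\<^bsub>G\<^esub> p, \<one>\<^bsub>G\<^esub>),
      (commutator G a b, c),
      (commutator G c a, \<one>\<^bsub>G\<^esub>), (commutator G c b, b [^]\<^bsub>G\<^esub> p)})"
| "relations p A6 G g = (let a = g La; b = g Lb; c = g Lc; d = g Ld in
     {(a [^]\<^bsub>G\<^esub> (p ^ 2), \<one>\<^bsub>G\<^esub>), (b [^]\<^bsub>G\<^esub> p, \<one>\<^bsub>G\<^esub>), (c [^]\<^bsub>G\<^esub> p, \<one>\<^bsub>G\<^esub>), (d [^]\<^bsub>G\<^esub> p, \<one>\<^bsub>G\<^esub>),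
      (commutator G a b, c),
      (commutator G c a, \<one>\<^bsub>G\<^esub>), (commutator G c b, d),
      (commutator G d a, \<one>\<^bsub>G\<^esub>), (commutator G d b, \<one>\<^bsub>G\<^esub>)})"

definition listed_group :: "nat \<Rightarrow> label \<Rightarrow> (letter \<times> bool) list set set monoid" where
  "listed_group p L = presented_group (alphabet L) (relations p L)"

definition listed_gen :: "nat \<Rightarrow> label \<Rightarrow> letter \<Rightarrow> (letter \<times> bool) list set set" where
  "listed_gen p L x = presented_gen (alphabet L) (relations p L) x"

text \<open>Here \<open>\<eta>\<close> is the fixed quadratic non-residue modulo \<open>p\<close>; it plays no role for \<open>p = 2\<close>.\<close>

definition labels :: "nat \<Rightarrow> nat \<Rightarrow> label set" where
  "labels p \<eta> = (if p = 2 then {A1, A2, A3} else {A4 1, A4 \<eta>, A5, A6})"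

abbreviation cyc :: "nat \<Rightarrow> int monoid" where
  "cyc n \<equiv> integer_mod_group n"

end

theory Submission
  imports Defs "HOL-Algebra.Zassenhaus" "HOL-Number_Theory.Euler_Criterion"
begin

text \<open>All the groups in question have a normal form \<open>b\<^sup>n a\<^sup>i c\<^sup>j d\<^sup>k\<close> with \<open>c = [a, b]\<close> and \<open>d = [c, b]\<close>, where
  \<open>a\<close> lies in the abelian maximal subgroup and \<open>d\<close> is central of order \<open>p\<close>. Up to the choice of
  \<open>a\<close> and \<open>b\<close> such a group of order \<open>p\<^sup>5\<close> is determined by two residues \<open>s\<close>, \<open>t\<close> modulo \<open>p\<close> with
  \<open>z\<^sup>p = d\<^sup>s\<close> and \<open>b\<^sup>p = d\<^sup>t\<close>, where \<open>z\<close> is \<open>a\<^sup>p\<close> corrected by a word in \<open>c\<close> and \<open>d\<close> so as to be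
  central. A change of generators multiplies \<open>s\<close> by a nonzero square and \<open>t\<close> by any unit, and it can
  remove \<open>t\<close> if \<open>s\<close> is a unit; this gives the list, and the invariants are read off the normal form.

  Conversely, a minimal nonabelian maximal subgroup \<open>M\<close> forces \<open>d\<^sup>p = 1\<close> and the centrality of \<open>d\<close>, so
  that \<open>G\<close> is an image of the integral group of normal words. The nonabelian subgroup of index
  \<open>p\<^sup>2\<close>, compared with \<open>M\<close>, allows \<open>b\<close> to be chosen with \<open>b\<^sup>p\<close> a power of \<open>d\<close>. Then \<open>\<langle>b, c\<rangle>\<close> is nonabelian of
  order \<open>p\<^sup>3\<close>, and since all subgroups of index \<open>p\<^sup>3\<close> are abelian, \<open>G\<close> has order \<open>p\<^sup>5\<close>.\<close>

text \<open>A presentation bounds the order of its group only from above, and collapse has to be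
  excluded. Therefore everything is compared with one concrete model: normal words with integer
  exponents multiply by polynomial formulas, and the words to be killed are described by
  congruences. That these words form a normal subgroup is the consistency of all the presentations
  at once, and the order \<open>p^5\<close> is counted only there.

  The number \<open>eps p\<close> carries the whole difference between \<open>p = 2\<close> and odd
  \<open>p\<close>. The exponent of \<open>a^(p^2)\<close> is written as \<open>s + eps p\<close>
  because the correction by \<open>c\<close> that makes \<open>z\<close> central contributes the
  \<open>eps p\<close>, which leaves \<open>z^p = d^s\<close>.

  The squares arise as follows. Passing to \<open>a^i\<close> and \<open>b^w z^l\<close> turns
  \<open>d\<close> into \<open>d^(w^2 i)\<close> and \<open>z\<close> into \<open>z^i\<close>, up to
  powers of \<open>d\<close>; hence \<open>i\<close> cancels from \<open>s\<close>, which is divided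
  by \<open>w^2\<close>. The factor \<open>z^l\<close> adds a multiple of \<open>s\<close> to the
  exponent of \<open>b^p\<close>, which clears \<open>t\<close> if \<open>s\<close> is a unit; if
  \<open>s = 0\<close>, the free exponent \<open>i\<close> rescales \<open>t\<close>.

  For the converse the order of the group is unknown until the end, so the calculus of words is set
  up for words with an arbitrary kernel.\<close>

lemma group_homI: "group G \<Longrightarrow> group H \<Longrightarrow> h \<in> hom G H \<Longrightarrow> group_hom G H h"
  by (simp add: group_hom_def group_hom_axioms_def)

section \<open>Free groups and presentations\<close>

lemma words_append_iff [simp]: "u @ v \<in> words X \<longleftrightarrow> u \<in> words X \<and> v \<in> words X"
  by (auto simp: words_def)

lemma words_Nil [simp]: "[] \<in> words X"
  by (simp add: words_def)

lemma words_Cons_iff [simp]: "(x, e) # w \<in> words X \<longleftrightarrow> x \<in> X \<and> w \<in> words X"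
  by (auto simp: words_def)

lemma equiv_word_equiv: "equiv (words X) (word_equiv X)"
proof (rule equivI)
  show "word_equiv X \<subseteq> words X \<times> words X" by (auto simp: word_equiv_def)
  show "refl_on (words X) (word_equiv X)" by (auto simp: word_equiv_def refl_on_def)
  have "sym ((cancellation X \<union> (cancellation X)\<inverse>)\<^sup>*)"
    by (rule sym_rtrancl) (auto simp: sym_def)
  then show "sym (word_equiv X)" by (auto simp: word_equiv_def sym_def)
  show "trans (word_equiv X)" by (auto simp: word_equiv_def trans_def)
qed

lemma cancellationI:
  "u \<in> words X \<Longrightarrow> v \<in> words X \<Longrightarrow> x \<in> X \<Longrightarrow>
    (u @ [(x, e), (x, \<not> e)] @ v, u @ v) \<in> cancellation X"
  unfolding cancellation_def by blast

lemma cancellation_context: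
  assumes "(u, v) \<in> cancellation X" "l \<in> words X" "r \<in> words X"
  shows "(l @ u @ r, l @ v @ r) \<in> cancellation X"
proof -
  obtain u' v' x e where *: "u = u' @ [(x, e), (x, \<not> e)] @ v'" "v = u' @ v'"
      "u' \<in> words X" "v' \<in> words X" "x \<in> X"
    using assms(1) unfolding cancellation_def by blast
  have "l @ u @ r = (l @ u') @ [(x, e), (x, \<not> e)] @ (v' @ r)" "l @ v @ r = (l @ u') @ (v' @ r)"
    by (simp_all add: *)
  moreover have "l @ u' \<in> words X" "v' @ r \<in> words X" using * assms by auto
  ultimately show ?thesis using *(5) by (metis cancellationI)
qed

lemma word_equiv_context:
  assumes "(u, v) \<in> word_equiv X" "l \<in> words X" "r \<in> words X"
  shows "(l @ u @ r, l @ v @ r) \<in> word_equiv X"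
proof -
  have "(u, v) \<in> (cancellation X \<union> (cancellation X)\<inverse>)\<^sup>*" and w: "u \<in> words X" "v \<in> words X"
    using assms by (auto simp: word_equiv_def)
  from this(1) have "(l @ u @ r, l @ v @ r) \<in> (cancellation X \<union> (cancellation X)\<inverse>)\<^sup>*"
  proof (induction rule: rtrancl_induct)
    case (step y z)
    then have "(l @ y @ r, l @ z @ r) \<in> cancellation X \<union> (cancellation X)\<inverse>"
      using cancellation_context assms by blast
    with step show ?case by (meson rtrancl.rtrancl_into_rtrancl)
  qed simp
  with w assms show ?thesis by (auto simp: word_equiv_def)
qed

lemma word_equiv_append:
  assumes "(u, u') \<in> word_equiv X" "(v, v') \<in> word_equiv X"
  shows "(u @ v, u' @ v') \<in> word_equiv X"
proof -
  have "u \<in> words X" "u' \<in> words X" "v \<in> words X" "v' \<in> words X"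
    using assms by (auto simp: word_equiv_def)
  then have "(u @ v, u' @ v) \<in> word_equiv X" "(u' @ v, u' @ v') \<in> word_equiv X"
    using word_equiv_context[OF assms(1), of "[]" v] word_equiv_context[OF assms(2), of u' "[]"]
    by auto
  then show ?thesis using equiv_word_equiv by (meson equivE transD)
qed

abbreviation word_class :: "'g set \<Rightarrow> ('g \<times> bool) list \<Rightarrow> ('g \<times> bool) list set" where
  "word_class X w \<equiv> word_equiv X `` {w}"

lemma word_class_eq_iff:
  "u \<in> words X \<Longrightarrow> v \<in> words X \<Longrightarrow> word_class X u = word_class X v \<longleftrightarrow> (u, v) \<in> word_equiv X"
  using eq_equiv_class_iff[OF equiv_word_equiv] by blast

lemma carrier_free_group: "carrier (free_group X) = word_class X ` words X"
  by (auto simp: free_group_def quotient_def)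

lemma one_free_group: "\<one>\<^bsub>free_group X\<^esub> = word_class X []"
  by (simp add: free_group_def)

text \<open>The product of \<open>free_group\<close> is the saturation of all concatenations of
  representatives. Equivalence respects concatenation, so these lie in one class and a single pair
  of representatives decides the product.\<close>

lemma word_class_mult:
  assumes "u \<in> words X" "v \<in> words X"
  shows "word_class X u \<otimes>\<^bsub>free_group X\<^esub> word_class X v = word_class X (u @ v)"
proof -
  have "{u' @ v' | u' v'. u' \<in> word_class X u \<and> v' \<in> word_class X v} \<subseteq> word_class X (u @ v)"
    using word_equiv_append by fastforce
  moreover have "u \<in> word_class X u" "v \<in> word_class X v"
    using assms equiv_class_self[OF equiv_word_equiv] by auto
  then have "u @ v \<in> {u' @ v' | u' v'. u' \<in> word_class X u \<and> v' \<in> word_class X v}"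
    by blast
  ultimately have "word_equiv X `` {u' @ v' | u' v'. u' \<in> word_class X u \<and> v' \<in> word_class X v} =
      word_class X (u @ v)"
    using equiv_word_equiv[of X] by (auto simp: equiv_def dest: transD)
  then show ?thesis by (simp add: free_group_def)
qed

text \<open>Left inverses suffice for \<open>groupI\<close>. The inverse letter of the head is
  appended to the inverse \<open>w'\<close> of the tail, so that the cancelling pair stands between
  \<open>w'\<close> and \<open>w\<close>.\<close>

lemma word_inverse:
  assumes "w \<in> words X"
  shows "\<exists>w' \<in> words X. (w' @ w, []) \<in> word_equiv X"
  using assms
proof (induction w)
  case Nil
  then show ?case by (intro bexI[of _ "[]"]) (auto simp: word_equiv_def)
next
  case (Cons y w)
  obtain x e where y: "y = (x, e)" by fastforce
  with Cons obtain w' where w': "w' \<in> words X" "(w' @ w, []) \<in> word_equiv X" "x \<in> X" "w \<in> words X"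
    by auto
  have "(w' @ [(x, \<not> e), (x, \<not> \<not> e)] @ w, w' @ w) \<in> cancellation X"
    using w' by (intro cancellationI)
  then have "((w' @ [(x, \<not> e)]) @ y # w, w' @ w) \<in> word_equiv X"
    using w' y by (auto simp: word_equiv_def)
  with w' have "((w' @ [(x, \<not> e)]) @ y # w, []) \<in> word_equiv X"
    using equiv_word_equiv[of X] by (meson equivE transD)
  then show ?case using w' by (intro bexI[of _ "w' @ [(x, \<not> e)]"]) auto
qed

lemma group_free_group: "group (free_group X)"
proof (rule groupI)
  fix x assume "x \<in> carrier (free_group X)"
  then obtain w where w: "w \<in> words X" "x = word_class X w" by (auto simp: carrier_free_group)
  from word_inverse[OF w(1)] obtain w' where w': "w' \<in> words X" "(w' @ w, []) \<in> word_equiv X"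
    by blast
  then show "\<exists>y \<in> carrier (free_group X). y \<otimes>\<^bsub>free_group X\<^esub> x = \<one>\<^bsub>free_group X\<^esub>"
    by (intro bexI[of _ "word_class X w'"])
      (auto simp: w word_class_mult one_free_group word_class_eq_iff carrier_free_group)
qed (auto simp: carrier_free_group word_class_mult one_free_group)

lemma free_gen_closed [simp]: "x \<in> X \<Longrightarrow> free_gen X x \<in> carrier (free_group X)"
  by (auto simp: free_gen_def carrier_free_group)

lemma inv_free_gen:
  assumes "x \<in> X"
  shows "inv\<^bsub>free_group X\<^esub> free_gen X x = word_class X [(x, False)]"
proof (rule group.inv_equality[OF group_free_group])
  have "([(x, False), (x, True)], []) \<in> word_equiv X"
    using assms cancellationI[of "[]" X "[]" x False] by (auto simp: word_equiv_def)
  then show "word_class X [(x, False)] \<otimes>\<^bsub>free_group X\<^esub> free_gen X x = \<one>\<^bsub>free_group X\<^esub>"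
    using assms by (simp add: free_gen_def word_class_mult one_free_group word_class_eq_iff)
qed (use assms in \<open>auto simp: carrier_free_group free_gen_def\<close>)

lemma generate_free_gen: "generate (free_group X) (free_gen X ` X) = carrier (free_group X)"
proof
  show "generate (free_group X) (free_gen X ` X) \<subseteq> carrier (free_group X)"
    using group.generate_incl[OF group_free_group] by (metis free_gen_closed image_subsetI)
  have "word_class X w \<in> generate (free_group X) (free_gen X ` X)" if "w \<in> words X" for w
    using that
  proof (induction w)
    case Nil
    then show ?case using generate.one[of "free_group X"] by (simp add: one_free_group)
  next
    case (Cons y w)
    obtain x e where y: "y = (x, e)" by fastforce
    have "word_class X [y] \<in> generate (free_group X) (free_gen X ` X)"
    proof (cases e)
      case True
      with Cons y show ?thesis
        using generate.incl[of "free_gen X x" "free_gen X ` X" "free_group X"]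
        by (auto simp: free_gen_def)
    next
      case False
      with Cons y show ?thesis
        using generate.inv[of "free_gen X x" "free_gen X ` X" "free_group X"]
        by (auto simp: inv_free_gen)
    qed
    moreover have "word_class X (y # w) = word_class X [y] \<otimes>\<^bsub>free_group X\<^esub> word_class X w"
      using Cons y by (subst word_class_mult) auto
    ultimately show ?case using Cons y by (auto intro: generate.eng)
  qed
  then show "carrier (free_group X) \<subseteq> generate (free_group X) (free_gen X ` X)"
    by (auto simp: carrier_free_group)
qed

section \<open>Evaluation of words and the universal property of free groups\<close>

primrec word_eval :: "('a, 'b) monoid_scheme \<Rightarrow> ('g \<Rightarrow> 'a) \<Rightarrow> ('g \<times> bool) list \<Rightarrow> 'a" where
  "word_eval H f [] = \<one>\<^bsub>H\<^esub>"
| "word_eval H f (y # w) =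
     (if snd y then f (fst y) else inv\<^bsub>H\<^esub> f (fst y)) \<otimes>\<^bsub>H\<^esub> word_eval H f w"

context group
begin

lemma word_eval_closed:
  "f \<in> X \<rightarrow> carrier G \<Longrightarrow> w \<in> words X \<Longrightarrow> word_eval G f w \<in> carrier G"
proof (induction w)
  case (Cons y w)
  then show ?case by (cases y) auto
qed simp

lemma word_eval_append:
  "f \<in> X \<rightarrow> carrier G \<Longrightarrow> u \<in> words X \<Longrightarrow> v \<in> words X \<Longrightarrow>
    word_eval G f (u @ v) = word_eval G f u \<otimes> word_eval G f v"
proof (induction u)
  case (Cons y u)
  then show ?case by (cases y) (auto simp: m_assoc word_eval_closed Pi_iff)
qed (simp add: word_eval_closed)

lemma word_eval_cong:
  assumes f: "f \<in> X \<rightarrow> carrier G" and "(u, v) \<in> word_equiv X"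
  shows "word_eval G f u = word_eval G f v"
proof -
  have canc: "word_eval G f u = word_eval G f v" if c: "(u, v) \<in> cancellation X" for u v
  proof -
    obtain u' v' x e where *: "u = u' @ [(x, e), (x, \<not> e)] @ v'" "v = u' @ v'"
      "u' \<in> words X" "v' \<in> words X" "x \<in> X"
      using c unfolding cancellation_def by blast
    have "word_eval G f ([(x, e), (x, \<not> e)] @ v') = word_eval G f v'"
      using * f word_eval_closed[OF f *(4)] by (auto simp: Pi_iff m_assoc[symmetric])
    then show ?thesis using * f by (simp only: word_eval_append[OF f] words_append_iff) (simp add: word_eval_append[OF f])
  qed
  have "(u, v) \<in> (cancellation X \<union> (cancellation X)\<inverse>)\<^sup>*"
    using assms by (auto simp: word_equiv_def)
  then show ?thesis
    by (induction rule: rtrancl_induct) (auto dest: canc)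
qed

lemma free_group_universal:
  assumes f: "f \<in> X \<rightarrow> carrier G"
  obtains h where "h \<in> hom (free_group X) G" "\<And>x. x \<in> X \<Longrightarrow> h (free_gen X x) = f x"
proof
  \<comment> \<open>A class is evaluated at an arbitrary representative;
    \<open>word_eval_cong\<close> makes the choice immaterial.\<close>
  define h where "h = (\<lambda>U. word_eval G f (SOME w. w \<in> U))"
  have h: "h (word_class X w) = word_eval G f w" if w: "w \<in> words X" for w
  proof -
    have "w \<in> word_class X w" by (rule equiv_class_self[OF equiv_word_equiv w])
    then have "(SOME w'. w' \<in> word_class X w) \<in> word_class X w" by (rule someI)
    then show ?thesis using word_eval_cong[OF f] by (auto simp: h_def)
  qed
  show "h \<in> hom (free_group X) G"
    by (rule homI) (auto simp: carrier_free_group h word_class_mult word_eval_append[OF f]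
        intro: word_eval_closed[OF f])
  show "h (free_gen X x) = f x" if "x \<in> X" for x
    using that f by (auto simp: free_gen_def h Pi_iff)
qed

section \<open>Normal closures and presented groups\<close>

lemma normal_Inter:
  assumes "S \<noteq> {}" "\<And>N. N \<in> S \<Longrightarrow> N \<lhd> G"
  shows "\<Inter>S \<lhd> G"
proof (rule normal_invI)
  show "subgroup (\<Inter>S) G"
    using assms by (intro subgroups_Inter) (auto intro: normal_imp_subgroup)
  show "\<And>x h. x \<in> carrier G \<Longrightarrow> h \<in> \<Inter>S \<Longrightarrow> x \<otimes> h \<otimes> inv x \<in> \<Inter>S"
    using assms by (auto dest: normal.inv_op_closed2)
qed

lemma normal_closure_normal:
  assumes "S \<subseteq> carrier G"
  shows "normal_closure G S \<lhd> G"
  unfolding normal_closure_def using assms normal_self by (intro normal_Inter) auto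

lemma normal_closure_minimal: "N \<lhd> G \<Longrightarrow> S \<subseteq> N \<Longrightarrow> normal_closure G S \<subseteq> N"
  unfolding normal_closure_def by blast

lemma normal_closure_incl: "S \<subseteq> normal_closure G S"
  unfolding normal_closure_def by blast

end

text \<open>Closedness ensures that at least the whole free group is a normal subgroup above the
  relators; otherwise the intersection in \<open>normal_closure\<close> could run over the empty
  family and be \<open>UNIV\<close>.\<close>

locale presentation =
  fixes X :: "'g set"
    and R :: "('g \<times> bool) list set monoid \<Rightarrow> ('g \<Rightarrow> ('g \<times> bool) list set) \<Rightarrow>
       (('g \<times> bool) list set \<times> ('g \<times> bool) list set) set"
  assumes relations_closed: "(u, v) \<in> R (free_group X) (free_gen X) \<Longrightarrow>
      u \<in> carrier (free_group X) \<and> v \<in> carrier (free_group X)"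
begin

abbreviation "F \<equiv> free_group X"

definition quotient_map :: "('g \<times> bool) list set \<Rightarrow> ('g \<times> bool) list set set" where
  "quotient_map u = relator_closure X R #>\<^bsub>F\<^esub> u"

lemma normal_relator_closure: "relator_closure X R \<lhd> F"
proof -
  interpret F: group F by (rule group_free_group)
  show ?thesis
    unfolding relator_closure_def using relations_closed
    by (intro F.normal_closure_normal) auto
qed

lemma group_presented_group: "group (presented_group X R)"
  unfolding presented_group_def
  by (rule normal.factorgroup_is_group[OF normal_relator_closure])

lemma quotient_map_hom: "quotient_map \<in> hom F (presented_group X R)"
  unfolding presented_group_def quotient_map_def[abs_def]
  by (rule normal.r_coset_hom_Mod[OF normal_relator_closure])

lemma quotient_map_free_gen: "quotient_map (free_gen X x) = presented_gen X R x"
  by (simp add: presented_gen_def quotient_map_def)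

lemma quotient_map_image: "quotient_map ` carrier F = carrier (presented_group X R)"
  by (simp add: presented_group_def carrier_FactGroup quotient_map_def[abs_def])

lemma quotient_map_relation:
  assumes "(u, v) \<in> R F (free_gen X)"
  shows "quotient_map u = quotient_map v"
proof -
  interpret N: normal "relator_closure X R" F by (rule normal_relator_closure)
  let ?S = "{u \<otimes>\<^bsub>F\<^esub> inv\<^bsub>F\<^esub> v | u v. (u, v) \<in> R F (free_gen X)}"
  have "u \<otimes>\<^bsub>F\<^esub> inv\<^bsub>F\<^esub> v \<in> relator_closure X R"
    using N.normal_closure_incl[of ?S] assms unfolding relator_closure_def by blast
  then have "u \<in> relator_closure X R #>\<^bsub>F\<^esub> v"
    using relations_closed[OF assms] N.rcos_module_rev[OF N.is_group] by blast
  then show ?thesis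
    using relations_closed[OF assms] N.repr_independence[OF _ _ N.subgroup_axioms]
    unfolding quotient_map_def by simp
qed

lemma generate_presented_gen:
  "generate (presented_group X R) (presented_gen X R ` X) = carrier (presented_group X R)"
proof -
  interpret q: group_hom F "presented_group X R" quotient_map
    using group_free_group group_presented_group quotient_map_hom by (rule group_homI)
  have "generate (presented_group X R) (quotient_map ` free_gen X ` X) =
      quotient_map ` generate F (free_gen X ` X)"
    by (rule q.generate_img) auto
  then show ?thesis
    by (simp add: generate_free_gen quotient_map_image image_image quotient_map_free_gen)
qed

lemma presented_gen_closed: "x \<in> X \<Longrightarrow> presented_gen X R x \<in> carrier (presented_group X R)"
  by (metis quotient_map_free_gen quotient_map_image free_gen_closed imageI)

text \<open>Von Dyck's theorem: the kernel of \<open>h\<close> is normal and contains every relator,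
  hence contains \<open>relator_closure\<close>, so \<open>h\<close> factors through the
  quotient.\<close>

lemma presented_group_universal:
  assumes H: "group H" and h: "h \<in> hom F H"
    and eq: "\<And>u v. (u, v) \<in> R F (free_gen X) \<Longrightarrow> h u = h v"
  obtains g where "g \<in> hom (presented_group X R) H"
    "\<And>u. u \<in> carrier F \<Longrightarrow> g (quotient_map u) = h u"
proof -
  interpret N: normal "relator_closure X R" F by (rule normal_relator_closure)
  interpret h: group_hom F H h using group_free_group H h by (rule group_homI)
  have "relator_closure X R \<subseteq> kernel F H h"
    unfolding relator_closure_def
    using relations_closed eq by (intro N.normal_closure_minimal h.normal_kernel) (auto simp: kernel_def)
  then have "h x = h y" if "x \<in> carrier F" "y \<in> carrier F" "quotient_map x = quotient_map y" for x y
  proof -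
    have "x \<in> relator_closure X R #>\<^bsub>F\<^esub> y"
      using that N.rcos_self[OF that(1) N.subgroup_axioms] by (simp add: quotient_map_def)
    then have "x \<otimes>\<^bsub>F\<^esub> inv\<^bsub>F\<^esub> y \<in> relator_closure X R"
      using that N.rcos_module_imp[OF N.is_group] by blast
    with \<open>relator_closure X R \<subseteq> kernel F H h\<close> have "h (x \<otimes>\<^bsub>F\<^esub> inv\<^bsub>F\<^esub> y) = \<one>\<^bsub>H\<^esub>"
      by (auto simp: kernel_def)
    then show ?thesis using that by (simp add: h.H.inv_solve_right')
  qed
  then obtain g where "g \<in> hom (F Mod relator_closure X R) H"
      "\<And>x. x \<in> carrier F \<Longrightarrow> g (relator_closure X R #>\<^bsub>F\<^esub> x) = h x"
    using FactGroup_universal[OF h N.normal_axioms] unfolding quotient_map_def by metis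
  then show ?thesis
    using that unfolding presented_group_def quotient_map_def by blast
qed

end

section \<open>The listed groups as presentations\<close>

lemma commutator_closed [simp]:
  "group G \<Longrightarrow> x \<in> carrier G \<Longrightarrow> y \<in> carrier G \<Longrightarrow> commutator G x y \<in> carrier G"
  by (simp add: commutator_def group.is_monoid monoid.m_closed group.inv_closed)

lemma hom_commutator:
  assumes "group G" "group H" "h \<in> hom G H" "x \<in> carrier G" "y \<in> carrier G"
  shows "h (commutator G x y) = commutator H (h x) (h y)"
proof -
  interpret group_hom G H h using assms by (intro group_homI)
  show ?thesis using assms by (simp add: commutator_def)
qed

lemma relations_carrier:
  assumes "group G" "\<And>x. x \<in> alphabet L \<Longrightarrow> g x \<in> carrier G" "(u, v) \<in> relations p L G g"
  shows "u \<in> carrier G \<and> v \<in> carrier G"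
proof -
  interpret group G by fact
  have "g La \<in> carrier G" "g Lb \<in> carrier G" "g Lc \<in> carrier G" "L = A6 \<Longrightarrow> g Ld \<in> carrier G"
    using assms(2) by (cases L; simp)+
  then show ?thesis
    using assms(1,3) by (cases L) (auto simp: Let_def)
qed

text \<open>Relations are built from group operations only, hence are natural in the group. This is
  applied along the quotient map, to see that the generators of a listed group satisfy its
  relations, and along a map out of the free group, to see that it respects them.\<close>

lemma relations_hom:
  assumes "group G" "group H" "h \<in> hom G H"
    and "\<And>x. x \<in> alphabet L \<Longrightarrow> g x \<in> carrier G" "\<And>x. x \<in> alphabet L \<Longrightarrow> h (g x) = f x"
  shows "relations p L H f = map_prod h h ` relations p L G g"
proof -
  interpret group_hom G H h using assms by (intro group_homI)
  note hom_commutator[OF assms(1-3), simp]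
  have "g La \<in> carrier G" "g Lb \<in> carrier G" "g Lc \<in> carrier G" "L = A6 \<Longrightarrow> g Ld \<in> carrier G"
    "f La = h (g La)" "f Lb = h (g Lb)" "f Lc = h (g Lc)" "L = A6 \<Longrightarrow> f Ld = h (g Ld)"
    using assms(4,5) by (cases L; simp)+
  then show ?thesis
    by (cases L) (simp_all add: Let_def hom_nat_pow)
qed

interpretation listed: presentation "alphabet L" "relations p L" for p L
proof
  show "(u, v) \<in> relations p L (free_group (alphabet L)) (free_gen (alphabet L)) \<Longrightarrow>
      u \<in> carrier (free_group (alphabet L)) \<and> v \<in> carrier (free_group (alphabet L))" for u v
    by (rule relations_carrier[OF group_free_group]) auto
qed

lemma group_listed_group: "group (listed_group p L)"
  unfolding listed_group_def by (rule listed.group_presented_group)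

lemma listed_gen_closed: "x \<in> alphabet L \<Longrightarrow> listed_gen p L x \<in> carrier (listed_group p L)"
  unfolding listed_group_def listed_gen_def by (rule listed.presented_gen_closed)

lemma generate_listed_gen:
  "generate (listed_group p L) (listed_gen p L ` alphabet L) = carrier (listed_group p L)"
  using listed.generate_presented_gen[of L p]
  by (simp add: listed_group_def listed_gen_def[abs_def])

lemma group_hom_listed_map:
  "group_hom (free_group (alphabet L)) (listed_group p L) (listed.quotient_map L p)"
  using group_free_group[of "alphabet L"] group_listed_group[of p L] listed.quotient_map_hom[of L p]
  by (simp add: listed_group_def group_hom_def group_hom_axioms_def)

definition satisfies :: "nat \<Rightarrow> label \<Rightarrow> ('a, 'b) monoid_scheme \<Rightarrow> (letter \<Rightarrow> 'a) \<Rightarrow> bool" where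
  "satisfies p L G g \<longleftrightarrow> (\<forall>x \<in> alphabet L. g x \<in> carrier G) \<and> (\<forall>(u, v) \<in> relations p L G g. u = v)"

lemma satisfies_listed_gen: "satisfies p L (listed_group p L) (listed_gen p L)"
proof -
  interpret q: group_hom "free_group (alphabet L)" "listed_group p L" "listed.quotient_map L p"
    by (rule group_hom_listed_map)
  have "relations p L (listed_group p L) (listed_gen p L) =
      map_prod (listed.quotient_map L p) (listed.quotient_map L p) `
        relations p L (free_group (alphabet L)) (free_gen (alphabet L))"
    by (rule relations_hom[OF q.G.is_group q.H.is_group q.homh])
      (auto simp: listed.quotient_map_free_gen listed_gen_def)
  then show ?thesis
    using listed.quotient_map_relation[of _ _ p L] listed_gen_closed unfolding satisfies_def by auto
qed

lemma Ball_case_prodD: "(x, y) \<in> S \<Longrightarrow> \<forall>(u, v) \<in> S. P u v \<Longrightarrow> P x y"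
  by blast

lemma listed_group_universal:
  assumes "group H" "satisfies p L H f"
  obtains h where "h \<in> hom (listed_group p L) H" "\<And>x. x \<in> alphabet L \<Longrightarrow> h (listed_gen p L x) = f x"
proof -
  interpret H: group H by fact
  let ?F = "free_group (alphabet L)"
  obtain h0 where h0: "h0 \<in> hom ?F H" "\<And>x. x \<in> alphabet L \<Longrightarrow> h0 (free_gen (alphabet L) x) = f x"
    using H.free_group_universal[of f "alphabet L"] assms(2) unfolding satisfies_def by blast
  have "h0 u = h0 v" if "(u, v) \<in> relations p L ?F (free_gen (alphabet L))" for u v
  proof -
    have *: "relations p L H f = map_prod h0 h0 ` relations p L ?F (free_gen (alphabet L))"
      by (rule relations_hom[OF group_free_group assms(1) h0(1) _ h0(2)]) auto
    have "(h0 u, h0 v) \<in> relations p L H f"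
      unfolding * using that by (rule map_prod_imageI)
    moreover have "\<forall>(u, v) \<in> relations p L H f. u = v"
      using assms(2) by (simp add: satisfies_def)
    ultimately show ?thesis by (rule Ball_case_prodD)
  qed
  with h0 obtain h where h: "h \<in> hom (listed_group p L) H"
      "\<And>u. u \<in> carrier ?F \<Longrightarrow> h (listed.quotient_map L p u) = h0 u"
    using listed.presented_group_universal[OF assms(1), of h0 L p] unfolding listed_group_def by blast
  have "h (listed_gen p L x) = f x" if "x \<in> alphabet L" for x
    using h(2)[of "free_gen (alphabet L) x"] that h0(2)
    by (simp add: listed.quotient_map_free_gen listed_gen_def)
  with h(1) show ?thesis using that by blast
qed

section \<open>Finite p-groups\<close>

text \<open>The class equation: by orbit and stabilizer an orbit with more than one point has size
  divisible by \<open>p\<close>, and these orbits partition the points that are not fixed.\<close>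

lemma (in group_action) prime_dvd_card_fixed_points:
  assumes "prime p" "order G = p ^ n" "finite E" "p dvd card E"
  shows "p dvd card {x \<in> E. \<forall>g \<in> carrier G. \<phi> g x = x}"
proof -
  let ?F = "{x \<in> E. \<forall>g \<in> carrier G. \<phi> g x = x}"
  let ?C = "{orbit G \<phi> x | x. x \<in> E - ?F}"
  have orbit_dvd: "p dvd card (orbit G \<phi> x)" if x: "x \<in> E - ?F" for x
  proof -
    have "x \<in> E" using x by blast
    from orbit_stabilizer_theorem[OF this, unfolded assms(2), symmetric]
    have "card (orbit G \<phi> x) dvd p ^ n" by (rule dvdI)
    moreover have "card (orbit G \<phi> x) \<noteq> 1"
    proof
      assume "card (orbit G \<phi> x) = 1"
      then obtain y where "orbit G \<phi> x = {y}" by (auto simp: card_1_singleton_iff)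
      moreover have "x \<in> orbit G \<phi> x" using x orbit_refl by blast
      ultimately have "orbit G \<phi> x = {x}" by auto
      then have "\<forall>g \<in> carrier G. \<phi> g x = x" unfolding orbit_def by blast
      with x show False by blast
    qed
    ultimately show ?thesis
      using assms(1) by (auto simp: divides_primepow_nat)
  qed
  have orbit_sub: "orbit G \<phi> x \<subseteq> E - ?F" if x: "x \<in> E - ?F" for x
  proof
    fix y assume y: "y \<in> orbit G \<phi> x"
    have yE: "y \<in> E" using y x element_image unfolding orbit_def by blast
    moreover have "x = y" if "\<forall>g \<in> carrier G. \<phi> g y = y"
    proof -
      have "x \<in> orbit G \<phi> y" using orbit_sym[of x y] x y yE by blast
      then show ?thesis using that unfolding orbit_def by auto
    qed
    ultimately show "y \<in> E - ?F" using x by blast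
  qed
  have "x \<in> orbit G \<phi> x" if "x \<in> E" for x using that by (rule orbit_refl)
  then have un: "\<Union>?C = E - ?F" using orbit_sub by blast
  have "p dvd card (\<Union>?C)"
  proof (rule dvd_partition)
    show "finite (\<Union>?C)" using assms(3) unfolding un by blast
    show "\<forall>c1\<in>?C. \<forall>c2\<in>?C. c1 \<noteq> c2 \<longrightarrow> c1 \<inter> c2 = {}"
      using disjoint_union by (auto simp: orbits_def)
  qed (use orbit_dvd in blast)
  then have "p dvd card (E - ?F)" unfolding un .
  moreover have "card E = card ?F + card (E - ?F)"
    using assms(3) by (subst card_Un_disjoint[symmetric]) (auto intro: arg_cong[of _ _ card])
  ultimately show ?thesis using assms(4) by (simp add: dvd_add_left_iff)
qed

section \<open>Maximal subgroups of finite p-groups\<close>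

context group
begin

lemma finite_rcosets: "finite (carrier G) \<Longrightarrow> subgroup H G \<Longrightarrow> finite (rcosets H)"
  by (simp add: finite_UnionD rcosets_part_G)

lemma index_times_card:
  "subgroup H G \<Longrightarrow> subgroup_index G H * card H = order G"
  by (simp add: subgroup_index_def lagrange)

text \<open>The inverse turns right multiplication into a left action; the restricted abstraction is
  needed because \<open>Bij\<close> consists of extensional maps.\<close>

lemma r_coset_action:
  assumes H: "subgroup H G"
  shows "group_action (G\<lparr>carrier := H\<rparr>) (rcosets H) (\<lambda>h. \<lambda>X \<in> rcosets H. X #> inv h)"
proof -
  note HG = subgroup.subset[OF H]
  have closed: "X #> g \<in> rcosets H" if "X \<in> rcosets H" "g \<in> carrier G" for X g
    using that HG by (auto simp: RCOSETS_def coset_mult_assoc)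
  have assoc: "X #> g #> g' = X #> (g \<otimes> g')"
    if "X \<in> rcosets H" "g \<in> carrier G" "g' \<in> carrier G" for X g g'
    using that rcosets_part_G[OF H] by (intro coset_mult_assoc) auto
  have one: "X #> \<one> = X" if "X \<in> rcosets H" for X
    using that rcosets_part_G[OF H] by (intro coset_mult_one) auto
  have bij: "(\<lambda>X \<in> rcosets H. X #> inv h) \<in> Bij (rcosets H)" if h: "h \<in> H" for h
  proof -
    have "h \<in> carrier G" using h HG by blast
    then have "bij_betw (\<lambda>X \<in> rcosets H. X #> inv h) (rcosets H) (rcosets H)"
      by (intro bij_betwI[of _ _ _ "\<lambda>X. X #> h"]) (auto simp: closed assoc one)
    then show ?thesis by (simp add: Bij_def)
  qed
  interpret H: group "G\<lparr>carrier := H\<rparr>" by (rule subgroup_imp_group[OF H])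
  have "group_hom (G\<lparr>carrier := H\<rparr>) (BijGroup (rcosets H)) (\<lambda>h. \<lambda>X \<in> rcosets H. X #> inv h)"
  proof (rule group_homI[OF H.is_group group_BijGroup], rule homI)
    show "(\<lambda>X \<in> rcosets H. X #> inv (x \<otimes>\<^bsub>G\<lparr>carrier := H\<rparr>\<^esub> y)) =
        (\<lambda>X \<in> rcosets H. X #> inv x) \<otimes>\<^bsub>BijGroup (rcosets H)\<^esub> (\<lambda>X \<in> rcosets H. X #> inv y)"
      if "x \<in> carrier (G\<lparr>carrier := H\<rparr>)" "y \<in> carrier (G\<lparr>carrier := H\<rparr>)" for x y
    proof -
      have "x \<in> H" "y \<in> H" "x \<in> carrier G" "y \<in> carrier G" using that HG by auto
      then show ?thesis
        using bij by (auto simp: BijGroup_def compose_def assoc closed inv_mult_group intro!: restrict_ext)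
    qed
  qed (use bij in \<open>auto simp: BijGroup_def\<close>)
  then show ?thesis by (simp add: group_action_def)
qed

lemma maximal_subgroup_above:
  assumes "finite (carrier G)" "subgroup H G" "H \<noteq> carrier G"
  obtains M where "maximal_subgroup M G" "H \<subseteq> M"
proof -
  let ?S = "{K. subgroup K G \<and> K \<noteq> carrier G}"
  have "finite ?S"
    by (rule finite_subset[of _ "Pow (carrier G)"]) (use assms subgroup.subset in auto)
  then obtain M where "M \<in> ?S" "H \<subseteq> M" "\<forall>K \<in> ?S. M \<subseteq> K \<longrightarrow> K = M"
    using finite_has_maximal2[of ?S H] assms by auto
  then show ?thesis by (intro that) (auto simp: maximal_subgroup_def)
qed

end

locale p_group = group +
  fixes p :: nat and n :: nat
  assumes prime_p: "prime p" and order_pow: "order G = p ^ n"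
begin

lemma finite_carrier: "finite (carrier G)"
  using order_gt_0_iff_finite order_pow prime_p prime_gt_0_nat by simp

lemma finite_subgroup: "subgroup H G \<Longrightarrow> finite H"
  using finite_carrier by (meson finite_subset subgroup.subset)

lemma p_group_subgroup:
  assumes "subgroup H G"
  obtains m where "p_group (G\<lparr>carrier := H\<rparr>) p m" "card H = p ^ m" "m \<le> n"
proof -
  have "card H dvd p ^ n" using index_times_card[OF assms] order_pow by (metis dvd_triv_right)
  then obtain m where "card H = p ^ m" "m \<le> n" using divides_primepow_nat[OF prime_p] by blast
  moreover from this have "p_group (G\<lparr>carrier := H\<rparr>) p m"
    using subgroup_imp_group[OF assms] prime_p
    by (simp add: p_group_def p_group_axioms_def order_def)
  ultimately show ?thesis using that by blast
qed

lemma index_iff_card: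
  assumes "subgroup H G" "t \<le> n"
  shows "subgroup_index G H = p ^ t \<longleftrightarrow> card H = p ^ (n - t)"
proof -
  have *: "subgroup_index G H * card H = p ^ t * p ^ (n - t)"
    using index_times_card[OF assms(1)] order_pow assms(2) by (simp flip: power_add)
  have "p > 0" using prime_p prime_gt_0_nat by blast
  then have "p ^ t > 0" "p ^ (n - t) > 0" by simp_all
  with * show ?thesis by (metis mult_cancel1 mult_cancel2 neq0_conv)
qed

text \<open>\<open>M\<close> acts on its right cosets, and \<open>M #> x\<close> is fixed exactly if
  \<open>x\<close> conjugates \<open>M\<close> into itself. The number of fixed cosets is divisible
  by \<open>p\<close> and \<open>M\<close> is one of them, so some \<open>x\<close> outside
  \<open>M\<close> normalises \<open>M\<close>; by maximality the normaliser \<open>N\<close> is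
  everything.\<close>

lemma maximal_subgroup_normal:
  assumes M: "maximal_subgroup M G"
  shows "M \<lhd> G"
proof -
  have sub: "subgroup M G" and ne: "M \<noteq> carrier G"
    using M by (auto simp: maximal_subgroup_def)
  note MG = subgroup.subset[OF sub]
  interpret act: group_action "G\<lparr>carrier := M\<rparr>" "rcosets M" "\<lambda>h. \<lambda>X \<in> rcosets M. X #> inv h"
    by (rule r_coset_action[OF sub])
  obtain m where m: "card M = p ^ m" using p_group_subgroup[OF sub] by blast
  have "card (rcosets M) dvd p ^ n"
    using lagrange[OF sub] order_pow by (metis dvd_triv_left)
  moreover have "card (rcosets M) \<noteq> 1"
  proof
    assume "card (rcosets M) = 1"
    then have "card M = card (carrier G)" using lagrange[OF sub] by (simp add: order_def)
    then show False using ne MG finite_carrier card_subset_eq by blast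
  qed
  ultimately have "p dvd card (rcosets M)"
    using prime_p by (auto simp: divides_primepow_nat)
  let ?F = "{X \<in> rcosets M. \<forall>g \<in> M. X #> inv g = X}"
  have "{X \<in> rcosets M. \<forall>g \<in> carrier (G\<lparr>carrier := M\<rparr>). (\<lambda>X \<in> rcosets M. X #> inv g) X = X} = ?F"
    by auto
  then have dvd: "p dvd card ?F"
    using act.prime_dvd_card_fixed_points[OF prime_p, of m] m finite_rcosets[OF finite_carrier sub]
      \<open>p dvd card (rcosets M)\<close> by (simp add: order_def)
  have "M #> \<one> \<in> rcosets M" by (rule rcosetsI[OF MG]) simp
  then have "M \<in> rcosets M" using MG by simp
  then have "M \<in> ?F"
    using sub by (auto simp: subgroup.m_inv_closed coset_join2 subset_eq subgroup.mem_carrier)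
  have "card ?F \<noteq> 1"
  proof
    assume "card ?F = 1"
    with dvd have "p dvd 1" by (simp only:)
    then show False using prime_gt_1_nat[OF prime_p] by simp
  qed
  then have "?F \<noteq> {M}" by (metis (no_types) card_1_singleton_iff One_nat_def)
  with \<open>M \<in> ?F\<close> obtain X where X: "X \<in> ?F" "X \<noteq> M" by blast
  then obtain x where x: "x \<in> carrier G" "X = M #> x" by (auto simp: RCOSETS_def)
  have "x \<notin> M" using X x sub by (metis coset_join2)
  have conj: "x \<otimes> h \<otimes> inv x \<in> M" if h: "h \<in> M" for h
  proof -
    have hG: "h \<in> carrier G" using h MG by blast
    have "inv h \<in> M" by (rule subgroup.m_inv_closed[OF sub h])
    then have "M #> x #> h = M #> x" using X(1) x hG by auto
    then have "M #> (x \<otimes> h) = M #> x" using x hG MG by (simp add: coset_mult_assoc)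
    then have "x \<otimes> h \<in> M #> x" using rcos_self[OF _ sub, of "x \<otimes> h"] x hG by simp
    then show ?thesis
      using subgroup.rcos_module_imp[OF sub is_group x(1), of "x \<otimes> h"] x hG by simp
  qed
  define N where "N = {g \<in> carrier G. \<forall>h \<in> M. g \<otimes> h \<otimes> inv g \<in> M}"
  \<comment> \<open>\<open>N\<close> asks only for inclusion. Finiteness upgrades it to equality,
    which closure of \<open>N\<close> under inverses requires.\<close>
  have conj_image: "(\<lambda>h. g \<otimes> h \<otimes> inv g) ` M = M" if g: "g \<in> N" for g
  proof (rule card_subset_eq[OF finite_subgroup[OF sub]])
    have "inj_on (\<lambda>h. g \<otimes> h \<otimes> inv g) M"
    proof (rule inj_onI)
      fix h h' assume h: "h \<in> M" "h' \<in> M" and eq: "g \<otimes> h \<otimes> inv g = g \<otimes> h' \<otimes> inv g"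
      have "h \<in> carrier G" "h' \<in> carrier G" "g \<in> carrier G" using h g MG by (auto simp: N_def)
      with eq show "h = h'" by simp
    qed
    then show "card ((\<lambda>h. g \<otimes> h \<otimes> inv g) ` M) = card M" by (rule card_image)
  qed (use g in \<open>auto simp: N_def\<close>)
  have "subgroup N G"
  proof (rule subgroupI)
    have "\<one> \<in> N" using MG by (auto simp: N_def subset_eq)
    then show "N \<noteq> {}" by blast
    fix a assume a: "a \<in> N"
    have "inv a \<otimes> h \<otimes> inv (inv a) \<in> M" if "h \<in> M" for h
    proof -
      have "h \<in> (\<lambda>h. a \<otimes> h \<otimes> inv a) ` M" unfolding conj_image[OF a] by (rule that)
      then obtain h' where h': "h = a \<otimes> h' \<otimes> inv a" "h' \<in> M" by (rule imageE)
      moreover have "a \<in> carrier G" using a unfolding N_def by blast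
      moreover have "h' \<in> carrier G" using h'(2) MG by blast
      moreover from calculation have "inv a \<otimes> h = h' \<otimes> inv a"
        using h'(1) by (simp add: m_assoc[symmetric])
      ultimately show ?thesis by (simp add: m_assoc)
    qed
    then show "inv a \<in> N" using a by (auto simp: N_def)
    fix b assume b: "b \<in> N"
    have "a \<otimes> b \<otimes> h \<otimes> inv (a \<otimes> b) = a \<otimes> (b \<otimes> h \<otimes> inv b) \<otimes> inv a" if "h \<in> M" for h
      using that a b MG by (auto simp: N_def m_assoc inv_mult_group subset_eq)
    then show "a \<otimes> b \<in> N" using a b by (auto simp: N_def)
  qed (auto simp: N_def)
  moreover have "M \<subseteq> N" using sub MG by (auto simp: N_def subgroup.m_closed subgroup.m_inv_closed)
  ultimately have "N = M \<or> N = carrier G" using M by (auto simp: maximal_subgroup_def)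
  moreover have "x \<in> N" using x conj by (auto simp: N_def)
  ultimately have "N = carrier G" using \<open>x \<notin> M\<close> by blast
  then show ?thesis by (intro normal_invI[OF sub]) (auto simp: N_def)
qed

text \<open>The last power \<open>y^(p^e)\<close> of an outside element before the powers enter
  \<open>M\<close> is an \<open>x\<close> outside \<open>M\<close> with \<open>x^p\<close> in
  \<open>M\<close>. By maximality \<open>M\<close> and \<open>x\<close> generate the group, so there
  are at most \<open>p\<close> cosets, while the index is a power of \<open>p\<close> other than
  1.\<close>

lemma maximal_subgroup_index:
  assumes M: "maximal_subgroup M G"
  shows "subgroup_index G M = p"
proof -
  have sub: "subgroup M G" and ne: "M \<noteq> carrier G"
    using M by (auto simp: maximal_subgroup_def)
  interpret M: normal M G by (rule maximal_subgroup_normal[OF M])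
  obtain y where y: "y \<in> carrier G" "y \<notin> M" using ne M.subset by blast
  have "y [^] (p ^ n) \<in> M"
    using pow_order_eq_1[OF y(1)] order_pow M.one_closed by simp
  define e where "e = (LEAST e. y [^] (p ^ e) \<in> M)"
  have e: "y [^] (p ^ e) \<in> M" unfolding e_def by (rule LeastI) fact
  have "e \<noteq> 0" using e y by (auto intro: gr0I)
  then obtain e' where e': "e = Suc e'" by (cases e) auto
  define x where "x = y [^] (p ^ e')"
  have x: "x \<in> carrier G" using y by (simp add: x_def)
  have "x \<notin> M" using not_less_Least[of e' "\<lambda>e. y [^] (p ^ e) \<in> M"] e' by (simp add: e_def x_def)
  have xp: "x [^] p \<in> M" using e y by (simp add: x_def e' nat_pow_pow mult.commute)
  let ?K = "M <#> generate G {x}"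
  have "subgroup ?K G"
    using M.normal_axioms x by (intro mult_norm_subgroup generate_is_subgroup) auto
  moreover have "M \<subseteq> ?K"
  proof
    fix h assume "h \<in> M"
    then have "h \<otimes> \<one> \<in> ?K" using generate.one[of G "{x}"] unfolding set_mult_def by blast
    then show "h \<in> ?K" using \<open>h \<in> M\<close> M.subset by auto
  qed
  moreover have "\<one> \<otimes> x \<in> ?K"
    using generate.incl[of x "{x}" G] M.one_closed unfolding set_mult_def by blast
  then have "x \<in> ?K" using x by simp
  ultimately have K: "?K = carrier G" using M \<open>x \<notin> M\<close> by (auto simp: maximal_subgroup_def)
  have p0: "p > 0" using prime_p prime_gt_0_nat by blast
  have "rcosets M \<subseteq> (\<lambda>i. M #> x [^] i) ` {..<p}"
  proof
    fix X assume "X \<in> rcosets M"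
    then obtain g where g: "g \<in> carrier G" "X = M #> g" by (auto simp: RCOSETS_def)
    then have "g \<in> ?K" using K by simp
    then obtain h s where h: "h \<in> M" "s \<in> generate G {x}" "g = h \<otimes> s"
      by (auto simp: set_mult_def)
    then obtain k where k: "s = x [^] (k :: int)" using generate_pow[OF x] by auto
    note h = h(1) h(3)[unfolded k]
    have hG: "h \<in> carrier G" using h M.subset by blast
    define q r where "q = k div int p" and "r = k mod int p"
    have "x [^] k = (x [^] p) [^] q \<otimes> x [^] nat r"
    proof -
      have "x [^] k = x [^] (int p * q + r)" by (simp add: q_def r_def)
      also have "\<dots> = x [^] (int p * q) \<otimes> x [^] r" by (rule int_pow_mult[OF x])
      also have "x [^] (int p * q) = (x [^] p) [^] q" using x by (simp add: int_pow_pow int_pow_int[symmetric])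
      also have "x [^] r = x [^] nat r" using p0 by (simp add: r_def int_pow_int[symmetric])
      finally show ?thesis .
    qed
    moreover have "(x [^] p) [^] q \<in> M" by (rule subgroup_int_pow_closed[OF sub xp])
    ultimately have "g = (h \<otimes> (x [^] p) [^] q) \<otimes> x [^] nat r" "h \<otimes> (x [^] p) [^] q \<in> M"
      using h hG x by (auto simp: m_assoc)
    moreover have "M #> (h \<otimes> (x [^] p) [^] q) = M" if "h \<otimes> (x [^] p) [^] q \<in> M"
      using that sub by (intro coset_join2) (auto simp: subgroup.mem_carrier)
    ultimately have "X = M #> x [^] nat r"
      using g(2) x hG M.subset coset_mult_assoc[of M "h \<otimes> (x [^] p) [^] q" "x [^] nat r"] by simp
    moreover have "nat r < p" using p0 by (simp add: r_def nat_less_iff)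
    ultimately show "X \<in> (\<lambda>i. M #> x [^] i) ` {..<p}" by blast
  qed
  then have le: "card (rcosets M) \<le> p"
    by (metis card_image_le card_lessThan card_mono finite_imageI finite_lessThan le_trans)
  have "card (rcosets M) dvd p ^ n" using lagrange[OF sub] order_pow by (metis dvd_triv_left)
  then obtain j where j: "card (rcosets M) = p ^ j" using divides_primepow_nat[OF prime_p] by blast
  have "j \<noteq> 0"
  proof
    assume "j = 0"
    then have "card M = card (carrier G)" using lagrange[OF sub] j by (simp add: order_def)
    then show False using ne M.subset finite_carrier card_subset_eq by blast
  qed
  moreover have "j \<le> 1"
    using le j prime_p by (metis power_increasing_iff power_one_right prime_gt_1_nat)
  ultimately have "j = 1" by simp
  then show ?thesis using j by (simp add: subgroup_index_def)
qed

lemma index_p_maximal: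
  assumes "subgroup M G" "subgroup_index G M = p"
  shows "maximal_subgroup M G"
proof -
  have pM: "p * card M = order G" using index_times_card[OF assms(1)] assms(2) by simp
  have "p > 1" using prime_p prime_gt_1_nat by blast
  have "K = M \<or> K = carrier G" if K: "subgroup K G" "M \<subseteq> K" for K
  proof -
    interpret K: group "G\<lparr>carrier := K\<rparr>" by (rule subgroup_imp_group[OF K(1)])
    have "subgroup M (G\<lparr>carrier := K\<rparr>)" by (rule subgroup_incl[OF assms(1) K])
    then have "card M dvd card K"

      using dvd_triv_right[of "card M" "card (rcosets\<^bsub>G\<lparr>carrier := K\<rparr>\<^esub> M)"]
      by (simp add: K.lagrange order_def)
    then obtain c where c: "card K = c * card M" by (metis dvd_def mult.commute)
    obtain i where "i * card K = order G" using index_times_card[OF K(1)] by blast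
    then have "i * c * card M = p * card M" using pM c by simp
    moreover have "card M > 0" using assms(1) finite_subgroup by (metis card_gt_0_iff empty_iff subgroup.one_closed)
    ultimately have "i * c = p" by simp
    then have "c = 1 \<or> c = p" using prime_p by (metis dvd_triv_right prime_nat_iff)
    then show ?thesis
    proof
      assume "c = 1" then show ?thesis using c K card_subset_eq[OF finite_subgroup[OF K(1)], of M] by auto
    next
      assume "c = p"
      then have "card K = card (carrier G)" using c pM by (simp add: order_def)
      then show ?thesis using subgroup.subset[OF K(1)] finite_carrier by (simp add: card_subset_eq)
    qed
  qed
  moreover have "M \<noteq> carrier G"
    using pM \<open>p > 1\<close> prime_p order_pow by (auto simp: order_def)
  ultimately show ?thesis using assms by (auto simp: maximal_subgroup_def)
qed

lemma maximal_subgroup_iff: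
  "maximal_subgroup M G \<longleftrightarrow> subgroup M G \<and> subgroup_index G M = p"
  using index_p_maximal maximal_subgroup_index maximal_subgroup_def by blast

lemma index_p_normal: "subgroup M G \<Longrightarrow> subgroup_index G M = p \<Longrightarrow> M \<lhd> G"
  by (simp add: index_p_maximal maximal_subgroup_normal)

lemma index_p_pow:
  assumes "subgroup M G" "subgroup_index G M = p" "x \<in> carrier G"
  shows "x [^] p \<in> M"
proof -
  interpret M: normal M G by (rule index_p_normal[OF assms(1,2)])
  interpret Q: group "G Mod M" by (rule M.factorgroup_is_group)
  have "(M #> x) [^]\<^bsub>G Mod M\<^esub> p = \<one>\<^bsub>G Mod M\<^esub>"
    using Q.pow_order_eq_1[of "M #> x"] assms
    by (simp add: subgroup_index_def order_def FactGroup_def rcosetsI M.subset)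
  then have "M #> x [^] p = M" using M.FactGroup_pow[OF assms(3)] by simp
  then show ?thesis using rcos_self[of "x [^] p" M] assms by simp
qed

lemma index_p_coset:
  assumes M: "subgroup M G" "subgroup_index G M = p"
    and x: "x \<in> carrier G" "x \<notin> M" and y: "y \<in> carrier G"
  obtains h k where "h \<in> M" "y = h \<otimes> x [^] (k :: int)"
proof -
  interpret M: normal M G by (rule index_p_normal[OF M])
  let ?K = "M <#> generate G {x}"
  have "subgroup ?K G"
    using M.normal_axioms x by (intro mult_norm_subgroup generate_is_subgroup) auto
  moreover have "M \<subseteq> ?K"
  proof
    fix h assume "h \<in> M"
    then have "h \<otimes> \<one> \<in> ?K" using generate.one[of G "{x}"] unfolding set_mult_def by blast
    then show "h \<in> ?K" using \<open>h \<in> M\<close> M.subset by auto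
  qed
  moreover have "\<one> \<otimes> x \<in> ?K"
    using generate.incl[of x "{x}" G] M.one_closed unfolding set_mult_def by blast
  then have "x \<in> ?K" using x by simp
  ultimately have "?K = carrier G"
    using index_p_maximal[OF M] x(2) by (auto simp: maximal_subgroup_def)
  then have "y \<in> ?K" using y by simp
  then obtain h s where h: "h \<in> M" "s \<in> generate G {x}" "y = h \<otimes> s"
    by (auto simp: set_mult_def)
  then obtain k where "s = x [^] (k :: int)" using generate_pow[OF x(1)] by auto
  then show ?thesis using that h by blast
qed

text \<open>The quotient by \<open>M\<close> is cyclic. For \<open>x\<close> outside
  \<open>M\<close> one has \<open>y = h x^k\<close> with \<open>h\<close> in \<open>M\<close>, and
  then \<open>[x,y]\<close> is the conjugate by \<open>x^k\<close> of \<open>[x,h]\<close>, which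
  lies in \<open>M\<close>.\<close>

lemma index_p_commutator:
  assumes M: "subgroup M G" "subgroup_index G M = p" and x: "x \<in> carrier G" and y: "y \<in> carrier G"
  shows "commutator G x y \<in> M"
proof (cases "x \<in> M")
  interpret M: normal M G by (rule index_p_normal[OF M])
  case True
  then have "inv y \<otimes> x \<otimes> y \<in> M" using M.inv_op_closed1 y by blast
  then have "inv x \<otimes> (inv y \<otimes> x \<otimes> y) \<in> M" using True by blast
  then show ?thesis using x y by (simp add: commutator_def m_assoc)
next
  case False
  interpret M: normal M G by (rule index_p_normal[OF M])
  obtain h k where h: "h \<in> M" "y = h \<otimes> x [^] (k :: int)"
    by (rule index_p_coset[OF M x False y])
  have hG: "h \<in> carrier G" using h M.subset by blast
  have X: "x [^] k \<in> carrier G" using x by simp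
  have "x [^] k \<otimes> x = x \<otimes> x [^] k"
    using int_pow_mult[OF x, of k 1] int_pow_mult[OF x, of 1 k] x by (simp add: add.commute)
  then have "inv x \<otimes> inv (x [^] k) = inv (x [^] k) \<otimes> inv x"
    using inv_mult_group[OF X x] inv_mult_group[OF x X] by simp
  moreover have "commutator G x y = inv x \<otimes> inv (x [^] k) \<otimes> (inv h \<otimes> x \<otimes> h) \<otimes> x [^] k"
    using h hG x X by (simp add: commutator_def inv_mult_group m_assoc)
  ultimately have "commutator G x y = inv (x [^] k) \<otimes> (inv x \<otimes> inv h \<otimes> x \<otimes> h) \<otimes> x [^] k"
    using hG x X by (simp add: m_assoc)
  moreover have "inv x \<otimes> inv h \<otimes> x \<in> M"
    by (rule M.inv_op_closed1[OF x]) (use h in simp)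
  then have "inv x \<otimes> inv h \<otimes> x \<otimes> h \<in> M" using h by simp
  ultimately show ?thesis using M.inv_op_closed1[OF X] by simp
qed

lemma index_p_above:
  assumes "subgroup H G" "H \<noteq> carrier G"
  obtains M where "subgroup M G" "subgroup_index G M = p" "H \<subseteq> M"
  using maximal_subgroup_above[OF finite_carrier assms] maximal_subgroup_iff by metis

end

text \<open>Descent: as long as the ambient order exceeds \<open>p^m\<close>, \<open>K\<close> is
  proper and hence lies in a subgroup of index \<open>p\<close>, where the argument is
  repeated.\<close>

lemma subgroup_order_between:
  assumes "p_group G p n" "subgroup K G" "card K \<le> p ^ m" "m \<le> n"
  obtains L where "subgroup L G" "K \<subseteq> L" "card L = p ^ m"
  using assms
proof (induction n arbitrary: G thesis rule: less_induct)
  case (less n G)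
  interpret p_group G p n by fact
  show ?case
  proof (cases "m = n")
    case True
    then show ?thesis
      using less.prems(1)[of "carrier G"] subgroup_self subgroup.subset[OF less.prems(3)] order_pow
      by (simp add: order_def)
  next
    case False
    then have mn: "m < n" using less.prems by simp
    have "p > 1" using prime_p prime_gt_1_nat by blast
    then have "p ^ m < p ^ n" using mn by (rule power_strict_increasing[rotated])
    then have "K \<noteq> carrier G" using less.prems(4) order_pow by (auto simp: order_def)
    then obtain M where M: "subgroup M G" "subgroup_index G M = p" "K \<subseteq> M"
      using index_p_above less.prems(3) by blast
    have "card M = p ^ (n - 1)" using index_iff_card[OF M(1), of 1] M(2) mn by simp
    then have "p_group (G\<lparr>carrier := M\<rparr>) p (n - 1)"
      using subgroup_imp_group[OF M(1)] prime_p
      by (simp add: p_group_def p_group_axioms_def order_def)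
    moreover have "subgroup K (G\<lparr>carrier := M\<rparr>)" by (rule subgroup_incl[OF less.prems(3) M(1,3)])
    ultimately obtain L where L: "subgroup L (G\<lparr>carrier := M\<rparr>)" "K \<subseteq> L" "card L = p ^ m"
      using less.IH[of "n - 1" "G\<lparr>carrier := M\<rparr>"] less.prems(4) mn
        by (metis Suc_pred' bot_nat_0.not_eq_extremum lessI less_Suc_eq_le not_less_zero diff_Suc_1)
    then show ?thesis using less.prems(1) incl_subgroup[OF M(1)] by blast
  qed
qed

lemma (in group) comm_subgroup_iff:
  assumes "subgroup H G"
  shows "comm_group (G\<lparr>carrier := H\<rparr>) \<longleftrightarrow> (\<forall>x \<in> H. \<forall>y \<in> H. x \<otimes> y = y \<otimes> x)"
  using subgroup_imp_group[OF assms]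
  by (auto simp: comm_group_def comm_monoid_def comm_monoid_axioms_def group_def)

text \<open>If \<open>x\<close> and \<open>y\<close> did not commute, their centralisers
  \<open>C x\<close> and \<open>C y\<close> would be proper and nontrivial, hence of order and index
  \<open>p\<close>. Both then contain the nontrivial \<open>[x,y]\<close>, so they coincide, and
  \<open>x\<close> would centralise \<open>y\<close>.\<close>

lemma (in p_group) order_p_squared_comm:
  assumes "n \<le> 2" "x \<in> carrier G" "y \<in> carrier G"
  shows "x \<otimes> y = y \<otimes> x"
proof (rule ccontr)
  assume ne: "x \<otimes> y \<noteq> y \<otimes> x"
  define C where "C = (\<lambda>u. {g \<in> carrier G. g \<otimes> u = u \<otimes> g})"
  have sub: "subgroup (C u) G" if u: "u \<in> carrier G" for u
  proof (rule subgroupI)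
    show "C u \<noteq> {}" using u by (auto simp: C_def intro!: exI[of _ "\<one>"])
    fix a assume a: "a \<in> C u"
    then have "a \<otimes> (inv a \<otimes> u) = a \<otimes> (u \<otimes> inv a)" using u by (simp add: C_def m_assoc[symmetric]) (simp add: m_assoc)
    then show "inv a \<in> C u" using a u by (auto simp: C_def)
    fix b assume b: "b \<in> C u"
    have ab: "a \<in> carrier G" "a \<otimes> u = u \<otimes> a" "b \<in> carrier G" "b \<otimes> u = u \<otimes> b"
      using a b by (auto simp: C_def)
    have "a \<otimes> b \<otimes> u = a \<otimes> (b \<otimes> u)" using ab(1,3) u by (rule m_assoc)
    also have "\<dots> = a \<otimes> u \<otimes> b" unfolding ab(4) using ab(1,3) u by (simp only: m_assoc)
    also have "\<dots> = u \<otimes> (a \<otimes> b)" unfolding ab(2) using ab(1,3) u by (simp only: m_assoc)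
    finally have "a \<otimes> b \<otimes> u = u \<otimes> (a \<otimes> b)" .
    then show "a \<otimes> b \<in> C u" using a b by (simp add: C_def)
  qed (auto simp: C_def)
  have p1: "p > 1" using prime_p prime_gt_1_nat by blast
  have idx: "subgroup_index G (C u) = p" "card (C u) = p"
    if u: "u \<in> carrier G" "v \<in> carrier G" "u \<otimes> v \<noteq> v \<otimes> u" for u v
  proof -
    obtain m where m: "card (C u) = p ^ m" "m \<le> n" using p_group_subgroup[OF sub[OF u(1)]] by blast
    have "v \<notin> C u" using u by (auto simp: C_def)
    then have "C u \<noteq> carrier G" using u by blast
    then have "card (C u) \<noteq> card (carrier G)"
      using finite_carrier card_subset_eq[of "carrier G" "C u"] by (auto simp: C_def)
    then have "m \<noteq> n" using m order_pow by (auto simp: order_def)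
    moreover have "m \<noteq> 0"
    proof
      assume "m = 0"
      then have "card (C u) = 1" using m by simp
      moreover have "u \<in> C u" "\<one> \<in> C u" using u by (auto simp: C_def)
      ultimately have "u = \<one>" by (metis card_1_singletonE singletonD)
      then show False using u by auto
    qed
    ultimately have "m = 1" "n = 2" using m assms(1) by auto
    then show "card (C u) = p" using m by simp
    then show "subgroup_index G (C u) = p"
      using index_iff_card[OF sub[OF u(1)], of 1] \<open>n = 2\<close> by simp
  qed
  note xy = assms(2,3) ne
  have yx: "y \<in> carrier G" "x \<in> carrier G" "y \<otimes> x \<noteq> x \<otimes> y" using xy by auto
  have "commutator G x y \<in> C x \<inter> C y"
    using index_p_commutator sub xy idx(1)[OF xy] idx(1)[OF yx] by simp
  moreover have "commutator G x y \<noteq> \<one>"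
  proof
    assume "commutator G x y = \<one>"
    then have "inv (y \<otimes> x) \<otimes> (x \<otimes> y) = \<one>" using xy by (simp add: commutator_def inv_mult_group m_assoc)
    then show False using ne xy by (metis inv_closed inv_equality inv_inv m_closed)
  qed
  moreover have "\<one> \<in> C x \<inter> C y" using xy by (auto simp: C_def)
  moreover have inter: "subgroup (C x \<inter> C y) G" using sub xy subgroups_Inter_pair by blast
  moreover obtain j where j: "card (C x \<inter> C y) = p ^ j"
    using p_group_subgroup[OF inter] by blast
  ultimately have "j \<noteq> 0" by (metis card_1_singletonE power_0 singletonD)
  then have "p \<le> card (C x \<inter> C y)" using j p1 by (simp add: self_le_power)
  then have "C x \<inter> C y = C x" "C x \<inter> C y = C y"
    using idx(2)[OF xy] idx(2)[OF yx] sub xy finite_subgroup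
    by (metis Int_lower1 card_seteq)
      (metis Int_lower2 \<open>p \<le> card (C x \<inter> C y)\<close> card_seteq finite_subgroup idx(2) sub yx)
  moreover have "x \<in> C x" using xy by (simp add: C_def)
  ultimately show False using ne by (auto simp: C_def)
qed

lemma (in p_group) nonabelian_card:
  assumes "subgroup H G" "x \<in> H" "y \<in> H" "x \<otimes> y \<noteq> y \<otimes> x"
  shows "p ^ 3 \<le> card H"
proof -
  obtain m where m: "p_group (G\<lparr>carrier := H\<rparr>) p m" "card H = p ^ m"
    using p_group_subgroup[OF assms(1)] by blast
  have "\<not> m \<le> 2" using p_group.order_p_squared_comm[OF m(1), of x y] assms by auto
  then show ?thesis using m prime_gt_1_nat[OF prime_p] by (simp add: power_increasing)
qed

lemma finite_p_group_iff: "finite_p_group p G \<longleftrightarrow> (\<exists>n. p_group G p n)"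
proof
  assume "\<exists>n. p_group G p n"
  then obtain n where "p_group G p n" ..
  then interpret p_group G p n .
  show "finite_p_group p G"
    using prime_p finite_carrier order_pow is_group by (auto simp: finite_p_group_def)
qed (auto simp: finite_p_group_def p_group_def p_group_axioms_def)

section \<open>Membership in the classes of groups, expressed by subgroups of the ambient
  group\<close>

context p_group
begin

abbreviation commutes :: "'a set \<Rightarrow> bool" where
  "commutes K \<equiv> \<forall>x \<in> K. \<forall>y \<in> K. x \<otimes> y = y \<otimes> x"

lemma index_eq_iff:
  assumes "subgroup H G"
  shows "subgroup_index G H = m \<longleftrightarrow> m * card H = order G"
proof -
  have "card H > 0"
    using finite_subgroup[OF assms] subgroup.one_closed[OF assms] card_gt_0_iff by blast
  then show ?thesis using index_times_card[OF assms] by (metis mult_cancel2 neq0_conv)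
qed

text \<open>Indices inside \<open>H\<close> become products of cardinalities, and subgroups of
  \<open>H\<close> become subgroups of \<open>G\<close> below \<open>H\<close>; no nested group
  structures are left for the counting arguments.\<close>

lemma A_group_subgroup_iff:
  assumes H: "subgroup H G" and t: "t \<ge> 1"
  shows "A_group p t (G\<lparr>carrier := H\<rparr>) \<longleftrightarrow>
    (\<forall>K. subgroup K G \<and> K \<subseteq> H \<and> p ^ t * card K = card H \<longrightarrow> commutes K) \<and>
    (\<exists>K. subgroup K G \<and> K \<subseteq> H \<and> p ^ (t - 1) * card K = card H \<and> \<not> commutes K)"
proof -
  obtain m where "p_group (G\<lparr>carrier := H\<rparr>) p m"
    using p_group_subgroup[OF H] by blast
  then interpret H: p_group "G\<lparr>carrier := H\<rparr>" p m .
  have sub: "subgroup K (G\<lparr>carrier := H\<rparr>) \<longleftrightarrow> subgroup K G \<and> K \<subseteq> H" for K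
    using incl_subgroup[OF H] subgroup_incl[OF _ H] subgroup.subset[of K "G\<lparr>carrier := H\<rparr>"] by auto
  have idx: "subgroup_index (G\<lparr>carrier := H\<rparr>) K = c \<longleftrightarrow> c * card K = card H"
    if "subgroup K (G\<lparr>carrier := H\<rparr>)" for K c
    using H.index_eq_iff[OF that] by (simp add: order_def)
  have "finite_p_group p (G\<lparr>carrier := H\<rparr>)"
    using H.p_group_axioms finite_p_group_iff by blast
  then have "A_group p t (G\<lparr>carrier := H\<rparr>) \<longleftrightarrow>
    (\<forall>K. subgroup K (G\<lparr>carrier := H\<rparr>) \<and> p ^ t * card K = card H \<longrightarrow> comm_group (G\<lparr>carrier := K\<rparr>)) \<and>
    (\<exists>K. subgroup K (G\<lparr>carrier := H\<rparr>) \<and> p ^ (t - 1) * card K = card H \<and>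
      \<not> comm_group (G\<lparr>carrier := K\<rparr>))"
    using t unfolding A_group_def by (simp add: idx cong: conj_cong)
  also have "\<dots> \<longleftrightarrow> (\<forall>K. subgroup K G \<and> K \<subseteq> H \<and> p ^ t * card K = card H \<longrightarrow> commutes K) \<and>
    (\<exists>K. subgroup K G \<and> K \<subseteq> H \<and> p ^ (t - 1) * card K = card H \<and> \<not> commutes K)"
    unfolding sub using comm_subgroup_iff by (metis (no_types, lifting))
  finally show ?thesis .
qed

text \<open>The class with \<open>t = 1\<close> consists of the minimal nonabelian groups: every
  proper subgroup lies in one of index \<open>p\<close>, and the only subgroup of index
  \<open>p^0\<close> is \<open>H\<close> itself.\<close>

lemma A1_group_subgroup_iff:
  assumes H: "subgroup H G"
  shows "A_group p 1 (G\<lparr>carrier := H\<rparr>) \<longleftrightarrow>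
    \<not> commutes H \<and> (\<forall>K. subgroup K G \<and> K \<subset> H \<longrightarrow> commutes K)"
proof -
  obtain m where m: "p_group (G\<lparr>carrier := H\<rparr>) p m" "card H = p ^ m"
    using p_group_subgroup[OF H] by blast
  interpret H: p_group "G\<lparr>carrier := H\<rparr>" p m by fact
  have eq: "K = H" if "K \<subseteq> H" "card K = card H" for K
    using that finite_subgroup[OF H] by (simp add: card_subset_eq)
  have p1: "p > 1" using prime_p prime_gt_1_nat by blast
  have "(\<forall>K. subgroup K G \<and> K \<subseteq> H \<and> p * card K = card H \<longrightarrow> commutes K) \<longleftrightarrow>
      (\<forall>K. subgroup K G \<and> K \<subset> H \<longrightarrow> commutes K)"
  proof (intro iffI allI impI)
    fix K assume *: "\<forall>K. subgroup K G \<and> K \<subseteq> H \<and> p * card K = card H \<longrightarrow> commutes K"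
      and K: "subgroup K G \<and> K \<subset> H"
    then have "subgroup K (G\<lparr>carrier := H\<rparr>)" "K \<noteq> carrier (G\<lparr>carrier := H\<rparr>)"
      using subgroup_incl[OF _ H] by auto
    then obtain L where L: "subgroup L (G\<lparr>carrier := H\<rparr>)" "subgroup_index (G\<lparr>carrier := H\<rparr>) L = p" "K \<subseteq> L"
      using H.index_p_above by blast
    then have "p * card L = card H" using H.index_eq_iff[OF L(1)] by (simp add: order_def)
    then have "commutes L"
      using * incl_subgroup[OF H L(1)] subgroup.subset[OF L(1)] by simp
    then show "commutes K" using L(3) by blast
  next
    fix K assume "\<forall>K. subgroup K G \<and> K \<subset> H \<longrightarrow> commutes K"
      and "subgroup K G \<and> K \<subseteq> H \<and> p * card K = card H"
    moreover from this have "K \<noteq> H" using p1 m(2) by auto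
    ultimately show "commutes K" by blast
  qed
  moreover have "(\<exists>K. subgroup K G \<and> K \<subseteq> H \<and> card K = card H \<and> \<not> commutes K) \<longleftrightarrow> \<not> commutes H"
    using eq H by blast
  ultimately show ?thesis using A_group_subgroup_iff[OF H, of 1] by (simp; blast)
qed

lemma index_p_above_in_subgroup:
  assumes "subgroup H G" "subgroup K G" "K \<subset> H"
  obtains L where "subgroup L G" "K \<subseteq> L" "L \<subseteq> H" "p * card L = card H"
proof -
  obtain m where "p_group (G\<lparr>carrier := H\<rparr>) p m" using p_group_subgroup[OF assms(1)] by blast
  then interpret H: p_group "G\<lparr>carrier := H\<rparr>" p m .
  have "subgroup K (G\<lparr>carrier := H\<rparr>)" "K \<noteq> carrier (G\<lparr>carrier := H\<rparr>)"
    using subgroup_incl[OF assms(2,1)] assms(3) by auto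
  then obtain L where L: "subgroup L (G\<lparr>carrier := H\<rparr>)" "subgroup_index (G\<lparr>carrier := H\<rparr>) L = p" "K \<subseteq> L"
    using H.index_p_above by blast
  then show ?thesis
    using that incl_subgroup[OF assms(1) L(1)] H.index_eq_iff[OF L(1)] subgroup.subset[OF L(1)]
    by (simp add: order_def)
qed

lemma index_p_in_subgroup:
  assumes "subgroup H G" "subgroup L G" "L \<subseteq> H" "p * card L = card H"
  shows "x \<in> H \<Longrightarrow> x [^] p \<in> L"
    and "x \<in> H \<Longrightarrow> y \<in> H \<Longrightarrow> commutator G x y \<in> L"
proof -
  obtain m where "p_group (G\<lparr>carrier := H\<rparr>) p m" using p_group_subgroup[OF assms(1)] by blast
  then interpret H: p_group "G\<lparr>carrier := H\<rparr>" p m .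
  have L: "subgroup L (G\<lparr>carrier := H\<rparr>)" by (rule subgroup_incl[OF assms(2,1,3)])
  then have idx: "subgroup_index (G\<lparr>carrier := H\<rparr>) L = p"
    using H.index_eq_iff[OF L] assms(4) by (simp add: order_def)
  show "x [^] p \<in> L" if "x \<in> H"
    using H.index_p_pow[OF L idx, of x] that by (simp add: nat_pow_consistent[symmetric])
  show "commutator G x y \<in> L" if "x \<in> H" "y \<in> H"
    using H.index_p_commutator[OF L idx, of x y] that
    by (simp add: commutator_def m_inv_consistent[OF assms(1)])
qed

text \<open>For noncommuting \<open>x\<close>, \<open>y\<close> in \<open>L\<close> the centraliser
  \<open>C\<close> of \<open>x\<close> in \<open>L\<close> gives a strict chain
  \<open>Z < C < L\<close>, because \<open>x\<close> is in \<open>C\<close> but not central and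
  \<open>y\<close> is not in \<open>C\<close>. This needs index at least \<open>p^2\<close>.\<close>

lemma commutes_of_central_index_p:
  assumes L: "subgroup L G" and Z: "subgroup Z G" "Z \<subseteq> L"
    and central: "\<And>z x. z \<in> Z \<Longrightarrow> x \<in> L \<Longrightarrow> z \<otimes> x = x \<otimes> z"
    and card: "card L \<le> p * card Z"
  shows "commutes L"
proof (rule ccontr)
  assume "\<not> commutes L"
  then obtain x y where xy: "x \<in> L" "y \<in> L" "x \<otimes> y \<noteq> y \<otimes> x" by blast
  note LG = subgroup.subset[OF L]
  have x: "x \<in> carrier G" using xy LG by blast
  define C where "C = {g \<in> L. g \<otimes> x = x \<otimes> g}"
  have sub: "subgroup C G"
  proof (rule subgroupI)
    show "C \<noteq> {}" using xy by (auto simp: C_def)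
    fix a assume "a \<in> C"
    then have a: "a \<in> L" "a \<otimes> x = x \<otimes> a" "a \<in> carrier G" using LG by (auto simp: C_def)
    have "inv a \<otimes> x = inv a \<otimes> (x \<otimes> a) \<otimes> inv a" using a(3) x by (simp add: m_assoc)
    also have "\<dots> = x \<otimes> inv a" unfolding a(2)[symmetric] using a(3) x by (simp add: m_assoc[symmetric])
    finally show "inv a \<in> C" using a subgroup.m_inv_closed[OF L] by (simp add: C_def)
    fix b assume "b \<in> C"
    then have b: "b \<in> L" "b \<otimes> x = x \<otimes> b" "b \<in> carrier G" using LG by (auto simp: C_def)
    have "a \<otimes> b \<otimes> x = a \<otimes> (b \<otimes> x)" using a(3) b(3) x by (rule m_assoc)
    also have "\<dots> = a \<otimes> x \<otimes> b" unfolding b(2) using a(3) b(3) x by (simp only: m_assoc)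
    also have "\<dots> = x \<otimes> (a \<otimes> b)" unfolding a(2) using a(3) b(3) x by (simp only: m_assoc)
    finally show "a \<otimes> b \<in> C" using a(1) b(1) subgroup.m_closed[OF L] by (simp add: C_def)
  qed (use LG in \<open>auto simp: C_def\<close>)
  have fin: "finite L" "finite C" using finite_subgroup L sub by auto
  have "x \<notin> Z" using central[of x y] xy by auto
  moreover have "Z \<subseteq> C" using central xy(1) Z(2) by (auto simp: C_def)
  moreover have "x \<in> C" using xy by (simp add: C_def)
  ultimately have "card Z < card C" using fin by (intro psubset_card_mono) auto
  moreover have "y \<in> L - C" using xy by (auto simp: C_def)
  then have "card C < card L" using fin by (intro psubset_card_mono) (auto simp: C_def)
  moreover obtain i j where "card Z = p ^ i" "card C = p ^ j"
    using p_group_subgroup[OF Z(1)] p_group_subgroup[OF sub] by metis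
  moreover obtain k where "card L = p ^ k" using p_group_subgroup[OF L] by metis
  moreover have "p > 1" using prime_p prime_gt_1_nat by blast
  ultimately have "i < j" "j < k" "p ^ k \<le> p ^ Suc i" using card by auto
  moreover from this(3) have "k \<le> Suc i" using \<open>p > 1\<close> power_le_imp_le_exp by blast
  ultimately show False by simp
qed

lemma A0_group_subgroup_iff:
  assumes H: "subgroup H G"
  shows "A_group p 0 (G\<lparr>carrier := H\<rparr>) \<longleftrightarrow> commutes H"
  using p_group_subgroup[OF H] finite_p_group_iff comm_subgroup_iff[OF H]
  unfolding A_group_def by auto

end

section \<open>The covering group\<close>

text \<open>The binomial coefficient C(m,2), extended to negative \<open>m\<close> because the
  exponents of \<open>b\<close> range over all integers.\<close>

definition tri :: "int \<Rightarrow> int" where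
  "tri m = m * (m - 1) div 2"

lemma two_tri: "2 * tri m = m * (m - 1)"
  by (simp add: tri_def)

lemma tri_0 [simp]: "tri 0 = 0" and tri_1 [simp]: "tri 1 = 0"
  by (simp_all add: tri_def)

lemma tri_add: "tri (m + n) = tri m + tri n + m * n"
proof -
  have "2 * tri (m + n) = 2 * (tri m + tri n + m * n)"
    by (simp only: distrib_left two_tri) (simp add: algebra_simps)
  then show ?thesis by simp
qed

lemma tri_mult: "tri (m * n) = m * m * tri n + n * tri m"
proof -
  have "2 * tri (m * n) = m * m * (2 * tri n) + n * (2 * tri m)"
    by (simp only: two_tri) (simp add: algebra_simps)
  then have "2 * tri (m * n) = 2 * (m * m * tri n + n * tri m)" by (simp add: algebra_simps)
  then show ?thesis by simp
qed

lemma tri_of_nat: "tri (int m) = int (m choose 2)"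
proof -
  have "2 * (m choose 2) = m * (m - 1)" by (cases m) (simp_all add: choose_two)
  then have "2 * int (m choose 2) = int m * (int m - 1)"
    by (cases m) (auto simp: algebra_simps of_nat_mult[symmetric] simp del: of_nat_mult)
  then show ?thesis using two_tri[of "int m"] by simp
qed

text \<open>The residue of C(p,2) modulo a prime \<open>p\<close>, which allows \<open>p = 2\<close>
  and odd \<open>p\<close> to be treated together.\<close>

definition eps :: "nat \<Rightarrow> int" where
  "eps p = (if p = 2 then 1 else 0)"

lemma prime_dvd_tri:
  assumes "prime p"
  shows "int p dvd tri (int p) - eps p"
proof (cases "p = 2")
  case False
  then have "odd p" using assms by (metis prime_odd_nat prime_ge_2_nat le_neq_implies_less)
  then obtain m where "p = 2 * m + 1" by (elim oddE)
  then have "tri (int p) = int p * int m" using two_tri[of "int p"] by simp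
  then show ?thesis using False by (simp add: eps_def)
qed (simp add: eps_def tri_def)

text \<open>The sign in front of \<open>w * eps p\<close> is free because \<open>p\<close> divides
  \<open>2 * eps p\<close>. In this form the congruence says that \<open>b^(p w)\<close> commutes
  with \<open>a\<close> once \<open>c^p d^(eps p) = 1\<close>.\<close>

lemma prime_dvd_tri_mult:
  assumes "prime p"
  shows "int p dvd tri (int p * w) + w * eps p"
proof -
  have "tri (int p * w) + w * eps p =
      int p * (int p * tri w) + w * (tri (int p) - eps p) + w * (2 * eps p)"
    by (subst tri_mult) (simp add: algebra_simps)
  moreover have "int p dvd 2 * eps p" by (simp add: eps_def)
  ultimately show ?thesis using prime_dvd_tri[OF assms] by (metis dvd_add dvd_mult dvd_triv_left)
qed

text \<open>The tuple \<open>(n, i, j, k)\<close> stands for \<open>b\<^sup>n a\<^sup>i c\<^sup>j d\<^sup>k\<close> where \<open>c = [a, b]\<close>, \<open>d = [c, b]\<close>, the elements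
  \<open>a\<close>, \<open>c\<close>, \<open>d\<close> commute and \<open>d\<close> is central.\<close>

definition poly_group :: "(int \<times> int \<times> int \<times> int) monoid" where
  "poly_group = \<lparr>carrier = UNIV,
     monoid.mult = (\<lambda>(n, i, j, k) (n', i', j', k').
       (n + n', i + i', j + n' * i + j', k + n' * j + tri n' * i + k')),
     one = (0, 0, 0, 0)\<rparr>"

text \<open>With \<open>z = a\<^sup>p c\<^bsup>C(p,2)\<^esup> d\<^bsup>C(p,3)\<^esup>\<close>, which is central, these are the words that vanish
  under the relations \<open>d\<^sup>p = c\<^sup>p d\<^bsup>C(p,2)\<^esup> = 1\<close>, \<open>z\<^sup>p = d\<^sup>s\<close> and \<open>b\<^sup>p = d\<^sup>t\<close>; note that
  \<open>C(p,2)\<close> is congruent to \<open>eps p\<close> modulo \<open>p\<close>.\<close>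

definition relN :: "nat \<Rightarrow> int \<Rightarrow> int \<Rightarrow> (int \<times> int \<times> int \<times> int) set" where
  "relN p s t = {(n, i, j, k). \<exists>w u v. n = int p * w \<and> i = int p * int p * u \<and> j = int p * v \<and>
     int p dvd k + u * (s + eps p) + v * eps p + t * w}"

lemma relN_I:
  "int p dvd k + u * (s + eps p) + v * eps p + t * w \<Longrightarrow>
    (int p * w, int p * int p * u, int p * v, k) \<in> relN p s t"
  unfolding relN_def by blast

lemma relN_E:
  assumes "(n, i, j, k) \<in> relN p s t"
  obtains w u v where "n = int p * w" "i = int p * int p * u" "j = int p * v"
    "int p dvd k + u * (s + eps p) + v * eps p + t * w"
  using assms unfolding relN_def by blast

lemma mult_poly_group:
  "(n, i, j, k) \<otimes>\<^bsub>poly_group\<^esub> (n', i', j', k') =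
    (n + n', i + i', j + n' * i + j', k + n' * j + tri n' * i + k')"
  by (simp add: poly_group_def)

lemma one_poly_group: "\<one>\<^bsub>poly_group\<^esub> = (0, 0, 0, 0)"
  by (simp add: poly_group_def)

lemma carrier_poly_group [simp]: "carrier poly_group = UNIV"
  by (simp add: poly_group_def)

lemma group_poly_group: "group poly_group"
proof (rule groupI)
  fix x y z :: "int \<times> int \<times> int \<times> int"
  show "x \<otimes>\<^bsub>poly_group\<^esub> y \<otimes>\<^bsub>poly_group\<^esub> z = x \<otimes>\<^bsub>poly_group\<^esub> (y \<otimes>\<^bsub>poly_group\<^esub> z)"
    by (cases x; cases y; cases z) (simp add: mult_poly_group tri_add algebra_simps)
  show "\<one>\<^bsub>poly_group\<^esub> \<otimes>\<^bsub>poly_group\<^esub> x = x"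
    by (cases x) (simp add: mult_poly_group one_poly_group)
  obtain n i j k where x: "x = (n, i, j, k)" by (cases x)
  have "(- n, - i, - j + n * i, - k + n * (j - n * i) + tri n * i) \<otimes>\<^bsub>poly_group\<^esub> x = \<one>\<^bsub>poly_group\<^esub>"
    by (simp add: x mult_poly_group one_poly_group algebra_simps)
  then show "\<exists>y \<in> carrier poly_group. y \<otimes>\<^bsub>poly_group\<^esub> x = \<one>\<^bsub>poly_group\<^esub>" by auto
qed auto

lemma inv_poly_group:
  "inv\<^bsub>poly_group\<^esub> (n, i, j, k) = (- n, - i, - j + n * i, - k + n * (j - n * i) + tri n * i)"
  by (rule group.inv_equality[OF group_poly_group])
    (simp_all add: mult_poly_group one_poly_group algebra_simps)

lemma relN_mult:
  assumes "x \<in> relN p s t" "y \<in> relN p s t"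
  shows "x \<otimes>\<^bsub>poly_group\<^esub> y \<in> relN p s t"
proof -
  from assms(1) obtain w u v k where x: "x = (int p * w, int p * int p * u, int p * v, k)"
    and dx: "int p dvd k + u * (s + eps p) + v * eps p + t * w" unfolding relN_def by blast
  from assms(2) obtain w' u' v' k' where y: "y = (int p * w', int p * int p * u', int p * v', k')"
    and dy: "int p dvd k' + u' * (s + eps p) + v' * eps p + t * w'" unfolding relN_def by blast
  have eq: "x \<otimes>\<^bsub>poly_group\<^esub> y = (int p * (w + w'), int p * int p * (u + u'),
      int p * (v + int p * int p * w' * u + v'),
      k + int p * w' * (int p * v) + tri (int p * w') * (int p * int p * u) + k')"
    by (simp add: x y mult_poly_group algebra_simps)
  have "(k + int p * w' * (int p * v) + tri (int p * w') * (int p * int p * u) + k') +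
      (u + u') * (s + eps p) + (v + int p * int p * w' * u + v') * eps p + t * (w + w') =
      (k + u * (s + eps p) + v * eps p + t * w) + (k' + u' * (s + eps p) + v' * eps p + t * w') +
      int p * (w' * int p * v + tri (int p * w') * int p * u + int p * w' * u * eps p)"
    by (simp add: algebra_simps)
  then show ?thesis unfolding eq using dx dy by (intro relN_I) (metis dvd_add dvd_triv_left)
qed

lemma relN_inv:
  assumes "x \<in> relN p s t"
  shows "inv\<^bsub>poly_group\<^esub> x \<in> relN p s t"
proof -
  from assms obtain w u v k where x: "x = (int p * w, int p * int p * u, int p * v, k)"
    and dx: "int p dvd k + u * (s + eps p) + v * eps p + t * w" unfolding relN_def by blast
  let ?k = "- k + int p * w * (int p * v - int p * w * (int p * int p * u)) +
      tri (int p * w) * (int p * int p * u)"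
  have eq: "inv\<^bsub>poly_group\<^esub> x = (int p * (- w), int p * int p * (- u),
      int p * (- v + int p * int p * w * u), ?k)"
    by (simp add: x inv_poly_group algebra_simps)
  have "?k + (- u) * (s + eps p) + (- v + int p * int p * w * u) * eps p + t * (- w) =
      - (k + u * (s + eps p) + v * eps p + t * w) +
      int p * (w * (int p * v - int p * w * (int p * int p * u)) + tri (int p * w) * int p * u +
        int p * w * u * eps p)"
    by (simp add: algebra_simps)
  then show ?thesis unfolding eq using dx by (intro relN_I) (metis dvd_add dvd_minus_iff dvd_triv_left)
qed

lemma relN_conj:
  assumes p: "prime p" and N: "x \<in> relN p s t"
  shows "inv\<^bsub>poly_group\<^esub> y \<otimes>\<^bsub>poly_group\<^esub> x \<otimes>\<^bsub>poly_group\<^esub> y \<in> relN p s t"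
proof -
  from N obtain w u v k where x: "x = (int p * w, int p * int p * u, int p * v, k)"
    and dx: "int p dvd k + u * (s + eps p) + v * eps p + t * w" unfolding relN_def by blast
  obtain n i j l where y: "y = (n, i, j, l)" by (cases y)
  let ?k = "k + n * (int p * v) + tri n * (int p * int p * u) - int p * w * j - tri (int p * w) * i"
  let ?z = "(int p * w, int p * int p * u, int p * (v + n * int p * u - w * i), ?k)"
  \<comment> \<open>The tuple \<open>?z\<close> is obtained by solving \<open>y z = x y\<close>
    coordinate by coordinate, which avoids the explicit inverse of \<open>y\<close>.\<close>
  have "y \<otimes>\<^bsub>poly_group\<^esub> ?z = x \<otimes>\<^bsub>poly_group\<^esub> y"
    by (simp add: x y mult_poly_group algebra_simps)
  then have eq: "inv\<^bsub>poly_group\<^esub> y \<otimes>\<^bsub>poly_group\<^esub> x \<otimes>\<^bsub>poly_group\<^esub> y = ?z"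
    using group.inv_solve_left[OF group_poly_group, of ?z y "x \<otimes>\<^bsub>poly_group\<^esub> y"]
    by (simp add: monoid.m_assoc[OF group.is_monoid[OF group_poly_group]] group.inv_closed[OF group_poly_group])
  \<comment> \<open>The only term not visibly divisible by \<open>p\<close> stems from moving
    \<open>b^(p w)\<close> past \<open>a^i\<close>. It is handled by
    \<open>prime_dvd_tri_mult\<close>; the relation between \<open>c^p\<close> and \<open>d\<close>
    in \<open>relN\<close> is there for this reason.\<close>
  have "?k + u * (s + eps p) + (v + n * int p * u - w * i) * eps p + t * w =
      (k + u * (s + eps p) + v * eps p + t * w) +
      int p * (n * v + tri n * int p * u - w * j + n * u * eps p) - i * (tri (int p * w) + w * eps p)"
    by (simp add: algebra_simps)
  moreover have "int p dvd tri (int p * w) + w * eps p" by (rule prime_dvd_tri_mult[OF p])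
  ultimately have "int p dvd ?k + u * (s + eps p) + (v + n * int p * u - w * i) * eps p + t * w"
    using dx by (metis dvd_add dvd_diff dvd_mult dvd_triv_left)
  then show ?thesis unfolding eq by (rule relN_I)
qed

lemma normal_relN:
  assumes "prime p"
  shows "relN p s t \<lhd> poly_group"
proof (rule group.normal_invI[OF group_poly_group])
  show "subgroup (relN p s t) poly_group"
  proof (rule group.subgroupI[OF group_poly_group])
    have "(int p * 0, int p * int p * 0, int p * 0, 0) \<in> relN p s t" by (rule relN_I) simp
    then show "relN p s t \<noteq> {}" by blast
  qed (auto intro: relN_mult relN_inv)
  fix x h assume "h \<in> relN p s t"
  then show "x \<otimes>\<^bsub>poly_group\<^esub> h \<otimes>\<^bsub>poly_group\<^esub> inv\<^bsub>poly_group\<^esub> x \<in> relN p s t"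
    using relN_conj[OF assms, of h s t "inv\<^bsub>poly_group\<^esub> x"] group.inv_inv[OF group_poly_group] by simp
qed

text \<open>Nothing is assumed about when two words are equal. The same calculus thus serves the
  model, the presented groups, and a group whose order is still unknown.\<close>

locale word_group = group +
  fixes el :: "int \<Rightarrow> int \<Rightarrow> int \<Rightarrow> int \<Rightarrow> 'a"
  assumes el_mult: "el n i j k \<otimes> el n' i' j' k' =
      el (n + n') (i + i') (j + n' * i + j') (k + n' * j + tri n' * i + k')"
    and carrier_el: "carrier G = {el n i j k | n i j k. True}"

context word_group
begin

lemma el_closed [simp]: "el n i j k \<in> carrier G"
  using carrier_el by blast

lemma el_cases:
  assumes "x \<in> carrier G"
  obtains n i j k where "x = el n i j k"
  using assms carrier_el by auto

lemma one_eq_el: "\<one> = el 0 0 0 0"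
proof -
  have "el 0 0 0 0 \<otimes> el 0 0 0 0 = el 0 0 0 0" by (simp add: el_mult)
  then show ?thesis using r_cancel_one[of "el 0 0 0 0" "el 0 0 0 0"] by simp
qed

lemma inv_el: "inv el n i j k = el (- n) (- i) (- j + n * i) (- k + n * (j - n * i) + tri n * i)"
  by (rule inv_equality) (simp_all add: el_mult one_eq_el algebra_simps)

lemma commutator_el:
  "commutator G (el n i j k) (el n' i' j' k') =
    el 0 0 (n' * i - n * i') (n' * j + tri n' * i - n * j' - tri n * i')"
proof -
  have "commutator G (el n i j k) (el n' i' j' k') =
      inv (el n' i' j' k' \<otimes> el n i j k) \<otimes> (el n i j k \<otimes> el n' i' j' k')"
    by (simp add: commutator_def inv_mult_group m_assoc)
  moreover have "el n i j k \<otimes> el n' i' j' k' = (el n' i' j' k' \<otimes> el n i j k) \<otimes>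
      el 0 0 (n' * i - n * i') (n' * j + tri n' * i - n * j' - tri n * i')"
    by (simp add: el_mult algebra_simps)
  ultimately show ?thesis by (simp add: inv_solve_left')
qed

text \<open>Collecting \<open>b\<close> to the left moves the \<open>r\<close>-fold power of
  \<open>b^n\<close> past one factor for each \<open>r < m\<close>. The sums of \<open>r\<close> and
  of \<open>tri (r * n)\<close> over these \<open>r\<close> are C(m,2) and \<open>n^2\<close> C(m,3)
  + \<open>tri n\<close> C(m,2).\<close>

lemma el_nat_pow:
  "el n i j k [^] (m :: nat) = el (int m * n) (int m * i) (int m * j + n * i * tri (int m))
     (int m * k + n * j * tri (int m) + i * (n * n * int (m choose 3) + tri n * tri (int m)))"
proof (induction m)
  case 0
  then show ?case by (simp add: one_eq_el numeral_3_eq_3)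
next
  case (Suc m)
  have "tri (int (Suc m)) = tri (int m) + int m"
    using tri_add[of "int m" 1] by (simp add: add.commute)
  moreover have "int (Suc m choose 3) = int (m choose 3) + tri (int m)"
    by (simp add: tri_of_nat numeral_3_eq_3 numeral_2_eq_2)
  ultimately show ?case
    using Suc by (simp add: el_mult algebra_simps)
qed

lemma el_0_int_pow: "el 0 i j k [^] (m :: int) = el 0 (m * i) (m * j) (m * k)"
proof (cases m)
  case (nonneg m')
  then show ?thesis by (simp add: int_pow_int el_nat_pow)
next
  case (neg m')
  then have "el 0 i j k [^] m = inv (el 0 i j k [^] Suc m')"
    using int_pow_neg_int[of "el 0 i j k" "Suc m'"] by simp
  then show ?thesis by (simp only: el_nat_pow inv_el) (simp add: neg algebra_simps)
qed

lemma el_1_int_pow: "el 1 0 0 0 [^] (m :: int) = el m 0 0 0"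
proof (cases m)
  case (nonneg m')
  then show ?thesis by (simp add: int_pow_int el_nat_pow)
next
  case (neg m')
  then have "el 1 0 0 0 [^] m = inv (el 1 0 0 0 [^] Suc m')"
    using int_pow_neg_int[of "el 1 0 0 0" "Suc m'"] by simp
  then show ?thesis by (simp only: el_nat_pow inv_el) (simp add: neg algebra_simps)
qed

lemma el_decompose:
  "el n i j k = el 1 0 0 0 [^] n \<otimes> el 0 1 0 0 [^] i \<otimes> el 0 0 1 0 [^] j \<otimes> el 0 0 0 1 [^] k"
  by (simp add: el_0_int_pow el_1_int_pow el_mult)

end

text \<open>Since the kernel of \<open>el\<close> is prescribed exactly, \<open>G\<close> is a copy
  of \<open>poly_group\<close> modulo \<open>relN p s t\<close> with a chosen pair of
  generators.\<close>

locale p_cover = word_group G el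
  for G (structure) and p :: nat and s t :: int and el +
  assumes prime_p: "prime p"
    and el_one_iff: "el n i j k = \<one> \<longleftrightarrow> (n, i, j, k) \<in> relN p s t"

definition model :: "nat \<Rightarrow> int \<Rightarrow> int \<Rightarrow> (int \<times> int \<times> int \<times> int) set monoid" where
  "model p s t = poly_group Mod relN p s t"

definition model_el :: "nat \<Rightarrow> int \<Rightarrow> int \<Rightarrow> int \<Rightarrow> int \<Rightarrow> int \<Rightarrow> int \<Rightarrow> (int \<times> int \<times> int \<times> int) set" where
  "model_el p s t n i j k = relN p s t #>\<^bsub>poly_group\<^esub> (n, i, j, k)"

lemma p_cover_model:
  assumes p: "prime p"
  shows "p_cover (model p s t) p s t (model_el p s t)"
proof -
  interpret P: group poly_group by (rule group_poly_group)
  interpret N: normal "relN p s t" poly_group by (rule normal_relN[OF p])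
  interpret Q: group "model p s t" unfolding model_def by (rule N.factorgroup_is_group)
  show ?thesis
  proof (unfold_locales, goal_cases)
    case (1 n i j k n' i' j' k')
    show ?case
      by (simp add: model_def model_el_def N.rcos_sum mult_poly_group)
  next
    case 2 show ?case
      by (auto simp: model_def model_el_def carrier_FactGroup)
  next
    case 3 show ?case by (rule p)
  next
    case (4 n i j k)
    show ?case
      using P.coset_join1[OF _ _ N.subgroup_axioms, of "(n, i, j, k)"]
        P.coset_join2[OF _ N.subgroup_axioms, of "(n, i, j, k)"]
      by (auto simp: model_def model_el_def)
  qed
qed

context p_cover
begin

lemma p_gt_1: "p > 1" and p_pos: "p > 0"
  using prime_p prime_gt_1_nat prime_gt_0_nat by auto

lemma prime_int: "prime (int p)"
  using prime_p by simp

lemma el_eq_iff: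
  "el n i j k = el n' i' j' k' \<longleftrightarrow> (n' - n, i' - i, j' - j - (n' - n) * i,
     k' - k - (n' - n) * j - tri (n' - n) * i) \<in> relN p s t"
proof -
  have "el n' i' j' k' = el n i j k \<otimes> el (n' - n) (i' - i) (j' - j - (n' - n) * i)
     (k' - k - (n' - n) * j - tri (n' - n) * i)"
    by (simp add: el_mult)
  then show ?thesis by (simp flip: el_one_iff)
qed

lemma el_eq_iff_same:
  "el n i j k = el n i' j' k' \<longleftrightarrow> (\<exists>u v. i' = i + int p * int p * u \<and> j' = j + int p * v \<and>
     int p dvd k' - k + u * (s + eps p) + v * eps p)"
proof -
  have "(0, i' - i, j' - j, k' - k) \<in> relN p s t \<longleftrightarrow>
    (\<exists>u v. i' - i = int p * int p * u \<and> j' - j = int p * v \<and>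
     int p dvd k' - k + u * (s + eps p) + v * eps p)"
    using p_pos by (auto simp: relN_def)
  then show ?thesis by (simp add: el_eq_iff algebra_simps)
qed

lemma el_cong_mod_p: "el n i j k = el n' i' j' k' \<Longrightarrow> [n' = n] (mod int p) \<and> [i' = i] (mod int p)"
  by (auto simp: el_eq_iff relN_def cong_iff_dvd_diff)

lemma el_reduce:
  obtains n' i' j' k' where "el n i j k = el n' i' j' k'" "0 \<le> n'" "n' < int p"
    "0 \<le> i'" "i' < int p * int p" "0 \<le> j'" "j' < int p" "0 \<le> k'" "k' < int p"
    "n' = n mod int p" "i' = i mod (int p * int p)"
proof -
  have P: "0 < int p" "0 < int p * int p" using p_pos by auto
  define m where "m = n mod int p - n"
  define w where "w = - (n div int p)"
  have m: "m = int p * w" unfolding m_def w_def by (simp add: minus_div_mult_eq_mod [symmetric])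
  define u where "u = - (i div (int p * int p))"
  define v where "v = - ((j + m * i) div int p)"
  \<comment> \<open>Reducing the exponents of \<open>b\<close>, \<open>a\<close> and
    \<open>c\<close> releases powers of \<open>d\<close>. They are collected in \<open>l\<close>, so
    the exponent of \<open>d\<close> is reduced last.\<close>
  define l where "l = k + m * j + tri m * i - u * (s + eps p) - v * eps p - t * w"
  have i: "i mod (int p * int p) - i = int p * int p * u"
    unfolding u_def by (simp add: minus_div_mult_eq_mod [symmetric])
  have j: "(j + m * i) mod int p - j - m * i = int p * v"
    unfolding v_def by (simp add: minus_div_mult_eq_mod [symmetric])
  have k: "int p dvd (l mod int p - k - m * j - tri m * i) + u * (s + eps p) + v * eps p + t * w"
  proof -
    have "l mod int p - l = int p * (- (l div int p))" by (simp add: minus_div_mult_eq_mod [symmetric])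
    moreover have "(l mod int p - k - m * j - tri m * i) + u * (s + eps p) + v * eps p + t * w =
      l mod int p - l" by (simp add: l_def)
    ultimately show ?thesis by simp
  qed
  have "el n i j k = el (n mod int p) (i mod (int p * int p)) ((j + m * i) mod int p) (l mod int p)"
    unfolding el_eq_iff m_def[symmetric] i j using relN_I[OF k] m by simp
  then show ?thesis by (rule that) (use P in auto)
qed

lemma el_eq_reduced:
  assumes "el n i j k = el n' i' j' k'"
    and "0 \<le> n" "n < int p" "0 \<le> i" "i < int p * int p" "0 \<le> j" "j < int p" "0 \<le> k" "k < int p"
    and "0 \<le> n'" "n' < int p" "0 \<le> i'" "i' < int p * int p" "0 \<le> j'" "j' < int p" "0 \<le> k'" "k' < int p"
  shows "n = n' \<and> i = i' \<and> j = j' \<and> k = k'"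
proof -
  have eqI: "x = y" if "0 \<le> x" "x < m" "0 \<le> y" "y < m" "y = x + m * u" for x y m u :: int
    using that by (metis mod_mult_self2 mod_pos_pos_trivial)
  obtain w u v where "n' - n = int p * w" "i' - i = int p * int p * u"
      "j' - j - (n' - n) * i = int p * v"
      and d: "int p dvd k' - k - (n' - n) * j - tri (n' - n) * i + u * (s + eps p) + v * eps p + t * w"
    using assms(1)[unfolded el_eq_iff] by (rule relN_E)
  then have *: "n' = n + int p * w" "i' = i + int p * int p * u" "j' = j + (n' - n) * i + int p * v"
    by linarith+
  have n: "n = n'" by (rule eqI[OF assms(2,3,10,11) *(1)])
  then have w: "w = 0" using *(1) p_pos by simp
  have i: "i = i'" by (rule eqI[OF assms(4,5,12,13) *(2)])
  then have u: "u = 0" using *(2) p_pos by simp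
  have "j' = j + int p * v" using *(3) n by simp
  then have j: "j = j'" by (rule eqI[OF assms(6,7,14,15)])
  then have v: "v = 0" using *(3) p_pos n by simp
  have "int p dvd k' - k" using d n w u v by simp
  then have "k mod int p = k' mod int p" by (simp add: mod_eq_dvd_iff dvd_diff_commute)
  then have "k = k'" using assms(8,9,16,17) by simp
  with n i j show ?thesis by simp
qed

text \<open>The commutator is a word in \<open>c\<close> and \<open>d\<close>. Its
  \<open>c\<close>-exponent must be a multiple \<open>p v\<close>, and \<open>v * eps p\<close> is
  the carry into the exponent of \<open>d\<close>, as \<open>c^p = d^(eps p)\<close>.\<close>

lemma commute_el_iff:
  "el n i j k \<otimes> el n' i' j' k' = el n' i' j' k' \<otimes> el n i j k \<longleftrightarrow>
    (\<exists>v. n' * i - n * i' = int p * v \<and>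
      int p dvd n' * j + tri n' * i - n * j' - tri n * i' + v * eps p)"
proof -
  have "el n i j k \<otimes> el n' i' j' k' = (el n' i' j' k' \<otimes> el n i j k) \<otimes>
      el 0 0 (n' * i - n * i') (n' * j + tri n' * i - n * j' - tri n * i')"
    by (simp add: el_mult algebra_simps)
  then have "el n i j k \<otimes> el n' i' j' k' = el n' i' j' k' \<otimes> el n i j k \<longleftrightarrow>
      el 0 0 (n' * i - n * i') (n' * j + tri n' * i - n * j' - tri n * i') = \<one>"
    by simp
  also have "\<dots> \<longleftrightarrow> (\<exists>v. n' * i - n * i' = int p * v \<and>
      int p dvd n' * j + tri n' * i - n * j' - tri n * i' + v * eps p)"
    unfolding el_one_iff using p_pos by (auto simp: relN_def)
  finally show ?thesis .
qed

lemma order_eq: "order G = p ^ 5"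
proof -
  let ?B = "{0..<int p} \<times> {0..<int p * int p} \<times> {0..<int p} \<times> {0..<int p}"
  have "bij_betw (\<lambda>(n, i, j, k). el n i j k) ?B (carrier G)"
  proof (rule bij_betw_imageI)
    show "inj_on (\<lambda>(n, i, j, k). el n i j k) ?B"
      by (intro inj_onI) (auto dest: el_eq_reduced)
    show "(\<lambda>(n, i, j, k). el n i j k) ` ?B = carrier G"
    proof
      show "carrier G \<subseteq> (\<lambda>(n, i, j, k). el n i j k) ` ?B"
      proof
        fix x assume "x \<in> carrier G"
        then obtain n i j k where x: "x = el n i j k" by (rule el_cases)
        obtain n' i' j' k' where *: "el n i j k = el n' i' j' k'" "0 \<le> n'" "n' < int p"
          "0 \<le> i'" "i' < int p * int p" "0 \<le> j'" "j' < int p" "0 \<le> k'" "k' < int p"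
          by (rule el_reduce)
        then show "x \<in> (\<lambda>(n, i, j, k). el n i j k) ` ?B"
          unfolding x by (intro image_eqI[of _ _ "(n', i', j', k')"]) auto
      qed
    qed auto
  qed
  then have "card (carrier G) = card ?B" by (metis bij_betw_same_card)
  also have "\<dots> = p ^ 5"
    by (simp add: card_cartesian_product nat_mult_distrib eval_nat_numeral)
  finally show ?thesis by (simp add: order_def)
qed

sublocale p_group G p 5
  using prime_p order_eq by unfold_locales

end

text \<open>Equality of two normal words depends on \<open>p\<close>, \<open>s\<close>,
  \<open>t\<close> only, so sending a word to the word with the same exponents is well defined and
  injective.\<close>

lemma p_cover_iso:
  fixes G :: "('a, 'x) monoid_scheme" and G' :: "('b, 'y) monoid_scheme"
  assumes "p_cover G p s t el" "p_cover G' p s t el'"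
  obtains h where "h \<in> iso G G'" "\<And>n i j k. h (el n i j k) = el' n i j k"
proof -
  interpret G: p_cover G p s t el by fact
  interpret G': p_cover G' p s t el' by fact
  have eq: "el n i j k = el n' i' j' k' \<longleftrightarrow> el' n i j k = el' n' i' j' k'" for n i j k n' i' j' k'
    by (simp add: G.el_eq_iff G'.el_eq_iff)
  define h where "h x = (SOME y. \<exists>n i j k. x = el n i j k \<and> y = el' n i j k)" for x
  have h: "h (el n i j k) = el' n i j k" for n i j k
    unfolding h_def by (rule some_equality) (use eq in \<open>blast, metis\<close>)
  have "h \<in> hom G G'"
  proof (rule homI)
    fix x y assume "x \<in> carrier G" "y \<in> carrier G"
    then obtain n i j k n' i' j' k' where "x = el n i j k" "y = el n' i' j' k'"
      by (metis G.el_cases)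
    then show "h (x \<otimes>\<^bsub>G\<^esub> y) = h x \<otimes>\<^bsub>G'\<^esub> h y" by (simp add: G.el_mult G'.el_mult h)
  next
    fix x assume "x \<in> carrier G"
    then obtain n i j k where "x = el n i j k" by (rule G.el_cases)
    then show "h x \<in> carrier G'" by (simp add: h)
  qed
  moreover have "bij_betw h (carrier G) (carrier G')"
  proof (rule bij_betw_imageI)
    show "inj_on h (carrier G)"
      unfolding G.carrier_el by (auto intro!: inj_onI simp: h eq)
    show "h ` carrier G = carrier G'"
    proof
      show "carrier G' \<subseteq> h ` carrier G"
      proof
        fix y assume "y \<in> carrier G'"
        then obtain n i j k where "y = el' n i j k" by (rule G'.el_cases)
        then show "y \<in> h ` carrier G" by (metis h G.el_closed imageI)
      qed
    qed (auto simp: h elim!: G.el_cases)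
  qed
  ultimately show ?thesis using that h by (auto simp: iso_def)
qed

lemma p_cover_transport:
  assumes "p_cover G p s t el" "group G'" "h \<in> iso G G'"
  shows "p_cover G' p s t (\<lambda>n i j k. h (el n i j k))"
proof -
  interpret p_cover G p s t el by fact
  interpret G': group G' by fact
  interpret h: group_hom G G' h
    using assms by (intro group_homI) (auto simp: iso_def intro: is_group)
  have inj: "inj_on h (carrier G)" and im: "h ` carrier G = carrier G'"
    using assms(3) by (auto simp: iso_def bij_betw_def)
  show ?thesis
  proof unfold_locales
    show "carrier G' = {h (el n i j k) | n i j k. True}"
      unfolding im[symmetric] by (auto elim!: el_cases)
    show "h (el n i j k) = \<one>\<^bsub>G'\<^esub> \<longleftrightarrow> (n, i, j, k) \<in> relN p s t" for n i j k
      using inj el_one_iff[of n i j k] by (metis el_closed h.hom_one inj_onD one_closed)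
  qed (use prime_p in \<open>auto simp: el_mult simp flip: h.hom_mult\<close>)
qed

section \<open>Subgroups of a covered group\<close>

lemma prime_inverse:
  fixes q :: int
  assumes "prime q" "\<not> q dvd x"
  obtains y where "q dvd x * y - 1"
proof -
  have "coprime x q" using assms by (simp add: prime_imp_coprime coprime_commute)
  then obtain y where "[x * y = 1] (mod q)" using cong_solve_coprime_int by blast
  then show ?thesis using that by (simp add: cong_iff_dvd_diff)
qed

context word_group
begin

text \<open>The exact exponents \<open>J\<close>, \<open>K\<close> are mostly irrelevant. What is
  recorded is that the \<open>c\<close>-exponent is linear in \<open>m\<close> modulo any
  \<open>r\<close> dividing \<open>i\<close>, as the collection terms are multiples of
  \<open>i\<close>.\<close>

lemma el_int_pow:
  fixes r :: int
  obtains J K where "el n i j k [^] (m :: int) = el (m * n) (m * i) J K"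
    "r dvd i \<longrightarrow> r dvd J - m * j"
proof (cases m)
  case (nonneg m')
  then show ?thesis
    by (intro that[of "m * j + n * i * tri m"]) (auto simp: int_pow_int el_nat_pow)
next
  case (neg m')
  define q where "q = Suc m'"
  have m: "m = - int q" using neg by (simp add: q_def)
  have "el n i j k [^] m = inv (el n i j k [^] q)"
    using int_pow_neg_int[of "el n i j k" q] by (simp add: m)
  also have "\<dots> = el (- (int q * n)) (- (int q * i))
      (- (int q * j + n * i * tri (int q)) + int q * n * (int q * i))
      (- (int q * k + n * j * tri (int q) + i * (n * n * int (q choose 3) + tri n * tri (int q))) +
       int q * n * (int q * j + n * i * tri (int q) - int q * n * (int q * i)) + tri (int q * n) * (int q * i))"
    by (simp only: el_nat_pow inv_el)
  finally have *: "el n i j k [^] m = el (m * n) (m * i)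
      (- (int q * j + n * i * tri (int q)) + int q * n * (int q * i))
      (- (int q * k + n * j * tri (int q) + i * (n * n * int (q choose 3) + tri n * tri (int q))) +
       int q * n * (int q * j + n * i * tri (int q) - int q * n * (int q * i)) + tri (int q * n) * (int q * i))"
    by (simp add: m)
  show ?thesis
  proof (rule that[OF *], rule impI)
    assume "r dvd i"
    moreover have "- (int q * j + n * i * tri (int q)) + int q * n * (int q * i) - m * j =
        i * (int q * n * int q - n * tri (int q))"
      by (simp add: m algebra_simps)
    ultimately show "r dvd - (int q * j + n * i * tri (int q)) + int q * n * (int q * i) - m * j"
      by simp
  qed
qed

lemma subgroup_el_lincomb:
  fixes r :: int
  assumes K: "subgroup K G" and x: "el n i j k \<in> K" and y: "el n' i' j' k' \<in> K"
  obtains J L where "el (\<alpha> * n + \<beta> * n') (\<alpha> * i + \<beta> * i') J L \<in> K"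
    "r dvd i \<longrightarrow> r dvd i' \<longrightarrow> r dvd J - (\<alpha> * j + \<beta> * j')"
proof -
  obtain J L where 1: "el n i j k [^] \<alpha> = el (\<alpha> * n) (\<alpha> * i) J L" "r dvd i \<longrightarrow> r dvd J - \<alpha> * j"
    by (rule el_int_pow[of n i j k \<alpha>])
  obtain J' L' where 2: "el n' i' j' k' [^] \<beta> = el (\<beta> * n') (\<beta> * i') J' L'"
    "r dvd i' \<longrightarrow> r dvd J' - \<beta> * j'"
    by (rule el_int_pow[of n' i' j' k' \<beta>])
  have "el n i j k [^] \<alpha> \<otimes> el n' i' j' k' [^] \<beta> \<in> K"
    using K x y by (simp add: subgroup.m_closed subgroup_int_pow_closed)
  then have "el (\<alpha> * n + \<beta> * n') (\<alpha> * i + \<beta> * i') (J + \<beta> * n' * (\<alpha> * i) + J')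
      (L + \<beta> * n' * J + tri (\<beta> * n') * (\<alpha> * i) + L') \<in> K"
    by (simp add: 1 2 el_mult)
  moreover have "r dvd (J + \<beta> * n' * (\<alpha> * i) + J') - (\<alpha> * j + \<beta> * j')" if "r dvd i" "r dvd i'"
  proof -
    have "(J + \<beta> * n' * (\<alpha> * i) + J') - (\<alpha> * j + \<beta> * j') =
        (J - \<alpha> * j) + (J' - \<beta> * j') + \<beta> * n' * \<alpha> * i" by simp
    then show ?thesis using 1(2) 2(2) that by (metis dvd_add dvd_mult)
  qed
  ultimately show ?thesis using that by blast
qed

end

context p_cover
begin

lemma el_add_k: "int p dvd k' - k \<Longrightarrow> el n i j k' = el n i j k"
  by (simp add: el_eq_iff_same) (metis dvd_minus_iff minus_diff_eq add_0_right mult_zero_left mult_zero_right)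

lemma el_add_j: "el n i (j + int p * v) k = el n i j (k + v * eps p)"
proof -
  have "el n i j (k + v * eps p) = el n i (j + int p * v) k"
    unfolding el_eq_iff_same by (intro exI[of _ 0] exI[of _ v]) simp
  then show ?thesis ..
qed

lemma el_add_i: "el n (i + int p * int p * u) j k = el n i j (k + u * (s + eps p))"
proof -
  have "el n i j (k + u * (s + eps p)) = el n (i + int p * int p * u) j k"
    unfolding el_eq_iff_same by (intro exI[of _ u] exI[of _ 0]) simp
  then show ?thesis ..
qed

text \<open>\<open>b^(p w) = d^(t w)\<close> is traded for a power of \<open>d\<close>; the other
  corrections compensate for multiplying by \<open>b^(-p w)\<close> on the right of
  \<open>a^i c^j\<close>.\<close>

lemma el_p_n:
  "el (int p * w) i j k = el 0 i (j - int p * w * i) (k - int p * w * j + tri (- (int p * w)) * i + t * w)"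
proof -
  have "(int p * (- w), int p * int p * 0, int p * 0, t * w) \<in> relN p s t"
    by (rule relN_I) simp
  then show ?thesis by (simp add: el_eq_iff)
qed

lemma el_1_eq_one: "el 0 0 0 k = \<one> \<longleftrightarrow> int p dvd k"
  unfolding el_one_iff using p_pos by (auto simp: relN_def)

lemma subgroup_el_k:
  assumes K: "subgroup K G" and x: "el 0 0 0 \<kappa> \<in> K" and u: "\<not> int p dvd \<kappa>"
  shows "el 0 0 0 k \<in> K"
proof -
  obtain y where y: "int p dvd \<kappa> * y - 1" using prime_inverse[OF prime_int u] .
  have "el 0 0 0 \<kappa> [^] (y * k) \<in> K" by (rule subgroup_int_pow_closed[OF K x])
  then have "el 0 0 0 (y * k * \<kappa>) \<in> K" by (simp add: el_0_int_pow)
  moreover have "int p dvd y * k * \<kappa> - k"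
  proof -
    have "y * k * \<kappa> - k = k * (\<kappa> * y - 1)" by (simp add: algebra_simps)
    then show ?thesis using y by simp
  qed
  ultimately show ?thesis using el_add_k by simp
qed

lemma subgroup_el_k_shift:
  assumes K: "subgroup K G" and d: "el 0 0 0 1 \<in> K" and x: "el n i j k \<in> K"
  shows "el n i j k' \<in> K"
proof -
  have "el 0 0 0 (k' - k) \<in> K"
    using subgroup_el_k[OF K d] p_gt_1 by (simp add: zdvd1_eq)
  then have "el n i j k \<otimes> el 0 0 0 (k' - k) \<in> K" using K x by (simp add: subgroup.m_closed)
  then show ?thesis by (simp add: el_mult)
qed

section \<open>Frattini subgroup, derived subgroup, centre and maximal subgroups of a covered
  group\<close>

definition frat :: "'a set" where
  "frat = {el 0 (int p * u) j k | u j k. True}"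

definition derv :: "'a set" where
  "derv = {el 0 0 j k | j k. True}"

text \<open>These are the elements \<open>z^u d^k\<close> with
  \<open>z = a^p c^(-eps p)\<close>.\<close>

definition cent :: "'a set" where
  "cent = {el 0 (int p * u) (- u * eps p) k | u k. True}"

text \<open>Modulo the Frattini subgroup the group is a plane over the field with \<open>p\<close>
  elements with coordinates \<open>n\<close>, \<open>i\<close>; this is the preimage of a line in
  it, given by its equation.\<close>

definition line :: "int \<Rightarrow> int \<Rightarrow> 'a set" where
  "line x y = {el n i j k | n i j k. int p dvd x * n + y * i}"

lemma el_line_iff: "el n i j k \<in> line x y \<longleftrightarrow> int p dvd x * n + y * i"
proof
  assume "el n i j k \<in> line x y"
  then obtain n' i' j' k' where *: "el n i j k = el n' i' j' k'" "int p dvd x * n' + y * i'"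
    unfolding line_def by blast
  then have "[n' = n] (mod int p)" "[i' = i] (mod int p)" using el_cong_mod_p by blast+
  then have "[x * n' + y * i' = x * n + y * i] (mod int p)" by (intro cong_add cong_scalar_left)
  then show "int p dvd x * n + y * i" using *(2) cong_dvd_iff by blast
qed (auto simp: line_def)

lemma subgroup_line: "subgroup (line x y) G"
proof (rule subgroupI)
  show "line x y \<subseteq> carrier G" by (auto simp: line_def)
  show "line x y \<noteq> {}" using el_line_iff[of 0 0 0 0 x y] by auto
  fix g assume "g \<in> line x y"
  then obtain n i j k where g: "g = el n i j k" "int p dvd x * n + y * i" unfolding line_def by blast
  have "x * (- n) + y * (- i) = - (x * n + y * i)" by simp
  then show "inv g \<in> line x y" unfolding g inv_el el_line_iff using g(2) by (metis dvd_minus_iff)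
  fix h assume "h \<in> line x y"
  then obtain n' i' j' k' where h: "h = el n' i' j' k'" "int p dvd x * n' + y * i'" unfolding line_def by blast
  have "x * (n + n') + y * (i + i') = (x * n + y * i) + (x * n' + y * i')" by (simp add: algebra_simps)
  then show "g \<otimes> h \<in> line x y" unfolding g h el_mult el_line_iff using g(2) h(2) by (metis dvd_add)
qed

lemma index_p_frattini:
  assumes M: "subgroup M G" "subgroup_index G M = p"
  shows "el (int p * n) (int p * i) j k \<in> M"
proof -
  have "commutator G (el 0 1 0 0) (el 1 0 0 0) \<in> M" "commutator G (el 0 0 1 0) (el 1 0 0 0) \<in> M"
    "el 1 0 0 0 [^] p \<in> M" "el 0 1 0 0 [^] p \<in> M"
    using index_p_commutator[OF M] index_p_pow[OF M] by auto
  then have 1: "el 0 0 1 0 \<in> M" "el 0 0 0 1 \<in> M" "el (int p) 0 0 0 \<in> M" "el 0 (int p) 0 0 \<in> M"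
    by (simp_all add: commutator_el el_nat_pow)
  have "el (int p) 0 0 0 [^] n = el (n * int p) 0 0 0"
    using int_pow_pow[of "el 1 0 0 0" "int p" n] by (simp add: el_1_int_pow mult.commute)
  then have "el (int p * n) 0 0 0 = el (int p) 0 0 0 [^] n" by (simp add: mult.commute)
  moreover have "el (int p * n) (int p * i) j k =
      el (int p * n) 0 0 0 \<otimes> el 0 (int p) 0 0 [^] i \<otimes> el 0 0 1 0 [^] j \<otimes> el 0 0 0 1 [^] k"
    by (simp add: el_mult el_0_int_pow mult.commute)
  ultimately show ?thesis
    using 1 M(1) by (simp add: subgroup.m_closed subgroup_int_pow_closed)
qed

lemma index_p_el_cong:
  assumes M: "subgroup M G" "subgroup_index G M = p"
    and "el n i j k \<in> M" "int p dvd n' - n" "int p dvd i' - i"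
  shows "el n' i' j' k' \<in> M"
proof -
  obtain a b where ab: "n' = n + int p * a" "i' = i + int p * b"
    using assms(4,5) by (metis add.commute diff_add_cancel dvdE)
  have "el n i j k \<otimes> el (int p * a) (int p * b) J K \<in> M" for J K
    using assms index_p_frattini[OF M] by (simp add: subgroup.m_closed)
  then have "el n' i' (j + int p * a * i + J) (k + int p * a * j + tri (int p * a) * i + K) \<in> M" for J K
    by (simp add: el_mult ab)
  from this[of "j' - (j + int p * a * i)" "k' - (k + int p * a * j + tri (int p * a) * i)"]
  show ?thesis by simp
qed

text \<open>Burnside's basis argument: a maximal subgroup contains all \<open>p\<close>-th powers
  and commutators, so membership depends only on \<open>n\<close> and \<open>i\<close> modulo
  \<open>p\<close>. Two elements with unit determinant reach every residue pair, so no maximal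
  subgroup contains both.\<close>

lemma generating_pair:
  assumes K: "subgroup K G" and x: "el n i j k \<in> K" and y: "el n' i' j' k' \<in> K"
    and D: "\<not> int p dvd n * i' - n' * i"
  shows "K = carrier G"
proof (rule ccontr)
  assume "K \<noteq> carrier G"
  then obtain M where M: "subgroup M G" "subgroup_index G M = p" "K \<subseteq> M"
    using index_p_above K by blast
  obtain e where e: "int p dvd (n * i' - n' * i) * e - 1" using prime_inverse[OF prime_int D] .
  have comb: "el (\<alpha> * n + \<beta> * n') (\<alpha> * i + \<beta> * i') J L \<in> M" for \<alpha> \<beta> J L
  proof -
    obtain J' L' where "el (\<alpha> * n + \<beta> * n') (\<alpha> * i + \<beta> * i') J' L' \<in> M"
      using subgroup_el_lincomb[OF M(1), of n i j k n' i' j' k' \<alpha> \<beta>] x y M(3) by blast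
    then show ?thesis by (rule index_p_el_cong[OF M(1,2)]) auto
  qed
  have "el N I J L \<in> M" for N I J L
  proof -
    \<comment> \<open>Cramer's rule; \<open>e\<close> inverts the determinant modulo
      \<open>p\<close>.\<close>
    let ?\<alpha> = "e * (i' * N - n' * I)" and ?\<beta> = "e * (n * I - i * N)"
    have "N - (?\<alpha> * n + ?\<beta> * n') = - N * ((n * i' - n' * i) * e - 1)"
      "I - (?\<alpha> * i + ?\<beta> * i') = - I * ((n * i' - n' * i) * e - 1)"
      by (simp_all add: algebra_simps)
    then have "int p dvd N - (?\<alpha> * n + ?\<beta> * n')" "int p dvd I - (?\<alpha> * i + ?\<beta> * i')"
      using e by (metis dvd_mult)+
    then show ?thesis using index_p_el_cong[OF M(1,2) comb] by blast
  qed
  then have "carrier G \<subseteq> M" by (auto simp: carrier_el)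
  then have "M = carrier G" using subgroup.subset[OF M(1)] by (rule antisym[rotated])
  then show False using index_p_maximal[OF M(1,2)] by (simp add: maximal_subgroup_def)
qed

text \<open>The line contains the direction \<open>(y, - x)\<close>, and an element off the line is
  independent of it, so by \<open>generating_pair\<close> nothing lies strictly between the line and
  the group.\<close>

lemma maximal_line:
  assumes "\<not> (int p dvd x \<and> int p dvd y)"
  shows "maximal_subgroup (line x y) G"
proof -
  have w: "el y (- x) 0 0 \<in> line x y" by (simp add: el_line_iff)
  have "el 1 0 0 0 \<notin> line x y \<or> el 0 1 0 0 \<notin> line x y" using assms by (simp add: el_line_iff)
  then have "line x y \<noteq> carrier G" by (metis el_closed)
  moreover have "K = line x y \<or> K = carrier G" if K: "subgroup K G" "line x y \<subseteq> K" for K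
  proof (rule disjCI)
    assume "K \<noteq> carrier G"
    have "g \<in> line x y" if "g \<in> K" for g
    proof -
      have "g \<in> carrier G" using that subgroup.subset[OF K(1)] by blast
      then obtain n i j k where g: "g = el n i j k" by (rule el_cases)
      have "int p dvd n * (- x) - y * i"
        using generating_pair[OF K(1), of n i j k y "- x" 0 0] that g w K(2) \<open>K \<noteq> carrier G\<close> by blast
      then have "int p dvd x * n + y * i"
        by (metis dvd_minus_iff minus_add_distrib mult.commute mult_minus_left uminus_add_conv_diff add.commute)
      then show ?thesis by (simp add: g el_line_iff)
    qed
    then show "K = line x y" using K(2) by blast
  qed
  ultimately show ?thesis using subgroup_line by (auto simp: maximal_subgroup_def)
qed

lemma index_line: "\<not> (int p dvd x \<and> int p dvd y) \<Longrightarrow> subgroup_index G (line x y) = p"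
  using maximal_line maximal_subgroup_index by blast

lemma card_line: "\<not> (int p dvd x \<and> int p dvd y) \<Longrightarrow> card (line x y) = p ^ 4"
  using index_iff_card[OF subgroup_line, of 1 x y] index_line by simp

text \<open>Of the \<open>p + 1\<close> maximal subgroups, \<open>abel\<close> is the one containing
  \<open>a\<close>, and \<open>mline r\<close> is the one containing \<open>b a^r\<close>.\<close>

abbreviation abel :: "'a set" where "abel \<equiv> line 1 0"
abbreviation mline :: "int \<Rightarrow> 'a set" where "mline r \<equiv> line (- r) 1"

lemma not_dvd_one: "\<not> int p dvd 1"
  using p_gt_1 by (simp add: zdvd1_eq)

lemma index_p_cases:
  assumes M: "subgroup M G" "subgroup_index G M = p"
  obtains "M = abel" | r where "0 \<le> r" "r < int p" "M = mline r"
proof -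
  have max: "maximal_subgroup M G" by (rule index_p_maximal[OF M])
  have eq: "M = line x y" if "M \<subseteq> line x y" "\<not> (int p dvd x \<and> int p dvd y)" for x y
    using max maximal_line[OF that(2)] that(1) by (auto simp: maximal_subgroup_def)
  have MG: "M \<subseteq> carrier G" by (rule subgroup.subset[OF M(1)])
  show ?thesis
  proof (cases "\<exists>n i j k. el n i j k \<in> M \<and> \<not> int p dvd n")
    case False
    have "M \<subseteq> abel"
    proof
      fix g assume g: "g \<in> M"
      then obtain n i j k where "g = el n i j k" using MG el_cases by blast
      with g False show "g \<in> abel" by (auto simp: el_line_iff)
    qed
    then have "M = abel" using eq not_dvd_one by blast
    then show ?thesis by (rule that(1))
  next
    case True
    then obtain n i j k where x: "el n i j k \<in> M" "\<not> int p dvd n" by blast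
    obtain e where e: "int p dvd n * e - 1" using prime_inverse[OF prime_int x(2)] .
    \<comment> \<open>The slope \<open>i / n\<close> modulo \<open>p\<close>, with \<open>e\<close>
      the inverse of \<open>n\<close>.\<close>
    define r where "r = (e * i) mod int p"
    have r: "0 \<le> r" "r < int p" using p_pos by (simp_all add: r_def)
    have "int p dvd r - e * i" by (simp add: r_def mod_eq_dvd_iff [symmetric])
    have "M \<subseteq> mline r"
    proof
      fix g assume g: "g \<in> M"
      then obtain n' i' j' k' where g': "g = el n' i' j' k'" using MG el_cases by blast
      have "M \<noteq> carrier G" using max by (simp add: maximal_subgroup_def)
      then have "int p dvd n * i' - n' * i"
        using generating_pair[OF M(1) x(1), of n' i' j' k'] g g' by blast
      moreover have "- r * n' + 1 * i' = e * (n * i' - n' * i) - i' * (n * e - 1) - n' * (r - e * i)"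
        by (simp add: algebra_simps)
      ultimately have "int p dvd - r * n' + 1 * i'"
        using e \<open>int p dvd r - e * i\<close> by (metis dvd_diff dvd_mult)
      then show "g \<in> mline r" by (simp only: g' el_line_iff)
    qed
    then have "M = mline r" using eq not_dvd_one by blast
    then show ?thesis using that(2) r by blast
  qed
qed

text \<open>Besides \<open>a\<close>, \<open>c\<close>, \<open>d\<close> only the powers
  \<open>b^(p w)\<close> occur in \<open>abel\<close>, and these commute with \<open>a\<close> by
  \<open>prime_dvd_tri_mult\<close>.\<close>

lemma commutes_abel: "commutes abel"
proof (intro ballI)
  fix g h assume "g \<in> abel" "h \<in> abel"
  then obtain n i j k n' i' j' k' where g: "g = el n i j k" "int p dvd n" and h: "h = el n' i' j' k'" "int p dvd n'"
    unfolding line_def by auto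
  obtain w w' where w: "n = int p * w" "n' = int p * w'" using g h by (auto elim!: dvdE)
  have "n' * i - n * i' = int p * (w' * i - w * i')" by (simp add: w algebra_simps)
  moreover have "n' * j + tri n' * i - n * j' - tri n * i' + (w' * i - w * i') * eps p =
      int p * (w' * j - w * j') + i * (tri (int p * w') + w' * eps p) - i' * (tri (int p * w) + w * eps p)"
    by (simp add: w algebra_simps)
  then have "int p dvd n' * j + tri n' * i - n * j' - tri n * i' + (w' * i - w * i') * eps p"
    using prime_dvd_tri_mult[OF prime_p, of w] prime_dvd_tri_mult[OF prime_p, of w']
    by (metis dvd_add dvd_diff dvd_mult dvd_triv_left)
  ultimately show "g \<otimes> h = h \<otimes> g" unfolding g h commute_el_iff by blast
qed

lemma not_commute_el: "el 1 i j k \<otimes> el 0 0 1 0 \<noteq> el 0 0 1 0 \<otimes> el 1 i j k"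
  using p_pos not_dvd_one by (simp add: commute_el_iff)

lemma not_commutes_mline: "\<not> commutes (mline r)"
proof -
  have "el 1 r 0 0 \<in> mline r" "el 0 0 1 0 \<in> mline r" by (simp_all add: el_line_iff)
  then show ?thesis using not_commute_el by blast
qed

lemma cent_central:
  assumes "z \<in> cent" "x \<in> carrier G"
  shows "z \<otimes> x = x \<otimes> z"
proof -
  obtain u k where z: "z = el 0 (int p * u) (- u * eps p) k" using assms(1) unfolding cent_def by blast
  obtain n i j l where x: "x = el n i j l" using el_cases[OF assms(2)] .
  have "int p dvd tri n * (int p * u)" by simp
  then show ?thesis unfolding z x commute_el_iff
    by (intro exI[of _ "n * u"]) (simp add: algebra_simps)
qed

text \<open>Commuting with \<open>c\<close> forces \<open>p\<close> to divide the exponent of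
  \<open>b\<close>. Commuting with \<open>b\<close> forces \<open>i = p v\<close> and, through the
  carry of \<open>c^p\<close>, the exponent \<open>- v * eps p\<close> of \<open>c\<close> modulo
  \<open>p\<close>.\<close>

lemma group_center_eq: "group_center G = cent"
proof
  show "cent \<subseteq> group_center G"
    using cent_central by (auto simp: group_center_def cent_def)
  show "group_center G \<subseteq> cent"
  proof
    fix g assume g: "g \<in> group_center G"
    then have "g \<in> carrier G" by (simp add: group_center_def)
    then obtain n i j k where gel: "g = el n i j k" by (rule el_cases)
    have "g \<otimes> el 0 0 1 0 = el 0 0 1 0 \<otimes> g" "g \<otimes> el 1 0 0 0 = el 1 0 0 0 \<otimes> g"
      using g by (auto simp: group_center_def)
    then have n: "int p dvd n" and "\<exists>v. i = int p * v \<and> int p dvd j + v * eps p"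
      unfolding gel commute_el_iff using p_pos by auto
    then obtain v where v: "i = int p * v" "int p dvd j + v * eps p" by blast
    obtain w where w: "n = int p * w" using n by (auto elim!: dvdE)
    obtain l where l: "j + v * eps p = int p * l" using v(2) by (auto elim!: dvdE)
    have j: "j - int p * w * i = - v * eps p + int p * (l - w * i)"
      using l by (simp add: algebra_simps)
    have "g = el 0 (int p * v) (- v * eps p) (k - int p * w * j + tri (- (int p * w)) * i + t * w + (l - w * i) * eps p)"
      unfolding gel w el_p_n j el_add_j using v(1) by simp
    then show "g \<in> cent" unfolding cent_def by blast
  qed
qed

lemma subgroup_cent: "subgroup cent G"
proof (rule subgroupI)
  show "cent \<subseteq> carrier G" by (auto simp: cent_def)
  show "cent \<noteq> {}" by (auto simp: cent_def)
  fix g assume "g \<in> cent"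
  then obtain u k where g: "g = el 0 (int p * u) (- u * eps p) k" unfolding cent_def by blast
  have "inv g = el 0 (int p * (- u)) (- (- u) * eps p) (- k)" by (simp add: g inv_el)
  then show "inv g \<in> cent" unfolding cent_def by blast
  fix h assume "h \<in> cent"
  then obtain u' k' where h: "h = el 0 (int p * u') (- u' * eps p) k'" unfolding cent_def by blast
  have "g \<otimes> h = el 0 (int p * (u + u')) (- (u + u') * eps p) (k + k')"
    by (simp add: g h el_mult algebra_simps)
  then show "g \<otimes> h \<in> cent" unfolding cent_def by blast
qed

lemma cent_subset:
  assumes K: "subgroup K G" and "el 0 (int p) (- eps p) k0 \<in> K" "el 0 0 0 1 \<in> K"
  shows "cent \<subseteq> K"
proof
  fix g assume "g \<in> cent"
  then obtain u k where g: "g = el 0 (int p * u) (- u * eps p) k" unfolding cent_def by blast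
  have "el 0 (int p) (- eps p) k0 [^] u \<in> K" by (rule subgroup_int_pow_closed[OF K assms(2)])
  then have "el 0 (int p * u) (- u * eps p) (u * k0) \<in> K" by (simp add: el_0_int_pow mult.commute)
  then show "g \<in> K" unfolding g by (rule subgroup_el_k_shift[OF K assms(3)])
qed

lemma subgroup_derv: "subgroup derv G"
proof (rule subgroupI)
  show "derv \<subseteq> carrier G" "derv \<noteq> {}" by (auto simp: derv_def)
  fix g assume "g \<in> derv"
  then obtain j k where g: "g = el 0 0 j k" unfolding derv_def by blast
  then show "inv g \<in> derv" by (auto simp: inv_el derv_def)
  fix h assume "h \<in> derv"
  then obtain j' k' where h: "h = el 0 0 j' k'" unfolding derv_def by blast
  show "g \<otimes> h \<in> derv" by (auto simp: g h el_mult derv_def)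
qed

lemma subgroup_frat: "subgroup frat G"
proof (rule subgroupI)
  show "frat \<subseteq> carrier G" "frat \<noteq> {}" by (auto simp: frat_def)
  fix g assume "g \<in> frat"
  then obtain u j k where g: "g = el 0 (int p * u) j k" unfolding frat_def by blast
  have "inv g = el 0 (int p * (- u)) (- j) (- k)" by (simp add: g inv_el)
  then show "inv g \<in> frat" unfolding frat_def by blast
  fix h assume "h \<in> frat"
  then obtain u' j' k' where h: "h = el 0 (int p * u') j' k'" unfolding frat_def by blast
  have "g \<otimes> h = el 0 (int p * (u + u')) (j + j') (k + k')" by (simp add: g h el_mult algebra_simps)
  then show "g \<otimes> h \<in> frat" unfolding frat_def by blast
qed

lemma derv_subset:
  assumes K: "subgroup K G" and "el 0 0 1 k0 \<in> K" "el 0 0 0 1 \<in> K"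
  shows "derv \<subseteq> K"
proof
  fix g assume "g \<in> derv"
  then obtain j k where g: "g = el 0 0 j k" unfolding derv_def by blast
  have "el 0 0 1 k0 [^] j \<in> K" by (rule subgroup_int_pow_closed[OF K assms(2)])
  then have "el 0 0 j (j * k0) \<in> K" by (simp add: el_0_int_pow)
  then show "g \<in> K" unfolding g by (rule subgroup_el_k_shift[OF K assms(3)])
qed

lemma frat_subset:
  assumes K: "subgroup K G" and "el 0 (int p) j0 k1 \<in> K" and c: "el 0 0 1 k0 \<in> K" and d: "el 0 0 0 1 \<in> K"
  shows "frat \<subseteq> K"
proof
  fix g assume "g \<in> frat"
  then obtain u j k where g: "g = el 0 (int p * u) j k" unfolding frat_def by blast
  have "el 0 (int p) j0 k1 [^] u \<in> K" by (rule subgroup_int_pow_closed[OF K assms(2)])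
  then have 1: "el 0 (int p * u) (u * j0) (u * k1) \<in> K" by (simp add: el_0_int_pow mult.commute)
  have 2: "el 0 0 (j - u * j0) (k - u * k1) \<in> K"
    using derv_subset[OF K c d] unfolding derv_def by blast
  have "el 0 (int p * u) (u * j0) (u * k1) \<otimes> el 0 0 (j - u * j0) (k - u * k1) \<in> K"
    by (rule subgroup.m_closed[OF K 1 2])
  then show "g \<in> K" by (simp add: g el_mult)
qed

lemma frattini_eq: "frattini G = frat"
proof
  have "int p * u = 0 * n + 1 * (int p * u)" for u n by simp
  show "frat \<subseteq> frattini G"
  proof
    fix g assume "g \<in> frat"
    then obtain u j k where g: "g = el (int p * 0) (int p * u) j k" unfolding frat_def by auto
    have "g \<in> M" if "maximal_subgroup M G" for M
      using that index_p_frattini unfolding maximal_subgroup_iff g by blast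
    then show "g \<in> frattini G" by (auto simp: frattini_def g)
  qed
  show "frattini G \<subseteq> frat"
  proof
    fix g assume g: "g \<in> frattini G"
    then have "g \<in> carrier G" by (simp add: frattini_def)
    then obtain n i j k where gel: "g = el n i j k" by (rule el_cases)
    have "maximal_subgroup (line 1 0) G" "maximal_subgroup (line 0 1) G"
      using not_dvd_one by (auto intro: maximal_line)
    then have "g \<in> line 1 0" "g \<in> line 0 1" using g by (auto simp: frattini_def)
    then obtain w u where "n = int p * w" "i = int p * u"
      by (auto simp: gel el_line_iff elim!: dvdE)
    then show "g \<in> frat" unfolding gel frat_def using el_p_n by blast
  qed
qed

lemma commutator_in_derv:
  assumes "x \<in> carrier G" "y \<in> carrier G"
  shows "commutator G x y \<in> derv"
proof -
  obtain n i j k n' i' j' k' where "x = el n i j k" "y = el n' i' j' k'"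
    using assms el_cases by metis
  then show ?thesis unfolding derv_def by (simp only: commutator_el) blast
qed

lemma derived_eq: "derived_subgroup G = derv"
proof
  have "derived_set G (carrier G) \<subseteq> derv"
  proof
    fix g assume "g \<in> derived_set G (carrier G)"
    then obtain x y where xy: "x \<in> carrier G" "y \<in> carrier G" "g = x \<otimes> y \<otimes> inv x \<otimes> inv y" by auto
    then have "g = commutator G (inv x) (inv y)" by (simp add: commutator_def)
    then show "g \<in> derv" using xy by (simp add: commutator_in_derv)
  qed
  then show "derived_subgroup G \<subseteq> derv"
    unfolding derived_def by (rule generate_subgroup_incl[OF _ subgroup_derv])
  have sub: "subgroup (derived_subgroup G) G" by (rule derived_is_subgroup) simp
  have comm: "commutator G x y \<in> derived_subgroup G" if "x \<in> carrier G" "y \<in> carrier G" for x y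
  proof -
    have "commutator G x y = inv x \<otimes> inv y \<otimes> inv (inv x) \<otimes> inv (inv y)" using that by (simp add: commutator_def)
    then have "commutator G x y \<in> derived_set G (carrier G)" using that inv_closed by blast
    then show ?thesis unfolding derived_def by (rule generate.incl)
  qed
  show "derv \<subseteq> derived_subgroup G"
    using comm[of "el 0 1 0 0" "el 1 0 0 0"] comm[of "el 0 0 1 0" "el 1 0 0 0"]
    by (intro derv_subset[OF sub]) (auto simp: commutator_el)
qed

text \<open>Commutation with \<open>b\<close> takes \<open>c^j\<close> to \<open>d^j\<close> and
  kills \<open>d\<close>; as the index of \<open>lower_central\<close> is shifted, 3 is the index of
  the first trivial term.\<close>

lemma lower_central_eq:
  "lower_central G 1 = derv"
  "lower_central G 2 = {el 0 0 0 k | k. True}"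
  "lower_central G 3 = {\<one>}"
proof -
  let ?S1 = "{commutator G x y | x y. x \<in> carrier G \<and> y \<in> carrier G}"
  have S1: "?S1 \<subseteq> carrier G" by (auto intro: commutator_closed is_group)
  have "?S1 \<subseteq> derv"
  proof
    fix g assume "g \<in> ?S1"
    then show "g \<in> derv" using commutator_in_derv by blast
  qed
  moreover have "commutator G (el 0 1 0 0) (el 1 0 0 0) \<in> ?S1" "commutator G (el 0 0 1 0) (el 1 0 0 0) \<in> ?S1"
    using el_closed by blast+
  then have "el 0 0 1 0 \<in> ?S1" "el 0 0 0 1 \<in> ?S1" by (simp_all only: commutator_el) simp_all
  ultimately have "generate G ?S1 = derv"
    using derv_subset[OF generate_is_subgroup[OF S1]] generate.incl[of _ ?S1 G]
      generate_subgroup_incl[OF _ subgroup_derv, of ?S1] by blast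
  then show 1: "lower_central G 1 = derv" by simp
  let ?D = "{el 0 0 0 k | k. True}"
  have D: "subgroup ?D G"
  proof (rule subgroupI)
    show "?D \<subseteq> carrier G" "?D \<noteq> {}" by auto
    fix g assume "g \<in> ?D"
    then obtain k where g: "g = el 0 0 0 k" by blast
    then show "inv g \<in> ?D" by (auto simp: inv_el)
    fix h assume "h \<in> ?D"
    then show "g \<otimes> h \<in> ?D" by (auto simp: g el_mult)
  qed
  let ?S2 = "{commutator G x y | x y. x \<in> lower_central G 1 \<and> y \<in> carrier G}"
  have S2: "?S2 \<subseteq> carrier G" unfolding 1 derv_def by (auto intro: commutator_closed is_group)
  have "?S2 \<subseteq> ?D"
  proof
    fix g assume "g \<in> ?S2"
    then obtain x y where xy: "g = commutator G x y" "x \<in> derv" "y \<in> carrier G" unfolding 1 by blast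
    obtain j k where "x = el 0 0 j k" using xy(2) unfolding derv_def by blast
    moreover obtain n' i' j' k' where "y = el n' i' j' k'" using xy(3) by (rule el_cases)
    ultimately have "g = el 0 0 0 (n' * j)" using xy(1) by (simp add: commutator_el)
    then show "g \<in> ?D" by blast
  qed
  moreover have "commutator G (el 0 0 1 0) (el 1 0 0 0) \<in> ?S2"
    unfolding 1 derv_def using el_closed by blast
  then have "el 0 0 0 1 \<in> ?S2" by (simp add: commutator_el)
  then have "?D \<subseteq> generate G ?S2"
    using subgroup_el_k[OF generate_is_subgroup[OF S2], of 1] not_dvd_one generate.incl[of _ ?S2 G] by blast
  ultimately have "generate G ?S2 = ?D"
    using generate_subgroup_incl[OF _ D, of ?S2] by blast
  then show 2: "lower_central G 2 = ?D" by (simp add: numeral_2_eq_2)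
  let ?S3 = "{commutator G x y | x y. x \<in> lower_central G 2 \<and> y \<in> carrier G}"
  have triv: "commutator G x y = \<one>" if x: "x \<in> ?D" and y: "y \<in> carrier G" for x y
  proof -
    obtain k where "x = el 0 0 0 k" using x by blast
    moreover obtain n' i' j' k' where "y = el n' i' j' k'" using y by (rule el_cases)
    ultimately show ?thesis by (simp add: commutator_el one_eq_el)
  qed
  have "?S3 = {\<one>}"
  proof
    show "?S3 \<subseteq> {\<one>}" unfolding 2 using triv by auto
    have "commutator G (el 0 0 0 1) \<one> \<in> ?S3" unfolding 2 by blast
    moreover have "commutator G (el 0 0 0 1) \<one> = \<one>" by (rule triv) auto
    ultimately show "{\<one>} \<subseteq> ?S3" by simp
  qed
  then show "lower_central G 3 = {\<one>}" by (simp add: numeral_3_eq_3 numeral_2_eq_2 generate_one)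
qed

lemma nilpotency_class_eq: "nilpotency_class G = 3"
  unfolding nilpotency_class_def
proof (rule Least_equality)
  show "lower_central G 3 = {\<one>}" by (rule lower_central_eq)
  fix m assume m: "lower_central G m = {\<one>}"
  have ne: "el 0 0 0 1 \<noteq> \<one>" using el_1_eq_one not_dvd_one by blast
  have "el 0 0 0 1 \<in> lower_central G 0" "el 0 0 0 1 \<in> lower_central G 1" "el 0 0 0 1 \<in> lower_central G 2"
    unfolding lower_central_eq by (auto simp: derv_def)
  with m ne have "m \<noteq> 0 \<and> m \<noteq> 1 \<and> m \<noteq> 2" by (metis singletonD)
  then show "3 \<le> m" by simp
qed

lemma min_gens_eq: "min_gens G = 2"
  unfolding min_gens_def
proof (rule Least_equality)
  let ?S = "{el 1 0 0 0, el 0 1 0 0}"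
  have "el 1 0 0 0 \<noteq> el 0 1 0 0" using el_cong_mod_p[of 1 0 0 0 0 1 0 0] not_dvd_one
    by (auto simp: cong_iff_dvd_diff)
  then have "card ?S = 2" by simp
  moreover have S: "?S \<subseteq> carrier G" by auto
  moreover have "generate G ?S = carrier G"
    by (rule generating_pair[OF generate_is_subgroup[OF S], of 1 0 0 0 0 1 0 0])
      (use not_dvd_one in \<open>auto intro: generate.incl\<close>)
  ultimately show "\<exists>S \<subseteq> carrier G. finite S \<and> card S = 2 \<and> generate G S = carrier G"
    by (metis finite.emptyI finite.insertI)
next
  fix m assume "\<exists>S \<subseteq> carrier G. finite S \<and> card S = m \<and> generate G S = carrier G"
  then obtain S where S: "S \<subseteq> carrier G" "finite S" "card S = m" "generate G S = carrier G" by blast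
  show "2 \<le> m"
  proof (rule ccontr)
    assume "\<not> 2 \<le> m"
    then have "card S \<le> 1" using S by simp
    then obtain x where x: "x \<in> carrier G" "S \<subseteq> {x}"
      using S(1,2) by (metis card_le_Suc0_iff_eq One_nat_def one_closed subset_singleton_iff equals0D subsetI subset_iff singletonI)
    then have "generate G {x} = carrier G"
      using S(4) mono_generate[OF x(2)] generate_incl[of "{x}"] by auto
    then have "g \<otimes> h = h \<otimes> g" if "g \<in> carrier G" "h \<in> carrier G" for g h
    proof -
      from that obtain m1 m2 where m: "g = x [^] (m1 :: int)" "h = x [^] (m2 :: int)"
        using generate_pow[OF x(1)] \<open>generate G {x} = carrier G\<close> by blast
      show ?thesis unfolding m int_pow_mult[OF x(1), symmetric] by (simp add: add.commute)
    qed
    then show False using not_commute_el el_closed by blast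
  qed
qed

end

section \<open>Counting subgroups\<close>

context p_group
begin

lemma card_psubgroup:
  assumes "subgroup H G" "subgroup K G" "H \<subset> K" "p ^ i \<le> card H"
  shows "p ^ Suc i \<le> card K"
proof -
  obtain a b where ab: "card H = p ^ a" "card K = p ^ b"
    using p_group_subgroup[OF assms(1)] p_group_subgroup[OF assms(2)] by metis
  have "card H < card K" using assms finite_subgroup by (intro psubset_card_mono) auto
  moreover have "p > 1" using prime_p prime_gt_1_nat by blast
  ultimately have "i < b" using ab assms(4) by (metis le_less_trans power_less_imp_less_exp)
  then show ?thesis using ab \<open>p > 1\<close> by (simp add: power_increasing del: power_Suc)
qed

end

context p_cover
begin

definition dsub :: "'a set" where
  "dsub = {el 0 0 0 k | k. True}"

lemma subgroup_dsub: "subgroup dsub G"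
proof (rule subgroupI)
  show "dsub \<subseteq> carrier G" "dsub \<noteq> {}" by (auto simp: dsub_def)
  fix g assume "g \<in> dsub"
  then obtain k where g: "g = el 0 0 0 k" unfolding dsub_def by blast
  then show "inv g \<in> dsub" by (auto simp: inv_el dsub_def)
  fix h assume "h \<in> dsub"
  then show "g \<otimes> h \<in> dsub" by (auto simp: g el_mult dsub_def)
qed

lemma not_p_squared_dvd: "int p \<noteq> int p * int p * u"
proof
  assume "int p = int p * int p * u"
  then have "int p * 1 = int p * (int p * u)" by simp
  then have "1 = int p * u" using p_pos by (metis mult_cancel_left of_nat_0_less_iff less_irrefl)
  then show False using not_dvd_one by (metis dvd_triv_left)
qed

lemma c_not_central: "el 0 0 1 k \<otimes> el 1 0 0 0 \<noteq> el 1 0 0 0 \<otimes> el 0 0 1 k"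
  using p_pos not_dvd_one by (simp add: commute_el_iff)

text \<open>Each strict inclusion of p-subgroups costs at least a factor \<open>p\<close>. The
  chains \<open>1 < dsub < cent < frat < abel\<close> and \<open>1 < dsub < derv < frat\<close> with
  \<open>card abel = p^4\<close> leave no freedom, so no elements have to be counted.\<close>

lemma subgroup_cards:
  "card dsub = p" "card cent = p ^ 2" "card frat = p ^ 3" "card derv = p ^ 2"
proof -
  have d: "dsub \<subseteq> cent" "dsub \<subseteq> derv" "cent \<subseteq> frat" "derv \<subseteq> frat" "frat \<subseteq> abel"
    by (auto simp: dsub_def cent_def derv_def frat_def el_line_iff) (metis mult_zero_left mult_zero_right minus_zero)+
  have triv: "subgroup {\<one>} G" by (rule triv_subgroup)
  have "el 0 0 0 1 \<in> dsub" "el 0 0 0 1 \<noteq> \<one>" using el_1_eq_one not_dvd_one by (auto simp: dsub_def)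
  then have "{\<one>} \<subset> dsub" using subgroup.one_closed[OF subgroup_dsub] by blast
  from card_psubgroup[OF triv subgroup_dsub this, of 0]
  have 1: "p ^ 1 \<le> card dsub" by simp
  have "el 0 (int p * 1) (- 1 * eps p) 0 \<in> cent" unfolding cent_def by blast
  moreover have "el 0 (int p * 1) (- 1 * eps p) 0 \<notin> dsub"
  proof
    assume "el 0 (int p * 1) (- 1 * eps p) 0 \<in> dsub"
    then obtain k where "el 0 0 0 k = el 0 (int p * 1) (- 1 * eps p) 0" by (auto simp: dsub_def)
    then show False using not_p_squared_dvd by (auto simp: el_eq_iff_same)
  qed
  ultimately have "dsub \<subset> cent" using d by blast
  from card_psubgroup[OF subgroup_dsub subgroup_cent this 1] have 2: "p ^ 2 \<le> card cent"
    by (simp add: numeral_2_eq_2)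
  have c: "el 0 0 1 0 \<notin> cent" using c_not_central cent_central by (metis el_closed)
  then have "el 0 0 1 0 \<notin> dsub" using d by blast
  moreover have c': "el 0 0 1 0 \<in> derv" by (auto simp: derv_def)
  ultimately have "dsub \<subset> derv" using d by blast
  from card_psubgroup[OF subgroup_dsub subgroup_derv this 1] have 3: "p ^ 2 \<le> card derv"
    by (simp add: numeral_2_eq_2)
  have "cent \<subset> frat" using c c' d by blast
  from card_psubgroup[OF subgroup_cent subgroup_frat this 2] have 4: "p ^ 3 \<le> card frat"
    by (simp add: numeral_3_eq_3)
  have "el 0 (int p * 1) 0 0 \<in> frat" unfolding frat_def by blast
  moreover have "el 0 (int p * 1) 0 0 \<notin> derv"
  proof
    assume "el 0 (int p * 1) 0 0 \<in> derv"
    then obtain j k where "el 0 0 j k = el 0 (int p * 1) 0 0" by (auto simp: derv_def)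
    then show False using not_p_squared_dvd by (auto simp: el_eq_iff_same)
  qed
  ultimately have "derv \<subset> frat" using d by blast
  have "el 0 1 0 0 \<in> abel" by (simp add: el_line_iff)
  moreover have "el 0 1 0 0 \<notin> frat"
  proof
    assume "el 0 1 0 0 \<in> frat"
    then obtain u j k where "el 0 (int p * u) j k = el 0 1 0 0" by (auto simp: frat_def)
    then have "int p dvd 1 - int p * u" using el_cong_mod_p by (metis cong_iff_dvd_diff)
    then show False using not_dvd_one by (simp add: dvd_diff_left_iff)
  qed
  ultimately have "frat \<subset> abel" using d by blast
  have p: "p ^ i \<le> p ^ j \<longleftrightarrow> i \<le> j" for i j using p_gt_1 by (rule power_increasing_iff)
  have up: "\<not> p ^ i \<le> card H" if "subgroup H G" "subgroup K G" "H \<subset> K" "card K = p ^ j" "j \<le> i" for H K i j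
    using card_psubgroup[OF that(1-3), of i] that(4,5) by (auto simp: p simp del: power_Suc)
  have exact: "card H = p ^ i" if H: "subgroup H G" "p ^ i \<le> card H" "\<not> p ^ Suc i \<le> card H" for H i
  proof -
    obtain m where m: "card H = p ^ m" using p_group_subgroup[OF H(1)] by blast
    then have "i = m" using H(2,3) by (simp add: p del: power_Suc)
    then show ?thesis using m by simp
  qed
  have card_abel: "card abel = p ^ 4" using not_dvd_one by (intro card_line) simp
  have f: "\<not> p ^ 4 \<le> card frat"
    by (rule up[OF subgroup_frat subgroup_line \<open>frat \<subset> abel\<close> card_abel]) simp
  then show f': "card frat = p ^ 3" using exact[OF subgroup_frat 4] by simp
  have "\<not> p ^ 3 \<le> card cent"
    by (rule up[OF subgroup_cent subgroup_frat \<open>cent \<subset> frat\<close> f']) simp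
  then show c2: "card cent = p ^ 2" using exact[OF subgroup_cent 2] by (simp add: numeral_3_eq_3 numeral_2_eq_2)
  have "\<not> p ^ 3 \<le> card derv"
    by (rule up[OF subgroup_derv subgroup_frat \<open>derv \<subset> frat\<close> f']) simp
  then show "card derv = p ^ 2" using exact[OF subgroup_derv 3] by (simp add: numeral_3_eq_3 numeral_2_eq_2)
  have "\<not> p ^ 2 \<le> card dsub"
    by (rule up[OF subgroup_dsub subgroup_cent \<open>dsub \<subset> cent\<close> c2]) simp
  then show "card dsub = p" using exact[OF subgroup_dsub 1] by (simp add: numeral_2_eq_2)
qed

section \<open>Minimal nonabelian subgroups of a covered group\<close>

lemma el_p_mline:
  obtains k where "el 1 r 0 0 [^] p = el 0 (int p * r) (- r * eps p) k"
proof -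
  have "el 1 r 0 0 [^] p = el (int p * 1) (int p * r) (r * tri (int p)) (r * int (p choose 3))"
    by (simp add: el_nat_pow)
  then have "el 1 r 0 0 [^] p = el 0 (int p * r) (r * tri (int p) - int p * 1 * (int p * r))
      (r * int (p choose 3) - int p * 1 * (r * tri (int p)) + tri (- (int p * 1)) * (int p * r) + t * 1)"
    by (simp only: el_p_n)
  then have pow: "el 1 r 0 0 [^] p = el 0 (int p * r) (r * tri (int p) - int p * 1 * (int p * r)) K"
    if "K = r * int (p choose 3) - int p * 1 * (r * tri (int p)) + tri (- (int p * 1)) * (int p * r) + t * 1" for K
    using that by (simp only:)
  obtain q where "tri (int p) - eps p = int p * q"
    using prime_dvd_tri[OF prime_p] by (auto elim!: dvdE)
  then have q: "tri (int p) = eps p + int p * q" by simp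
  obtain q' where q': "2 * eps p = int p * q'"
    by (cases "p = 2") (auto simp: eps_def)
  have "r * tri (int p) - int p * 1 * (int p * r) = - r * eps p + (r * (2 * eps p) + int p * (r * q - int p * r))"
    unfolding q by (simp add: algebra_simps)
  then have "r * tri (int p) - int p * 1 * (int p * r) = - r * eps p + int p * (r * q' + r * q - int p * r)"
    unfolding q' by (simp add: algebra_simps)
  then show ?thesis using that pow[OF refl] by (simp only: el_add_j)
qed

text \<open>A subgroup \<open>L\<close> of index \<open>p\<close> in \<open>mline r\<close> contains
  \<open>d\<close> and the \<open>p\<close>-th power of \<open>b a^r\<close>, which is
  \<open>z^r\<close> up to a power of \<open>d\<close>. For a unit \<open>r\<close> it therefore
  contains the centre, of order \<open>p^2\<close>; as \<open>L\<close> has order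
  \<open>p^3\<close>, it is abelian.\<close>

lemma mline_A1:
  assumes r: "\<not> int p dvd r"
  shows "A_group p 1 (G\<lparr>carrier := mline r\<rparr>)"
  unfolding A1_group_subgroup_iff[OF subgroup_line]
proof (intro conjI allI impI)
  show "\<not> commutes (mline r)" by (rule not_commutes_mline)
  fix K assume K: "subgroup K G \<and> K \<subset> mline r"
  obtain L where L: "subgroup L G" "K \<subseteq> L" "L \<subseteq> mline r" "p * card L = card (mline r)"
    using index_p_above_in_subgroup[OF subgroup_line, of K] K by blast
  have in_M: "el 1 r 0 0 \<in> mline r" "el 0 0 1 0 \<in> mline r" by (simp_all add: el_line_iff)
  note LM = index_p_in_subgroup[OF subgroup_line L(1,3,4)]
  have "commutator G (el 0 0 1 0) (el 1 r 0 0) \<in> L" using LM(2) in_M by blast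
  then have d: "el 0 0 0 1 \<in> L" by (simp add: commutator_el)
  obtain k where k: "el 1 r 0 0 [^] p = el 0 (int p * r) (- r * eps p) k" by (rule el_p_mline)
  then have w: "el 0 (int p * r) (- r * eps p) k \<in> L" using LM(1)[OF in_M(1)] by simp
  \<comment> \<open>The \<open>y\<close>-th power turns \<open>z^r\<close> into \<open>z\<close> up
    to a power of \<open>d\<close>, because \<open>z^p\<close> is a power of
    \<open>d\<close>.\<close>
  obtain y where y: "int p dvd r * y - 1" using prime_inverse[OF prime_int r] .
  then obtain q where q: "r * y = 1 + int p * q" by (metis add.commute diff_add_cancel dvdE)
  have "el 0 (int p * r) (- r * eps p) k [^] y \<in> L" by (rule subgroup_int_pow_closed[OF L(1) w])
  then have "el 0 (int p * (r * y)) (- (r * y) * eps p) (y * k) \<in> L"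
    by (simp add: el_0_int_pow mult_ac)
  then have "el 0 (int p + int p * int p * q) (- eps p + int p * (- q * eps p)) (y * k) \<in> L"
    unfolding q by (simp add: algebra_simps)
  then have "cent \<subseteq> L" unfolding el_add_i el_add_j by (rule cent_subset[OF L(1) _ d])
  moreover have "card (mline r) = p ^ 4" using not_dvd_one by (intro card_line) simp
  then have "card L = p ^ 3" using L(4) p_pos by (simp add: eval_nat_numeral)
  then have "card L \<le> p * card cent" by (simp add: subgroup_cards eval_nat_numeral)
  ultimately have "commutes L"
    using cent_central subgroup.subset[OF L(1)]
    by (intro commutes_of_central_index_p[OF L(1) subgroup_cent]) auto
  then show "commutes K" using L(2) by blast
qed

text \<open>With \<open>z = el 0 p (- eps p) 0\<close>, this is the subgroup generated by \<open>b z\<^sup>u\<close>, \<open>c z\<^sup>v\<close> and \<open>d\<close>.\<close>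

definition small :: "int \<Rightarrow> int \<Rightarrow> 'a set" where
  "small u v = {el n (int p * l) j k | n l j k. int p dvd l - u * n - v * (j + l * eps p)}"

text \<open>The condition does not depend on the word chosen for the element: another word for it
  changes the linear expression by a multiple of \<open>p\<close> only.\<close>

lemma el_small_iff: "el n (int p * l) j k \<in> small u v \<longleftrightarrow> int p dvd l - u * n - v * (j + l * eps p)"
proof
  assume "el n (int p * l) j k \<in> small u v"
  then obtain n' l' j' k' where *: "el n (int p * l) j k = el n' (int p * l') j' k'"
    "int p dvd l' - u * n' - v * (j' + l' * eps p)" unfolding small_def by blast
  from *(1)[unfolded el_eq_iff] obtain w U V where
    "n' - n = int p * w" "int p * l' - int p * l = int p * int p * U"
    "j' - j - (n' - n) * (int p * l) = int p * V" by (rule relN_E)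
  moreover from this(2) have "int p * (l' - l) = int p * (int p * U)" by (simp add: algebra_simps)
  then have "l' - l = int p * U" using p_pos by simp
  ultimately have "n' = n + int p * w" "l' = l + int p * U" "j' = j + int p * (w * int p * l + V)"
    by (simp_all add: algebra_simps)
  then have "l' - u * n' - v * (j' + l' * eps p) = (l - u * n - v * (j + l * eps p)) +
      int p * (U - u * w - v * (w * int p * l + V + U * eps p))"
    by (simp add: algebra_simps)
  then show "int p dvd l - u * n - v * (j + l * eps p)" using *(2) by (simp add: dvd_add_left_iff)
qed (auto simp: small_def)

lemma subgroup_small: "subgroup (small u v) G"
proof (rule subgroupI)
  show "small u v \<subseteq> carrier G" by (auto simp: small_def)
  have "el 0 (int p * 0) 0 0 \<in> small u v" unfolding el_small_iff by simp
  then show "small u v \<noteq> {}" by blast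
  fix g assume "g \<in> small u v"
  then obtain n l j k where g: "g = el n (int p * l) j k" "int p dvd l - u * n - v * (j + l * eps p)"
    unfolding small_def by blast
  have "inv g = el (- n) (int p * (- l)) (- j + n * (int p * l)) (- k + n * (j - n * (int p * l)) + tri n * (int p * l))"
    by (simp add: g inv_el)
  moreover have "- l - u * (- n) - v * (- j + n * (int p * l) + (- l) * eps p) =
    - (l - u * n - v * (j + l * eps p)) - int p * (v * n * l)"
    by (simp add: algebra_simps)
  then have "int p dvd - l - u * (- n) - v * (- j + n * (int p * l) + (- l) * eps p)"
    using g(2) by (metis dvd_diff dvd_minus_iff dvd_triv_left)
  ultimately show "inv g \<in> small u v" by (simp only: el_small_iff)
  fix h assume "h \<in> small u v"
  then obtain n' l' j' k' where h: "h = el n' (int p * l') j' k'" "int p dvd l' - u * n' - v * (j' + l' * eps p)"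
    unfolding small_def by blast
  have "g \<otimes> h = el (n + n') (int p * (l + l')) (j + n' * (int p * l) + j') (k + n' * j + tri n' * (int p * l) + k')"
    by (simp add: g h el_mult algebra_simps)
  moreover have "(l + l') - u * (n + n') - v * (j + n' * (int p * l) + j' + (l + l') * eps p) =
    (l - u * n - v * (j + l * eps p)) + (l' - u * n' - v * (j' + l' * eps p)) - int p * (v * n' * l)"
    by (simp add: algebra_simps)
  then have "int p dvd (l + l') - u * (n + n') - v * (j + n' * (int p * l) + j' + (l + l') * eps p)"
    using g(2) h(2) by (metis dvd_add dvd_diff dvd_triv_left)
  ultimately show "g \<otimes> h \<in> small u v" by (simp only: el_small_iff)
qed

lemma small_gens:
  "el 1 (int p * u) (- u * eps p) k \<in> small u v"
  "el 0 (int p * v) (1 - v * eps p) k \<in> small u v"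
  unfolding el_small_iff by simp_all

lemma mline_0_iff: "el n i j k \<in> mline 0 \<longleftrightarrow> int p dvd i"
  using el_line_iff[of n i j k 0 1] by simp

lemma small_psubset: "small u v \<subset> mline 0"
proof -
  have "el n (int p * l) j k \<in> mline 0" for n l j k by (simp only: mline_0_iff dvd_triv_left)
  then have "small u v \<subseteq> mline 0" unfolding small_def by blast
  moreover have "el 0 (int p * 1) (- eps p) 0 \<in> mline 0" by (simp only: mline_0_iff) simp
  moreover have "el 0 (int p * 1) (- eps p) 0 \<notin> small u v"
    unfolding el_small_iff using not_dvd_one by simp
  ultimately show ?thesis by blast
qed

lemma not_commutes_small: "\<not> commutes (small u v)"
proof -
  have "el 0 (int p * v) (1 - v * eps p) 0 \<otimes> el 1 (int p * u) (- u * eps p) 0 \<noteq>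
      el 1 (int p * u) (- u * eps p) 0 \<otimes> el 0 (int p * v) (1 - v * eps p) 0"
    using p_pos not_dvd_one by (simp add: commute_el_iff)
  then show ?thesis using small_gens by blast
qed

lemma card_mline: "card (mline r) = p ^ 4"
  using not_dvd_one by (intro card_line) simp

lemma card_nonabelian_in_mline:
  assumes "subgroup K G" "K \<subset> mline r" "\<not> commutes K"
  shows "card K = p ^ 3"
proof -
  obtain m where m: "card K = p ^ m" using p_group_subgroup[OF assms(1)] by blast
  have "p ^ 3 \<le> card K" using nonabelian_card[OF assms(1)] assms(3) by blast
  moreover have "card K < card (mline r)"
    using assms finite_subgroup[OF subgroup_line] by (intro psubset_card_mono)
  ultimately have "p ^ 3 \<le> p ^ m" "p ^ m < p ^ 4" using m card_mline by simp_all
  then have "3 \<le> m" "m < 4" using p_gt_1 power_increasing_iff power_less_imp_less_exp by blast+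
  then show ?thesis using m by (simp add: le_less_Suc_eq eval_nat_numeral)
qed

lemma card_small: "card (small u v) = p ^ 3"
  by (rule card_nonabelian_in_mline[OF subgroup_small small_psubset not_commutes_small])

lemma small_A1: "A_group p 1 (G\<lparr>carrier := small u v\<rparr>)"
  unfolding A1_group_subgroup_iff[OF subgroup_small]
proof (intro conjI allI impI)
  show "\<not> commutes (small u v)" by (rule not_commutes_small)
  fix K assume K: "subgroup K G \<and> K \<subset> small u v"
  then have "card K < p ^ 3"
    using psubset_card_mono[OF finite_subgroup[OF subgroup_small], of K u v] card_small by simp
  then show "commutes K" using nonabelian_card[of K] K by (metis leD)
qed

lemma small_mod: "small (u mod int p) (v mod int p) = small u v"
proof -
  have "el n (int p * l) j k \<in> small (u mod int p) (v mod int p) \<longleftrightarrow> el n (int p * l) j k \<in> small u v" for n l j k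
  proof -
    have "[l - (u mod int p) * n - (v mod int p) * (j + l * eps p) = l - u * n - v * (j + l * eps p)] (mod int p)"
      by (intro cong_diff cong_mult cong_refl) (simp_all add: cong_def)
    then show ?thesis unfolding el_small_iff by (rule cong_dvd_iff)
  qed
  then show ?thesis unfolding small_def by blast
qed

text \<open>Modulo \<open>d\<close> the elements of \<open>mline 0\<close> are
  \<open>b^n z^l c^m\<close> with \<open>m = j + l * eps p\<close>. Two of them commute iff the
  determinant \<open>D\<close> of their \<open>(n, m)\<close> vanishes modulo \<open>p\<close>, so a
  noncommuting pair fits exactly one linear law \<open>l = u n + v m\<close>. Both \<open>K\<close>
  and \<open>small u v\<close> have order \<open>p^3\<close>, and so does their nonabelian
  intersection.\<close>

lemma nonabelian_in_mline_0:
  assumes K: "subgroup K G" "K \<subset> mline 0" "\<not> commutes K"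
  obtains u v where "0 \<le> u" "u < int p" "0 \<le> v" "v < int p" "K = small u v"
proof -
  obtain x y where xy: "x \<in> K" "y \<in> K" "x \<otimes> y \<noteq> y \<otimes> x" using K(3) by blast
  have rep: "\<exists>n l j k. g = el n (int p * l) j k" if g: "g \<in> K" for g
  proof -
    have "g \<in> carrier G" using g subgroup.subset[OF K(1)] by blast
    then obtain n i j k where gel: "g = el n i j k" by (rule el_cases)
    then have "int p dvd i" using g K(2) mline_0_iff by blast
    then show ?thesis using gel by (auto elim!: dvdE)
  qed
  obtain n l j k where x: "x = el n (int p * l) j k" using rep xy by blast
  obtain n' l' j' k' where y: "y = el n' (int p * l') j' k'" using rep xy by blast
  define m where "m = j + l * eps p"
  define m' where "m' = j' + l' * eps p"
  define D where "D = n' * m - n * m'"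
  have D: "\<not> int p dvd D"
  proof
    assume "int p dvd D"
    have "n' * j + tri n' * (int p * l) - n * j' - tri n * (int p * l') + (n' * l - n * l') * eps p =
        D + int p * (tri n' * l - tri n * l')"
      by (simp add: D_def m_def m'_def algebra_simps)
    then have "int p dvd n' * j + tri n' * (int p * l) - n * j' - tri n * (int p * l') + (n' * l - n * l') * eps p"
      using \<open>int p dvd D\<close> by (metis dvd_add dvd_triv_left)
    moreover have "n' * (int p * l) - n * (int p * l') = int p * (n' * l - n * l')" by (simp add: algebra_simps)
    ultimately show False using xy(3) unfolding x y commute_el_iff by blast
  qed
  obtain e where e: "int p dvd D * e - 1" using prime_inverse[OF prime_int D] .
  \<comment> \<open>Cramer's rule for \<open>l = u n + v m\<close> and
    \<open>l' = u n' + v m'\<close>, with \<open>e\<close> the inverse of \<open>D\<close>.\<close>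
  define u where "u = e * (m * l' - l * m')"
  define v where "v = e * (n' * l - n * l')"
  have "l - u * n - v * m = - l * (D * e - 1)" "l' - u * n' - v * m' = - l' * (D * e - 1)"
    by (simp_all add: u_def v_def D_def algebra_simps)
  then have "x \<in> small u v" "y \<in> small u v"
    unfolding x y el_small_iff m_def[symmetric] m'_def[symmetric] using e by (simp_all only: dvd_mult)
  then have "p ^ 3 \<le> card (K \<inter> small u v)"
    using xy by (intro nonabelian_card[of _ x y] subgroups_Inter_pair K subgroup_small) auto
  moreover have "card K = p ^ 3" by (rule card_nonabelian_in_mline[OF K])
  ultimately have "K \<inter> small u v = K" "K \<inter> small u v = small u v"
    using card_small[of u v] finite_subgroup[OF K(1)] finite_subgroup[OF subgroup_small]
    by (metis Int_lower1 card_seteq, metis Int_lower2 card_seteq)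
  then have "K = small (u mod int p) (v mod int p)" by (simp add: small_mod)
  then show ?thesis using that[of "u mod int p" "v mod int p"] p_pos by simp
qed

lemma not_A1_mline_0: "\<not> A_group p 1 (G\<lparr>carrier := mline 0\<rparr>)"
  unfolding A1_group_subgroup_iff[OF subgroup_line]
  using small_psubset[of 0 0] not_commutes_small[of 0 0] subgroup_small[of 0 0] by blast

text \<open>In order \<open>p^4\<close> index \<open>p^2\<close> leaves order \<open>p^2\<close>,
  which is abelian, and \<open>small 0 0\<close> is a nonabelian subgroup of index
  \<open>p\<close>.\<close>

lemma A2_mline_0: "A_group p 2 (G\<lparr>carrier := mline 0\<rparr>)"
proof -
  have "commutes K" if "subgroup K G" "p ^ 2 * card K = p ^ 4" for K
  proof (rule ccontr)
    assume "\<not> commutes K"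
    then have "p ^ 3 \<le> card K" using nonabelian_card[OF that(1)] by blast
    moreover have "p ^ 2 * card K = p ^ 2 * p ^ 2" using that(2) by (simp add: power_add[symmetric])
    then have "card K = p ^ 2" using p_pos by (subst (asm) mult_left_cancel) auto
    ultimately have "p ^ 3 \<le> p ^ 2" by simp
    then show False using p_gt_1 power_increasing_iff[of p 3 2] by simp
  qed
  moreover have "p ^ 1 * card (small 0 0) = p ^ 4" by (simp add: card_small eval_nat_numeral)
  then have "\<exists>K. subgroup K G \<and> K \<subseteq> mline 0 \<and> p ^ (2 - 1) * card K = p ^ 4 \<and> \<not> commutes K"
    using small_psubset[of 0 0] not_commutes_small[of 0 0] subgroup_small[of 0 0] by auto
  ultimately show ?thesis
    unfolding A_group_subgroup_iff[OF subgroup_line, of 2, simplified] card_mline by auto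
qed

lemma not_A2_of_A1:
  assumes H: "subgroup H G" "A_group p 1 (G\<lparr>carrier := H\<rparr>) \<or> commutes H"
  shows "\<not> A_group p 2 (G\<lparr>carrier := H\<rparr>)"
proof
  assume "A_group p 2 (G\<lparr>carrier := H\<rparr>)"
  then obtain K where K: "subgroup K G" "K \<subseteq> H" "p ^ (2 - 1) * card K = card H" "\<not> commutes K"
    using A_group_subgroup_iff[OF H(1), of 2] by auto
  have "card K > 0" using finite_subgroup[OF K(1)] subgroup.one_closed[OF K(1)] card_gt_0_iff by blast
  then have "K \<noteq> H" using K(3) p_gt_1 by auto
  then show False using K H(2) unfolding A1_group_subgroup_iff[OF H(1)] by blast
qed

lemma inj_mline: "inj_on mline {0..<int p}"
proof (rule inj_onI)
  fix r r' assume *: "r \<in> {0..<int p}" "r' \<in> {0..<int p}" "mline r = mline r'"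
  have "el 1 r 0 0 \<in> mline r" by (simp add: el_line_iff)
  then have "el 1 r 0 0 \<in> mline r'" by (simp only: *(3))
  then have "int p dvd r - r'" by (simp add: el_line_iff)
  then have "r mod int p = r' mod int p" by (simp add: mod_eq_dvd_iff)
  then show "r = r'" using * by simp
qed

lemma index_p_set: "{H. subgroup H G \<and> subgroup_index G H = p} = insert abel (mline ` {0..<int p})"
proof
  show "{H. subgroup H G \<and> subgroup_index G H = p} \<subseteq> insert abel (mline ` {0..<int p})"
  proof
    fix H assume "H \<in> {H. subgroup H G \<and> subgroup_index G H = p}"
    then have H: "subgroup H G" "subgroup_index G H = p" by auto
    show "H \<in> insert abel (mline ` {0..<int p})"
      by (rule index_p_cases[OF H]) auto
  qed
  show "insert abel (mline ` {0..<int p}) \<subseteq> {H. subgroup H G \<and> subgroup_index G H = p}"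
    using index_line subgroup_line not_dvd_one by auto
qed

lemma mline_A1_iff: "r \<in> {0..<int p} \<Longrightarrow> A_group p 1 (G\<lparr>carrier := mline r\<rparr>) \<longleftrightarrow> r \<noteq> 0"
  using mline_A1[of r] not_A1_mline_0 zdvd_not_zless[of r "int p"] by (cases "r = 0") auto

lemma mu_set:
  "{H. A_subgroup p i H G \<and> subgroup_index G H = p} =
    {H \<in> insert abel (mline ` {0..<int p}). A_group p i (G\<lparr>carrier := H\<rparr>)}"
  unfolding index_p_set[symmetric] A_subgroup_def by auto

lemma mu_0: "mu p 0 G = 1"
proof -
  have "A_group p 0 (G\<lparr>carrier := abel\<rparr>)"
    unfolding A0_group_subgroup_iff[OF subgroup_line] by (rule commutes_abel)
  moreover have "\<not> A_group p 0 (G\<lparr>carrier := mline r\<rparr>)" for r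
    unfolding A0_group_subgroup_iff[OF subgroup_line] by (rule not_commutes_mline)
  ultimately have "{H \<in> insert abel (mline ` {0..<int p}). A_group p 0 (G\<lparr>carrier := H\<rparr>)} = {abel}"
    by blast
  then show ?thesis by (simp add: mu_def mu_set)
qed

lemma mu_1_set:
  "{H. A_subgroup p 1 H G \<and> subgroup_index G H = p} = mline ` {1..<int p}"
proof -
  have "\<not> A_group p 1 (G\<lparr>carrier := abel\<rparr>)"
    using commutes_abel unfolding A1_group_subgroup_iff[OF subgroup_line] by blast
  then have "{H \<in> insert abel (mline ` {0..<int p}). A_group p 1 (G\<lparr>carrier := H\<rparr>)} =
      mline ` {r \<in> {0..<int p}. A_group p 1 (G\<lparr>carrier := mline r\<rparr>)}"
    by blast
  also have "{r \<in> {0..<int p}. A_group p 1 (G\<lparr>carrier := mline r\<rparr>)} = {1..<int p}"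
    using mline_A1_iff by force
  finally show ?thesis unfolding mu_set .
qed

lemma card_mline_image: "card (mline ` {1..<int p}) = p - 1"
proof -
  have "inj_on mline {1..<int p}" by (rule inj_on_subset[OF inj_mline]) auto
  then show ?thesis by (simp add: card_image)
qed

lemma mu_1: "mu p 1 G = p - 1"
  unfolding mu_def mu_1_set by (rule card_mline_image)

lemma mu_2: "mu p 2 G = 1"
proof -
  have "\<not> A_group p 2 (G\<lparr>carrier := abel\<rparr>)"
    using not_A2_of_A1[OF subgroup_line] commutes_abel by blast
  moreover have "A_group p 2 (G\<lparr>carrier := mline r\<rparr>) \<longleftrightarrow> r = 0" if "r \<in> {0..<int p}" for r
    using not_A2_of_A1[OF subgroup_line, of "- r" 1] mline_A1_iff[OF that] A2_mline_0 by blast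
  moreover have "0 \<in> {0..<int p}" using p_pos by simp
  ultimately have "{H \<in> insert abel (mline ` {0..<int p}). A_group p 2 (G\<lparr>carrier := H\<rparr>)} = {mline 0}"
    by blast
  then show ?thesis by (simp add: mu_def mu_set)
qed

lemma inj_small: "inj_on (\<lambda>(u, v). small u v) ({0..<int p} \<times> {0..<int p})"
proof (rule inj_onI, clarsimp)
  fix u v u' v' assume *: "0 \<le> u" "u < int p" "0 \<le> v" "v < int p" "0 \<le> u'" "u' < int p" "0 \<le> v'" "v' < int p"
    and eq: "small u v = small u' v'"
  have "el 1 (int p * u) (- u * eps p) 0 \<in> small u' v'" "el 0 (int p * v) (1 - v * eps p) 0 \<in> small u' v'"
    unfolding eq[symmetric] by (rule small_gens)+
  then have "int p dvd u - u'" "int p dvd v - v'" unfolding el_small_iff by simp_all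
  then have "u mod int p = u' mod int p" "v mod int p = v' mod int p" by (simp_all add: mod_eq_dvd_iff)
  then show "u = u' \<and> v = v'" using * by simp
qed

text \<open>Such a subgroup is proper, since \<open>mline 0\<close> is nonabelian, and lies in a
  maximal subgroup \<open>M\<close> other than \<open>abel\<close>. If \<open>M\<close> is itself
  minimal nonabelian, the two coincide; otherwise \<open>M\<close> is \<open>mline 0\<close> and its
  nonabelian proper subgroups are known.\<close>

lemma A1_subgroups: "{H. A_subgroup p 1 H G} =
    mline ` {1..<int p} \<union> (\<lambda>(u, v). small u v) ` ({0..<int p} \<times> {0..<int p})"
proof
  show "mline ` {1..<int p} \<union> (\<lambda>(u, v). small u v) ` ({0..<int p} \<times> {0..<int p}) \<subseteq> {H. A_subgroup p 1 H G}"
    using mu_1_set small_A1 subgroup_small by (auto simp: A_subgroup_def)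
  show "{H. A_subgroup p 1 H G} \<subseteq>
    mline ` {1..<int p} \<union> (\<lambda>(u, v). small u v) ` ({0..<int p} \<times> {0..<int p})"
  proof
    fix H assume "H \<in> {H. A_subgroup p 1 H G}"
    then have H: "subgroup H G" "A_group p 1 (G\<lparr>carrier := H\<rparr>)" by (auto simp: A_subgroup_def)
    have A1: "\<not> commutes H" using H(2) unfolding A1_group_subgroup_iff[OF H(1)] by (rule conjunct1)
    have "H \<noteq> carrier G"
    proof
      assume "H = carrier G"
      moreover have "mline 0 \<subset> carrier G"
        using subgroup.subset[OF subgroup_line] maximal_line[of 0 1] not_dvd_one
        by (auto simp: maximal_subgroup_def)
      moreover have "\<forall>K. subgroup K G \<and> K \<subset> H \<longrightarrow> commutes K"
        using H(2) unfolding A1_group_subgroup_iff[OF H(1)] by (rule conjunct2)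
      ultimately have "commutes (mline 0)" using subgroup_line by (elim allE[of _ "mline 0"]) simp
      then show False using not_commutes_mline[of 0] by simp
    qed
    then obtain M where M: "subgroup M G" "subgroup_index G M = p" "H \<subseteq> M"
      using index_p_above[OF H(1)] by blast
    show "H \<in> mline ` {1..<int p} \<union> (\<lambda>(u, v). small u v) ` ({0..<int p} \<times> {0..<int p})"
    proof (cases "H = M")
      case True
      then have "H \<in> {H. A_subgroup p 1 H G \<and> subgroup_index G H = p}"
        using H M by (simp add: A_subgroup_def)
      then show ?thesis unfolding mu_1_set by blast
    next
      case False
      then have HM: "H \<subset> M" using M by blast
      have "M \<in> insert abel (mline ` {0..<int p})" using M unfolding index_p_set[symmetric] by blast
      moreover have "M \<noteq> abel"
      proof
        assume "M = abel"
        then have "commutes H" using commutes_abel M(3) by (meson subsetD)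
        with A1 show False by simp
      qed
      ultimately obtain r where r: "r \<in> {0..<int p}" "M = mline r" by blast
      have "r = 0"
      proof (rule ccontr)
        assume "r \<noteq> 0"
        then have "A_group p 1 (G\<lparr>carrier := mline r\<rparr>)" using mline_A1_iff[OF r(1)] by simp
        then have "\<forall>K. subgroup K G \<and> K \<subset> mline r \<longrightarrow> commutes K"
          unfolding A1_group_subgroup_iff[OF subgroup_line] by (rule conjunct2)
        then have "commutes H" using HM H(1) unfolding r(2) by (elim allE[of _ H]) simp
        with A1 show False by simp
      qed
      then have "H \<subset> mline 0" using HM r by simp
      from this A1 obtain u v where uv: "0 \<le> u" "u < int p" "0 \<le> v" "v < int p" "H = small u v"
        by (rule nonabelian_in_mline_0[OF H(1)])
      then have "(u, v) \<in> {0..<int p} \<times> {0..<int p}" by simp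
      then have "H \<in> (\<lambda>(u, v). small u v) ` ({0..<int p} \<times> {0..<int p})" using uv(5) by force
      then show ?thesis by blast
    qed
  qed
qed

text \<open>There are \<open>p - 1\<close> subgroups of order \<open>p^4\<close> and one of order
  \<open>p^3\<close> for each of the \<open>p^2\<close> pairs \<open>(u, v)\<close>; the different
  orders keep the two kinds apart.\<close>

lemma alpha1_eq: "alpha1 p G = p ^ 2 + p - 1"
proof -
  have "mline r \<noteq> small u v" for r u v
    using card_small[of u v] card_mline[of r] p_gt_1 power_inject_exp[of p 4 3] by auto
  then have "mline ` {1..<int p} \<inter> (\<lambda>(u, v). small u v) ` ({0..<int p} \<times> {0..<int p}) = {}" by auto
  then have "card {H. A_subgroup p 1 H G} = (p - 1) + p * p"
    unfolding A1_subgroups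
    by (subst card_Un_disjoint) (simp_all add: card_mline_image card_image[OF inj_small] card_cartesian_product)
  then show ?thesis using p_pos by (simp add: alpha1_def power2_eq_square)
qed

end

section \<open>Direct products of cyclic groups\<close>

context group
begin

lemma int_pow_mod_exponent:
  assumes "x \<in> carrier G" "x [^] (m :: nat) = \<one>"
  shows "x [^] (i mod int m) = x [^] (i :: int)"
proof -
  have "x [^] i = x [^] (int m * (i div int m) + i mod int m)" by simp
  also have "\<dots> = (x [^] m) [^] (i div int m) \<otimes> x [^] (i mod int m)"
    using assms(1) by (simp only: int_pow_mult int_pow_pow[symmetric] int_pow_int)
  finally show ?thesis using assms by simp
qed

text \<open>Equal orders replace the proof of injectivity, so no independence of generators has to
  be verified.\<close>

lemma iso_of_surj_card:
  assumes "group H" "h \<in> hom H (G\<lparr>carrier := K\<rparr>)" "K \<subseteq> h ` carrier H" "finite (carrier H)"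
    and "card K = card (carrier H)" "subgroup K G"
  shows "G\<lparr>carrier := K\<rparr> \<cong> H"
proof -
  have im: "h ` carrier H = K" using assms(2,3) by (auto simp: hom_def)
  then have "inj_on h (carrier H)" using assms(4,5) by (intro eq_card_imp_inj_on) auto
  then have "h \<in> iso H (G\<lparr>carrier := K\<rparr>)" using assms(2) im by (simp add: iso_def bij_betw_def)
  then have "H \<cong> G\<lparr>carrier := K\<rparr>" by (auto simp: is_iso_def)
  then show ?thesis using group.iso_sym[OF assms(1)] by blast
qed

lemma hom_cyc:
  assumes K: "subgroup K G" "x \<in> K" and "x [^] (m :: nat) = \<one>"
  shows "(\<lambda>i. x [^] i) \<in> hom (cyc m) (G\<lparr>carrier := K\<rparr>)"
proof (rule homI)
  have x: "x \<in> carrier G" by (rule subgroup.mem_carrier[OF K])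
  fix i j :: int
  show "x [^] i \<in> carrier (G\<lparr>carrier := K\<rparr>)" by (simp add: subgroup_int_pow_closed[OF K])
  show "x [^] (i \<otimes>\<^bsub>cyc m\<^esub> j) = x [^] i \<otimes>\<^bsub>G\<lparr>carrier := K\<rparr>\<^esub> x [^] j"
    by (simp add: int_pow_mod_exponent[OF x assms(3)] int_pow_mult x)
qed

lemma iso_cyc:
  assumes K: "subgroup K G" "x \<in> K" and "x [^] (m :: nat) = \<one>" "m > 0"
    and "\<And>g. g \<in> K \<Longrightarrow> \<exists>i :: int. g = x [^] i" and "card K = m"
  shows "G\<lparr>carrier := K\<rparr> \<cong> cyc m"
proof (rule iso_of_surj_card[where h = "\<lambda>i. x [^] i"])
  have x: "x \<in> carrier G" by (rule subgroup.mem_carrier[OF K])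
  have md: "x [^] (i mod int m) = x [^] i" for i :: int by (rule int_pow_mod_exponent[OF x assms(3)])
  show "(\<lambda>i. x [^] i) \<in> hom (cyc m) (G\<lparr>carrier := K\<rparr>)" by (rule hom_cyc[OF K assms(3)])
  show "K \<subseteq> (\<lambda>i. x [^] i) ` carrier (cyc m)"
  proof
    fix g assume "g \<in> K"
    then obtain i :: int where "g = x [^] i" using assms(5) by blast
    then have "g = x [^] (i mod int m)" by (simp add: md)
    moreover have "i mod int m \<in> carrier (cyc m)" using assms(4) by (simp add: carrier_integer_mod_group)
    ultimately show "g \<in> (\<lambda>i. x [^] i) ` carrier (cyc m)" by blast
  qed
qed (use assms in \<open>simp_all add: carrier_integer_mod_group\<close>)

text \<open>The second factor is an arbitrary finite group mapped into \<open>K\<close>, so that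
  triple products are obtained from the same lemma.\<close>

lemma iso_prod_cyc:
  assumes K: "subgroup K G" "x \<in> K" and xm: "x [^] (m :: nat) = \<one>" "m > 0"
    and H: "group H" "finite (carrier H)" "h \<in> hom H (G\<lparr>carrier := K\<rparr>)"
    and comm: "\<And>y. y \<in> carrier H \<Longrightarrow> h y \<otimes> x = x \<otimes> h y"
    and surj: "\<And>g. g \<in> K \<Longrightarrow> \<exists>(i :: int) y. y \<in> carrier H \<and> g = x [^] i \<otimes> h y"
    and card: "card K = m * card (carrier H)"
  shows "G\<lparr>carrier := K\<rparr> \<cong> cyc m \<times>\<times> H"
proof (rule iso_of_surj_card[where h = "\<lambda>(i, y). x [^] i \<otimes> h y"])
  have x: "x \<in> carrier G" by (rule subgroup.mem_carrier[OF K])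
  have md: "x [^] (i mod int m) = x [^] i" for i :: int by (rule int_pow_mod_exponent[OF x xm(1)])
  have hK: "h y \<in> K" if "y \<in> carrier H" for y using H(3) that by (auto simp: hom_def)
  then have hG: "h y \<in> carrier G" if "y \<in> carrier H" for y
    using that by (meson K(1) subgroup.mem_carrier)
  have comm': "h y \<otimes> x [^] i = x [^] i \<otimes> h y" if "y \<in> carrier H" for i :: int and y
  proof -
    have "x [^] n \<otimes> h y = h y \<otimes> x [^] n" for n :: nat
      using pow_mult_distrib comm[OF that] x hG[OF that] by (metis group_commutes_pow)
    then have n: "h y \<otimes> x [^] n = x [^] n \<otimes> h y" for n :: nat by simp
    show ?thesis
    proof (cases i)
      case (nonneg n') then show ?thesis by (simp add: int_pow_int n)
    next
      case (neg n')
      let ?z = "x [^] Suc n'"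
      have z: "?z \<in> carrier G" using x by simp
      have "inv ?z \<otimes> (h y \<otimes> ?z) \<otimes> inv ?z = inv ?z \<otimes> (?z \<otimes> h y) \<otimes> inv ?z" by (simp only: n)
      moreover have "inv ?z \<otimes> (h y \<otimes> ?z) \<otimes> inv ?z = inv ?z \<otimes> h y"
        using z hG[OF that] by (simp add: m_assoc del: nat_pow_Suc)
      moreover have "inv ?z \<otimes> (?z \<otimes> h y) \<otimes> inv ?z = h y \<otimes> inv ?z"
        using z hG[OF that] by (simp add: m_assoc[symmetric] del: nat_pow_Suc)
      moreover have "x [^] i = inv ?z" unfolding neg by (rule int_pow_neg_int[OF x])
      ultimately show ?thesis by simp
    qed
  qed
  show "(\<lambda>(i, y). x [^] i \<otimes> h y) \<in> hom (cyc m \<times>\<times> H) (G\<lparr>carrier := K\<rparr>)"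
  proof (rule homI, goal_cases)
    case (1 z)
    then show ?case
      using hK K by (auto simp: subgroup.m_closed subgroup_int_pow_closed)
  next
    case (2 z w)
    obtain i y i' y' where zw: "z = (i, y)" "w = (i', y')" by fastforce
    have y: "y \<in> carrier H" "y' \<in> carrier H" using 2 zw by auto
    have "x [^] (i + i') \<otimes> (h y \<otimes> h y') = x [^] i \<otimes> (x [^] i' \<otimes> h y) \<otimes> h y'"
      using x hG y by (simp add: int_pow_mult m_assoc)
    also have "\<dots> = x [^] i \<otimes> (h y \<otimes> x [^] i') \<otimes> h y'"
      by (simp only: comm'[OF y(1), of i'])
    also have "\<dots> = x [^] i \<otimes> h y \<otimes> (x [^] i' \<otimes> h y')"
      using x hG y by (simp add: m_assoc)
    finally show ?case using y hom_mult[OF H(3)] by (simp add: zw md)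
  qed
  show "K \<subseteq> (\<lambda>(i, y). x [^] i \<otimes> h y) ` carrier (cyc m \<times>\<times> H)"
  proof
    fix g assume "g \<in> K"
    then obtain i :: int and y where "y \<in> carrier H" "g = x [^] i \<otimes> h y" using surj by blast
    then have "g = x [^] (i mod int m) \<otimes> h y" by (simp add: md)
    moreover have "(i mod int m, y) \<in> carrier (cyc m \<times>\<times> H)"
      using xm(2) \<open>y \<in> carrier H\<close> by (simp add: carrier_integer_mod_group)
    ultimately show "g \<in> (\<lambda>(i, y). x [^] i \<otimes> h y) ` carrier (cyc m \<times>\<times> H)" by force
  qed
  show "group (cyc m \<times>\<times> H)" by (intro DirProd_group group_integer_mod_group H(1))
qed (use xm card H K in \<open>simp_all add: carrier_integer_mod_group card_cartesian_product DirProd_def\<close>)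

end

context p_cover
begin

lemma el_0_commute: "el 0 i j k \<otimes> el 0 i' j' k' = el 0 i' j' k' \<otimes> el 0 i j k"
  by (simp add: el_mult add.commute)

lemma z_int_pow: "el 0 (int p) (- eps p) 0 [^] (m :: int) = el 0 (int p * m) (- m * eps p) 0"
  by (simp add: el_0_int_pow mult.commute)

text \<open>This encodes \<open>z^(p w) = d^(w s)\<close>: the \<open>eps p\<close> in the exponent
  of \<open>a^(p^2)\<close> is cancelled by the \<open>p\<close>-th power of
  \<open>c^(-eps p)\<close>.\<close>

lemma z_shift: "el 0 (int p * (u + int p * w)) (- (u + int p * w) * eps p) k = el 0 (int p * u) (- u * eps p) (k + w * s)"
proof -
  have "el 0 (int p * (u + int p * w)) (- (u + int p * w) * eps p) k =
      el 0 (int p * u + int p * int p * w) (- u * eps p + int p * (- w * eps p)) k"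
    by (simp add: algebra_simps)
  also have "\<dots> = el 0 (int p * u) (- u * eps p) (k + - w * eps p * eps p + w * (s + eps p))"
    by (simp only: el_add_i el_add_j)
  also have "k + - w * eps p * eps p + w * (s + eps p) = k + w * s"
    by (simp add: eps_def algebra_simps)
  finally show ?thesis .
qed

lemma card_cyc [simp]: "m > 0 \<Longrightarrow> card (carrier (cyc m)) = m" "m > 0 \<Longrightarrow> finite (carrier (cyc m))"
  by (simp_all add: carrier_integer_mod_group)

lemma z_in_cent: "el 0 (int p) (- eps p) 0 \<in> cent"
proof -
  have "el 0 (int p * 1) (- 1 * eps p) 0 \<in> cent" unfolding cent_def by blast
  then show ?thesis by simp
qed

lemma hom_d: "dsub \<subseteq> K \<Longrightarrow> (\<lambda>k. el 0 0 0 k) \<in> hom (cyc p) (G\<lparr>carrier := K\<rparr>)"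
proof (rule homI, goal_cases)
  case (1 k)
  then show ?case by (auto simp: dsub_def)
next
  case (2 k l)
  have "el 0 0 0 ((k + l) mod int p) = el 0 0 0 (k + l)"
    by (rule el_add_k) (simp add: mod_eq_dvd_iff[symmetric])
  then show ?case by (simp add: el_mult)
qed

lemma d_reduce: "\<exists>y. y \<in> carrier (cyc p) \<and> el n i j k = el n i j y"
proof (intro exI conjI)
  show "k mod int p \<in> carrier (cyc p)" using p_pos by (simp add: carrier_integer_mod_group)
  show "el n i j k = el n i j (k mod int p)"
    by (rule el_add_k[symmetric]) (simp add: mod_eq_dvd_iff[symmetric])
qed

text \<open>As \<open>z^p = d^s\<close> with \<open>s\<close> a unit, the powers of \<open>z\<close>
  already include \<open>d\<close>.\<close>

lemma cent_iso_cyc: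
  assumes s: "\<not> int p dvd s"
  shows "G\<lparr>carrier := cent\<rparr> \<cong> cyc (p ^ 2)"
proof (rule iso_cyc[OF subgroup_cent z_in_cent])
  show "el 0 (int p) (- eps p) 0 [^] (p ^ 2) = \<one>"
  proof -
    have "el 0 (int p) (- eps p) 0 [^] (p ^ 2) = el 0 (int p * (0 + int p * int p)) (- (0 + int p * int p) * eps p) 0"
      using z_int_pow[of "int (p ^ 2)", unfolded int_pow_int] by (simp add: power2_eq_square)
    also have "\<dots> = \<one>" unfolding z_shift by (simp add: el_1_eq_one)
    finally show ?thesis .
  qed
  fix g assume "g \<in> cent"
  then obtain u k where g: "g = el 0 (int p * u) (- u * eps p) k" unfolding cent_def by blast
  obtain y where y: "int p dvd s * y - 1" using prime_inverse[OF prime_int s] .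
  have "el 0 (int p) (- eps p) 0 [^] (u + int p * (y * k)) = el 0 (int p * u) (- u * eps p) (0 + y * k * s)"
    unfolding z_int_pow by (rule z_shift)
  also have "\<dots> = g" unfolding g
  proof (rule el_add_k)
    have "0 + y * k * s - k = k * (s * y - 1)" by (simp add: algebra_simps)
    then show "int p dvd 0 + y * k * s - k" using y by simp
  qed
  finally show "\<exists>i :: int. g = el 0 (int p) (- eps p) 0 [^] i" by metis
qed (use p_pos subgroup_cards in auto)

lemma z_pow_p:
  assumes "int p dvd s"
  shows "el 0 (int p) (- eps p) 0 [^] p = \<one>"
proof -
  have "el 0 (int p) (- eps p) 0 [^] p = el 0 (int p * (0 + int p * 1)) (- (0 + int p * 1) * eps p) 0"
    using z_int_pow[of "int p"] by (simp add: int_pow_int)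
  also have "\<dots> = \<one>" unfolding z_shift using assms by (simp add: el_1_eq_one)
  finally show ?thesis .
qed

lemma cent_iso_prod:
  assumes s: "int p dvd s"
  shows "G\<lparr>carrier := cent\<rparr> \<cong> cyc p \<times>\<times> cyc p"
proof (rule iso_prod_cyc[OF subgroup_cent z_in_cent z_pow_p[OF s] p_pos, where h = "\<lambda>k. el 0 0 0 k"])
  have "dsub \<subseteq> cent" by (auto simp: dsub_def cent_def) (metis mult_zero_left mult_zero_right minus_zero)
  then show "(\<lambda>k. el 0 0 0 k) \<in> hom (cyc p) (G\<lparr>carrier := cent\<rparr>)" by (rule hom_d)
  fix g assume "g \<in> cent"
  then obtain u k where g: "g = el 0 (int p * u) (- u * eps p) k" unfolding cent_def by blast
  obtain y where y: "y \<in> carrier (cyc p)" "g = el 0 (int p * u) (- u * eps p) y"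
    using d_reduce unfolding g by blast
  then have "g = el 0 (int p) (- eps p) 0 [^] u \<otimes> el 0 0 0 y" unfolding z_int_pow by (simp add: el_mult)
  then show "\<exists>(i :: int) y. y \<in> carrier (cyc p) \<and> g = el 0 (int p) (- eps p) 0 [^] i \<otimes> el 0 0 0 y"
    using y(1) by blast
qed (use p_pos subgroup_cards in \<open>auto simp: el_0_commute power2_eq_square\<close>)

lemma c_in_derv: "el 0 0 1 0 \<in> derv" and c_in_frat: "el 0 0 1 0 \<in> frat"
proof -
  show "el 0 0 1 0 \<in> derv" by (auto simp: derv_def)
  have "el 0 (int p * 0) 1 0 \<in> frat" unfolding frat_def by blast
  then show "el 0 0 1 0 \<in> frat" by simp
qed

lemma c_pow_p: "el 0 0 1 0 [^] p = el 0 0 0 (eps p)"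
  using el_add_j[of 0 0 0 1 0] by (simp add: el_nat_pow)

lemma derv_iso_prod:
  assumes "p \<noteq> 2"
  shows "G\<lparr>carrier := derv\<rparr> \<cong> cyc p \<times>\<times> cyc p"
proof (rule iso_prod_cyc[OF subgroup_derv c_in_derv _ p_pos, where h = "\<lambda>k. el 0 0 0 k"])
  show "el 0 0 1 0 [^] p = \<one>" using assms by (simp add: c_pow_p eps_def el_1_eq_one)
  show "(\<lambda>k. el 0 0 0 k) \<in> hom (cyc p) (G\<lparr>carrier := derv\<rparr>)"
    by (rule hom_d) (auto simp: dsub_def derv_def)
  fix g assume "g \<in> derv"
  then obtain j k where g: "g = el 0 0 j k" unfolding derv_def by blast
  obtain y where y: "y \<in> carrier (cyc p)" "g = el 0 0 j y" using d_reduce unfolding g by blast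
  then have "g = el 0 0 1 0 [^] j \<otimes> el 0 0 0 y" by (simp add: el_mult el_0_int_pow)
  then show "\<exists>(i :: int) y. y \<in> carrier (cyc p) \<and> g = el 0 0 1 0 [^] i \<otimes> el 0 0 0 y"
    using y(1) by blast
qed (use p_pos subgroup_cards in \<open>auto simp: el_0_commute power2_eq_square\<close>)

lemma c_pow_4: "p = 2 \<Longrightarrow> el 0 0 1 0 [^] (4 :: nat) = \<one>"
  using el_add_j[of 0 0 0 2 0] by (simp add: el_nat_pow eps_def el_1_eq_one)

lemma el_shift_2: "p = 2 \<Longrightarrow> el n i (j + 2 * v) k = el n i j (k + v)"
  using el_add_j[of n i j v k] by (simp add: eps_def)

lemma derv_iso_cyc:
  assumes p: "p = 2"
  shows "G\<lparr>carrier := derv\<rparr> \<cong> cyc 4"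
proof (rule iso_cyc[OF subgroup_derv c_in_derv c_pow_4[OF p]])
  fix g assume "g \<in> derv"
  then obtain j k where g: "g = el 0 0 j k" unfolding derv_def by blast
  have "el 0 0 1 0 [^] (j + 2 * k) = g"
    using el_shift_2[OF p, of 0 0 j k 0] by (simp add: el_0_int_pow g)
  then show "\<exists>i :: int. g = el 0 0 1 0 [^] i" by metis
qed (use p subgroup_cards in auto)

lemma zp_in_frat: "el 0 (int p) j k \<in> frat"
proof -
  have "el 0 (int p * 1) j k \<in> frat" unfolding frat_def by blast
  then show ?thesis by simp
qed

text \<open>For odd \<open>p\<close> and a unit \<open>s\<close>, \<open>d\<close> is a power of
  \<open>a^(p^2) = d^s\<close>; hence \<open>a^p\<close> generates a factor of order
  \<open>p^2\<close>, and \<open>c\<close> of order \<open>p\<close> complements it.\<close>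

lemma frat_iso_cyc_p_squared:
  assumes p: "p \<noteq> 2" and s: "\<not> int p dvd s"
  shows "G\<lparr>carrier := frat\<rparr> \<cong> cyc (p ^ 2) \<times>\<times> cyc p"
proof (rule iso_prod_cyc[OF subgroup_frat zp_in_frat[of 0 0], where h = "\<lambda>j. el 0 0 1 0 [^] j"])
  have e: "eps p = 0" using p by (simp add: eps_def)
  show "el 0 (int p) 0 0 [^] (p ^ 2) = \<one>"
    using el_add_i[of 0 0 "int p" 0 0] by (simp add: el_nat_pow power2_eq_square el_1_eq_one mult_ac)
  show "(\<lambda>j. el 0 0 1 0 [^] j) \<in> hom (cyc p) (G\<lparr>carrier := frat\<rparr>)"
    by (rule hom_cyc[OF subgroup_frat c_in_frat]) (simp add: c_pow_p e el_1_eq_one)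
  fix g assume "g \<in> frat"
  then obtain u j k where g: "g = el 0 (int p * u) j k" unfolding frat_def by blast
  obtain y where y: "int p dvd s * y - 1" using prime_inverse[OF prime_int s] .
  define j' where "j' = j mod int p"
  have j: "j = j' + int p * (j div int p)" by (simp add: j'_def)
  have "g = el 0 (int p * u) j' k"
    unfolding g by (subst j) (simp only: el_add_j e mult_zero_right add_0_right)
  also have "\<dots> = el 0 (int p * u) j' (0 + y * k * (s + eps p))"
  proof (rule el_add_k[symmetric])
    have "0 + y * k * (s + eps p) - k = k * (s * y - 1)" by (simp add: e algebra_simps)
    then show "int p dvd 0 + y * k * (s + eps p) - k" using y by simp
  qed
  also have "\<dots> = el 0 (int p * u + int p * int p * (y * k)) j' 0" by (simp only: el_add_i)
  also have "\<dots> = el 0 (int p) 0 0 [^] (u + int p * (y * k)) \<otimes> el 0 0 1 0 [^] j'"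
    by (simp add: el_mult el_0_int_pow algebra_simps)
  finally have "g = el 0 (int p) 0 0 [^] (u + int p * (y * k)) \<otimes> el 0 0 1 0 [^] j'" .
  moreover have "j' \<in> carrier (cyc p)" using p_pos by (simp add: j'_def carrier_integer_mod_group)
  ultimately show "\<exists>(i :: int) y. y \<in> carrier (cyc p) \<and> g = el 0 (int p) 0 0 [^] i \<otimes> el 0 0 1 0 [^] y"
    by blast
qed (use p_pos subgroup_cards in \<open>auto simp: el_0_commute el_0_int_pow eval_nat_numeral\<close>)

lemma frat_iso_cyc_p:
  assumes p: "p \<noteq> 2" and s: "int p dvd s"
  shows "G\<lparr>carrier := frat\<rparr> \<cong> cyc p \<times>\<times> cyc p \<times>\<times> cyc p"
proof (rule iso_prod_cyc[OF subgroup_frat zp_in_frat[of 0 0] _ p_pos, where h = "\<lambda>(j, k). el 0 0 j k"])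
  have e: "eps p = 0" using p by (simp add: eps_def)
  show "el 0 (int p) 0 0 [^] p = \<one>" using z_pow_p[OF s] by (simp add: e)
  have red: "el n i (j mod int p) (k mod int p) = el n i j k" for n i j k
  proof -
    have "el n i (j mod int p + int p * (j div int p)) k = el n i (j mod int p) (k + (j div int p) * eps p)"
      by (rule el_add_j)
    moreover have "el n i (j mod int p) (k mod int p) = el n i (j mod int p) k"
      by (rule el_add_k) (simp add: mod_eq_dvd_iff[symmetric])
    ultimately show ?thesis by (simp add: e)
  qed
  show "(\<lambda>(j, k). el 0 0 j k) \<in> hom (cyc p \<times>\<times> cyc p) (G\<lparr>carrier := frat\<rparr>)"
  proof (rule homI, goal_cases)
    case (1 z)
    have "el 0 (int p * 0) j k \<in> frat" for j k unfolding frat_def by blast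
    then show ?case by (cases z) simp
  next
    case (2 z w)
    then show ?case by (cases z; cases w) (simp add: red el_mult)
  qed
  fix g assume "g \<in> frat"
  then obtain u j k where g: "g = el 0 (int p * u) j k" unfolding frat_def by blast
  then have "g = el 0 (int p * u) (j mod int p) (k mod int p)" by (simp add: red)
  then have "g = el 0 (int p) 0 0 [^] u \<otimes> (\<lambda>(j, k). el 0 0 j k) (j mod int p, k mod int p)"
    by (simp add: el_mult el_0_int_pow mult.commute)
  moreover have "(j mod int p, k mod int p) \<in> carrier (cyc p \<times>\<times> cyc p)"
    using p_pos by (simp add: carrier_integer_mod_group)
  ultimately show "\<exists>(i :: int) y. y \<in> carrier (cyc p \<times>\<times> cyc p) \<and>
      g = el 0 (int p) 0 0 [^] i \<otimes> (\<lambda>(j, k). el 0 0 j k) y" by blast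
next
  show "group (cyc p \<times>\<times> cyc p)" by (intro DirProd_group group_integer_mod_group)
qed (use p_pos subgroup_cards in \<open>auto simp: el_0_commute eval_nat_numeral DirProd_def card_cartesian_product\<close>)

lemma frat_iso_cyc_4:
  assumes p: "p = 2"
  shows "G\<lparr>carrier := frat\<rparr> \<cong> cyc 4 \<times>\<times> cyc 2"
proof -
  \<comment> \<open>Here \<open>c\<close> has order 4, and the complement needs an involution
    \<open>a^2 c^q\<close>. Its square is \<open>d^(s + 1 + q)\<close>, so the parity of
    \<open>s\<close> dictates \<open>q\<close>.\<close>
  define q where "q = (if even s then - 1 else 0 :: int)"
  have "even (s + 1 + q)" by (simp add: q_def)
  then obtain l where l: "s + 1 + q = 2 * l" by (rule evenE)
  let ?y = "el 0 2 q 0"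
  have y: "?y \<in> frat" using zp_in_frat p by simp
  have y2: "?y [^] (2 :: nat) = \<one>"
  proof -
    have "?y [^] (2 :: nat) = el 0 4 (2 * q) 0" by (simp add: el_nat_pow)
    also have "\<dots> = el 0 0 (2 * q) (s + 1)" using el_add_i[of 0 0 1 "2 * q" 0] p by (simp add: eps_def)
    also have "\<dots> = el 0 0 0 (s + 1 + q)" using el_shift_2[OF p, of 0 0 0 q "s + 1"] by simp
    also have "\<dots> = \<one>" using l p by (simp add: el_1_eq_one)
    finally show ?thesis .
  qed
  show ?thesis
  proof (rule iso_prod_cyc[OF subgroup_frat c_in_frat c_pow_4[OF p], where h = "\<lambda>u. ?y [^] u"])
    show "(\<lambda>u. ?y [^] u) \<in> hom (cyc 2) (G\<lparr>carrier := frat\<rparr>)" by (rule hom_cyc[OF subgroup_frat y y2])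
    fix g assume "g \<in> frat"
    then obtain u j k where g: "g = el 0 (int p * u) j k" unfolding frat_def by blast
    have "g = el 0 (2 * u) (j + 2 * k) 0" using el_shift_2[OF p, of 0 "2 * u" j k 0] p by (simp add: g)
    also have "\<dots> = el 0 0 1 0 [^] (j + 2 * k - u * q) \<otimes> ?y [^] u"
      by (simp add: el_mult el_0_int_pow algebra_simps)
    also have "?y [^] u = ?y [^] (u mod int 2)"
      by (rule int_pow_mod_exponent[OF el_closed y2, symmetric])
    finally show "\<exists>(i :: int) y. y \<in> carrier (cyc 2) \<and> g = el 0 0 1 0 [^] i \<otimes> ?y [^] y"
      by (intro exI[of _ "j + 2 * k - u * q"] exI[of _ "u mod int 2"])
        (simp add: carrier_integer_mod_group)
  qed (use p subgroup_cards in \<open>auto simp: el_0_commute el_0_int_pow\<close>)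
qed

end

section \<open>Recognising covered groups\<close>

context group
begin

lemma commute_nat_pow:
  assumes "x \<in> carrier G" "y \<in> carrier G" "x \<otimes> y = y \<otimes> x"
  shows "x \<otimes> y [^] (n :: nat) = y [^] n \<otimes> x"
proof (induction n)
  case (Suc n)
  have "x \<otimes> y [^] Suc n = (x \<otimes> y [^] n) \<otimes> y" using assms by (simp add: m_assoc)
  also have "\<dots> = y [^] n \<otimes> (x \<otimes> y)" unfolding Suc using assms(1,2) by (simp add: m_assoc)
  also have "\<dots> = y [^] Suc n \<otimes> x" unfolding assms(3) using assms(1,2) by (simp add: m_assoc)
  finally show ?case .
qed (use assms in simp)

lemma commute_inv:
  assumes "x \<in> carrier G" "y \<in> carrier G" "x \<otimes> y = y \<otimes> x"
  shows "x \<otimes> inv y = inv y \<otimes> x"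
proof -
  have "inv y \<otimes> (x \<otimes> y) \<otimes> inv y = inv y \<otimes> x" using assms(1,2) by (simp add: m_assoc)
  moreover have "inv y \<otimes> (y \<otimes> x) \<otimes> inv y = x \<otimes> inv y" using assms(1,2) by (simp add: m_assoc[symmetric])
  ultimately show ?thesis by (simp add: assms(3))
qed

lemma commute_mult:
  assumes "x \<in> carrier G" "y \<in> carrier G" "z \<in> carrier G" "x \<otimes> y = y \<otimes> x" "x \<otimes> z = z \<otimes> x"
  shows "x \<otimes> (y \<otimes> z) = y \<otimes> z \<otimes> x"
proof -
  have "x \<otimes> (y \<otimes> z) = (x \<otimes> y) \<otimes> z" using assms(1-3) by (simp add: m_assoc)
  also have "\<dots> = y \<otimes> (x \<otimes> z)" unfolding assms(4) using assms(1-3) by (simp add: m_assoc)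
  also have "\<dots> = y \<otimes> z \<otimes> x" unfolding assms(5) using assms(1-3) by (simp add: m_assoc)
  finally show ?thesis .
qed

lemma commute_int_pow:
  assumes "x \<in> carrier G" "y \<in> carrier G" "x \<otimes> y = y \<otimes> x"
  shows "x \<otimes> y [^] (n :: int) = y [^] n \<otimes> x"
proof (cases n)
  case (nonneg m)
  then show ?thesis using commute_nat_pow[OF assms] by (simp add: int_pow_int)
next
  case (neg m)
  have "x \<otimes> inv (y [^] Suc m) = inv (y [^] Suc m) \<otimes> x"
    using assms by (intro commute_inv commute_nat_pow) auto
  then show ?thesis unfolding neg int_pow_neg_int[OF assms(2)] .
qed

lemma conj_nat_pow:
  assumes "x \<in> carrier G" "y \<in> carrier G" "b \<in> carrier G" "x \<otimes> b = b \<otimes> y"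
  shows "x [^] n \<otimes> b = b \<otimes> y [^] (n :: nat)"
proof (induction n)
  case (Suc n)
  have "x [^] Suc n \<otimes> b = x [^] n \<otimes> (x \<otimes> b)" using assms(1-3) by (simp add: m_assoc)
  also have "\<dots> = (x [^] n \<otimes> b) \<otimes> y" unfolding assms(4) using assms(1-3) by (simp add: m_assoc)
  also have "\<dots> = b \<otimes> y [^] Suc n" unfolding Suc using assms(1-3) by (simp add: m_assoc)
  finally show ?case .
qed (use assms in simp)

lemma conj_int_pow:
  assumes "x \<in> carrier G" "y \<in> carrier G" "b \<in> carrier G" "x \<otimes> b = b \<otimes> y"
  shows "x [^] m \<otimes> b = b \<otimes> y [^] (m :: int)"
proof (cases m)
  case (nonneg n)
  then show ?thesis by (simp add: int_pow_int conj_nat_pow[OF assms])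
next
  case (neg n)
  let ?x = "x [^] Suc n" and ?y = "y [^] Suc n"
  have xy: "?x \<in> carrier G" "?y \<in> carrier G" using assms by auto
  have "inv ?x \<otimes> (?x \<otimes> b) \<otimes> inv ?y = inv ?x \<otimes> (b \<otimes> ?y) \<otimes> inv ?y"
    by (simp only: conj_nat_pow[OF assms])
  moreover have "inv ?x \<otimes> (?x \<otimes> b) \<otimes> inv ?y = b \<otimes> inv ?y"
    using xy assms(3) by (simp add: m_assoc[symmetric] del: nat_pow_Suc)
  moreover have "inv ?x \<otimes> (b \<otimes> ?y) \<otimes> inv ?y = inv ?x \<otimes> b"
    using xy assms(3) by (simp add: m_assoc del: nat_pow_Suc)
  ultimately show ?thesis
    unfolding neg int_pow_neg_int[OF assms(1)] int_pow_neg_int[OF assms(2)] by simp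
qed

lemma commutator_eq_iff:
  assumes "x \<in> carrier G" "y \<in> carrier G" "z \<in> carrier G"
  shows "commutator G x y = z \<longleftrightarrow> x \<otimes> y = y \<otimes> x \<otimes> z"
proof -
  have "commutator G x y = inv (y \<otimes> x) \<otimes> (x \<otimes> y)"
    using assms by (simp add: commutator_def inv_mult_group m_assoc)
  then show ?thesis
    using assms inv_solve_left[of z "y \<otimes> x" "x \<otimes> y"] by (metis inv_solve_left' m_closed)
qed

definition normal_word :: "'a \<Rightarrow> 'a \<Rightarrow> int \<Rightarrow> int \<Rightarrow> int \<Rightarrow> int \<Rightarrow> 'a" where
  "normal_word a b n i j k = b [^] n \<otimes> a [^] i \<otimes> commutator G a b [^] j \<otimes>
     commutator G (commutator G a b) b [^] k"

end

text \<open>Only the commutation rules are required, no orders. As \<open>c\<close> and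
  \<open>d\<close> are parameters tied by equations, an instance may supply explicit elements for
  them, even \<open>\<one>\<close> for the last.\<close>

locale class_three = group +
  fixes a b c d
  assumes a [simp]: "a \<in> carrier G" and b [simp]: "b \<in> carrier G"
    and c_def: "c = commutator G a b" and d_def: "d = commutator G c b"
    and ca: "c \<otimes> a = a \<otimes> c" and da: "d \<otimes> a = a \<otimes> d" and dc: "d \<otimes> c = c \<otimes> d" and db: "d \<otimes> b = b \<otimes> d"
begin

lemma c [simp]: "c \<in> carrier G" and d [simp]: "d \<in> carrier G"
  by (simp_all add: c_def d_def is_group)

lemma ab: "a \<otimes> b = b \<otimes> (a \<otimes> c)" and cb: "c \<otimes> b = b \<otimes> (c \<otimes> d)"
  using commutator_eq_iff[of a b c] commutator_eq_iff[of c b d]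
  by (simp_all add: c_def[symmetric] d_def[symmetric] m_assoc)

abbreviation W :: "int \<Rightarrow> int \<Rightarrow> int \<Rightarrow> 'a" where
  "W i j k \<equiv> a [^] i \<otimes> c [^] j \<otimes> d [^] k"

lemma pow_commute:
  "c [^] (i :: int) \<otimes> a [^] (j :: int) = a [^] j \<otimes> c [^] i"
  "d [^] i \<otimes> a [^] j = a [^] j \<otimes> d [^] i"
  "d [^] i \<otimes> c [^] j = c [^] j \<otimes> d [^] i"
  "d [^] i \<otimes> b [^] j = b [^] j \<otimes> d [^] i"
proof -
  have *: "x [^] i \<otimes> y [^] j = y [^] j \<otimes> x [^] i"
    if "x \<in> carrier G" "y \<in> carrier G" "x \<otimes> y = y \<otimes> x" for x y and i j :: int
  proof -
    have "y \<otimes> x [^] i = x [^] i \<otimes> y" using that by (intro commute_int_pow) auto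
    then show ?thesis using that by (intro commute_int_pow) auto
  qed
  show "c [^] i \<otimes> a [^] j = a [^] j \<otimes> c [^] i" "d [^] i \<otimes> a [^] j = a [^] j \<otimes> d [^] i"
    "d [^] i \<otimes> c [^] j = c [^] j \<otimes> d [^] i" "d [^] i \<otimes> b [^] j = b [^] j \<otimes> d [^] i"
    by (rule *; simp add: ca da dc db)+
qed

lemma W_mult: "W i j k \<otimes> W i' j' k' = W (i + i') (j + j') (k + k')"
proof -
  have "W i j k \<otimes> W i' j' k' = a [^] i \<otimes> c [^] j \<otimes> (d [^] k \<otimes> a [^] i') \<otimes> c [^] j' \<otimes> d [^] k'"
    by (simp add: m_assoc)
  also have "\<dots> = a [^] i \<otimes> (c [^] j \<otimes> a [^] i') \<otimes> (d [^] k \<otimes> c [^] j') \<otimes> d [^] k'"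
    by (simp only: pow_commute(2)[of k i']) (simp add: m_assoc)
  also have "\<dots> = a [^] i \<otimes> a [^] i' \<otimes> (c [^] j \<otimes> c [^] j') \<otimes> (d [^] k \<otimes> d [^] k')"
    by (simp only: pow_commute(1)[of j i'] pow_commute(3)[of k j']) (simp add: m_assoc)
  finally show ?thesis by (simp add: int_pow_mult)
qed

lemma W_b: "W i j k \<otimes> b = b \<otimes> W i (j + i) (k + j)"
proof -
  have "a [^] i \<otimes> b = b \<otimes> (a \<otimes> c) [^] i" by (rule conj_int_pow) (simp_all add: ab)
  also have "(a \<otimes> c) [^] i = a [^] i \<otimes> c [^] i" by (rule int_pow_mult_distrib) (simp_all add: ca)
  finally have A: "a [^] i \<otimes> b = b \<otimes> (a [^] i \<otimes> c [^] i)" .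
  have "c [^] j \<otimes> b = b \<otimes> (c \<otimes> d) [^] j" by (rule conj_int_pow) (simp_all add: cb)
  also have "(c \<otimes> d) [^] j = c [^] j \<otimes> d [^] j" by (rule int_pow_mult_distrib) (simp_all add: dc)
  finally have C: "c [^] j \<otimes> b = b \<otimes> (c [^] j \<otimes> d [^] j)" .
  have D: "d [^] k \<otimes> b = b \<otimes> d [^] k" using pow_commute(4)[of k 1] by simp
  have "W i j k \<otimes> b = a [^] i \<otimes> c [^] j \<otimes> (d [^] k \<otimes> b)" by (simp add: m_assoc)
  also have "\<dots> = a [^] i \<otimes> (c [^] j \<otimes> b) \<otimes> d [^] k" unfolding D by (simp add: m_assoc)
  also have "\<dots> = (a [^] i \<otimes> b) \<otimes> c [^] j \<otimes> d [^] j \<otimes> d [^] k" unfolding C by (simp add: m_assoc)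
  also have "\<dots> = b \<otimes> (W i i 0 \<otimes> W 0 j (j + k))" unfolding A by (simp add: m_assoc int_pow_mult)
  also have "\<dots> = b \<otimes> W i (j + i) (k + j)" unfolding W_mult by (simp add: add.commute)
  finally show ?thesis .
qed

text \<open>Induction runs in both directions from 0; the downward step multiplies by one more
  \<open>b\<close> on the right, uses \<open>W_b\<close>, and cancels \<open>b\<close>
  again.\<close>

lemma W_b_pow: "W i j k \<otimes> b [^] n = b [^] n \<otimes> W i (j + n * i) (k + n * j + tri n * i)" for n :: int
proof (induction n rule: int_induct[where k = 0])
  case base
  then show ?case by simp
next
  case (step1 n)
  have "W i j k \<otimes> b [^] (n + 1) = W i j k \<otimes> b [^] n \<otimes> b" by (simp add: int_pow_mult m_assoc)
  also have "\<dots> = b [^] n \<otimes> (W i (j + n * i) (k + n * j + tri n * i) \<otimes> b)"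
    unfolding step1 by (simp add: m_assoc)
  also have "\<dots> = b [^] (n + 1) \<otimes> W i (j + n * i + i) (k + n * j + tri n * i + (j + n * i))"
    unfolding W_b by (simp add: int_pow_mult m_assoc)
  finally show ?case by (simp add: tri_add algebra_simps)
next
  case (step2 n)
  have *: "tri n = tri (n - 1) + (n - 1)" using tri_add[of "n - 1" 1] by simp
  have "W i j k \<otimes> b [^] (n - 1) \<otimes> b = W i j k \<otimes> b [^] n"
    using int_pow_mult[OF b, of "n - 1" 1] by (simp add: m_assoc)
  also have "\<dots> = b [^] n \<otimes> W i (j + n * i) (k + n * j + tri n * i)" by (rule step2)
  also have "\<dots> = b [^] (n - 1) \<otimes> (b \<otimes> W i (j + (n - 1) * i + i) (k + (n - 1) * j + tri (n - 1) * i + (j + (n - 1) * i)))"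
    using int_pow_mult[OF b, of "n - 1" 1] by (simp add: * m_assoc algebra_simps)
  also have "\<dots> = b [^] (n - 1) \<otimes> W i (j + (n - 1) * i) (k + (n - 1) * j + tri (n - 1) * i) \<otimes> b"
    unfolding W_b[symmetric] by (simp add: m_assoc)
  finally show ?case by simp
qed

lemma normal_word_eq: "normal_word a b n i j k = b [^] n \<otimes> W i j k"
  by (simp add: normal_word_def c_def[symmetric] d_def[symmetric] m_assoc)

lemma normal_word_mult:
  "normal_word a b n i j k \<otimes> normal_word a b n' i' j' k' =
    normal_word a b (n + n') (i + i') (j + n' * i + j') (k + n' * j + tri n' * i + k')"
proof -
  have "normal_word a b n i j k \<otimes> normal_word a b n' i' j' k' = b [^] n \<otimes> (W i j k \<otimes> b [^] n') \<otimes> W i' j' k'"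
    by (simp add: normal_word_eq m_assoc)
  also have "\<dots> = b [^] n \<otimes> b [^] n' \<otimes> (W i (j + n' * i) (k + n' * j + tri n' * i) \<otimes> W i' j' k')"
    unfolding W_b_pow by (simp add: m_assoc)
  also have "\<dots> = normal_word a b (n + n') (i + i') (j + n' * i + j') (k + n' * j + tri n' * i + k')"
    unfolding W_mult normal_word_eq by (simp add: int_pow_mult)
  finally show ?thesis .
qed

lemma normal_word_gens:
  "normal_word a b 1 0 0 0 = b" "normal_word a b 0 1 0 0 = a" "normal_word a b 0 0 0 0 = \<one>"
  "normal_word a b 0 0 1 0 = c" "normal_word a b 0 0 0 1 = d"
  by (simp_all add: normal_word_eq)

lemma normal_word_closed [simp]: "normal_word a b n i j k \<in> carrier G"
  by (simp add: normal_word_eq)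

lemma generate_normal_words: "generate G {a, b} = {normal_word a b n i j k | n i j k. True}"
proof
  let ?S = "{normal_word a b n i j k | n i j k. True}"
  have sub: "subgroup ?S G"
  proof (rule subgroupI)
    show "?S \<subseteq> carrier G" by auto
    have "normal_word a b 0 0 0 0 \<in> ?S" by blast
    then show "?S \<noteq> {}" by blast
    fix x assume "x \<in> ?S"
    then obtain n i j k where x: "x = normal_word a b n i j k" by blast
    have "normal_word a b (- n) (- i) (- j + n * i) (- k + n * (j - n * i) + tri n * i) \<otimes> x = \<one>"
      unfolding x normal_word_mult by (simp add: normal_word_gens algebra_simps)
    then have "inv x = normal_word a b (- n) (- i) (- j + n * i) (- k + n * (j - n * i) + tri n * i)"
      by (intro inv_equality) (simp_all add: x)
    then show "inv x \<in> ?S" by blast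
    fix y assume "y \<in> ?S"
    then obtain n' i' j' k' where y: "y = normal_word a b n' i' j' k'" by blast
    show "x \<otimes> y \<in> ?S" unfolding x y normal_word_mult by blast
  qed
  have "b \<in> ?S" "a \<in> ?S" using normal_word_gens by (metis (mono_tags, lifting) mem_Collect_eq)+
  then show "generate G {a, b} \<subseteq> ?S" by (intro generate_subgroup_incl[OF _ sub]) simp
  have gen: "subgroup (generate G {a, b}) G" by (rule generate_is_subgroup) simp
  have ab: "a \<in> generate G {a, b}" "b \<in> generate G {a, b}" by (auto intro: generate.incl)
  then have "c \<in> generate G {a, b}"
    unfolding c_def commutator_def by (intro subgroup.m_closed[OF gen] subgroup.m_inv_closed[OF gen])
  moreover from this have "d \<in> generate G {a, b}"
    unfolding d_def commutator_def using ab by (intro subgroup.m_closed[OF gen] subgroup.m_inv_closed[OF gen])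
  ultimately show "?S \<subseteq> generate G {a, b}"
    unfolding normal_word_eq using ab
    by (auto intro!: subgroup.m_closed[OF gen] subgroup_int_pow_closed[OF gen])
qed

end

text \<open>The power relations are exactly those that kill the words in \<open>relN\<close>; the
  group is thus an image of the model, possibly a proper one.\<close>

locale class_three_p = class_three +
  fixes p :: nat and s t :: int
  assumes prime_p: "prime p"
    and gen: "generate G {a, b} = carrier G"
    and d_pow: "d [^] p = \<one>" and c_pow: "c [^] p \<otimes> d [^] eps p = \<one>"
    and a_pow: "a [^] (p * p) = d [^] (s + eps p)" and b_pow: "b [^] p = d [^] t"
begin

lemma relN_normal_word:
  assumes "(n, i, j, k) \<in> relN p s t"
  shows "normal_word a b n i j k = \<one>"
proof -
  obtain w u v where *: "n = int p * w" "i = int p * int p * u" "j = int p * v"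
    and dv: "int p dvd k + u * (s + eps p) + v * eps p + t * w" using assms by (rule relN_E)
  have bn: "b [^] n = d [^] (t * w)"
    using b_pow by (simp add: * int_pow_pow[symmetric] int_pow_int)
  have ai: "a [^] i = d [^] ((s + eps p) * u)"
    using a_pow by (simp add: * int_pow_pow[symmetric] int_pow_int of_nat_mult[symmetric] del: of_nat_mult)
  have "c [^] p = d [^] (- eps p)"
    using c_pow inv_equality[of "c [^] p" "d [^] eps p"] by (simp add: int_pow_neg)
  moreover have "c [^] j = (c [^] p) [^] v"
    by (simp add: * int_pow_pow[symmetric] int_pow_int)
  ultimately have cj: "c [^] j = d [^] (- eps p * v)" by (simp only: int_pow_pow[OF d])
  have "normal_word a b n i j k = d [^] (t * w + (s + eps p) * u + - eps p * v + k)"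
    unfolding normal_word_eq bn ai cj by (simp only: int_pow_mult[OF d] m_assoc int_pow_closed m_closed d)
  also have "\<dots> = \<one>"
  proof -
    have "t * w + (s + eps p) * u + - eps p * v + k =
        (k + u * (s + eps p) + v * eps p + t * w) - v * (2 * eps p)" by (simp add: algebra_simps)
    moreover have "int p dvd 2 * eps p" by (simp add: eps_def)
    ultimately have "int p dvd t * w + (s + eps p) * u + - eps p * v + k"
      using dv by (metis dvd_diff dvd_mult)
    then obtain q where "t * w + (s + eps p) * u + - eps p * v + k = int p * q" by (auto elim!: dvdE)
    then show ?thesis using d_pow by (simp add: int_pow_pow[symmetric] int_pow_int)
  qed
  finally show ?thesis .
qed

lemma p_cover_of_kernel:
  assumes "\<And>n i j k. normal_word a b n i j k = \<one> \<Longrightarrow> (n, i, j, k) \<in> relN p s t"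
  shows "p_cover G p s t (normal_word a b)"
proof unfold_locales
  show "normal_word a b n i j k = \<one> \<longleftrightarrow> (n, i, j, k) \<in> relN p s t" for n i j k
    using assms relN_normal_word by blast
qed (use prime_p normal_word_mult gen generate_normal_words in auto)

text \<open>The model has \<open>p^5\<close> elements and maps onto the group by matching words. If
  the group has \<open>p^5\<close> elements too, the map is injective and no further word
  vanishes.\<close>

lemma p_cover_of_order:
  assumes "order G = p ^ 5"
  shows "p_cover G p s t (normal_word a b)"
proof (rule p_cover_of_kernel)
  interpret M: p_cover "model p s t" p s t "model_el p s t" by (rule p_cover_model[OF prime_p])
  let ?f = "\<lambda>x. case x of (n, i, j, k) \<Rightarrow> model_el p s t n i j k"
  have eq: "normal_word a b n i j k = normal_word a b n' i' j' k'"
    if "model_el p s t n i j k = model_el p s t n' i' j' k'" for n i j k n' i' j' k'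
  proof -
    have "normal_word a b n' i' j' k' = normal_word a b n i j k \<otimes> normal_word a b (n' - n) (i' - i)
      (j' - j - (n' - n) * i) (k' - k - (n' - n) * j - tri (n' - n) * i)"
      by (simp add: normal_word_mult)
    also have "normal_word a b (n' - n) (i' - i) (j' - j - (n' - n) * i) (k' - k - (n' - n) * j - tri (n' - n) * i) = \<one>"
      by (rule relN_normal_word) (use that M.el_eq_iff in blast)
    finally show ?thesis by simp
  qed
  define h where "h y = (SOME x. \<exists>n i j k. y = model_el p s t n i j k \<and> x = normal_word a b n i j k)" for y
  have h: "h (model_el p s t n i j k) = normal_word a b n i j k" for n i j k
    unfolding h_def by (rule some_equality) (use eq in \<open>blast, metis\<close>)
  have "h ` carrier (model p s t) = carrier G"
  proof
    show "h ` carrier (model p s t) \<subseteq> carrier G" by (auto simp: M.carrier_el h)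
    show "carrier G \<subseteq> h ` carrier (model p s t)"
    proof
      fix x assume "x \<in> carrier G"
      then obtain n i j k where "x = normal_word a b n i j k"
        unfolding gen[symmetric] generate_normal_words by blast
      then have "x = h (model_el p s t n i j k)" by (simp only: h)
      then show "x \<in> h ` carrier (model p s t)" using M.el_closed by blast
    qed
  qed
  moreover have "card (carrier (model p s t)) = card (carrier G)"
    using assms M.order_eq by (simp add: order_def)
  ultimately have inj: "inj_on h (carrier (model p s t))"
    using M.finite_carrier by (intro eq_card_imp_inj_on) auto
  fix n i j k assume "normal_word a b n i j k = \<one>"
  then have "h (model_el p s t n i j k) = h (model_el p s t 0 0 0 0)"
    by (simp add: h normal_word_gens)
  then have "model_el p s t n i j k = model_el p s t 0 0 0 0"
    using inj by (simp add: inj_on_eq_iff)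
  then show "(n, i, j, k) \<in> relN p s t" using M.el_one_iff M.one_eq_el by simp
qed

end

lemma (in p_cover) normal_word_el: "normal_word (el 0 1 0 0) (el 1 0 0 0) n i j k = el n i j k"
  by (subst el_decompose) (simp add: normal_word_def commutator_el)

lemma hom_normal_word:
  assumes "group G" "group H" "h \<in> hom G H" "a \<in> carrier G" "b \<in> carrier G"
  shows "h (group.normal_word G a b n i j k) = group.normal_word H (h a) (h b) n i j k"
proof -
  interpret group_hom G H h using assms by (intro group_homI)
  show ?thesis
    unfolding G.normal_word_def H.normal_word_def
    using assms by (simp add: hom_int_pow hom_commutator[OF assms(1-3)])
qed

section \<open>Covers of the listed groups\<close>

context group
begin

text \<open>Centrality of \<open>d\<close> is not among the relations. Conjugation by
  \<open>b\<close> maps \<open>d = a^(\<nu> p^2)\<close> to the same power of \<open>a c\<close>,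
  and the power of \<open>c\<close> that splits off vanishes. As \<open>s\<close> inverts
  \<open>\<nu>\<close>, \<open>a^(p^2) = d^s\<close>.\<close>

lemma class_three_p_A4:
  assumes p: "prime p" "p \<noteq> 2" and a: "a \<in> carrier G" and b: "b \<in> carrier G"
    and gen: "generate G {a, b} = carrier G"
    and c: "c = commutator G a b" and d: "d = commutator G c b"
    and rel: "a [^] (p ^ 3) = \<one>" "b [^] p = \<one>" "c [^] p = \<one>" "commutator G c a = \<one>"
      "d = a [^] (\<nu> * p ^ 2)"
    and s: "int p dvd int \<nu> * s - 1"
  shows "class_three_p G a b c d p s 0"
proof -
  have cG: "c \<in> carrier G" by (simp add: c a b is_group)
  have dG: "d \<in> carrier G" by (simp add: d cG b is_group)
  have e: "eps p = 0" using p by (simp add: eps_def)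
  have ca: "c \<otimes> a = a \<otimes> c" using rel(4) commutator_eq_iff[OF cG a one_closed] cG a by simp
  have ab: "a \<otimes> b = b \<otimes> (a \<otimes> c)" using commutator_eq_iff[OF a b cG] a b cG by (simp add: c[symmetric] m_assoc)
  have "a [^] (\<nu> * p ^ 2) \<otimes> b = b \<otimes> (a \<otimes> c) [^] (\<nu> * p ^ 2)"
    by (rule conj_nat_pow) (simp_all add: a b cG ab)
  also have "(a \<otimes> c) [^] (\<nu> * p ^ 2) = a [^] (\<nu> * p ^ 2) \<otimes> c [^] (\<nu> * p ^ 2)"
    by (rule pow_mult_distrib) (simp_all add: a cG ca)
  also have "c [^] (\<nu> * p ^ 2) = (c [^] p) [^] (\<nu> * p)"
    using cG by (simp add: nat_pow_pow power2_eq_square mult_ac)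
  finally have db: "d \<otimes> b = b \<otimes> d" using a b rel(3) by (simp add: rel(5))
  have da: "d \<otimes> a = a \<otimes> d" unfolding rel(5) by (rule commute_nat_pow[symmetric]) (simp_all add: a)
  have dc: "d \<otimes> c = c \<otimes> d" unfolding rel(5) by (rule commute_nat_pow[symmetric]) (simp_all add: a cG ca)
  have dp: "d [^] p = \<one>"
  proof -
    have "d [^] p = (a [^] (p ^ 3)) [^] \<nu>"
      using a by (simp add: rel(5) nat_pow_pow power2_eq_square power3_eq_cube mult_ac)
    then show ?thesis by (simp add: rel(1))
  qed
  have "d [^] s = a [^] (p * p)"
  proof -
    obtain q where q: "int \<nu> * s = 1 + int p * q" using s by (metis add.commute diff_add_cancel dvdE)
    have "d [^] s = a [^] (int (\<nu> * p ^ 2) * s)"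
      using a by (simp add: rel(5) int_pow_pow int_pow_int[symmetric])
    also have "int (\<nu> * p ^ 2) * s = int (p * p) * (int \<nu> * s)" by (simp add: power2_eq_square)
    also have "\<dots> = int (p * p) * (1 + int p * q)" by (simp only: q)
    also have "\<dots> = int (p * p) + int (p ^ 3) * q" by (simp add: power3_eq_cube algebra_simps)
    also have "a [^] \<dots> = a [^] (p * p) \<otimes> (a [^] (p ^ 3)) [^] q"
      using a by (simp only: int_pow_mult int_pow_pow[symmetric] int_pow_int)
    finally show ?thesis using a by (simp add: rel(1))
  qed
  then show ?thesis
    using p a b c d ca da dc db gen dp rel by unfold_locales (simp_all add: e)
qed

lemma class_three_p_A6:
  assumes p: "prime p" "p \<noteq> 2" and a: "a \<in> carrier G" and b: "b \<in> carrier G"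
    and gen: "generate G {a, b} = carrier G"
    and c: "c = commutator G a b" and d: "d = commutator G c b"
    and rel: "a [^] (p ^ 2) = \<one>" "b [^] p = \<one>" "c [^] p = \<one>" "d [^] p = \<one>"
      "commutator G c a = \<one>" "commutator G d a = \<one>" "commutator G d b = \<one>"
  shows "class_three_p G a b c d p 0 0"
proof -
  have cG: "c \<in> carrier G" by (simp add: c a b is_group)
  have dG: "d \<in> carrier G" by (simp add: d cG b is_group)
  have e: "eps p = 0" using p by (simp add: eps_def)
  have ca: "c \<otimes> a = a \<otimes> c" using rel(5) commutator_eq_iff[OF cG a one_closed] cG a by simp
  have da: "d \<otimes> a = a \<otimes> d" using rel(6) commutator_eq_iff[OF dG a one_closed] dG a by simp
  have db: "d \<otimes> b = b \<otimes> d" using rel(7) commutator_eq_iff[OF dG b one_closed] dG b by simp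
  have dc: "d \<otimes> c = c \<otimes> d"
    unfolding c commutator_def using dG a b da db by (intro commute_mult commute_inv) auto
  show ?thesis
    using p a b c d ca da dc db gen rel by unfold_locales (simp_all add: e power2_eq_square)
qed

text \<open>Only \<open>d = b^p\<close> and its commuting with \<open>b\<close> are evident. Moving
  \<open>c\<close> past \<open>b^n\<close> collects \<open>d^n\<close>, which for
  \<open>n = p\<close> shows that \<open>d\<close> commutes with \<open>c\<close>. After that,
  moving \<open>a\<close> past \<open>b^p\<close> collects \<open>c^p\<close> and \<open>d\<close>
  to the power C(p,2), both trivial for odd \<open>p\<close>, so \<open>d\<close> commutes with
  \<open>a\<close>.\<close>

lemma class_three_p_A5:
  assumes p: "prime p" "p \<noteq> 2" and a: "a \<in> carrier G" and b: "b \<in> carrier G"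
    and gen: "generate G {a, b} = carrier G"
    and c: "c = commutator G a b" and d: "d = commutator G c b"
    and rel: "a [^] (p ^ 2) = \<one>" "b [^] (p ^ 2) = \<one>" "c [^] p = \<one>" "commutator G c a = \<one>" "d = b [^] p"
  shows "class_three_p G a b c d p 0 1"
proof -
  have cG: "c \<in> carrier G" by (simp add: c a b is_group)
  have dG: "d \<in> carrier G" by (simp add: d cG b is_group)
  have e: "eps p = 0" using p by (simp add: eps_def)
  have ca: "c \<otimes> a = a \<otimes> c" using rel(4) commutator_eq_iff[OF cG a one_closed] cG a by simp
  have ab: "a \<otimes> b = b \<otimes> (a \<otimes> c)" using commutator_eq_iff[OF a b cG] a b cG by (simp add: c[symmetric] m_assoc)
  have cb: "c \<otimes> b = b \<otimes> (c \<otimes> d)" using commutator_eq_iff[OF cG b dG] b cG dG by (simp add: d[symmetric] m_assoc)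
  have db: "d \<otimes> b = b \<otimes> d" unfolding rel(5) by (rule commute_nat_pow[symmetric]) (simp_all add: b)
  have bd: "b \<otimes> d [^] n = d [^] n \<otimes> b" for n :: nat
    by (rule commute_nat_pow) (simp_all add: b dG db)
  have dp: "d [^] p = \<one>" using b rel(2) by (simp add: rel(5) nat_pow_pow power2_eq_square)
  have shift_c: "c \<otimes> b [^] n = b [^] n \<otimes> (c \<otimes> d [^] n)" for n :: nat
  proof (induction n)
    case (Suc n)
    have "c \<otimes> b [^] Suc n = (c \<otimes> b [^] n) \<otimes> b" using b cG by (simp add: m_assoc)
    also have "\<dots> = b [^] n \<otimes> (c \<otimes> (d [^] n \<otimes> b))" unfolding Suc using b cG dG by (simp add: m_assoc)
    also have "\<dots> = b [^] n \<otimes> ((c \<otimes> b) \<otimes> d [^] n)" unfolding bd[symmetric] using b cG dG by (simp add: m_assoc)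
    also have "\<dots> = b [^] Suc n \<otimes> (c \<otimes> (d \<otimes> d [^] n))" unfolding cb using b cG dG by (simp add: m_assoc)
    also have "d \<otimes> d [^] n = d [^] Suc n" using dG by (rule nat_pow_Suc2[symmetric])
    finally show ?case .
  qed (use cG in simp)
  from shift_c[of p] have "c \<otimes> d = d \<otimes> c" using dp cG by (simp add: rel(5)[symmetric])
  then have dc: "d \<otimes> c = c \<otimes> d" ..
  have shift_a: "a \<otimes> b [^] n = b [^] n \<otimes> (a \<otimes> c [^] n \<otimes> d [^] (n choose 2))" for n :: nat
  proof (induction n)
    case (Suc n)
    have cn: "c [^] n \<otimes> b = b \<otimes> (c [^] n \<otimes> d [^] n)"
      using conj_nat_pow[OF cG _ b cb, of n] pow_mult_distrib[OF dc[symmetric] cG dG, of n] cG dG by simp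
    have "a \<otimes> b [^] Suc n = (a \<otimes> b [^] n) \<otimes> b" using a b by (simp add: m_assoc)
    also have "\<dots> = b [^] n \<otimes> (a \<otimes> (c [^] n \<otimes> (d [^] (n choose 2) \<otimes> b)))"
      unfolding Suc using a b cG dG by (simp add: m_assoc)
    also have "\<dots> = b [^] n \<otimes> (a \<otimes> ((c [^] n \<otimes> b) \<otimes> d [^] (n choose 2)))"
      unfolding bd[symmetric] using a b cG dG by (simp add: m_assoc)
    also have "\<dots> = b [^] n \<otimes> ((a \<otimes> b) \<otimes> (c [^] n \<otimes> (d [^] n \<otimes> d [^] (n choose 2))))"
      unfolding cn using a b cG dG by (simp add: m_assoc)
    also have "\<dots> = b [^] Suc n \<otimes> (a \<otimes> (c \<otimes> c [^] n) \<otimes> (d [^] n \<otimes> d [^] (n choose 2)))"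
      unfolding ab using a b cG dG by (simp add: m_assoc)
    also have "c \<otimes> c [^] n = c [^] Suc n" using cG by (rule nat_pow_Suc2[symmetric])
    also have "d [^] n \<otimes> d [^] (n choose 2) = d [^] (Suc n choose 2)"
      using dG by (simp add: nat_pow_mult numeral_2_eq_2)
    finally show ?case .
  qed (use a in \<open>simp add: numeral_2_eq_2\<close>)
  have "int p dvd int (p choose 2)"
    using prime_dvd_tri[OF p(1)] by (simp add: e tri_of_nat)
  then obtain q where q: "p choose 2 = p * q" by (auto elim!: dvdE simp: int_dvd_int_iff)
  have "d [^] (p choose 2) = (d [^] p) [^] q" using dG by (simp add: q nat_pow_pow)
  then have da: "d \<otimes> a = a \<otimes> d"
    using shift_a[of p] a dG by (simp add: rel(3) rel(5)[symmetric] dp)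
  show ?thesis
    using p a b c d ca da dc db gen rel dp dG by unfold_locales (simp_all add: e power2_eq_square)
qed

text \<open>For \<open>p = 2\<close> both generators invert \<open>c\<close>, so their product
  centralises \<open>c\<close> and takes the role of \<open>a\<close>. The commutators become
  \<open>c^3\<close> and \<open>c^2\<close>, and \<open>(x y)^4 = x^4 y^4 c^2\<close> accounts for
  \<open>s + eps 2\<close>.\<close>

lemma class_three_p_2:
  assumes x: "x \<in> carrier G" and y: "y \<in> carrier G" and gen: "generate G {x, y} = carrier G"
    and c: "c = commutator G x y"
    and c4: "c [^] (4::nat) = \<one>" and cx: "commutator G c x = c [^] (2::nat)" and cy: "commutator G c y = c [^] (2::nat)"
    and xy4: "x [^] (4::nat) \<otimes> y [^] (4::nat) = (c [^] (2::nat)) [^] s"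
    and y2: "y [^] (2::nat) = (c [^] (2::nat)) [^] t"
  shows "class_three_p G (x \<otimes> y) y (commutator G (x \<otimes> y) y) (commutator G (commutator G (x \<otimes> y) y) y) 2 s t"
proof -
  have cG: "c \<in> carrier G" by (simp add: c x y is_group)
  have c4': "c \<otimes> (c \<otimes> (c \<otimes> c)) = \<one>" using c4 cG by (simp add: eval_nat_numeral m_assoc)
  have c4'': "c \<otimes> (c \<otimes> (c \<otimes> (c \<otimes> g))) = g" if "g \<in> carrier G" for g
  proof -
    have "c \<otimes> (c \<otimes> (c \<otimes> (c \<otimes> g))) = c \<otimes> (c \<otimes> (c \<otimes> c)) \<otimes> g" using that cG by (simp add: m_assoc)
    then show ?thesis using that by (simp add: c4')
  qed
  have rx: "c \<otimes> x = x \<otimes> (c \<otimes> (c \<otimes> c))"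
    using cx commutator_eq_iff[OF cG x, of "c [^] (2::nat)"] cG x by (simp add: eval_nat_numeral m_assoc)
  have ry: "c \<otimes> y = y \<otimes> (c \<otimes> (c \<otimes> c))"
    using cy commutator_eq_iff[OF cG y, of "c [^] (2::nat)"] cG y by (simp add: eval_nat_numeral m_assoc)
  have "x \<otimes> y = y \<otimes> x \<otimes> c" using commutator_eq_iff[OF x y cG] by (simp add: c)
  then have "x \<otimes> y \<otimes> (c \<otimes> (c \<otimes> c)) = y \<otimes> x \<otimes> (c \<otimes> (c \<otimes> (c \<otimes> c)))" using x y cG by (simp add: m_assoc)
  then have ryx: "y \<otimes> x = x \<otimes> (y \<otimes> (c \<otimes> (c \<otimes> c)))" using x y cG by (simp add: m_assoc c4')
  have rx': "c \<otimes> (x \<otimes> g) = x \<otimes> (c \<otimes> (c \<otimes> (c \<otimes> g)))" if "g \<in> carrier G" for g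
  proof -
    have "c \<otimes> (x \<otimes> g) = (c \<otimes> x) \<otimes> g" using that x cG by (simp add: m_assoc)
    then show ?thesis unfolding rx using that x cG by (simp add: m_assoc)
  qed
  have ry': "c \<otimes> (y \<otimes> g) = y \<otimes> (c \<otimes> (c \<otimes> (c \<otimes> g)))" if "g \<in> carrier G" for g
  proof -
    have "c \<otimes> (y \<otimes> g) = (c \<otimes> y) \<otimes> g" using that y cG by (simp add: m_assoc)
    then show ?thesis unfolding ry using that y cG by (simp add: m_assoc)
  qed
  have ryx': "y \<otimes> (x \<otimes> g) = x \<otimes> (y \<otimes> (c \<otimes> (c \<otimes> (c \<otimes> g))))" if "g \<in> carrier G" for g
  proof -
    have "y \<otimes> (x \<otimes> g) = (y \<otimes> x) \<otimes> g" using that x y by (simp add: m_assoc)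
    then show ?thesis unfolding ryx using that x y cG by (simp add: m_assoc)
  qed
  \<comment> \<open>A rewriting system that sorts every word into the order \<open>x\<close>,
    \<open>y\<close>, \<open>c\<close> and reduces the exponent of \<open>c\<close> modulo
    4.\<close>
  note collect = m_assoc rx ry ryx rx' ry' ryx' c4' c4'' x y cG
  let ?C = "c \<otimes> (c \<otimes> c)"
  have C: "commutator G (x \<otimes> y) y = ?C"
    by (subst commutator_eq_iff) (simp_all add: collect)
  have D: "commutator G ?C y = c \<otimes> c"
    by (subst commutator_eq_iff) (simp_all add: collect)
  have D': "c [^] (2::nat) = c \<otimes> c" using cG by (simp add: numeral_2_eq_2)
  have "x \<in> generate G {x \<otimes> y, y}"
  proof -
    have "subgroup (generate G {x \<otimes> y, y}) G" by (rule generate_is_subgroup) (simp add: x y)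
    moreover have "x \<otimes> y \<in> generate G {x \<otimes> y, y}" "y \<in> generate G {x \<otimes> y, y}" by (auto intro: generate.incl)
    ultimately have "(x \<otimes> y) \<otimes> inv y \<in> generate G {x \<otimes> y, y}"
      by (simp add: subgroup.m_closed subgroup.m_inv_closed)
    then show ?thesis using x y by (simp add: m_assoc)
  qed
  moreover have "y \<in> generate G {x \<otimes> y, y}" by (auto intro: generate.incl)
  ultimately have "generate G {x, y} \<subseteq> generate G {x \<otimes> y, y}"
    using generate_subgroup_incl[of "{x, y}" "generate G {x \<otimes> y, y}"] generate_is_subgroup[of "{x \<otimes> y, y}"] x y by simp
  then have gen': "generate G {x \<otimes> y, y} = carrier G"
    using gen generate_incl[of "{x \<otimes> y, y}"] x y by auto
  have "(x \<otimes> y) [^] (4::nat) = (x [^] (4::nat) \<otimes> y [^] (4::nat)) \<otimes> (c \<otimes> c)"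
    by (simp add: eval_nat_numeral collect)
  also have "\<dots> = (c \<otimes> c) [^] (s + 1)"
    unfolding xy4 D' using cG by (simp add: int_pow_mult)
  finally have a_pow: "(x \<otimes> y) [^] (4::nat) = (c \<otimes> c) [^] (s + 1)" .
  show ?thesis
    unfolding C D
  proof unfold_locales
    show "(x \<otimes> y) [^] (2 * 2 :: nat) = (c \<otimes> c) [^] (s + eps 2)" using a_pow by (simp add: eps_def)
    show "y [^] (2 :: nat) = (c \<otimes> c) [^] t" using y2 by (simp only: D')
    show "prime (2 :: nat)" by (rule two_is_prime_nat)
  qed (simp_all add: gen' C D eps_def collect numeral_2_eq_2)
qed

end

text \<open>In \<open>A4\<close> the relation \<open>d = a\<^bsup>\<nu>p^2\<^esup>\<close> means \<open>d = d\<^bsup>\<nu>s\<^esup>\<close>.\<close>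

fun params :: "nat \<Rightarrow> label \<Rightarrow> int \<Rightarrow> int \<Rightarrow> bool" where
  "params p A1 s t \<longleftrightarrow> p = 2 \<and> s = 0 \<and> t = 0"
| "params p A2 s t \<longleftrightarrow> p = 2 \<and> s = 0 \<and> t = 1"
| "params p A3 s t \<longleftrightarrow> p = 2 \<and> s = 1 \<and> t = 0"
| "params p (A4 \<nu>) s t \<longleftrightarrow> p \<noteq> 2 \<and> int p dvd int \<nu> * s - 1 \<and> t = 0"
| "params p A5 s t \<longleftrightarrow> p \<noteq> 2 \<and> s = 0 \<and> t = 1"
| "params p A6 s t \<longleftrightarrow> p \<noteq> 2 \<and> s = 0 \<and> t = 0"

text \<open>For \<open>p = 2\<close> the generators of the presentations are not adapted to the abelian maximal
  subgroup, which contains the product of the first two generators.\<close>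

fun base_a :: "('a, 'b) monoid_scheme \<Rightarrow> label \<Rightarrow> (letter \<Rightarrow> 'a) \<Rightarrow> 'a" where
  "base_a G A1 g = g La \<otimes>\<^bsub>G\<^esub> g Lb"
| "base_a G A2 g = g Lb \<otimes>\<^bsub>G\<^esub> g La"
| "base_a G A3 g = g La \<otimes>\<^bsub>G\<^esub> g Lb"
| "base_a G _ g = g La"

fun base_b :: "label \<Rightarrow> (letter \<Rightarrow> 'a) \<Rightarrow> 'a" where
  "base_b A2 g = g La"
| "base_b _ g = g Lb"

fun std_letter :: "(int \<Rightarrow> int \<Rightarrow> int \<Rightarrow> int \<Rightarrow> 'a) \<Rightarrow> letter \<Rightarrow> 'a" where
  "std_letter el La = el 0 1 0 0"
| "std_letter el Lb = el 1 0 0 0"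
| "std_letter el Lc = el 0 0 1 0"
| "std_letter el Ld = el 0 0 0 1"

text \<open>The substitution inverse to \<open>base_a\<close>, \<open>base_b\<close>: for
  \<open>p = 2\<close> the remaining letter is \<open>a b^(-1)\<close>, whose normal word is
  \<open>el (- 1) 1 (- 1) 1\<close>, since \<open>tri (- 1) = 1\<close>.\<close>

fun letter_el :: "(int \<Rightarrow> int \<Rightarrow> int \<Rightarrow> int \<Rightarrow> 'a) \<Rightarrow> label \<Rightarrow> letter \<Rightarrow> 'a" where
  "letter_el el A2 x = (case x of La \<Rightarrow> el 1 0 0 0 | Lb \<Rightarrow> el (- 1) 1 (- 1) 1 | _ \<Rightarrow> el 0 0 (- 1) 1)"
| "letter_el el A1 x = (case x of La \<Rightarrow> el (- 1) 1 (- 1) 1 | Lb \<Rightarrow> el 1 0 0 0 | _ \<Rightarrow> el 0 0 1 (- 1))"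
| "letter_el el A3 x = (case x of La \<Rightarrow> el (- 1) 1 (- 1) 1 | Lb \<Rightarrow> el 1 0 0 0 | _ \<Rightarrow> el 0 0 1 (- 1))"
| "letter_el el _ x = std_letter el x"

lemma satisfiesD:
  assumes "satisfies p L G g" "(u, v) \<in> relations p L G g"
  shows "u = v"
proof -
  have "\<forall>(u, v) \<in> relations p L G g. u = v" using assms(1) by (simp add: satisfies_def)
  with assms(2) show ?thesis by (rule Ball_case_prodD)
qed

lemma generate_three:
  assumes "group G" "x \<in> carrier G" "y \<in> carrier G"
  shows "generate G {x, y, commutator G x y} = generate G {x, y}"
    and "generate G {x, y, commutator G x y, commutator G (commutator G x y) y} = generate G {x, y}"
proof -
  interpret group G by fact
  let ?K = "generate G {x, y}"
  have K: "subgroup ?K G" by (rule generate_is_subgroup) (use assms in simp)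
  have xy: "x \<in> ?K" "y \<in> ?K" by (auto intro: generate.incl)
  have comm: "commutator G u v \<in> ?K" if "u \<in> ?K" "v \<in> ?K" for u v
    unfolding commutator_def using that
    by (intro subgroup.m_closed[OF K] subgroup.m_inv_closed[OF K])
  have c: "commutator G x y \<in> ?K" "commutator G (commutator G x y) y \<in> ?K" using xy comm by blast+
  show "generate G {x, y, commutator G x y} = ?K"
    using c xy generate_subgroup_incl[OF _ K] mono_generate[of "{x, y}"] by (intro antisym) auto
  show "generate G {x, y, commutator G x y, commutator G (commutator G x y) y} = ?K"
    using c xy generate_subgroup_incl[OF _ K] mono_generate[of "{x, y}"] by (intro antisym) auto
qed

lemma class_three_p_of_satisfies:
  assumes G: "group G" and p: "prime p" and par: "params p L s t" and sat: "satisfies p L G g"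
    and gen: "generate G (g ` alphabet L) = carrier G"
  shows "class_three_p G (base_a G L g) (base_b L g)
    (commutator G (base_a G L g) (base_b L g))
    (commutator G (commutator G (base_a G L g) (base_b L g)) (base_b L g)) p s t"
proof -
  interpret group G by fact
  have cl: "g La \<in> carrier G" "g Lb \<in> carrier G"
    using sat unfolding satisfies_def by (cases L; simp)+
  note rel = satisfiesD[OF sat]
  have c: "commutator G (g La) (g Lb) = g Lc" by (rule rel) (cases L; simp add: Let_def)
  have alph: "g ` alphabet L = (if L = A6 then {g La, g Lb, g Lc, g Ld} else {g La, g Lb, g Lc})"
    by (cases L) auto
  have gen: "generate G {g La, g Lb} = carrier G"
  proof (cases "L = A6")
    case True
    have "commutator G (g Lc) (g Lb) = g Ld" by (rule rel) (simp add: True Let_def)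
    then show ?thesis using gen generate_three(2)[OF G cl] alph True c by simp
  next
    case False
    then show ?thesis using gen generate_three(1)[OF G cl] alph c by simp
  qed
  then have gen': "generate G {g Lb, g La} = carrier G" by (simp add: insert_commute)
  show ?thesis
  proof (cases L)
    case L: A1
    have r: "g La [^]\<^bsub>G\<^esub> (4::nat) = \<one>\<^bsub>G\<^esub>" "g Lb [^]\<^bsub>G\<^esub> (2::nat) = \<one>\<^bsub>G\<^esub>" "g Lc [^]\<^bsub>G\<^esub> (4::nat) = \<one>\<^bsub>G\<^esub>"
      "commutator G (g Lc) (g La) = g Lc [^]\<^bsub>G\<^esub> (2::nat)" "commutator G (g Lc) (g Lb) = g Lc [^]\<^bsub>G\<^esub> (2::nat)"
      by (rule rel; simp add: L Let_def)+
    have "(g Lb [^]\<^bsub>G\<^esub> (2::nat)) [^]\<^bsub>G\<^esub> (2::nat) = g Lb [^]\<^bsub>G\<^esub> (4::nat)" using cl by (simp add: nat_pow_pow)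
    then have "g Lb [^]\<^bsub>G\<^esub> (4::nat) = \<one>\<^bsub>G\<^esub>" by (simp add: r)
    then show ?thesis
      using class_three_p_2[OF cl gen c[symmetric], of s t] r par L by simp
  next
    case L: A3
    have r: "g La [^]\<^bsub>G\<^esub> (8::nat) = \<one>\<^bsub>G\<^esub>" "g Lb [^]\<^bsub>G\<^esub> (2::nat) = \<one>\<^bsub>G\<^esub>" "g Lc [^]\<^bsub>G\<^esub> (2::nat) = g La [^]\<^bsub>G\<^esub> (4::nat)"
      "commutator G (g Lc) (g La) = g Lc [^]\<^bsub>G\<^esub> (2::nat)" "commutator G (g Lc) (g Lb) = g Lc [^]\<^bsub>G\<^esub> (2::nat)"
      by (rule rel; simp add: L Let_def)+
    have "(g Lb [^]\<^bsub>G\<^esub> (2::nat)) [^]\<^bsub>G\<^esub> (2::nat) = g Lb [^]\<^bsub>G\<^esub> (4::nat)" using cl by (simp add: nat_pow_pow)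
    then have b: "g Lb [^]\<^bsub>G\<^esub> (4::nat) = \<one>\<^bsub>G\<^esub>" by (simp add: r)
    have cG: "g Lc \<in> carrier G" using c cl by (metis commutator_closed G)
    have "g Lc [^]\<^bsub>G\<^esub> (4::nat) = (g La [^]\<^bsub>G\<^esub> (4::nat)) [^]\<^bsub>G\<^esub> (2::nat)"
      using cG by (simp add: r(3)[symmetric] nat_pow_pow)
    also have "\<dots> = \<one>\<^bsub>G\<^esub>" using cl r(1) by (simp add: nat_pow_pow)
    finally have "g Lc [^]\<^bsub>G\<^esub> (4::nat) = \<one>\<^bsub>G\<^esub>" .
    then show ?thesis
      using class_three_p_2[OF cl gen c[symmetric], of s t] r b par L cl by simp
  next
    case L: A2
    have r: "g La [^]\<^bsub>G\<^esub> (4::nat) = \<one>\<^bsub>G\<^esub>" "g Lb [^]\<^bsub>G\<^esub> (4::nat) = \<one>\<^bsub>G\<^esub>" "g Lc [^]\<^bsub>G\<^esub> (2::nat) = g La [^]\<^bsub>G\<^esub> (2::nat)"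
      "commutator G (g Lc) (g La) = g Lc [^]\<^bsub>G\<^esub> (2::nat)" "commutator G (g Lc) (g Lb) = g Lc [^]\<^bsub>G\<^esub> (2::nat)"
      by (rule rel; simp add: L Let_def)+
    have cG: "g Lc \<in> carrier G" using c cl by (metis commutator_closed G)
    have "g Lc [^]\<^bsub>G\<^esub> (4::nat) = (g La [^]\<^bsub>G\<^esub> (2::nat)) [^]\<^bsub>G\<^esub> (2::nat)"
      using cG by (simp add: r(3)[symmetric] nat_pow_pow)
    also have "\<dots> = \<one>\<^bsub>G\<^esub>" using cl r(1) by (simp add: nat_pow_pow)
    finally have c4: "g Lc [^]\<^bsub>G\<^esub> (4::nat) = \<one>\<^bsub>G\<^esub>" .
    \<comment> \<open>In this presentation the two generators exchange roles, so the commutator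
      becomes the inverse of the listed one, and the relations must be transferred to it.\<close>
    let ?c = "commutator G (g Lb) (g La)"
    have inv: "?c = inv\<^bsub>G\<^esub> g Lc" using cl unfolding c[symmetric] by (simp add: commutator_def inv_mult_group m_assoc)
    have inv2: "(inv\<^bsub>G\<^esub> g Lc) [^]\<^bsub>G\<^esub> (2::nat) = g Lc [^]\<^bsub>G\<^esub> (2::nat)"
    proof -
      have "g Lc [^]\<^bsub>G\<^esub> (2::nat) \<otimes>\<^bsub>G\<^esub> g Lc [^]\<^bsub>G\<^esub> (2::nat) = \<one>\<^bsub>G\<^esub>" using c4 cG by (simp add: nat_pow_mult)
      then have "inv\<^bsub>G\<^esub> (g Lc [^]\<^bsub>G\<^esub> (2::nat)) = g Lc [^]\<^bsub>G\<^esub> (2::nat)" using cG by (simp add: inv_equality)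
      then show ?thesis using cG by (simp add: nat_pow_inv)
    qed
    have inv_comm: "commutator G (inv\<^bsub>G\<^esub> g Lc) x = (inv\<^bsub>G\<^esub> g Lc) [^]\<^bsub>G\<^esub> (2::nat)"
      if x: "x \<in> carrier G" "commutator G (g Lc) x = g Lc [^]\<^bsub>G\<^esub> (2::nat)" for x
    proof -
      have "g Lc \<otimes>\<^bsub>G\<^esub> x = x \<otimes>\<^bsub>G\<^esub> (g Lc \<otimes>\<^bsub>G\<^esub> g Lc [^]\<^bsub>G\<^esub> (2::nat))"
        using x commutator_eq_iff[OF cG x(1), of "g Lc [^]\<^bsub>G\<^esub> (2::nat)"] cG by (simp add: m_assoc)
      also have "g Lc \<otimes>\<^bsub>G\<^esub> g Lc [^]\<^bsub>G\<^esub> (2::nat) = inv\<^bsub>G\<^esub> g Lc"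
      proof (rule inv_equality[symmetric])
        have "g Lc \<otimes>\<^bsub>G\<^esub> g Lc [^]\<^bsub>G\<^esub> (2::nat) \<otimes>\<^bsub>G\<^esub> g Lc = g Lc [^]\<^bsub>G\<^esub> (4::nat)"
          using cG by (simp add: eval_nat_numeral m_assoc)
        then show "g Lc \<otimes>\<^bsub>G\<^esub> g Lc [^]\<^bsub>G\<^esub> (2::nat) \<otimes>\<^bsub>G\<^esub> g Lc = \<one>\<^bsub>G\<^esub>" by (simp add: c4)
      qed (use cG in auto)
      finally have cx: "g Lc \<otimes>\<^bsub>G\<^esub> x = x \<otimes>\<^bsub>G\<^esub> inv\<^bsub>G\<^esub> g Lc" .
      have "inv\<^bsub>G\<^esub> g Lc \<otimes>\<^bsub>G\<^esub> x = x \<otimes>\<^bsub>G\<^esub> g Lc"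
        using conj_int_pow[OF cG _ x(1) cx, of "- 1"] cG by (simp add: int_pow_neg)
      moreover have "inv\<^bsub>G\<^esub> g Lc \<otimes>\<^bsub>G\<^esub> g Lc [^]\<^bsub>G\<^esub> (2::nat) = g Lc"
        using cG by (simp add: m_assoc[symmetric] numeral_2_eq_2)
      ultimately have "inv\<^bsub>G\<^esub> g Lc \<otimes>\<^bsub>G\<^esub> x = x \<otimes>\<^bsub>G\<^esub> inv\<^bsub>G\<^esub> g Lc \<otimes>\<^bsub>G\<^esub> g Lc [^]\<^bsub>G\<^esub> (2::nat)"
        using x(1) cG by (simp only: m_assoc inv_closed nat_pow_closed)
      then show ?thesis
        using x(1) cG commutator_eq_iff[of "inv\<^bsub>G\<^esub> g Lc" x "g Lc [^]\<^bsub>G\<^esub> (2::nat)"] unfolding inv2 by simp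
    qed
    have c4': "?c [^]\<^bsub>G\<^esub> (4::nat) = \<one>\<^bsub>G\<^esub>" unfolding inv using cG c4 by (simp add: nat_pow_inv)
    have c': "commutator G ?c (g Lb) = ?c [^]\<^bsub>G\<^esub> (2::nat)" "commutator G ?c (g La) = ?c [^]\<^bsub>G\<^esub> (2::nat)"
      unfolding inv by (rule inv_comm; simp add: r cl)+
    have st: "p = 2" "s = 0" "t = 1" using par L by auto
    have "g Lb [^]\<^bsub>G\<^esub> (4::nat) \<otimes>\<^bsub>G\<^esub> g La [^]\<^bsub>G\<^esub> (4::nat) = (?c [^]\<^bsub>G\<^esub> (2::nat)) [^]\<^bsub>G\<^esub> s"
      by (simp only: r st) simp
    moreover have "g La [^]\<^bsub>G\<^esub> (2::nat) = (?c [^]\<^bsub>G\<^esub> (2::nat)) [^]\<^bsub>G\<^esub> t"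
      using cl by (simp add: inv inv2 r(3) st)
    ultimately show ?thesis
      using class_three_p_2[OF cl(2,1) gen' refl c4' c'] by (simp only: L st base_a.simps base_b.simps)
  next
    case L: (A4 \<nu>)
    have r: "g La [^]\<^bsub>G\<^esub> (p ^ 3) = \<one>\<^bsub>G\<^esub>" "g Lb [^]\<^bsub>G\<^esub> p = \<one>\<^bsub>G\<^esub>" "g Lc [^]\<^bsub>G\<^esub> p = \<one>\<^bsub>G\<^esub>"
      "commutator G (g Lc) (g La) = \<one>\<^bsub>G\<^esub>" "commutator G (g Lc) (g Lb) = g La [^]\<^bsub>G\<^esub> (\<nu> * p ^ 2)"
      by (rule rel; simp add: L Let_def)+
    show ?thesis
      using class_three_p_A4[OF p _ cl gen c[symmetric] refl r] par L by (simp add: c)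
  next
    case L: A5
    have r: "g La [^]\<^bsub>G\<^esub> (p ^ 2) = \<one>\<^bsub>G\<^esub>" "g Lb [^]\<^bsub>G\<^esub> (p ^ 2) = \<one>\<^bsub>G\<^esub>" "g Lc [^]\<^bsub>G\<^esub> p = \<one>\<^bsub>G\<^esub>"
      "commutator G (g Lc) (g La) = \<one>\<^bsub>G\<^esub>" "commutator G (g Lc) (g Lb) = g Lb [^]\<^bsub>G\<^esub> p"
      by (rule rel; simp add: L Let_def)+
    show ?thesis
      using class_three_p_A5[OF p _ cl gen c[symmetric] refl r] par L by (simp add: c)
  next
    case L: A6
    have r: "g La [^]\<^bsub>G\<^esub> (p ^ 2) = \<one>\<^bsub>G\<^esub>" "g Lb [^]\<^bsub>G\<^esub> p = \<one>\<^bsub>G\<^esub>" "g Lc [^]\<^bsub>G\<^esub> p = \<one>\<^bsub>G\<^esub>"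
      "g Ld [^]\<^bsub>G\<^esub> p = \<one>\<^bsub>G\<^esub>" "commutator G (g Lc) (g La) = \<one>\<^bsub>G\<^esub>"
      "commutator G (g Ld) (g La) = \<one>\<^bsub>G\<^esub>" "commutator G (g Ld) (g Lb) = \<one>\<^bsub>G\<^esub>"
      by (rule rel; simp add: L Let_def)+
    have "commutator G (g Lc) (g Lb) = g Ld" by (rule rel) (simp add: L Let_def)
    then show ?thesis
      using class_three_p_A6[OF p _ cl gen c[symmetric] _ r] par L by (simp add: c)
  qed
qed

section \<open>Verification of the listed relations in the model\<close>

lemma relN_iff:
  assumes "p > 0"
  shows "(n, i, j, k) \<in> relN p s t \<longleftrightarrow> int p dvd n \<and> int p * int p dvd i \<and> int p dvd j \<and>
    int p dvd k + (i div (int p * int p)) * (s + eps p) + (j div int p) * eps p + t * (n div int p)"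
proof
  assume "(n, i, j, k) \<in> relN p s t"
  then show "int p dvd n \<and> int p * int p dvd i \<and> int p dvd j \<and>
    int p dvd k + (i div (int p * int p)) * (s + eps p) + (j div int p) * eps p + t * (n div int p)"
    using assms by (auto elim!: relN_E)
next
  assume *: "int p dvd n \<and> int p * int p dvd i \<and> int p dvd j \<and>
    int p dvd k + (i div (int p * int p)) * (s + eps p) + (j div int p) * eps p + t * (n div int p)"
  then have "(int p * (n div int p), int p * int p * (i div (int p * int p)), int p * (j div int p), k) \<in> relN p s t"
    by (intro relN_I) simp
  then show "(n, i, j, k) \<in> relN p s t" using * by simp
qed

context p_cover
begin

text \<open>With divisions in place of existential witnesses, equality of concrete words can be
  evaluated; this settles the relations for \<open>p = 2\<close>.\<close>

lemma el_eq_iff_2: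
  assumes "p = 2"
  shows "el n i j k = el n' i' j' k' \<longleftrightarrow> (let n'' = n' - n; i'' = i' - i; j'' = j' - j - n'' * i;
      k'' = k' - k - n'' * j - tri n'' * i in
    even n'' \<and> 4 dvd i'' \<and> even j'' \<and> even (k'' + (i'' div 4) * (s + 1) + j'' div 2 + t * (n'' div 2)))"
  unfolding el_eq_iff using assms relN_iff[of 2] by (simp add: Let_def eps_def)

lemma satisfies_letter_el:
  assumes par: "params p L s t"
  shows "satisfies p L G (letter_el el L)"
proof -
  have cl: "\<forall>x \<in> alphabet L. letter_el el L x \<in> carrier G"
    by (cases L) auto
  show ?thesis
  proof (cases "p = 2")
    case p: True
    have "(2::nat) choose 3 = 0" "(4::nat) choose 3 = 4" "(8::nat) choose 3 = 56"
      by (simp_all add: eval_nat_numeral)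
    then show ?thesis using par cl p unfolding satisfies_def
      by (cases L) (simp_all add: Let_def el_nat_pow commutator_el one_eq_el el_eq_iff_2[OF p] tri_def)
  next
    case p: False
    then have e: "eps p = 0" by (simp add: eps_def)
    have I: "el 0 (int p * int p * u) 0 0 = el 0 0 0 (u * s)" for u
      using el_add_i[of 0 0 u 0 0] by (simp add: e)
    have J: "el 0 0 (int p) 0 = el 0 0 0 0" using el_add_j[of 0 0 0 1 0] by (simp add: e)
    have K: "int p dvd k' - k \<Longrightarrow> el n i j k' = el n i j k" for n i j k k' by (rule el_add_k)
    have N: "el (int p) 0 0 0 = el 0 0 0 t" using el_p_n[of 1 0 0 0] by simp
    have N2: "el (int p * int p) 0 0 0 = el 0 0 0 0"
      using el_p_n[of "int p" 0 0 0] K[of "t * int p" 0 0 0 0] by simp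
    have K0: "el 0 0 0 (int p * k) = el 0 0 0 0" for k by (rule K) simp
    show ?thesis
    proof (cases L)
      case L: (A4 \<nu>)
      have 3: "el 0 (int p ^ 3) 0 0 = el 0 0 0 0"
        using I[of "int p"] K0 by (simp add: power3_eq_cube)
      have 4: "el 0 (int \<nu> * int p ^ 2) 0 0 = el 0 0 0 1"
      proof -
        have "el 0 (int \<nu> * int p ^ 2) 0 0 = el 0 0 0 (int \<nu> * s)"
          using I[of "int \<nu>"] by (simp add: power2_eq_square mult_ac)
        also have "\<dots> = el 0 0 0 1" by (rule K) (use par L in simp)
        finally show ?thesis .
      qed
      show ?thesis using par cl L unfolding satisfies_def
        by (simp add: Let_def el_nat_pow commutator_el one_eq_el J N 3 4)
    next
      case L: A5
      have 2: "el 0 (int p ^ 2) 0 0 = el 0 0 0 0" using I[of 1] par L by (simp add: power2_eq_square)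
      have 3: "el (int p ^ 2) 0 0 0 = el 0 0 0 0" using N2 by (simp add: power2_eq_square)
      show ?thesis using par cl L unfolding satisfies_def
        by (simp add: Let_def el_nat_pow commutator_el one_eq_el J N 2 3)
    next
      case L: A6
      have 2: "el 0 (int p ^ 2) 0 0 = el 0 0 0 0" using I[of 1] par L by (simp add: power2_eq_square)
      show ?thesis using par cl L unfolding satisfies_def
        using K0[of 1] by (simp add: Let_def el_nat_pow commutator_el one_eq_el J N 2)
    qed (use p par in auto)
  qed
qed

lemma base_letter_el:
  "base_a G L (letter_el el L) = el 0 1 0 0" "base_b L (letter_el el L) = el 1 0 0 0"
  by (cases L; simp add: el_mult)+

end

lemma hom_base:
  assumes "group G" "group H" "h \<in> hom G H" "\<And>x. x \<in> alphabet L \<Longrightarrow> g x \<in> carrier G"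
    "\<And>x. x \<in> alphabet L \<Longrightarrow> h (g x) = f x"
  shows "h (base_a G L g) = base_a H L f" "h (base_b L g) = base_b L f"
proof -
  have "g La \<in> carrier G" "g Lb \<in> carrier G" "h (g La) = f La" "h (g Lb) = f Lb"
    using assms(4,5) by (cases L; simp)+
  then show "h (base_a G L g) = base_a H L f" "h (base_b L g) = base_b L f"
    using assms(3) by (cases L; simp add: hom_mult)+
qed

text \<open>The relations of the presentation show that the words in \<open>relN\<close> vanish.
  Conversely the model satisfies the relations, so the presented group maps to it, and a word that
  vanishes in the presented group vanishes in the model. Together the kernel is exactly
  \<open>relN\<close>.\<close>

lemma p_cover_listed_group:
  assumes p: "prime p" and par: "params p L s t"
  obtains el where "p_cover (listed_group p L) p s t el"
    "\<And>x. x \<in> alphabet L \<Longrightarrow> listed_gen p L x = letter_el el L x"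
proof -
  define P where "P = listed_group p L"
  define g where "g = listed_gen p L"
  define a where "a = base_a P L g"
  define b where "b = base_b L g"
  have sat: "satisfies p L P g" unfolding P_def g_def by (rule satisfies_listed_gen)
  interpret P: group P unfolding P_def by (rule group_listed_group)
  interpret C: class_three_p P a b "commutator P a b" "commutator P (commutator P a b) b" p s t
    unfolding a_def b_def
    by (rule class_three_p_of_satisfies[OF P.is_group p par sat])
      (simp add: P_def g_def generate_listed_gen)
  interpret M: p_cover "model p s t" p s t "model_el p s t" by (rule p_cover_model[OF p])
  obtain h where h: "h \<in> hom P (model p s t)"
    "\<And>x. x \<in> alphabet L \<Longrightarrow> h (g x) = letter_el (model_el p s t) L x"
    using listed_group_universal[OF M.is_group M.satisfies_letter_el[OF par]]
    unfolding P_def g_def by blast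
  have gcl: "g x \<in> carrier P" if "x \<in> alphabet L" for x
    using that unfolding g_def P_def by (rule listed_gen_closed)
  \<comment> \<open>Matching the two base generators is enough, since normal words are built from
    them alone.\<close>
  have hab: "h a = model_el p s t 0 1 0 0" "h b = model_el p s t 1 0 0 0"
    using hom_base[OF P.is_group M.is_group h(1) gcl h(2)] by (simp_all add: a_def b_def M.base_letter_el)
  have cov: "p_cover P p s t (P.normal_word a b)"
  proof (rule C.p_cover_of_kernel)
    fix n i j k assume "P.normal_word a b n i j k = \<one>\<^bsub>P\<^esub>"
    then have "h (P.normal_word a b n i j k) = \<one>\<^bsub>model p s t\<^esub>"
      using hom_one[OF h(1) P.is_group M.is_group] by simp
    then have "model_el p s t n i j k = \<one>\<^bsub>model p s t\<^esub>"
      using hom_normal_word[OF P.is_group M.is_group h(1) C.a C.b] by (simp add: hab M.normal_word_el)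
    then show "(n, i, j, k) \<in> relN p s t" by (simp add: M.el_one_iff)
  qed
  interpret Q: p_cover P p s t "P.normal_word a b" by (rule cov)
  note rel = satisfiesD[OF sat]
  have cl: "g La \<in> carrier P" "g Lb \<in> carrier P" by (rule gcl; cases L; simp)+
  have c: "g Lc = commutator P (g La) (g Lb)" by (rule rel[symmetric]) (cases L; simp add: Let_def)
  have ab: "a = P.normal_word a b 0 1 0 0" "b = P.normal_word a b 1 0 0 0"
    by (simp_all add: C.normal_word_gens)
  have letters: "g La = letter_el (P.normal_word a b) L La \<and> g Lb = letter_el (P.normal_word a b) L Lb"
  proof (cases "p = 2")
    case True
    \<comment> \<open>The letter that is not a base generator is recovered as
      \<open>a b^(-1)\<close>.\<close>
    have "P.normal_word a b 0 1 0 0 \<otimes>\<^bsub>P\<^esub> inv\<^bsub>P\<^esub> P.normal_word a b 1 0 0 0 = P.normal_word a b (- 1) 1 (- 1) 1"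
      by (simp add: Q.inv_el Q.el_mult tri_def)
    then have "P.normal_word a b (- 1) 1 (- 1) 1 = a \<otimes>\<^bsub>P\<^esub> inv\<^bsub>P\<^esub> b"
      by (simp only: C.normal_word_gens)
    note w = this C.normal_word_gens(1)
    show ?thesis
      using par True cl
      by (cases L) (simp_all add: w, simp_all add: a_def b_def P.m_assoc)
  next
    case False
    note w = C.normal_word_gens(1,2)
    show ?thesis
      using False par cl by (cases L) (simp_all add: w, simp_all add: a_def b_def)
  qed
  have lc: "g Lc = letter_el (P.normal_word a b) L Lc"
    unfolding c using letters by (cases L) (simp_all add: Q.commutator_el tri_def)
  have ld: "g Ld = letter_el (P.normal_word a b) L Ld" if "L = A6"
  proof -
    have "g Ld = commutator P (g Lc) (g Lb)" by (rule rel[symmetric]) (simp add: that Let_def)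
    then show ?thesis using letters lc that by (simp add: Q.commutator_el)
  qed
  have "g x = letter_el (P.normal_word a b) L x" if "x \<in> alphabet L" for x
    using that letters lc ld by (cases L; cases x) auto
  with cov that show ?thesis unfolding P_def g_def by blast
qed

section \<open>Structure of the listed groups\<close>

context p_cover
begin

lemma generate_eqI:
  assumes "subgroup K G" "S \<subseteq> K" "\<And>H. subgroup H G \<Longrightarrow> S \<subseteq> H \<Longrightarrow> K \<subseteq> H"
  shows "K = generate G S"
proof
  have "S \<subseteq> carrier G" using assms(2) subgroup.subset[OF assms(1)] by blast
  then show "K \<subseteq> generate G S"
    using assms(3)[of "generate G S"] generate_is_subgroup generate.incl[of _ S G] by blast
  show "generate G S \<subseteq> K" by (rule generate_subgroup_incl[OF assms(2,1)])
qed

lemma subgroup_d_of_c: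
  assumes p: "p = 2" and H: "subgroup H G" and c: "el 0 0 1 k \<in> H"
  shows "el 0 0 0 1 \<in> H"
proof -
  have "el 0 0 1 k \<otimes> el 0 0 1 k \<in> H" using c by (intro subgroup.m_closed[OF H])
  then have "el 0 0 (0 + 2 * 1) (2 * k) \<in> H" by (simp add: el_mult)
  then have "el 0 0 0 (2 * k + 1) \<in> H" unfolding el_shift_2[OF p] .
  then show ?thesis by (rule subgroup_el_k[OF H]) (simp add: p)
qed

lemma el_0_0_frat: "el 0 0 j k \<in> frat"
proof -
  have "el 0 (int p * 0) j k \<in> frat" unfolding frat_def by blast
  then show ?thesis by simp
qed

text \<open>The exponents \<open>k\<close>, \<open>l\<close> are free because the listed letters
  involve various powers of \<open>d\<close>, and these do no harm: any \<open>c d^l\<close> squares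
  to \<open>d\<close>, and for odd \<open>s\<close> so does any \<open>z d^k\<close>.\<close>

lemma structure_2:
  assumes p: "p = 2"
  shows "frattini G = generate G {el 0 2 (- 1) k, el 0 0 1 l}"
    and "derived_subgroup G = generate G {el 0 0 1 l}"
    and "group_center G = generate G {el 0 2 (- 1) k, el 0 0 0 1}"
    and "odd s \<Longrightarrow> group_center G = generate G {el 0 2 (- 1) k}"
proof -
  have e: "eps p = 1" using p by (simp add: eps_def)
  have zf: "el 0 2 (- 1) k \<in> frat" using zp_in_frat[of "- 1" k] p by simp
  have cd: "el 0 0 1 l \<in> derv" "el 0 0 1 l \<in> frat"
    unfolding derv_def using el_0_0_frat by blast+
  have "el 0 (int p * 1) (- 1 * eps p) k \<in> cent" unfolding cent_def by blast
  then have zc: "el 0 2 (- 1) k \<in> cent" using p e by simp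
  have "el 0 (int p * 0) (- 0 * eps p) 1 \<in> cent" unfolding cent_def by blast
  then have dc: "el 0 0 0 1 \<in> cent" by simp
  show "frattini G = generate G {el 0 2 (- 1) k, el 0 0 1 l}"
    unfolding frattini_eq
  proof (rule generate_eqI[OF subgroup_frat])
    fix H assume H: "subgroup H G" "{el 0 2 (- 1) k, el 0 0 1 l} \<subseteq> H"
    then show "frat \<subseteq> H"
      using subgroup_d_of_c[OF p H(1)] p by (intro frat_subset[OF H(1)]) auto
  qed (use zf cd in auto)
  show "derived_subgroup G = generate G {el 0 0 1 l}"
    unfolding derived_eq
  proof (rule generate_eqI[OF subgroup_derv])
    fix H assume H: "subgroup H G" "{el 0 0 1 l} \<subseteq> H"
    then show "derv \<subseteq> H"
      using subgroup_d_of_c[OF p H(1)] by (intro derv_subset[OF H(1)]) auto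
  qed (use cd in auto)
  show "group_center G = generate G {el 0 2 (- 1) k, el 0 0 0 1}"
    unfolding group_center_eq
  proof (rule generate_eqI[OF subgroup_cent])
    fix H assume H: "subgroup H G" "{el 0 2 (- 1) k, el 0 0 0 1} \<subseteq> H"
    then show "cent \<subseteq> H" using p e by (intro cent_subset[OF H(1)]) auto
  qed (use zc dc in auto)
  show "group_center G = generate G {el 0 2 (- 1) k}" if s: "odd s"
    unfolding group_center_eq
  proof (rule generate_eqI[OF subgroup_cent])
    fix H assume H: "subgroup H G" "{el 0 2 (- 1) k} \<subseteq> H"
    have "el 0 2 (- 1) k \<otimes> el 0 2 (- 1) k \<in> H" using H by (intro subgroup.m_closed[OF H(1)]) auto
    then have "el 0 (0 + int p * int p * 1) (0 + 2 * (- 1)) (2 * k) \<in> H" by (simp add: el_mult p)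
    then have "el 0 0 0 (2 * k + s) \<in> H" unfolding el_shift_2[OF p] el_add_i by (simp add: e)
    then have "el 0 0 0 1 \<in> H" by (rule subgroup_el_k[OF H(1)]) (use s p in simp)
    then show "cent \<subseteq> H" using H p e by (intro cent_subset[OF H(1)]) auto
  qed (use zc in auto)
qed

lemma structure_odd:
  assumes p: "p \<noteq> 2"
  shows "frattini G = generate G {el 0 (int p) 0 0, el 0 0 0 1, el 0 0 1 0}"
    and "derived_subgroup G = generate G {el 0 0 0 1, el 0 0 1 0}"
    and "group_center G = generate G {el 0 (int p) 0 0, el 0 0 0 1}"
    and "\<not> int p dvd s \<Longrightarrow> frattini G = generate G {el 0 (int p) 0 0, el 0 0 1 0}"
    and "\<not> int p dvd s \<Longrightarrow> derived_subgroup G = generate G {el 0 (int p * int p) 0 0, el 0 0 1 0}"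
    and "\<not> int p dvd s \<Longrightarrow> group_center G = generate G {el 0 (int p) 0 0}"
proof -
  have e: "eps p = 0" using p by (simp add: eps_def)
  have zf: "el 0 (int p) 0 0 \<in> frat" by (rule zp_in_frat)
  have zc: "el 0 (int p) 0 0 \<in> cent" using z_in_cent e by simp
  have "el 0 (int p * 0) (- 0 * eps p) 1 \<in> cent" unfolding cent_def by blast
  then have dc: "el 0 0 0 1 \<in> cent" by simp
  have dd: "el 0 0 0 1 \<in> derv" "el 0 0 0 1 \<in> frat" "el 0 0 1 0 \<in> derv" "el 0 0 1 0 \<in> frat"
    unfolding derv_def using el_0_0_frat by blast+
  have sq: "el 0 (int p * int p) 0 0 = el 0 0 0 s" using el_add_i[of 0 0 1 0 0] by (simp add: e)
  have d: "el 0 0 0 1 \<in> H" if "\<not> int p dvd s" "subgroup H G" "el 0 (int p * int p) 0 0 \<in> H" for H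
    using subgroup_el_k[OF that(2) that(3)[unfolded sq] that(1)] .
  have d': "el 0 0 0 1 \<in> H" if "\<not> int p dvd s" "subgroup H G" "el 0 (int p) 0 0 \<in> H" for H
  proof (rule d[OF that(1,2)])
    have "el 0 (int p) 0 0 [^] (int p) \<in> H" by (rule subgroup_int_pow_closed[OF that(2,3)])
    then show "el 0 (int p * int p) 0 0 \<in> H" by (simp add: el_0_int_pow)
  qed
  have frat: "frat \<subseteq> H" if "subgroup H G" "el 0 (int p) 0 0 \<in> H" "el 0 0 1 0 \<in> H" "el 0 0 0 1 \<in> H" for H
    using that by (intro frat_subset)
  have cent: "cent \<subseteq> H" if "subgroup H G" "el 0 (int p) 0 0 \<in> H" "el 0 0 0 1 \<in> H" for H
    using that e by (intro cent_subset) auto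
  show "frattini G = generate G {el 0 (int p) 0 0, el 0 0 0 1, el 0 0 1 0}"
    unfolding frattini_eq by (rule generate_eqI[OF subgroup_frat]) (use zf dd frat in auto)
  show "derived_subgroup G = generate G {el 0 0 0 1, el 0 0 1 0}"
    unfolding derived_eq by (rule generate_eqI[OF subgroup_derv]) (use dd derv_subset in auto)
  show "group_center G = generate G {el 0 (int p) 0 0, el 0 0 0 1}"
    unfolding group_center_eq by (rule generate_eqI[OF subgroup_cent]) (use zc dc cent in auto)
  assume s: "\<not> int p dvd s"
  show "frattini G = generate G {el 0 (int p) 0 0, el 0 0 1 0}"
    unfolding frattini_eq by (rule generate_eqI[OF subgroup_frat]) (use zf dd frat d'[OF s] in auto)
  show "derived_subgroup G = generate G {el 0 (int p * int p) 0 0, el 0 0 1 0}"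
    unfolding derived_eq
  proof (rule generate_eqI[OF subgroup_derv])
    show "{el 0 (int p * int p) 0 0, el 0 0 1 0} \<subseteq> derv" using dd unfolding sq derv_def by blast
  qed (use derv_subset d[OF s] in auto)
  show "group_center G = generate G {el 0 (int p) 0 0}"
    unfolding group_center_eq by (rule generate_eqI[OF subgroup_cent]) (use zc cent d'[OF s] in auto)
qed

lemma letter_facts_2:
  assumes p: "p = 2"
  shows "el (- 1) 1 (- 1) 1 [^] (2::nat) = el 0 2 (- 1) (1 - t)"
    "el 0 0 (- 1) 1 = el 0 0 1 0" "el 0 0 1 (- 1) [^] (2::nat) = el 0 0 0 1"
    "el 0 0 1 0 [^] (2::nat) = el 0 0 0 1"
proof -
  show "el (- 1) 1 (- 1) 1 [^] (2::nat) = el 0 2 (- 1) (1 - t)"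
    "el 0 0 (- 1) 1 = el 0 0 1 0" "el 0 0 1 (- 1) [^] (2::nat) = el 0 0 0 1"
    "el 0 0 1 0 [^] (2::nat) = el 0 0 0 1"
    by (simp_all add: el_nat_pow el_eq_iff_2[OF p] tri_def Let_def binomial_eq_0)
qed

section \<open>Change of the parameters\<close>

lemma dvd_mult_cancel_unit:
  "\<not> int p dvd x \<Longrightarrow> int p dvd x * y \<Longrightarrow> int p dvd y"
  using prime_dvd_mult_iff[OF prime_int] by blast

text \<open>Only \<open>p = 2\<close> matters, where a unit is an odd number. These are the terms by
  which a change of generators for \<open>p = 2\<close> differs from the odd case.\<close>

lemma eps_odd: "\<not> int p dvd w \<Longrightarrow> int p dvd (w + 1) * eps p" "\<not> int p dvd w \<Longrightarrow> int p dvd (w * w - 1) * eps p"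
  by (auto simp: eps_def)

text \<open>Modulo \<open>p\<close> the exponent is \<open>l s + t w\<close> if \<open>w\<close> is
  a unit, because the \<open>eps p\<close> term then vanishes by \<open>eps_odd\<close>. Elements of
  this shape are the candidates for a new \<open>b\<close>.\<close>

lemma pth_power:
  obtains X where "el w (int p * l) j k [^] p = el 0 0 0 (l * s + t * w + (l + j) * ((w + 1) * eps p) + int p * X)"
proof -
  define A where "A = w * w * int (p choose 3) + tri w * tri (int p)"
  obtain q where "tri (int p) - eps p = int p * q" using prime_dvd_tri[OF prime_p] by (auto elim!: dvdE)
  then have q: "tri (int p) = eps p + int p * q" by simp
  define J where "J = int p * j + w * (int p * l) * tri (int p)"
  define K where "K = int p * k + w * j * tri (int p) + int p * l * A"
  have "el w (int p * l) j k [^] p = el (int p * w) (int p * (int p * l)) J K"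
    by (simp add: el_nat_pow J_def K_def A_def)
  also have "\<dots> = el 0 (int p * (int p * l)) (J - int p * w * (int p * (int p * l)))
      (K - int p * w * J + tri (- (int p * w)) * (int p * (int p * l)) + t * w)"
    by (rule el_p_n)
  also have "\<dots> = el 0 (0 + int p * int p * l) (0 + int p * (j + w * l * tri (int p) - int p * w * int p * l))
      (K - int p * w * J + tri (- (int p * w)) * (int p * (int p * l)) + t * w)"
    by (simp add: J_def algebra_simps)
  also have "\<dots> = el 0 0 0 (K - int p * w * J + tri (- (int p * w)) * (int p * (int p * l)) + t * w +
      l * (s + eps p) + (j + w * l * tri (int p) - int p * w * int p * l) * eps p)"
    by (simp only: el_add_i el_add_j) (simp add: add_ac)
  also have "K - int p * w * J + tri (- (int p * w)) * (int p * (int p * l)) + t * w +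
      l * (s + eps p) + (j + w * l * tri (int p) - int p * w * int p * l) * eps p =
    l * s + t * w + (l + j) * ((w + 1) * eps p) + int p * (k + w * j * q + l * A - w * J +
      tri (- (int p * w)) * (int p * l) + (w * l * q - w * int p * l) * eps p)"
  proof -
    have "eps p * eps p = eps p" by (simp add: eps_def)
    then show ?thesis unfolding K_def q by (simp add: algebra_simps)
  qed
  finally show ?thesis by (rule that)
qed

text \<open>New generators are \<open>a^i\<close> and \<open>b^w a^(p l)\<close>, for which the new
  \<open>d\<close> is \<open>d^(w^2 i)\<close>. Comparing \<open>a^(i p^2)\<close> and the
  \<open>p\<close>-th power of the new \<open>b\<close> with powers of this element gives the two
  congruences; in the first one \<open>i\<close> cancels.\<close>

lemma reparametrise:
  assumes i: "\<not> int p dvd i" and w: "\<not> int p dvd w"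
    and s': "int p dvd s - w * w * s'" and t': "int p dvd l * s + t * w - w * w * i * t'"
  obtains el' where "p_cover G p s' t' el'"
proof -
  let ?a = "el 0 i 0 0" and ?b = "el w (int p * l) 0 0"
  let ?c = "commutator G ?a ?b" let ?d = "commutator G ?c ?b"
  have c: "?c = el 0 0 (w * i) (tri w * i)" by (simp add: commutator_el)
  have d: "?d = el 0 0 0 (w * w * i)" unfolding c by (simp add: commutator_el mult.assoc)
  have gen: "generate G {?a, ?b} = carrier G"
  proof (rule generating_pair[OF generate_is_subgroup])
    show "el 0 i 0 0 \<in> generate G {?a, ?b}" "el w (int p * l) 0 0 \<in> generate G {?a, ?b}"
      by (auto intro: generate.incl)
    show "\<not> int p dvd 0 * (int p * l) - w * i" using i w prime_dvd_mult_iff[OF prime_int] by simp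
  qed simp
  have "class_three_p G ?a ?b ?c ?d p s' t'"
  proof unfold_locales
    show "?c \<otimes> ?a = ?a \<otimes> ?c" "?d \<otimes> ?a = ?a \<otimes> ?d" "?d \<otimes> ?c = ?c \<otimes> ?d" "?d \<otimes> ?b = ?b \<otimes> ?d"
      unfolding d unfolding c by (simp_all add: el_mult algebra_simps)
    show "?d [^] p = \<one>" unfolding d by (simp add: el_nat_pow el_1_eq_one)
    have "?c [^] p \<otimes> ?d [^] eps p = el 0 0 (0 + int p * (w * i)) (int p * (tri w * i) + eps p * (w * w * i))"
      unfolding d unfolding c by (simp add: el_nat_pow el_0_int_pow el_mult)
    also have "\<dots> = el 0 0 0 (int p * (tri w * i) + w * i * ((w + 1) * eps p))"
      unfolding el_add_j by (simp add: algebra_simps)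
    also have "\<dots> = \<one>" unfolding el_1_eq_one using eps_odd(1)[OF w] by (intro dvd_add) simp_all
    finally show "?c [^] p \<otimes> ?d [^] eps p = \<one>" .
    have "?a [^] (p * p) = el 0 (0 + int p * int p * i) 0 0" by (simp add: el_nat_pow)
    also have "\<dots> = el 0 0 0 (0 + i * (s + eps p))" by (rule el_add_i)
    also have "\<dots> = el 0 0 0 ((s' + eps p) * (w * w * i))"
    proof (rule el_add_k)
      have "0 + i * (s + eps p) - (s' + eps p) * (w * w * i) = i * (s - w * w * s') - i * ((w * w - 1) * eps p)"
        by (simp add: algebra_simps)
      then show "int p dvd 0 + i * (s + eps p) - (s' + eps p) * (w * w * i)"
        using s' eps_odd(2)[OF w] by (metis dvd_diff dvd_mult)
    qed
    finally show "?a [^] (p * p) = ?d [^] (s' + eps p)" unfolding d by (simp add: el_0_int_pow)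
    obtain X where X: "?b [^] p = el 0 0 0 (l * s + t * w + (l + 0) * ((w + 1) * eps p) + int p * X)"
      by (rule pth_power)
    also have "\<dots> = el 0 0 0 (t' * (w * w * i))"
    proof (rule el_add_k)
      have "l * s + t * w + (l + 0) * ((w + 1) * eps p) + int p * X - t' * (w * w * i) =
          (l * s + t * w - w * w * i * t') + l * ((w + 1) * eps p) + int p * X" by (simp add: algebra_simps)
      then show "int p dvd l * s + t * w + (l + 0) * ((w + 1) * eps p) + int p * X - t' * (w * w * i)"
        using t' eps_odd(1)[OF w] by (metis dvd_add dvd_mult dvd_triv_left)
    qed
    finally show "?b [^] p = ?d [^] t'" unfolding d by (simp add: el_0_int_pow)
  qed (use gen prime_p in auto)
  then have "p_cover G p s' t' (normal_word ?a ?b)"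
    by (rule class_three_p.p_cover_of_order[OF _ order_eq])
  then show ?thesis by (rule that)
qed

text \<open>The converse of \<open>reparametrise\<close>: the generators of any other cover have, up
  to irrelevant exponents, the shape used there. The relations themselves enforce it, so the two
  congruences describe all changes of the parameters.\<close>

lemma parameters_determined:
  assumes "p_cover G p s' t' el'"
  obtains i w l where "\<not> int p dvd i" "\<not> int p dvd w"
    "int p dvd s - w * w * s'" "int p dvd l * s + t * w - w * w * i * t'"
proof -
  interpret E: p_cover G p s' t' el' by fact
  let ?a = "el' 0 1 0 0" and ?b = "el' 1 0 0 0"
  have E: "commutator G ?a ?b = el' 0 0 1 0" "commutator G (el' 0 0 1 0) ?b = el' 0 0 0 1"
    "commutator G (el' 0 0 1 0) ?a = \<one>"
    by (simp_all add: E.commutator_el E.one_eq_el)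
  have d_ne: "el' 0 0 0 1 \<noteq> \<one>" using not_dvd_one E.el_1_eq_one by blast
  obtain n0 i j0 k0 where a0: "?a = el n0 i j0 k0" using E.el_closed by (rule el_cases)
  obtain w i1 j1 k1 where b: "?b = el w i1 j1 k1" using E.el_closed by (rule el_cases)
  define \<Delta> where "\<Delta> = w * i - n0 * i1"
  obtain x where c0: "el' 0 0 1 0 = el 0 0 \<Delta> x" using E(1) unfolding a0 b commutator_el \<Delta>_def by metis
  \<comment> \<open>That the new \<open>c\<close> commutes with the new \<open>a\<close> but not
    with the new \<open>b\<close> forces the new \<open>a\<close> into the abelian maximal
    subgroup.\<close>
  have "el 0 0 0 (n0 * \<Delta>) = \<one>" using E(3) unfolding c0 a0 by (simp add: commutator_el)
  moreover have "el 0 0 0 (w * \<Delta>) \<noteq> \<one>" using E(2) d_ne unfolding c0 b by (simp add: commutator_el)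
  ultimately have "int p dvd n0 * \<Delta>" "\<not> int p dvd w * \<Delta>" by (simp_all add: el_1_eq_one)
  then have n0: "int p dvd n0" and w: "\<not> int p dvd w" and \<Delta>: "\<not> int p dvd \<Delta>"
    using prime_dvd_mult_iff[OF prime_int] by blast+
  have i: "\<not> int p dvd i" using \<Delta> n0 unfolding \<Delta>_def by (metis dvd_diff dvd_mult dvd_mult2)
  obtain m where m: "n0 = int p * m" using n0 by (auto elim!: dvdE)
  obtain j0' k0' where a: "?a = el 0 i j0' k0'" unfolding a0 m el_p_n by blast
  define y where "y = w * j0' + tri w * i"
  have c: "el' 0 0 1 0 = el 0 0 (w * i) y" using E(1) unfolding a b by (simp add: commutator_el y_def)
  have d: "el' 0 0 0 1 = el 0 0 0 (w * w * i)" using E(2) unfolding c b by (simp add: commutator_el mult.assoc)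
  have dpow: "el' 0 0 0 m = el 0 0 0 (m * (w * w * i))" for m
    using E.el_0_int_pow[of 0 0 1 m] unfolding d by (simp add: el_0_int_pow)
  have "?b [^] p = el' 0 0 0 t'"
    using E.el_p_n[of 1 0 0 0] by (simp add: E.el_nat_pow)
  then have bp: "?b [^] p = el 0 0 0 (t' * (w * w * i))" unfolding dpow .
  \<comment> \<open>The \<open>p\<close>-th power of the new \<open>b\<close> is a power of
    \<open>d\<close>, whereas its exponent of \<open>a\<close> is \<open>p * i1\<close>; so
    \<open>p^2\<close> divides \<open>p * i1\<close>.\<close>
  have "int p dvd i1"
  proof -
    obtain J K where "?b [^] p = el (int p * w) (int p * i1) J K" unfolding b el_nat_pow by blast
    then obtain J' K' where "el 0 0 0 (t' * (w * w * i)) = el 0 (int p * i1) J' K'"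
      unfolding bp el_p_n by blast
    then obtain u where "int p * i1 = int p * int p * u" by (auto simp: el_eq_iff_same)
    then have "int p * i1 = int p * (int p * u)" by simp
    then have "i1 = int p * u" using p_pos by simp
    then show ?thesis by simp
  qed
  then obtain l where l: "i1 = int p * l" by (auto elim!: dvdE)
  obtain X where "?b [^] p = el 0 0 0 (l * s + t * w + (l + j1) * ((w + 1) * eps p) + int p * X)"
    unfolding b l by (rule pth_power)
  then have "el 0 0 0 (t' * (w * w * i)) = el 0 0 0 (l * s + t * w + (l + j1) * ((w + 1) * eps p) + int p * X)"
    using bp by simp
  then have "int p dvd l * s + t * w + (l + j1) * ((w + 1) * eps p) + int p * X - t' * (w * w * i)"
    using p_pos by (auto simp: el_eq_iff_same)
  moreover have "l * s + t * w - w * w * i * t' =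
      (l * s + t * w + (l + j1) * ((w + 1) * eps p) + int p * X - t' * (w * w * i)) -
      (l + j1) * ((w + 1) * eps p) - int p * X"
    by (simp add: algebra_simps)
  ultimately have t': "int p dvd l * s + t * w - w * w * i * t'"
    using eps_odd(1)[OF w] by (metis dvd_diff dvd_mult dvd_triv_left)
  have "?a [^] (p * p) = el' 0 0 0 (s' + eps p)"
    using E.el_add_i[of 0 0 1 0 0] by (simp add: E.el_nat_pow)
  then have "el 0 0 0 ((s' + eps p) * (w * w * i)) = ?a [^] (p * p)" unfolding dpow by simp
  also have "\<dots> = el 0 (0 + int p * int p * i) (0 + int p * (int p * j0')) (int p * (int p * k0'))"
    unfolding a by (simp add: el_nat_pow mult.assoc)
  also have "\<dots> = el 0 0 0 (int p * (int p * k0') + int p * j0' * eps p + i * (s + eps p))"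
    by (simp only: el_add_i el_add_j)
  finally have "int p dvd int p * (int p * k0') + int p * j0' * eps p + i * (s + eps p) - (s' + eps p) * (w * w * i)"
    using p_pos by (auto simp: el_eq_iff_same)
  moreover have "i * (s - w * w * s') =
      (int p * (int p * k0') + int p * j0' * eps p + i * (s + eps p) - (s' + eps p) * (w * w * i)) +
      i * ((w * w - 1) * eps p) - int p * (int p * k0' + j0' * eps p)"
    by (simp add: algebra_simps)
  ultimately have "int p dvd i * (s - w * w * s')"
    using eps_odd(2)[OF w] by (metis dvd_add dvd_diff dvd_mult dvd_triv_left)
  then have "int p dvd s - w * w * s'" using dvd_mult_cancel_unit[OF i] by blast
  then show ?thesis using that i w t' by blast
qed

end

text \<open>By Euler's criterion the Legendre symbol is multiplicative modulo \<open>p\<close>, and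
  -1, 0, 1 are distinguished modulo an odd prime.\<close>

lemma QuadRes_mult_nonresidues:
  assumes p: "prime p" "p > 2" and "\<not> QuadRes (int p) x" "\<not> QuadRes (int p) y"
  shows "QuadRes (int p) (x * y)"
proof -
  have unit: "\<not> [z = 0] (mod int p)" if "\<not> QuadRes (int p) z" for z
  proof
    assume "[z = 0] (mod int p)"
    then have "[0 ^ 2 = z] (mod int p)" by (simp add: cong_sym)
    with that show False unfolding QuadRes_def by blast
  qed
  have L: "Legendre x (int p) = - 1" "Legendre y (int p) = - 1"
    using assms(3,4) unit by (simp_all add: Legendre_def)
  have E: "[Legendre z (int p) = z ^ ((p - 1) div 2)] (mod int p)" for z
    using euler_criterion[OF p] by simp
  have "[(- 1) * (- 1) = x ^ ((p - 1) div 2) * y ^ ((p - 1) div 2)] (mod int p)"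
    using cong_mult[OF E[of x] E[of y]] unfolding L .
  then have "[Legendre (x * y) (int p) = 1] (mod int p)"
    using E[of "x * y"] by (simp add: power_mult_distrib) (metis cong_sym cong_trans)
  moreover have "\<not> [- 1 = 1] (mod int p)"
  proof
    assume "[- 1 = 1] (mod int p)"
    then have "int p dvd 2" by (simp add: cong_iff_dvd_diff)
    then show False using p(2) by (auto dest: zdvd_imp_le)
  qed
  moreover have "\<not> [0 = 1] (mod int p)" using p(2) by (simp add: cong_iff_dvd_diff zdvd1_eq)
  ultimately show ?thesis by (auto simp: Legendre_def split: if_splits)
qed

section \<open>Parameters and labels\<close>

lemma params_exist:
  assumes p: "prime p" and \<eta>: "p > 2 \<Longrightarrow> \<not> QuadRes (int p) (int \<eta>)" and L: "L \<in> labels p \<eta>"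
  obtains s t where "params p L s t"
proof (cases "p = 2")
  case True
  then show ?thesis using L that by (auto simp: labels_def)
next
  case False
  then have p2: "p > 2" using prime_ge_2_nat[OF p] by simp
  have "\<not> int p dvd int \<eta>"
  proof
    assume "int p dvd int \<eta>"
    then have "[0 ^ 2 = int \<eta>] (mod int p)" by (simp add: cong_iff_dvd_diff)
    then show False using \<eta>[OF p2] unfolding QuadRes_def by blast
  qed
  moreover have "prime (int p)" using p by simp
  ultimately obtain y where "int p dvd int \<eta> * y - 1" using prime_inverse by blast
  then have "params p (A4 \<eta>) y 0" "params p (A4 1) 1 0" "params p A5 0 1" "params p A6 0 0"
    using False by simp_all
  then show ?thesis using L that False by (auto simp: labels_def)
qed

text \<open>The cases follow the invariants: whether \<open>s\<close> is a unit, then its quadratic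
  character for odd \<open>p\<close>, and whether \<open>t\<close> is a unit when \<open>s\<close>
  vanishes.\<close>

lemma p_cover_label:
  assumes cov: "p_cover G p s t el" and \<eta>: "p > 2 \<Longrightarrow> \<not> QuadRes (int p) (int \<eta>)"
  obtains L s' t' el' where "L \<in> labels p \<eta>" "params p L s' t'" "p_cover G p s' t' el'"
proof -
  interpret p_cover G p s t el by fact
  consider (two_odd) "p = 2" "odd s" | (two_even) "p = 2" "even s" "even t" | (two_t) "p = 2" "even s" "odd t"
    | (res) "p \<noteq> 2" "\<not> int p dvd s" "QuadRes (int p) s"
    | (nonres) "p \<noteq> 2" "\<not> int p dvd s" "\<not> QuadRes (int p) s"
    | (s0) "p \<noteq> 2" "int p dvd s" "int p dvd t" | (t) "p \<noteq> 2" "int p dvd s" "\<not> int p dvd t"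
    by blast
  then show ?thesis
  proof cases
    case two_odd
    \<comment> \<open>For odd \<open>s\<close> the choice \<open>l = t\<close> makes
      \<open>l s + t\<close> even.\<close>
    obtain el' where "p_cover G p 1 0 el'"
      by (rule reparametrise[of 1 1 1 t 0]) (use two_odd in auto)
    with two_odd that[of A3 1 0] show ?thesis by (simp add: labels_def)
  next
    case two_even
    obtain el' where "p_cover G p 0 0 el'"
      by (rule reparametrise[of 1 1 0 0 0]) (use two_even in auto)
    with two_even that[of A1 0 0] show ?thesis by (simp add: labels_def)
  next
    case two_t
    obtain el' where "p_cover G p 0 1 el'"
      by (rule reparametrise[of 1 1 0 0 1]) (use two_t in auto)
    with two_t that[of A2 0 1] show ?thesis by (simp add: labels_def)
  next
    case s0
    obtain el' where "p_cover G p 0 0 el'"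
      by (rule reparametrise[of 1 1 0 0 0]) (use s0 not_dvd_one in auto)
    with s0 that[of A6 0 0] show ?thesis by (simp add: labels_def)
  next
    case t
    \<comment> \<open>Taking \<open>i = t\<close> turns \<open>d\<close> into \<open>d^t\<close>, so
      that \<open>b^p\<close> equals the new \<open>d\<close>.\<close>
    obtain el' where "p_cover G p 0 1 el'"
      by (rule reparametrise[of t 1 0 0 1]) (use t not_dvd_one in auto)
    with t that[of A5 0 1] show ?thesis by (simp add: labels_def)
  next
    case res
    obtain w where "[w ^ 2 = s] (mod int p)" using res unfolding QuadRes_def by blast
    then have w: "int p dvd s - w * w * 1" by (simp add: cong_iff_dvd_diff power2_eq_square dvd_diff_commute)
    moreover have "s = (s - w * w * 1) + w * w" by simp
    ultimately have wu: "\<not> int p dvd w" using res(2) by (metis dvd_mult dvd_add)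
    obtain y where y: "int p dvd s * y - 1" using prime_inverse[OF prime_int res(2)] .
    \<comment> \<open>With \<open>y\<close> inverse to \<open>s\<close>, the choice
      \<open>l = - t w y\<close> clears the exponent of \<open>b^p\<close>.\<close>
    obtain el' where "p_cover G p 1 0 el'"
    proof (rule reparametrise[OF not_dvd_one wu w, of "- t * w * y" 0])
      have "- t * w * y * s + t * w - w * w * 1 * 0 = - t * w * (s * y - 1)" by (simp add: algebra_simps)
      then show "int p dvd - t * w * y * s + t * w - w * w * 1 * 0" using y by simp
    qed
    with res that[of "A4 1" 1 0] show ?thesis by (simp add: labels_def)
  next
    case nonres
    have p2: "p > 2" using nonres(1) prime_ge_2_nat[OF prime_p] by simp
    \<comment> \<open>The target \<open>s'\<close> is the inverse of \<open>\<eta>\<close>;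
      \<open>s\<close> differs from it by the factor \<open>\<eta> s\<close>, a product of two
      nonresidues and hence a square.\<close>
    obtain w where "[w ^ 2 = int \<eta> * s] (mod int p)"
      using QuadRes_mult_nonresidues[OF prime_p p2 \<eta>[OF p2] nonres(3)] unfolding QuadRes_def by blast
    then have w: "int p dvd int \<eta> * s - w * w" by (simp add: cong_iff_dvd_diff power2_eq_square dvd_diff_commute)
    obtain s' t' where par: "params p (A4 \<eta>) s' t'"
      using params_exist[OF prime_p \<eta>, of "A4 \<eta>"] nonres(1) by (auto simp: labels_def)
    then have es: "int p dvd int \<eta> * s' - 1" "t' = 0" by simp_all
    have \<eta>0: "\<not> int p dvd int \<eta>"
    proof
      assume "int p dvd int \<eta>"
      then have "int p dvd int \<eta> * s'" by (rule dvd_mult2)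
      from dvd_diff[OF this es(1)] show False using not_dvd_one by simp
    qed
    have "\<not> int p dvd int \<eta> * s" using \<eta>0 nonres(2) prime_dvd_mult_iff[OF prime_int] by blast
    moreover have "int \<eta> * s = (int \<eta> * s - w * w) + w * w" by simp
    ultimately have wu: "\<not> int p dvd w" using w by (metis dvd_mult dvd_add)
    have "s - w * w * s' = s' * (int \<eta> * s - w * w) - s * (int \<eta> * s' - 1)" by (simp add: algebra_simps)
    then have w': "int p dvd s - w * w * s'" using w es(1) by (metis dvd_diff dvd_mult)
    obtain y where y: "int p dvd s * y - 1" using prime_inverse[OF prime_int nonres(2)] .
    obtain el' where "p_cover G p s' 0 el'"
    proof (rule reparametrise[OF not_dvd_one wu w', of "- t * w * y" 0])
      have "- t * w * y * s + t * w - w * w * 1 * 0 = - t * w * (s * y - 1)" by (simp add: algebra_simps)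
      then show "int p dvd - t * w * y * s + t * w - w * w * 1 * 0" using y by simp
    qed
    with nonres es that[of "A4 \<eta>" s' 0] show ?thesis by (simp add: labels_def)
  qed
qed

text \<open>Whether \<open>s\<close> is a unit is invariant, and for vanishing \<open>s\<close> so
  is whether \<open>t\<close> is a unit. If both labels are of type \<open>A4\<close>, the ratio of
  the values of \<open>s\<close> is a square, so the parameters cannot be 1 and a
  nonresidue.\<close>

lemma label_unique:
  assumes G: "p_cover G p s t el" "p_cover G p s' t' el'"
    and par: "params p L s t" "params p L' s' t'" and L: "L \<in> labels p \<eta>" "L' \<in> labels p \<eta>"
    and \<eta>: "p > 2 \<Longrightarrow> \<not> QuadRes (int p) (int \<eta>)"
  shows "L = L'"
proof -
  interpret p_cover G p s t el by fact
  interpret E: p_cover G p s' t' el' by fact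
  obtain i w l where 1: "\<not> int p dvd i" "\<not> int p dvd w"
    "int p dvd s - w * w * s'" "int p dvd l * s + t * w - w * w * i * t'"
    using parameters_determined[OF G(2)] .
  obtain i' w' l' where 2: "\<not> int p dvd i'" "\<not> int p dvd w'"
    "int p dvd s' - w' * w' * s" "int p dvd l' * s' + t' * w' - w' * w' * i' * t"
    using E.parameters_determined[OF G(1)] .
  have s: "int p dvd s \<longleftrightarrow> int p dvd s'"
    using 1(3) 2(3) by (metis dvd_add dvd_mult diff_add_cancel)
  have st: "t = t'" if "s = 0" "s' = 0" "t \<in> {0, 1}" "t' \<in> {0, 1}"
  proof (rule ccontr)
    assume "t \<noteq> t'"
    then have "t = 0 \<and> t' = 1 \<or> t = 1 \<and> t' = 0" using that by auto
    moreover have "int p dvd t * w - w * w * i * t'" using 1(4) that(1) by simp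
    ultimately have "int p dvd w * w * i \<or> int p dvd w" by auto
    then show False using 1(1,2) by (simp add: prime_dvd_mult_iff[OF prime_int])
  qed
  show ?thesis
  proof (cases "p = 2")
    case True
    then have "L \<in> {A1, A2, A3}" "L' \<in> {A1, A2, A3}" using L by (auto simp: labels_def)
    then show ?thesis using par st s True by auto
  next
    case False
    then have p2: "p > 2" using prime_ge_2_nat[OF prime_p] by simp
    note nr = \<eta>[OF p2]
    have L': "L \<in> {A4 1, A4 \<eta>, A5, A6}" "L' \<in> {A4 1, A4 \<eta>, A5, A6}"
      using L False by (auto simp: labels_def)
    have contr: False if "int p dvd int \<eta> * y - 1" "int p dvd x - 1" "int p dvd x - v * v * y" for x y v :: int
    proof -
      have "v * v - int \<eta> = v * v * - (int \<eta> * y - 1) - int \<eta> * (x - v * v * y) + int \<eta> * (x - 1)"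
        by (simp add: algebra_simps)
      then have "int p dvd v * v - int \<eta>" using that by (metis dvd_add dvd_diff dvd_minus_iff dvd_mult)
      then have "[v ^ 2 = int \<eta>] (mod int p)" by (simp add: cong_iff_dvd_diff power2_eq_square)
      then show False using nr unfolding QuadRes_def by blast
    qed
    have nd: "\<not> int p dvd y" if xy: "int p dvd x * y - 1" for x y :: int
    proof
      assume "int p dvd y"
      then have "int p dvd x * y" by (rule dvd_mult)
      from dvd_diff[OF this xy] show False using not_dvd_one by simp
    qed
    have notA4: "x = 0 \<and> y \<in> {0, 1}" if "params p M x y" "\<not> (\<exists>\<nu>. M = A4 \<nu>)" for M x y
      using that False by (cases M) auto
    have isA4: "\<not> int p dvd x" if M: "params p M x y" "\<exists>\<nu>. M = A4 \<nu>" for M x y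
    proof -
      obtain \<nu> where "M = A4 \<nu>" using M(2) by blast
      then have "int p dvd int \<nu> * x - 1" using M(1) by simp
      then show ?thesis by (rule nd)
    qed
    show ?thesis
    proof (cases "\<exists>\<nu>. L = A4 \<nu>")
      case True
      then have "\<not> int p dvd s'" using isA4[OF par(1)] s by blast
      then have "\<exists>\<nu>. L' = A4 \<nu>" using notA4[OF par(2)] dvd_0_right by blast
      with True obtain \<nu> \<nu>' where \<nu>: "L = A4 \<nu>" "L' = A4 \<nu>'" by blast
      then have "\<nu> \<in> {1, \<eta>}" "\<nu>' \<in> {1, \<eta>}" using L' by auto
      moreover have "int p dvd int \<nu> * s - 1" "int p dvd int \<nu>' * s' - 1" using par \<nu> by simp_all
      ultimately show ?thesis
        using contr[of s' s w, OF _ _ 1(3)] contr[of s s' w', OF _ _ 2(3)] \<nu> by auto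
    next
      case False
      then have "s = 0" "t \<in> {0, 1}" using notA4[OF par(1)] by blast+
      moreover have "\<not> (\<exists>\<nu>. L' = A4 \<nu>)" using isA4[OF par(2)] s \<open>s = 0\<close> dvd_0_right by blast
      then have "s' = 0" "t' \<in> {0, 1}" using notA4[OF par(2)] by blast+
      ultimately have "t = t'" using st by blast
      then show ?thesis using par L' \<open>s = 0\<close> \<open>s' = 0\<close> not_dvd_one by auto
    qed
  qed
qed

section \<open>Groups with an abelian and a minimal nonabelian maximal subgroup\<close>

text \<open>Otherwise a Bezout combination of \<open>k\<close> and \<open>p\<close> would put
  \<open>x\<close> itself into \<open>H\<close>.\<close>

lemma (in group) prime_dvd_exponent:
  assumes "prime p" "subgroup H G" "x \<in> carrier G" "x [^] p \<in> H" "x \<notin> H" "x [^] (k :: int) \<in> H"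
  shows "int p dvd k"
proof (rule ccontr)
  assume "\<not> int p dvd k"
  moreover have "prime (int p)" using assms(1) by simp
  ultimately obtain y where "int p dvd k * y - 1" using prime_inverse by blast
  then obtain q where "k * y - 1 = int p * q" by (auto elim!: dvdE)
  then have q: "k * y + int p * (- q) = 1" by simp
  have "(x [^] k) [^] y \<otimes> (x [^] p) [^] (- q) \<in> H"
    using assms(2,4,6) by (simp add: subgroup.m_closed subgroup_int_pow_closed del: int_pow_neg)
  also have "(x [^] k) [^] y \<otimes> (x [^] p) [^] (- q) = x [^] (k * y + int p * (- q))"
    using assms(3) by (simp only: int_pow_pow int_pow_mult int_pow_int[symmetric])
  also have "\<dots> = x" using assms(3) by (simp only: q int_pow_1)
  finally show False using assms(5) by simp
qed

context p_group
begin

text \<open>At least one generator lies outside \<open>A\<close>; modulo \<open>A\<close> the other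
  is a power of it, and dividing by that power moves the other one into \<open>A\<close>.\<close>

lemma adapted_generators:
  assumes A: "subgroup A G" "subgroup_index G A = p"
    and xy: "x \<in> carrier G" "y \<in> carrier G" and gen: "generate G {x, y} = carrier G"
  obtains a b where "a \<in> A" "b \<in> carrier G" "b \<notin> A" "generate G {a, b} = carrier G"
proof -
  have "A \<noteq> carrier G" using index_p_maximal[OF A] by (simp add: maximal_subgroup_def)
  then have "\<not> {x, y} \<subseteq> A"
    using generate_subgroup_incl[OF _ A(1), of "{x, y}"] gen subgroup.subset[OF A(1)] by auto
  then consider "y \<notin> A" | "y \<in> A" "x \<notin> A" by blast
  then show ?thesis
  proof cases
    case 1
    obtain h k where h: "h \<in> A" "x = h \<otimes> y [^] (k :: int)"
      by (rule index_p_coset[OF A xy(2) 1 xy(1)])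
    have hG: "h \<in> carrier G" using h A by (meson subgroup.mem_carrier)
    have sub: "subgroup (generate G {h, y}) G" by (rule generate_is_subgroup) (use hG xy in simp)
    have "h \<in> generate G {h, y}" "y \<in> generate G {h, y}" by (auto intro: generate.incl)
    then have "{x, y} \<subseteq> generate G {h, y}"
      using h(2) by (simp add: subgroup.m_closed[OF sub] subgroup_int_pow_closed[OF sub])
    then have "carrier G \<subseteq> generate G {h, y}"
      using generate_subgroup_incl[OF _ sub] gen by blast
    then have "generate G {h, y} = carrier G" using generate_incl[of "{h, y}"] hG xy by auto
    then show ?thesis using that h(1) xy(2) 1 by blast
  next
    case 2
    then show ?thesis using that[of y x] xy gen by (simp add: insert_commute)
  qed
qed

text \<open>If \<open>a\<close> were in \<open>M\<close>, the normal subgroup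
  \<open>A \<inter> M\<close> together with \<open>b\<close> would generate the group, so every
  element of \<open>A\<close> would be \<open>l b^k\<close> with \<open>l\<close> in
  \<open>A \<inter> M\<close> and \<open>b^k\<close> in \<open>A\<close>. Then \<open>p\<close>
  divides \<open>k\<close>, so \<open>b^k\<close> is in \<open>M\<close>, and
  \<open>A \<subseteq> M\<close> contradicts maximality. The second part uses that \<open>a\<close>
  generates modulo \<open>M\<close>.\<close>

lemma index_p_not_abelian:
  assumes A: "subgroup A G" "subgroup_index G A = p"
    and a: "a \<in> A" and b: "b \<in> carrier G" "b \<notin> A" and gen: "generate G {a, b} = carrier G"
    and M: "subgroup M G" "subgroup_index G M = p" "M \<noteq> A"
  obtains k where "a \<notin> M" "b \<otimes> a [^] (k :: int) \<in> M"
proof -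
  have aG: "a \<in> carrier G" using a A by (meson subgroup.mem_carrier)
  have "a \<notin> M"
  proof
    assume aM: "a \<in> M"
    have "\<Inter>{A, M} \<lhd> G" using index_p_normal A M by (intro normal_Inter) auto
    then have N: "A \<inter> M \<lhd> G" by simp
    let ?K = "(A \<inter> M) <#> generate G {b}"
    have K: "subgroup ?K G"
      using N b by (intro mult_norm_subgroup generate_is_subgroup) auto
    have "a \<otimes> \<one> \<in> ?K" using a aM generate.one[of G "{b}"] unfolding set_mult_def by blast
    then have "a \<in> ?K" using aG by simp
    moreover have "\<one> \<otimes> b \<in> ?K"
      using generate.incl[of b "{b}" G] subgroup.one_closed[OF A(1)] subgroup.one_closed[OF M(1)]
      unfolding set_mult_def by blast
    then have "b \<in> ?K" using b by simp
    ultimately have GK: "carrier G \<subseteq> ?K" using generate_subgroup_incl[OF _ K, of "{a, b}"] gen by simp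
    have "A \<subseteq> M"
    proof
      fix e assume e: "e \<in> A"
      then have eG: "e \<in> carrier G" using A by (meson subgroup.mem_carrier)
      then have "e \<in> ?K" using GK by blast
      then obtain l s where l: "l \<in> A" "l \<in> M" "s \<in> generate G {b}" "e = l \<otimes> s"
        by (auto simp: set_mult_def)
      obtain k where k: "s = b [^] (k :: int)" using l(3) generate_pow[OF b(1)] by auto
      have lG: "l \<in> carrier G" using l(1) A by (meson subgroup.mem_carrier)
      have "inv l \<otimes> e \<in> A" using l(1) e A(1) by (simp add: subgroup.m_closed subgroup.m_inv_closed)
      moreover have "inv l \<otimes> e = b [^] k" using l(4) k lG b by (simp add: m_assoc[symmetric])
      ultimately have "b [^] k \<in> A" by simp
      then have "int p dvd k"
        using prime_dvd_exponent[OF prime_p A(1) b(1) index_p_pow[OF A b(1)] b(2)] by blast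
      then obtain q where q: "k = int p * q" by (auto elim!: dvdE)
      have "b [^] k = (b [^] p) [^] q" using b by (simp add: q int_pow_pow[symmetric] int_pow_int)
      also have "\<dots> \<in> M" by (rule subgroup_int_pow_closed[OF M(1) index_p_pow[OF M(1,2) b(1)]])
      finally show "e \<in> M" using l k M(1) by (simp add: subgroup.m_closed)
    qed
    moreover have "maximal_subgroup A G" "maximal_subgroup M G" using index_p_maximal A M by blast+
    ultimately show False using M by (auto simp: maximal_subgroup_def)
  qed
  obtain h k where h: "h \<in> M" "b = h \<otimes> a [^] (k :: int)"
    by (rule index_p_coset[OF M(1,2) aG \<open>a \<notin> M\<close> b(1)])
  have hG: "h \<in> carrier G" using h(1) M(1) by (meson subgroup.mem_carrier)
  have "b \<otimes> a [^] (- k) = h" using h(2) hG aG by (simp add: m_assoc int_pow_mult[symmetric])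
  with h(1) have "b \<otimes> a [^] (- k) \<in> M" by simp
  with \<open>a \<notin> M\<close> show ?thesis by (rule that)
qed

text \<open>A subgroup \<open>L\<close> of index \<open>p\<close> in \<open>M\<close> above
  \<open>b\<close> is abelian and contains \<open>[e,b]\<close> and \<open>e^p\<close>. Hence
  \<open>[e,b]\<close> commutes with \<open>b\<close>; and as \<open>e\<close> and
  \<open>[e,b]\<close> commute inside \<open>A\<close>, conjugating \<open>e^p\<close> by
  \<open>b\<close> multiplies it by \<open>[e,b]^p\<close>, which must be trivial. With
  \<open>e = c\<close> this concerns \<open>d\<close>.\<close>

lemma minimal_nonabelian_relations:
  assumes A: "subgroup A G" "subgroup_index G A = p" "commutes A"
    and M: "subgroup M G" "subgroup_index G M = p" "\<not> commutes M"
      "\<And>K. subgroup K G \<Longrightarrow> K \<subset> M \<Longrightarrow> commutes K"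
    and b: "b \<in> M" and e: "e \<in> A" "e \<in> M"
  shows "commutator G e b \<otimes> b = b \<otimes> commutator G e b" "commutator G e b [^] p = \<one>"
proof -
  have bG: "b \<in> carrier G" and eG: "e \<in> carrier G" using b e M by (meson subgroup.mem_carrier)+
  have sub: "subgroup (generate G {b}) G" by (rule generate_is_subgroup) (use bG in simp)
  have "generate G {b} \<subseteq> M" by (rule generate_subgroup_incl[OF _ M(1)]) (use b in simp)
  moreover have "commutes (generate G {b})"
    unfolding generate_pow[OF bG] using bG by (auto simp: int_pow_mult[symmetric] add.commute)
  ultimately have "generate G {b} \<subset> M" using M(3) by blast
  then obtain L where L: "subgroup L G" "generate G {b} \<subseteq> L" "L \<subseteq> M" "p * card L = card M"
    by (rule index_p_above_in_subgroup[OF M(1) sub])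
  have "card L > 0" using finite_subgroup[OF L(1)] subgroup.one_closed[OF L(1)] card_gt_0_iff by blast
  then have "L \<noteq> M" using L(4) prime_gt_1_nat[OF prime_p] by auto
  then have comm: "commutes L" using M(4)[OF L(1)] L(3) by blast
  have bL: "b \<in> L" using L(2) generate.incl[of b "{b}" G] by blast
  have ep: "e [^] p \<in> L" and eb: "commutator G e b \<in> L"
    using index_p_in_subgroup[OF M(1) L(1,3,4)] e b by blast+
  show "commutator G e b \<otimes> b = b \<otimes> commutator G e b" using comm eb bL by blast
  have cG: "commutator G e b \<in> carrier G" by (simp add: eG bG is_group)
  have cA: "commutator G e b \<in> A" by (rule index_p_commutator[OF A(1,2) eG bG])
  have "e \<otimes> b = b \<otimes> (e \<otimes> commutator G e b)"
    using commutator_eq_iff[OF eG bG cG] eG bG cG by (simp add: m_assoc)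
  then have "e [^] p \<otimes> b = b \<otimes> (e \<otimes> commutator G e b) [^] p"
    by (intro conj_nat_pow eG bG m_closed cG)
  also have "(e \<otimes> commutator G e b) [^] p = e [^] p \<otimes> commutator G e b [^] p"
    using A(3) e(1) cA by (intro pow_mult_distrib eG cG) blast
  finally have "b \<otimes> e [^] p = b \<otimes> (e [^] p \<otimes> commutator G e b [^] p)"
    using comm ep bL by auto
  then have "e [^] p = e [^] p \<otimes> commutator G e b [^] p" using eG bG cG by simp
  then show "commutator G e b [^] p = \<one>" using eG cG by (metis l_cancel_one' nat_pow_closed)
qed

lemma coprime_int_pow_inverse:
  assumes "\<not> int p dvd f"
  obtains g where "\<And>x. x \<in> carrier G \<Longrightarrow> x [^] (f * g) = x"
proof -
  have "coprime f (int p ^ n)"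
    using assms prime_imp_coprime[of "int p" f] prime_p by (simp add: coprime_commute)
  then obtain g where "[f * g = 1] (mod (int p ^ n))" using cong_solve_coprime_int by blast
  then obtain q where q: "f * g = 1 + int (p ^ n) * q"
    by (metis cong_iff_lin cong_sym mult.commute of_nat_power)
  have "x [^] (f * g) = x" if x: "x \<in> carrier G" for x
  proof -
    have "x [^] (f * g) = x \<otimes> (x [^] (p ^ n)) [^] q"
      unfolding q using x by (simp only: int_pow_mult int_pow_1 int_pow_pow[symmetric] int_pow_int)
    also have "x [^] (p ^ n) = \<one>" using pow_order_eq_1[OF x] by (simp add: order_pow)
    finally show ?thesis using x by simp
  qed
  then show ?thesis by (rule that)
qed

end

text \<open>The situation before the order is known: of the power relations only those on
  \<open>c\<close> and \<open>d\<close> are available.\<close>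

locale word_p_group = word_group G el + p_group G p rank
  for G (structure) and el and p rank +
  assumes d_pow: "el 0 0 0 (int p) = \<one>" and c_pow: "el 0 0 (int p) (eps p) = \<one>"
begin

lemma p_gt_1: "p > 1" and p_pos: "p > 0"
  using prime_p prime_gt_1_nat prime_gt_0_nat by auto

lemma el_add_pk: "el n i j (k + int p * q) = el n i j k"
proof -
  have "el n i j (k + int p * q) = el n i j k \<otimes> el 0 0 0 (int p) [^] q"
    by (simp add: el_mult el_0_int_pow mult.commute)
  then show ?thesis by (simp add: d_pow)
qed

lemma el_add_k:
  assumes "int p dvd k' - k"
  shows "el n i j k' = el n i j k"
proof -
  obtain q where "k' - k = int p * q" using assms by (rule dvdE)
  then have "k' = k + int p * q" by simp
  then show ?thesis by (simp only: el_add_pk)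
qed

lemma el_add_j: "el n i (j + int p * v) k = el n i j (k + v * eps p)"
proof -
  have "el n i (j + int p * v) k = el n i j (k - v * eps p) \<otimes> el 0 0 (int p) (eps p) [^] v"
    by (simp add: el_mult el_0_int_pow mult.commute)
  also have "\<dots> = el n i j (k - v * eps p)" by (simp add: c_pow)
  also have "\<dots> = el n i j (k + v * eps p)"
  proof (rule el_add_k)
    have "int p dvd v * (2 * eps p)" by (simp add: eps_def)
    moreover have "k - v * eps p - (k + v * eps p) = - (v * (2 * eps p))" by simp
    ultimately show "int p dvd k - v * eps p - (k + v * eps p)" by (simp only: dvd_minus_iff)
  qed
  finally show ?thesis .
qed

lemma el_central:
  "el (int p * w) (int p * u) (- u * eps p) k \<otimes> el n i j l = el n i j l \<otimes> el (int p * w) (int p * u) (- u * eps p) k"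
proof -
  let ?z = "el (int p * w) (int p * u) (- u * eps p) k"
  have "commutator G ?z (el n i j l) = el 0 0 (0 + int p * (n * u - w * i))
      (n * (- u * eps p) + tri n * (int p * u) - int p * w * j - tri (int p * w) * i)"
    by (simp add: commutator_el algebra_simps)
  also have "\<dots> = el 0 0 0 (n * (- u * eps p) + tri n * (int p * u) - int p * w * j - tri (int p * w) * i +
      (n * u - w * i) * eps p)"
    by (rule el_add_j)
  also have "\<dots> = el 0 0 0 0"
  proof (rule el_add_k)
    have "n * (- u * eps p) + tri n * (int p * u) - int p * w * j - tri (int p * w) * i +
      (n * u - w * i) * eps p - 0 = int p * (tri n * u - w * j) - i * (tri (int p * w) + w * eps p)"
      by (simp add: algebra_simps)
    then show "int p dvd n * (- u * eps p) + tri n * (int p * u) - int p * w * j - tri (int p * w) * i +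
      (n * u - w * i) * eps p - 0"
      using prime_dvd_tri_mult[OF prime_p, of w] by (metis dvd_diff dvd_mult dvd_triv_left)
  qed
  finally have "commutator G ?z (el n i j l) = \<one>" by (simp add: one_eq_el)
  then show ?thesis using commutator_eq_iff[of ?z "el n i j l" \<one>] by simp
qed

lemma z_int_pow: "el 0 (int p) (- eps p) 0 [^] (m :: int) = el 0 (int p * m) (- m * eps p) 0"
  by (simp add: el_0_int_pow mult.commute)

text \<open>Let \<open>x = b a\<^sup>m\<close>. As \<open>M\<close> is generated by \<open>x\<close> and \<open>c\<close>, its central elements \<open>z\<close> and \<open>b\<^sup>p\<close> are powers of
  \<open>w = x\<^sup>p\<close> modulo \<open>d\<close>. If \<open>b\<^sup>p\<close> were congruent to a power of \<open>w\<close> with exponent prime to \<open>p\<close>, then \<open>K\<close>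
  would contain \<open>w\<close>, hence \<open>z\<close>, and then all of \<open>L\<close>. So the exponent is divisible by \<open>p\<close>, and
  multiplying \<open>b\<close> by a power of \<open>z\<close> makes \<open>b\<^sup>p\<close> a power of \<open>d\<close>.\<close>

lemma p_cover_of_subgroups:
  assumes L: "subgroup L G" "subgroup_index G L = p" "el 1 0 0 0 \<in> L" "el 0 1 0 0 \<notin> L"
    and M: "subgroup M G" "subgroup_index G M = p" "el 1 m 0 0 \<in> M"
      "\<And>H. subgroup H G \<Longrightarrow> H \<subset> M \<Longrightarrow> commutes H"
    and K: "subgroup K G" "K \<subseteq> L" "p * card K = card L" "\<not> commutes K"
    and A3: "\<And>H. subgroup H G \<Longrightarrow> p ^ 3 * card H = p ^ rank \<Longrightarrow> commutes H"
  obtains s t el' where "p_cover G p s t el'"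
proof -
  let ?a = "el 0 1 0 0" and ?b = "el 1 0 0 0" and ?c = "el 0 0 1 0" and ?d = "el 0 0 0 1"
  let ?z = "el 0 (int p) (- eps p) 0"
  have comm_c: "?c = commutator G ?a ?b" and comm_d: "?d = commutator G ?c ?b"
    by (simp_all add: commutator_el)
  have cd_in: "?c \<in> H" "?d \<in> H" "el (int p) 0 0 0 \<in> H" "el 0 (int p) 0 0 \<in> H"
    if H: "subgroup H G" "subgroup_index G H = p" for H
  proof -
    show "?c \<in> H" "?d \<in> H" unfolding comm_c comm_d by (rule index_p_commutator[OF H]; simp)+
    show "el (int p) 0 0 0 \<in> H" "el 0 (int p) 0 0 \<in> H"
      using index_p_pow[OF H, of ?b] index_p_pow[OF H, of ?a] by (simp_all add: el_nat_pow)
  qed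
  have z_in: "?z \<in> H" if H: "subgroup H G" "el 0 (int p) 0 0 \<in> H" "?c \<in> H" for H
  proof -
    have "el 0 (int p) 0 0 \<otimes> ?c [^] (- eps p) \<in> H"
      using H by (simp add: subgroup.m_closed subgroup_int_pow_closed del: int_pow_neg)
    then show ?thesis by (simp add: el_mult el_0_int_pow)
  qed
  have dk_in: "el 0 0 0 k \<in> H" if H: "subgroup H G" "?d \<in> H" for H k
  proof -
    have "?d [^] k \<in> H" by (rule subgroup_int_pow_closed[OF H])
    then show ?thesis by (simp add: el_0_int_pow)
  qed
  \<comment> \<open>\<open>L\<close> contains \<open>b\<close>, \<open>c\<close>, \<open>d\<close>
    but not \<open>a\<close>, so removing the other factors leaves a power of \<open>a\<close> that
    lies in \<open>L\<close> only if \<open>p\<close> divides the exponent.\<close>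
  have in_L: "int p dvd i" if g: "el n i j k \<in> L" for n i j k
  proof -
    have "inv (?b [^] n) \<otimes> el n i j k \<otimes> inv (?c [^] j \<otimes> el 0 0 0 k) \<in> L"
      using L g cd_in[OF L(1,2)] dk_in[OF L(1)]
      by (intro subgroup.m_closed[OF L(1)] subgroup.m_inv_closed[OF L(1)] subgroup_int_pow_closed[OF L(1)]) auto
    then have "?a [^] i \<in> L" by (simp add: el_1_int_pow el_0_int_pow el_mult inv_el)
    then show ?thesis
      using prime_dvd_exponent[OF prime_p L(1), of ?a i] cd_in[OF L(1,2)] L(4) by (simp add: el_nat_pow)
  qed
  \<comment> \<open>Inside \<open>L\<close> the commutator is the determinant of the coordinates
    \<open>n\<close> and \<open>j + u * eps p\<close>, as for \<open>small\<close>.\<close>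
  have comm_L: "commutator G (el n (int p * u) j k) (el n' (int p * u') j' k') =
      el 0 0 0 (n' * (j + u * eps p) - n * (j' + u' * eps p))" for n u j k n' u' j' k'
  proof -
    have "commutator G (el n (int p * u) j k) (el n' (int p * u') j' k') =
      el 0 0 (0 + int p * (n' * u - n * u')) (n' * j + tri n' * (int p * u) - n * j' - tri n * (int p * u'))"
      by (simp add: commutator_el algebra_simps)
    also have "\<dots> = el 0 0 0 ((n' * j + tri n' * (int p * u) - n * j' - tri n * (int p * u')) + (n' * u - n * u') * eps p)"
      by (rule el_add_j)
    also have "\<dots> = el 0 0 0 (n' * (j + u * eps p) - n * (j' + u' * eps p) + int p * (tri n' * u - tri n * u'))"
      by (simp add: algebra_simps)
    finally show ?thesis unfolding el_add_pk .
  qed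
  have comm_iff: "commutator G x y = \<one> \<longleftrightarrow> x \<otimes> y = y \<otimes> x" if "x \<in> carrier G" "y \<in> carrier G" for x y
    using commutator_eq_iff[OF that one_closed] that by simp
  obtain x1 x2 where x12: "x1 \<in> K" "x2 \<in> K" "x1 \<otimes> x2 \<noteq> x2 \<otimes> x1" using K(4) by blast
  have rep: "\<exists>n u j k. x = el n (int p * u) j k" if x: "x \<in> L" for x
  proof -
    have "x \<in> carrier G" by (rule subgroup.mem_carrier[OF L(1) x])
    then obtain n i j k where x': "x = el n i j k" by (rule el_cases)
    then have "int p dvd i" using in_L x by simp
    then obtain u where "i = int p * u" by (rule dvdE)
    with x' show ?thesis by auto
  qed
  obtain n1 u1 j1 k1 where x1: "x1 = el n1 (int p * u1) j1 k1" using rep x12(1) K(2) by blast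
  obtain n2 u2 j2 k2 where x2: "x2 = el n2 (int p * u2) j2 k2" using rep x12(2) K(2) by blast
  define m1 where "m1 = j1 + u1 * eps p"
  define m2 where "m2 = j2 + u2 * eps p"
  define D where "D = n2 * m1 - n1 * m2"
  have comm_x12: "el 0 0 0 D \<noteq> \<one>"
    using x12(3) comm_iff[of x1 x2] comm_L[of n1 u1 j1 k1 n2 u2 j2 k2]
    unfolding x1 x2 D_def m1_def m2_def by simp
  have d_ne: "?d \<noteq> \<one>"
  proof
    assume "?d = \<one>"
    then have "?d [^] D = \<one>" by simp
    then show False using comm_x12 by (simp add: el_0_int_pow)
  qed
  have d_eq: "el 0 0 0 k = \<one> \<longleftrightarrow> int p dvd k" for k
  proof
    assume "el 0 0 0 k = \<one>"
    then have "?d [^] k \<in> {\<one>}" by (simp add: el_0_int_pow)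
    then show "int p dvd k"
      using prime_dvd_exponent[OF prime_p triv_subgroup, of ?d k] d_ne d_pow by (simp add: el_nat_pow)
  next
    assume "int p dvd k"
    then show "el 0 0 0 k = \<one>" using el_add_k[of k 0 0 0 0] by (simp add: one_eq_el)
  qed
  then have D: "\<not> int p dvd D" using comm_x12 by blast
  \<comment> \<open>Since \<open>d\<close> commutes with \<open>x = b a^i c^j d^k\<close>, the pair
    \<open>c\<close>, \<open>x\<close> fits \<open>class_three\<close> again with \<open>d\<close>
    and \<open>\<one>\<close> as its commutators; this yields normal words for the subgroup it
    generates.\<close>
  have words: "generate G {?c, el 1 i j k} = {el 1 i j k [^] (n :: int) \<otimes> el 0 0 j' k' | n j' k'. True}"
    and nonab: "el 1 i j k \<otimes> ?c \<noteq> ?c \<otimes> el 1 i j k" for i j k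
  proof -
    let ?x = "el 1 i j k"
    have cx: "commutator G ?c ?x = ?d" "commutator G ?d ?x = \<one>" by (simp_all add: commutator_el one_eq_el)
    interpret C: class_three G ?c ?x ?d \<one>
      by unfold_locales (simp_all add: cx el_mult)
    have nw: "normal_word ?c ?x n j' k' q = ?x [^] n \<otimes> el 0 0 j' k'" for n j' k' q
      unfolding C.normal_word_eq by (simp add: el_0_int_pow el_mult)
    show "generate G {?c, ?x} = {?x [^] (n :: int) \<otimes> el 0 0 j' k' | n j' k'. True}"
      unfolding C.generate_normal_words nw by blast
    show "?x \<otimes> ?c \<noteq> ?c \<otimes> ?x" using comm_iff[of ?c ?x] cx(1) d_ne by auto
  qed
  \<comment> \<open>Commuting with \<open>c\<close> makes the exponent of \<open>x\<close> divisible
    by \<open>p\<close>, and commuting with \<open>x\<close> does the same for \<open>c\<close>;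
    what is left is a power of \<open>x^p\<close> times a power of \<open>d\<close>.\<close>
  have central: "\<exists>f q. y = (el 1 i j k [^] p) [^] (f :: int) \<otimes> el 0 0 0 q"
    if y: "y \<in> generate G {?c, el 1 i j k}" and cy: "y \<otimes> ?c = ?c \<otimes> y" "y \<otimes> el 1 i j k = el 1 i j k \<otimes> y"
    for y i j k
  proof -
    let ?x = "el 1 i j k"
    obtain n j' k' where y': "y = ?x [^] (n :: int) \<otimes> el 0 0 j' k'" using y unfolding words by blast
    obtain J Q where xn: "?x [^] n = el n (n * i) J Q" by (rule el_int_pow[of 1 i j k n]) simp
    have yel: "y = el n (n * i) (J + j') (Q + k')" unfolding y' xn by (simp add: el_mult)
    have "commutator G y ?c = \<one>" using cy(1) comm_iff[of y ?c] unfolding yel by simp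
    then have "el 0 0 0 (- n) = \<one>" unfolding yel by (simp add: commutator_el)
    then have n: "int p dvd n" by (simp add: d_eq)
    have "commutator G y ?x = \<one>" using cy(2) comm_iff[of y ?x] unfolding yel by simp
    then have "el 0 0 0 (J + j' - n * j - tri n * i) = \<one>" unfolding yel by (simp add: commutator_el algebra_simps)
    moreover have "?x [^] n \<otimes> ?x = ?x \<otimes> ?x [^] n" using commute_int_pow[of ?x ?x n] by simp
    then have "commutator G (?x [^] n) ?x = \<one>" using comm_iff[of "?x [^] n" ?x] by simp
    then have "el 0 0 0 (J - n * j - tri n * i) = \<one>" unfolding xn by (simp add: commutator_el algebra_simps)
    ultimately have "int p dvd (J + j' - n * j - tri n * i) - (J - n * j - tri n * i)"
      unfolding d_eq by (rule dvd_diff)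
    then have "int p dvd j'" by simp
    with n obtain f v where fv: "n = int p * f" "j' = int p * v" by (auto elim!: dvdE)
    have "?x [^] n = (?x [^] p) [^] f" by (simp add: fv int_pow_pow[symmetric] int_pow_int)
    moreover have "el 0 0 j' k' = el 0 0 0 (k' + v * eps p)" using el_add_j[of 0 0 0 v k'] by (simp add: fv)
    ultimately show ?thesis unfolding y' by auto
  qed
  let ?x = "el 1 m 0 0"
  \<comment> \<open>\<open>c\<close> and \<open>x\<close> do not commute, so by minimality of
    \<open>M\<close> they generate all of it.\<close>
  have genM: "generate G {?c, ?x} = M"
  proof -
    have sub: "subgroup (generate G {?c, ?x}) G" by (rule generate_is_subgroup) simp
    have "generate G {?c, ?x} \<subseteq> M"
      using cd_in(1)[OF M(1,2)] M(3) by (intro generate_subgroup_incl[OF _ M(1)]) simp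
    moreover have "\<not> commutes (generate G {?c, ?x})"
      using nonab[of m 0 0] generate.incl[of ?c "{?c, ?x}" G] generate.incl[of ?x "{?c, ?x}" G] by auto
    ultimately show ?thesis using M(4)[OF sub] by blast
  qed
  define w where "w = ?x [^] p"
  have wG: "w \<in> carrier G" by (simp add: w_def)
  have z_cent: "?z \<otimes> el n i j k = el n i j k \<otimes> ?z" for n i j k
    using el_central[of 0 1 0 n i j k] by simp
  have \<beta>_cent: "el (int p) 0 0 0 \<otimes> el n i j k = el n i j k \<otimes> el (int p) 0 0 0" for n i j k
    using el_central[of 1 0 0 n i j k] by simp
  have "?z \<in> M" by (rule z_in[OF M(1) cd_in(4)[OF M(1,2)] cd_in(1)[OF M(1,2)]])
  then obtain r q1 where z_w: "?z = w [^] (r :: int) \<otimes> el 0 0 0 q1"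
    using central[of ?z m 0 0] z_cent unfolding genM w_def by blast
  have "el (int p) 0 0 0 \<in> M" by (rule cd_in(3)[OF M(1,2)])
  then obtain f q2 where \<beta>_w: "el (int p) 0 0 0 = w [^] (f :: int) \<otimes> el 0 0 0 q2"
    using central[of "el (int p) 0 0 0" m 0 0] \<beta>_cent unfolding genM w_def by blast
  obtain q3 where w_el: "w = el (int p) 0 0 0 \<otimes> ?z [^] m \<otimes> el 0 0 0 q3"
  proof -
    obtain v where "tri (int p * 1) + 1 * eps p = int p * v"
      using prime_dvd_tri_mult[OF prime_p, of 1] by (auto elim!: dvdE)
    then have v: "tri (int p) = int p * v - eps p" by simp
    have "w = el (int p) (int p * m) (m * tri (int p)) (m * int (p choose 3))"
      by (simp add: w_def el_nat_pow)
    also have "m * tri (int p) = - m * eps p + int p * (m * v)" unfolding v by (simp add: algebra_simps)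
    also have "el (int p) (int p * m) (- m * eps p + int p * (m * v)) (m * int (p choose 3)) =
        el (int p) (int p * m) (- m * eps p) (m * int (p choose 3) + m * v * eps p)"
      by (rule el_add_j)
    also have "\<dots> = el (int p) 0 0 0 \<otimes> ?z [^] m \<otimes> el 0 0 0 (m * int (p choose 3) + m * v * eps p)"
      unfolding z_int_pow by (simp add: el_mult)
    finally show ?thesis by (rule that)
  qed
  have d_comm: "el 0 0 0 k \<otimes> el n' i' j' k' = el n' i' j' k' \<otimes> el 0 0 0 k" for k n' i' j' k'
    by (simp add: el_mult add.commute)
  have f: "int p dvd f"
  proof (rule ccontr)
    assume "\<not> int p dvd f"
    then obtain g where g: "\<And>x. x \<in> carrier G \<Longrightarrow> x [^] (f * g) = x" by (rule coprime_int_pow_inverse) blast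
    have KL: "x \<in> L \<Longrightarrow> x [^] p \<in> K" "x \<in> L \<Longrightarrow> y \<in> L \<Longrightarrow> commutator G x y \<in> K" for x y
      using index_p_in_subgroup[OF L(1) K(1,2,3)] by blast+
    have dK: "?d \<in> K" using KL(2)[of ?c ?b] cd_in(1)[OF L(1,2)] L(3) by (simp add: comm_d)
    have \<beta>K: "el (int p) 0 0 0 \<in> K" using KL(1)[OF L(3)] by (simp add: el_nat_pow)
    have "w [^] f = el (int p) 0 0 0 \<otimes> inv (el 0 0 0 q2)"
      using \<beta>_w wG inv_solve_right[of "w [^] f" "el (int p) 0 0 0" "el 0 0 0 q2"] by simp
    then have "w [^] f \<in> K" using \<beta>K dk_in[OF K(1) dK] K(1) by (simp add: subgroup.m_closed subgroup.m_inv_closed)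
    then have "(w [^] f) [^] g \<in> K" by (rule subgroup_int_pow_closed[OF K(1)])
    then have wK: "w \<in> K" using g[OF wG] wG by (simp add: int_pow_pow)
    have zK: "?z \<in> K"
      unfolding z_w using wK dk_in[OF K(1) dK] K(1) by (simp add: subgroup.m_closed subgroup_int_pow_closed)
    obtain g' where g': "int p dvd D * g' - 1" using prime_inverse[of "int p" D] prime_p D by auto
    then obtain h where h: "D * g' = 1 + int p * h" by (metis add.commute diff_add_cancel dvdE)
    \<comment> \<open>Since \<open>z\<close> is in \<open>K\<close>, the \<open>a\<close>-coordinate
      of an element of \<open>K\<close> can be cleared; the \<open>c\<close>-coordinate then becomes
      \<open>J + U * eps p\<close>.\<close>
    have reach: "el N 0 (N' + int p * v) k \<in> K"
      if "el N (int p * U) J Q \<in> K" "J + U * eps p = N' + int p * v" for N U J Q N' v k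
    proof -
      have "?z [^] (- U) \<in> K" by (rule subgroup_int_pow_closed[OF K(1) zK])
      then have "el N (int p * U) J Q \<otimes> el 0 (- (int p * U)) (U * eps p) 0 \<otimes> el 0 0 0 (k - Q) \<in> K"
        using that(1) dk_in[OF K(1) dK] unfolding z_int_pow by (intro subgroup.m_closed[OF K(1)]) auto
      then show ?thesis by (simp add: el_mult that(2))
    qed
    have comb: "\<exists>U J Q. el (\<alpha> * n1 + \<gamma> * n2) (int p * U) J Q \<in> K \<and> int p dvd J + U * eps p - (\<alpha> * m1 + \<gamma> * m2)" for \<alpha> \<gamma>
    proof -
      obtain J Q where J: "el (\<alpha> * n1 + \<gamma> * n2) (\<alpha> * (int p * u1) + \<gamma> * (int p * u2)) J Q \<in> K"
        "int p dvd int p * u1 \<longrightarrow> int p dvd int p * u2 \<longrightarrow> int p dvd J - (\<alpha> * j1 + \<gamma> * j2)"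
        using subgroup_el_lincomb[OF K(1) x12(1)[unfolded x1] x12(2)[unfolded x2]] by metis
      have "\<alpha> * (int p * u1) + \<gamma> * (int p * u2) = int p * (\<alpha> * u1 + \<gamma> * u2)" by (simp add: algebra_simps)
      moreover have "J + (\<alpha> * u1 + \<gamma> * u2) * eps p - (\<alpha> * m1 + \<gamma> * m2) = J - (\<alpha> * j1 + \<gamma> * j2)"
        by (simp add: m1_def m2_def algebra_simps)
      ultimately show ?thesis using J by (metis dvd_triv_left)
    qed
    \<comment> \<open>Combining \<open>x1\<close> and \<open>x2\<close> with coefficients
      \<open>n2 g'\<close> and \<open>- n1 g'\<close> cancels \<open>b\<close> and leaves
      \<open>c\<close> to the power \<open>D g'\<close>, congruent to 1. The coefficients
      \<open>- m2 g'\<close> and \<open>m1 g'\<close> isolate \<open>b\<close> in the same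
      way.\<close>
    have cK: "el 0 0 1 k \<in> K" for k
    proof -
      obtain U J Q where *: "el (n2 * g' * n1 + - n1 * g' * n2) (int p * U) J Q \<in> K"
        "int p dvd J + U * eps p - (n2 * g' * m1 + - n1 * g' * m2)" using comb by blast
      have "n2 * g' * n1 + - n1 * g' * n2 = 0" by simp
      moreover have "n2 * g' * m1 + - n1 * g' * m2 = 1 + int p * h" using h by (simp add: D_def algebra_simps)
      moreover obtain v where "J + U * eps p - (n2 * g' * m1 + - n1 * g' * m2) = int p * v" using *(2) by (auto elim!: dvdE)
      ultimately have "J + U * eps p = 1 + int p * (h + v)" by (simp add: algebra_simps)
      then have "el 0 0 (1 + int p * (h + v)) (k - (h + v) * eps p) \<in> K"
        using reach[of 0 U J Q 1 "h + v"] *(1) by simp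
      then show ?thesis unfolding el_add_j by simp
    qed
    have bK: "el 1 0 0 k \<in> K" for k
    proof -
      obtain U J Q where *: "el (- m2 * g' * n1 + m1 * g' * n2) (int p * U) J Q \<in> K"
        "int p dvd J + U * eps p - (- m2 * g' * m1 + m1 * g' * m2)" using comb by blast
      have N: "- m2 * g' * n1 + m1 * g' * n2 = 1 + int p * h" using h by (simp add: D_def algebra_simps)
      obtain v where "J + U * eps p = 0 + int p * v" using *(2) by (auto elim!: dvdE)
      then have "el (1 + int p * h) 0 (0 + int p * v) Q' \<in> K" for Q'
        using reach[of "1 + int p * h" U J Q 0 v] *(1) unfolding N by simp
      then have "el (1 + int p * h) 0 0 (Q' + v * eps p) \<in> K" for Q' unfolding el_add_j .
      moreover have "el (int p) 0 0 0 [^] (- h) \<in> K" by (rule subgroup_int_pow_closed[OF K(1) \<beta>K])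
      then have "el (- (int p * h)) 0 0 0 \<in> K"
        using int_pow_pow[of ?b "int p" "- h"] by (simp add: el_1_int_pow)
      ultimately have "el (1 + int p * h) 0 0 ((k - v * eps p) + v * eps p) \<otimes> el (- (int p * h)) 0 0 0 \<in> K"
        by (intro subgroup.m_closed[OF K(1)])
      then show ?thesis by (simp add: el_mult)
    qed
    have "L \<subseteq> K"
    proof
      fix x assume "x \<in> L"
      then obtain n u j k where x: "x = el n (int p * u) j k" using rep by blast
      have "?b [^] n \<otimes> ?z [^] u \<otimes> ?c [^] (j + u * eps p) \<otimes> el 0 0 0 k \<in> K"
        using bK[of 0] cK[of 0] zK dk_in[OF K(1) dK]
        by (intro subgroup.m_closed[OF K(1)] subgroup_int_pow_closed[OF K(1)]) auto
      then show "x \<in> K" unfolding z_int_pow by (simp add: x el_1_int_pow el_0_int_pow el_mult)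
    qed
    then have "card L \<le> card K" using finite_subgroup[OF K(1)] by (simp add: card_mono)
    moreover have "card K > 0" using x12(1) finite_subgroup[OF K(1)] card_gt_0_iff by blast
    ultimately show False using K(3) p_gt_1 by (metis less_le_not_le mult_less_cancel2 nat_mult_1 mult.commute)
  qed
  then obtain f' where f': "f = int p * f'" by (auto elim!: dvdE)
  have "\<not> int p dvd 1 - f"
  proof
    assume "int p dvd 1 - f"
    then have "int p dvd 1 - f + f" using f by (rule dvd_add)
    then show False using p_gt_1 by (simp add: zdvd1_eq)
  qed
  then obtain g where g: "\<And>x. x \<in> carrier G \<Longrightarrow> x [^] ((1 - f) * g) = x" by (rule coprime_int_pow_inverse) blast
  have z_pow_el: "?z [^] i \<otimes> el 0 0 0 k = el 0 (int p * i) (- i * eps p) k" for i k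
    unfolding z_int_pow by (simp add: el_mult)
  \<comment> \<open>Substituting \<open>b^p = w^f\<close> into \<open>w = b^p z^m\<close> gives
    \<open>w^(1 - f) = z^m\<close>, all modulo \<open>d\<close>. As \<open>1 - f\<close> is a unit
    with inverse \<open>g\<close>, \<open>w = z^(m g)\<close>, and with \<open>f = p f'\<close> this
    yields \<open>b^p = z^(p q)\<close> modulo \<open>d\<close>.\<close>
  define q where "q = m * g * f'"
  obtain T where T: "el (int p) 0 0 0 = ?z [^] (int p * q) \<otimes> el 0 0 0 T"
  proof -
    obtain N I J Q where w_rep: "w = el N I J Q" using wG carrier_el by blast
    have wf: "w [^] f = el (int p) 0 0 0 \<otimes> inv (el 0 0 0 q2)"
      using \<beta>_w wG inv_solve_right[of "w [^] f" "el (int p) 0 0 0" "el 0 0 0 q2"] by simp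
    have "w [^] (1 - f) = inv (w [^] f) \<otimes> w"
      using int_pow_mult[OF wG, of "- f" 1] int_pow_neg[OF wG, of f] wG by simp
    also have "\<dots> = inv (el (int p) 0 0 0 \<otimes> inv (el 0 0 0 q2)) \<otimes> (el (int p) 0 0 0 \<otimes> ?z [^] m \<otimes> el 0 0 0 q3)"
      unfolding wf using w_el by simp
    also have "\<dots> = ?z [^] m \<otimes> el 0 0 0 (q2 + q3)"
      unfolding z_int_pow by (simp add: inv_el el_mult)
    finally have "w [^] (1 - f) = ?z [^] m \<otimes> el 0 0 0 (q2 + q3)" .
    then have "w [^] ((1 - f) * g) = (?z [^] m \<otimes> el 0 0 0 (q2 + q3)) [^] g" using wG by (simp add: int_pow_pow[symmetric])
    then have w1: "w = el 0 (int p * (m * g)) (- (m * g) * eps p) ((q2 + q3) * g)"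
      using g[OF wG] unfolding z_pow_el by (simp add: el_0_int_pow mult_ac)
    have "el (int p) 0 0 0 = el 0 (int p * (int p * q)) (- (int p * q) * eps p) ((q2 + q3) * g * f + q2)"
      using \<beta>_w unfolding w1 by (simp add: el_0_int_pow el_mult f' q_def mult_ac)
    then show ?thesis using that unfolding z_pow_el[symmetric] by blast
  qed
  define b' where "b' = el 1 (- (int p * q)) (q * eps p) 0"
  have b'_eq: "b' = ?b \<otimes> ?z [^] (- q)" unfolding z_int_pow b'_def by (simp add: el_mult)
  have b'p: "b' [^] p = el 0 0 0 T"
  proof -
    have "?b \<otimes> ?z [^] (- q) = ?z [^] (- q) \<otimes> ?b"
      using z_cent[of 1 0 0 0] by (intro commute_int_pow) auto
    then have "b' [^] p = ?b [^] p \<otimes> (?z [^] (- q)) [^] p" unfolding b'_eq by (intro pow_mult_distrib) auto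
    also have "(?z [^] (- q)) [^] p = ?z [^] (- (int p * q))" by (simp add: int_pow_pow int_pow_int[symmetric] mult.commute)
    also have "?b [^] p = ?z [^] (int p * q) \<otimes> el 0 0 0 T" using T by (simp add: el_nat_pow)
    finally show ?thesis unfolding z_int_pow by (simp add: el_mult)
  qed
  let ?S = "generate G {?c, b'}"
  have S: "subgroup ?S G" by (rule generate_is_subgroup) (simp add: b'_def)
  have S_in: "?c \<in> ?S" "b' \<in> ?S" by (auto intro: generate.incl)
  have S_nonab: "\<not> commutes ?S" using S_in nonab unfolding b'_def by blast
  \<comment> \<open>Since \<open>b'^p\<close> and \<open>c^p\<close> are powers of \<open>d\<close>,
    all three exponents can be reduced below \<open>p\<close>.\<close>
  have "card ?S \<le> p ^ 3"
  proof -
    have "?S \<subseteq> (\<lambda>(n, j, k). b' [^] n \<otimes> el 0 0 j k) ` ({0..<int p} \<times> {0..<int p} \<times> {0..<int p})"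
    proof
      fix y assume "y \<in> ?S"
      then obtain n j k where y: "y = b' [^] (n :: int) \<otimes> el 0 0 j k" unfolding b'_def words by blast
      have b'G: "b' \<in> carrier G" by (simp add: b'_def)
      have "b' [^] n = b' [^] (n mod int p) \<otimes> (b' [^] p) [^] (n div int p)"
        using int_pow_mult[OF b'G, of "n mod int p" "int p * (n div int p)"] b'G
        by (simp add: int_pow_pow[symmetric] int_pow_int)
      then have bn: "b' [^] n = b' [^] (n mod int p) \<otimes> el 0 0 0 (T * (n div int p))"
        by (simp add: b'p el_0_int_pow mult.commute)
      have jj: "el 0 0 (j mod int p + int p * (j div int p)) k = el 0 0 (j mod int p) (k + (j div int p) * eps p)"
        by (rule el_add_j)
      define k' where "k' = T * (n div int p) + (k + (j div int p) * eps p)"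
      have kk: "el 0 0 (j mod int p) (k' mod int p) = el 0 0 (j mod int p) k'"
        by (rule el_add_k) (simp add: mod_eq_dvd_iff[symmetric])
      have "y = b' [^] (n mod int p) \<otimes> el 0 0 (j mod int p) (k' mod int p)"
        unfolding y bn kk unfolding k'_def using jj b'G by (simp add: m_assoc el_mult)
      then show "y \<in> (\<lambda>(n, j, k). b' [^] n \<otimes> el 0 0 j k) ` ({0..<int p} \<times> {0..<int p} \<times> {0..<int p})"
        using p_pos by (intro image_eqI[of _ _ "(n mod int p, j mod int p, k' mod int p)"]) auto
    qed
    then have "card ?S \<le> card ({0..<int p} \<times> {0..<int p} \<times> {0..<int p})"
      by (rule surj_card_le[rotated]) simp
    then show ?thesis by (simp add: card_cartesian_product eval_nat_numeral)
  qed
  moreover have "p ^ 3 \<le> card ?S" using nonabelian_card[OF S] S_nonab by blast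
  ultimately have card_S: "card ?S = p ^ 3" by simp
  \<comment> \<open>In a larger group the nonabelian \<open>?S\<close> would lie in a subgroup of
    index \<open>p^3\<close>, which is abelian. The lower bound below comes from \<open>K\<close>,
    which is nonabelian of index \<open>p^2\<close>.\<close>
  have rank_le: "rank \<le> 5"
  proof (rule ccontr)
    assume "\<not> rank \<le> 5"
    then have "card ?S \<le> p ^ (rank - 3)" using card_S p_gt_1 by (simp add: power_increasing)
    then obtain H where H: "subgroup H G" "?S \<subseteq> H" "card H = p ^ (rank - 3)"
      using subgroup_order_between[OF p_group_axioms S, of "rank - 3"] by auto
    have "p ^ 3 * card H = p ^ rank" using H(3) \<open>\<not> rank \<le> 5\<close> by (simp flip: power_add)
    then have "commutes H" using A3 H(1) by blast
    then show False using S_nonab H(2) by blast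
  qed
  have card_L: "p * card L = p ^ rank" using index_eq_iff[OF L(1), of p] L(2) order_pow by simp
  have rank: "rank = 5"
  proof (rule ccontr)
    assume "rank \<noteq> 5"
    then have "rank \<le> 4" using rank_le by simp
    have "p ^ 3 \<le> card K" using nonabelian_card[OF K(1)] x12 by blast
    then have "p * (p * p ^ 3) \<le> p * (p * card K)" by simp
    then have "p ^ 5 \<le> p ^ rank" using K(3) card_L by (simp add: eval_nat_numeral)
    moreover have "p ^ rank \<le> p ^ 4" using \<open>rank \<le> 4\<close> p_gt_1 by (simp add: power_increasing)
    ultimately show False using p_gt_1 power_increasing_iff[of p 5 4] by simp
  qed
  have zL: "?z \<in> L" by (rule z_in[OF L(1) cd_in(4)[OF L(1,2)] cd_in(1)[OF L(1,2)]])
  have "b' \<in> L" unfolding b'_eq using L(1,3) zL by (intro subgroup.m_closed[OF L(1)] subgroup_int_pow_closed[OF L(1)]) auto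
  then have "?S \<subseteq> L" using cd_in(1)[OF L(1,2)] by (intro generate_subgroup_incl[OF _ L(1)]) simp
  moreover have "p * card ?S = card L"
  proof -
    have "p * card L = p * (p * card ?S)" using card_L card_S rank by (simp add: eval_nat_numeral)
    then show ?thesis using p_pos by simp
  qed
  \<comment> \<open>Counting shows that \<open>?S\<close> has index \<open>p\<close> in
    \<open>L\<close>, so it contains \<open>z^p\<close>. Being central there, \<open>z^p\<close> is
    a power of \<open>b'^p\<close> times a power of \<open>d\<close>, hence a power of
    \<open>d\<close>; this defines \<open>s\<close>.\<close>
  ultimately have "?z [^] p \<in> ?S" using index_p_in_subgroup(1)[OF L(1) S] zL by blast
  moreover have zp: "?z [^] p = el 0 (int p * int p) (0 + int p * - eps p) 0"
    using z_int_pow[of "int p", unfolded int_pow_int] by simp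
  have zp_cent: "?z [^] p \<otimes> el n i j k = el n i j k \<otimes> ?z [^] p" for n i j k
    using commute_nat_pow[of "el n i j k" ?z p] z_cent by simp
  ultimately obtain h r where "?z [^] p = (b' [^] p) [^] (h :: int) \<otimes> el 0 0 0 r"
    using central[of "?z [^] p" "- (int p * q)" "q * eps p" 0] zp_cent unfolding b'_def[symmetric]
    by (metis b'_def)
  then obtain s where s: "?z [^] p = el 0 0 0 s" by (simp add: b'p el_0_int_pow el_mult)
  have a_pow: "?a [^] (p * p) = el 0 0 0 (s + eps p)"
  proof -
    have "?a [^] (p * p) = el 0 (int p * int p) (0 + int p * - eps p) 0 \<otimes> el 0 0 (0 + int p * eps p) 0"
      by (simp add: el_nat_pow el_mult)
    also have "\<dots> = el 0 0 0 s \<otimes> el 0 0 0 (0 + eps p * eps p)"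
      unfolding zp[symmetric] s by (simp only: el_add_j)
    also have "eps p * eps p = eps p" by (simp add: eps_def)
    finally show ?thesis by (simp add: el_mult)
  qed
  have ab': "commutator G ?a b' = ?c" and cb': "commutator G ?c b' = ?d"
    by (simp_all add: b'_def commutator_el)
  have gen: "generate G {?a, b'} = carrier G"
  proof -
    let ?H = "generate G {?a, b'}"
    have H: "subgroup ?H G" by (rule generate_is_subgroup) (simp add: b'_def)
    have ab: "?a \<in> ?H" "b' \<in> ?H" by (auto intro: generate.incl)
    have comm: "commutator G u v \<in> ?H" if "u \<in> ?H" "v \<in> ?H" for u v
      unfolding commutator_def using that by (intro subgroup.m_closed[OF H] subgroup.m_inv_closed[OF H])
    have c: "?c \<in> ?H" using comm[OF ab] by (simp add: ab')
    then have d: "?d \<in> ?H" using comm[OF c ab(2)] by (simp add: cb')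
    have "?a [^] (int p) \<in> ?H" by (rule subgroup_int_pow_closed[OF H ab(1)])
    then have "?z \<in> ?H" using z_in[OF H] c by (simp add: el_0_int_pow)
    then have "b' \<otimes> ?z [^] q \<in> ?H" using ab(2) by (simp add: subgroup.m_closed[OF H] subgroup_int_pow_closed[OF H])
    then have b: "?b \<in> ?H" unfolding z_int_pow b'_def by (simp add: el_mult)
    have "el n i j k \<in> ?H" for n i j k
      using ab b c d unfolding el_decompose[of n i j k]
      by (simp add: subgroup.m_closed[OF H] subgroup_int_pow_closed[OF H])
    then show ?thesis using subgroup.subset[OF H] by (auto simp: carrier_el)
  qed
  have "class_three_p G ?a b' ?c ?d p s T"
    by unfold_locales
      (use gen a_pow b'p d_pow c_pow prime_p in
        \<open>auto simp: commutator_el b'_def el_mult el_nat_pow el_0_int_pow\<close>)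
  then have "p_cover G p s T (normal_word ?a b')"
    by (rule class_three_p.p_cover_of_order) (simp add: order_pow rank)
  then show ?thesis by (rule that)
qed

end

lemma (in p_group) word_p_group_normal_word:
  assumes "class_three G a b c d" and gen: "generate G {a, b} = carrier G"
    and "d [^] p = \<one>" "c [^] p \<otimes> d [^] eps p = \<one>"
  shows "word_p_group G (normal_word a b) p n"
proof -
  interpret C: class_three G a b c d by fact
  show ?thesis
  proof unfold_locales
    show "carrier G = {normal_word a b n i j k | n i j k. True}"
      unfolding gen[symmetric] by (rule C.generate_normal_words)
    show "normal_word a b 0 0 0 (int p) = \<one>" "normal_word a b 0 0 (int p) (eps p) = \<one>"
      using assms by (simp_all add: C.normal_word_eq int_pow_int)
  qed (rule C.normal_word_mult)
qed

text \<open>Two choices of \<open>b\<close> are needed: one inside \<open>M\<close>, where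
  minimality gives the relations on \<open>d\<close>, and one inside a maximal subgroup
  \<open>L\<close> above the nonabelian \<open>K\<close>. They differ by a power of
  \<open>a\<close>, which changes neither \<open>c\<close> nor \<open>d\<close>.\<close>

lemma (in p_group) p_cover_of_maximal_subgroups:
  assumes A: "subgroup A G" "subgroup_index G A = p" "commutes A"
    and M: "subgroup M G" "subgroup_index G M = p" "\<not> commutes M"
      "\<And>H. subgroup H G \<Longrightarrow> H \<subset> M \<Longrightarrow> commutes H"
    and K: "subgroup K G" "p ^ 2 * card K = p ^ n" "\<not> commutes K"
    and A3: "\<And>H. subgroup H G \<Longrightarrow> p ^ 3 * card H = p ^ n \<Longrightarrow> commutes H"
    and xy: "x \<in> carrier G" "y \<in> carrier G" "generate G {x, y} = carrier G"
  obtains s t el where "p_cover G p s t el"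
proof -
  have p1: "p > 1" using prime_p prime_gt_1_nat by blast
  obtain a b' where a: "a \<in> A" and b': "b' \<in> carrier G" "b' \<notin> A" "generate G {a, b'} = carrier G"
    by (rule adapted_generators[OF A(1,2) xy])
  have aG: "a \<in> carrier G" by (rule subgroup.mem_carrier[OF A(1) a])
  have "M \<noteq> A" using M(3) A(3) by blast
  obtain m where "a \<notin> M" and bM: "b' \<otimes> a [^] (m :: int) \<in> M"
    by (rule index_p_not_abelian[OF A(1,2) a b' M(1,2) \<open>M \<noteq> A\<close>])
  have shift: "v \<notin> A \<and> generate G {a, v} = carrier G"
    if u: "u \<in> carrier G" "u \<notin> A" "generate G {a, u} = carrier G" and v: "v = u \<otimes> a [^] (k :: int)" for u v k
  proof
    have uv: "u = v \<otimes> a [^] (- k)" using u(1) aG by (simp add: v m_assoc int_pow_mult[symmetric])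
    have vG: "v \<in> carrier G" using u(1) aG by (simp add: v)
    show "v \<notin> A"
    proof
      assume "v \<in> A"
      then have "v \<otimes> a [^] (- k) \<in> A" by (intro subgroup.m_closed[OF A(1)] subgroup_int_pow_closed[OF A(1)] a)
      then show False using u(2) uv by simp
    qed
    have sub: "subgroup (generate G {a, v}) G" by (rule generate_is_subgroup) (use aG vG in simp)
    have av: "a \<in> generate G {a, v}" "v \<in> generate G {a, v}" by (auto intro: generate.incl)
    then have "v \<otimes> a [^] (- k) \<in> generate G {a, v}"
      by (intro subgroup.m_closed[OF sub] subgroup_int_pow_closed[OF sub])
    then have "generate G {a, u} \<subseteq> generate G {a, v}"
      using av by (intro generate_subgroup_incl[OF _ sub]) (simp flip: uv)
    then show "generate G {a, v} = carrier G" using u(3) subgroup.subset[OF sub] by blast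
  qed
  define b where "b = b' \<otimes> a [^] m"
  have b: "b \<in> M" "b \<in> carrier G" "b \<notin> A" "generate G {a, b} = carrier G"
    using bM b'(1) aG shift[OF b', of b m] by (auto simp: b_def)
  define c where "c = commutator G a b"
  define d where "d = commutator G c b"
  have cA: "c \<in> A" and cM: "c \<in> M"
    unfolding c_def using index_p_commutator[OF _ _ aG b(2)] A M by auto
  have cG: "c \<in> carrier G" by (rule subgroup.mem_carrier[OF A(1) cA])
  have dA: "d \<in> A" unfolding d_def by (rule index_p_commutator[OF A(1,2) cG b(2)])
  have dG: "d \<in> carrier G" by (rule subgroup.mem_carrier[OF A(1) dA])
  have db: "d \<otimes> b = b \<otimes> d" and dp: "d [^] p = \<one>"
    unfolding d_def using minimal_nonabelian_relations[OF A M b(1) cA cM] by blast+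
  interpret C: class_three G a b c d
    by unfold_locales (use aG b(2) c_def d_def A(3) a cA dA db in auto)
  have bpA: "b [^] p \<in> A" by (rule index_p_pow[OF A(1,2) b(2)])
  \<comment> \<open>Both \<open>b^p\<close> and \<open>a\<close> lie in the abelian
    \<open>A\<close>. Moving \<open>a\<close> past \<open>b^p\<close> collects \<open>c^p\<close>
    and \<open>d\<close> to the power C(p,2), so their product is trivial.\<close>
  have "b [^] p \<otimes> a = a \<otimes> b [^] p" using A(3) a bpA by blast
  also have "\<dots> = b [^] p \<otimes> (a \<otimes> (c [^] p \<otimes> d [^] tri (int p)))"
    using C.W_b_pow[of 1 0 0 "int p"] aG b(2) cG dG by (simp add: int_pow_int m_assoc)
  finally have "a = a \<otimes> (c [^] p \<otimes> d [^] tri (int p))" using aG b(2) cG dG by simp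
  then have "c [^] p \<otimes> d [^] tri (int p) = \<one>" using aG cG dG by (metis l_cancel_one' int_pow_closed m_closed nat_pow_closed)
  moreover have "d [^] tri (int p) = d [^] eps p"
  proof -
    obtain q where "tri (int p) - eps p = int p * q" using prime_dvd_tri[OF prime_p] by (rule dvdE)
    then have q: "tri (int p) = eps p + int p * q" by simp
    show ?thesis unfolding q using dp dG by (simp add: int_pow_mult int_pow_pow[symmetric] int_pow_int)
  qed
  ultimately have cp: "c [^] p \<otimes> d [^] eps p = \<one>" by simp
  interpret W: word_p_group G "normal_word a b" p n
    by (rule word_p_group_normal_word[OF C.class_three_axioms b(4) dp cp])
  have "K \<noteq> carrier G"
  proof
    assume "K = carrier G"
    then have "p ^ 2 * p ^ n = p ^ n" using K(2) order_pow by (simp add: order_def)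
    then show False using p1 by simp
  qed
  then obtain L where L: "subgroup L G" "subgroup_index G L = p" "K \<subseteq> L"
    by (rule index_p_above[OF K(1)])
  have "L \<noteq> A" using L(3) K(3) A(3) by blast
  obtain k where aL: "a \<notin> L" and b0L: "b \<otimes> a [^] (k :: int) \<in> L"
    by (rule index_p_not_abelian[OF A(1,2) a b(2-4) L(1,2) \<open>L \<noteq> A\<close>])
  define b0 where "b0 = b \<otimes> a [^] k"
  have b0_word: "b0 = normal_word a b 1 k 0 0" by (simp add: b0_def C.normal_word_eq)
  have b0: "b0 \<in> carrier G" "generate G {a, b0} = carrier G"
    using shift[OF b(2-4), of b0 k] aG b(2) by (auto simp: b0_def)
  have c0: "c = commutator G a b0"
    using W.commutator_el[of 0 1 0 0 1 k 0 0] unfolding b0_word C.normal_word_gens by (simp add: C.normal_word_gens)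
  have d0: "d = commutator G c b0"
    using W.commutator_el[of 0 0 1 0 1 k 0 0] unfolding b0_word C.normal_word_gens by (simp add: C.normal_word_gens)
  have db0: "d \<otimes> b0 = b0 \<otimes> d"
    unfolding b0_def by (rule commute_mult) (use dG b(2) aG db C.da commute_int_pow in auto)
  interpret C0: class_three G a b0 c d
    by unfold_locales (use aG b0(1) c0 d0 C.ca C.da C.dc db0 in auto)
  interpret W0: word_p_group G "normal_word a b0" p n
    by (rule word_p_group_normal_word[OF C0.class_three_axioms b0(2) dp cp])
  have "normal_word a b0 1 (- k) 0 0 = b0 \<otimes> a [^] (- k)" using aG b0(1) by (simp add: C0.normal_word_eq)
  also have "\<dots> = b" using aG b(2) by (simp add: b0_def m_assoc int_pow_mult[symmetric])
  finally have "normal_word a b0 1 (- k) 0 0 = b" .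
  then have bM0: "normal_word a b0 1 (- k) 0 0 \<in> M" using b(1) by simp
  have Lp: "p * card L = p ^ n" using index_eq_iff[OF L(1), of p] L(2) order_pow by simp
  have KL: "p * card K = card L"
  proof -
    have "p * (p * card K) = p * card L" using Lp K(2) by (simp add: power2_eq_square)
    then show ?thesis using p1 by simp
  qed
  show ?thesis
    by (rule W0.p_cover_of_subgroups[OF L(1,2) _ _ M(1,2) bM0 M(4) K(1) L(3) KL K(3) A3])
      (use aL b0L that in \<open>auto simp: C0.normal_word_gens simp flip: b0_def\<close>)
qed

lemma p_cover_of_A3_group:
  fixes G (structure)
  assumes A3: "A_group p 3 G" and M: "A_subgroup p 1 M G" "subgroup_index G M = p"
    and A: "subgroup A G" "comm_group (subgroup_as_group G A)" "subgroup_index G A = p"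
    and gens: "min_gens G = 2"
  obtains s t el where "p_cover G p s t el"
proof -
  have "finite_p_group p G" using A3 by (simp add: A_group_def)
  then obtain n where "p_group G p n" using finite_p_group_iff by blast
  then interpret p_group G p n .
  have M': "subgroup M G" "\<not> commutes M" "\<And>H. subgroup H G \<Longrightarrow> H \<subset> M \<Longrightarrow> commutes H"
    using M(1) A1_group_subgroup_iff[of M] unfolding A_subgroup_def by blast+
  have A': "commutes A" using A comm_subgroup_iff by blast
  \<comment> \<open>Viewing the group as a subgroup of itself makes the subgroup criterion
    applicable.\<close>
  have "A_group p 3 (G\<lparr>carrier := carrier G\<rparr>)" using A3 by simp
  from A_group_subgroup_iff[THEN iffD1, OF subgroup_self _ this]
  have "(\<forall>K. subgroup K G \<and> K \<subseteq> carrier G \<and> p ^ 3 * card K = p ^ n \<longrightarrow> commutes K) \<and>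
    (\<exists>K. subgroup K G \<and> K \<subseteq> carrier G \<and> p ^ (3 - 1) * card K = p ^ n \<and> \<not> commutes K)"
    using order_pow unfolding order_def by simp
  then have *: "\<And>H. subgroup H G \<Longrightarrow> H \<subseteq> carrier G \<Longrightarrow> p ^ 3 * card H = p ^ n \<Longrightarrow> commutes H"
    "\<exists>K. subgroup K G \<and> p ^ 2 * card K = p ^ n \<and> \<not> commutes K"
    by (blast, auto)
  from *(2) obtain K where K: "subgroup K G" "p ^ 2 * card K = p ^ n" "\<not> commutes K" by blast
  have "\<exists>m. \<exists>S \<subseteq> carrier G. finite S \<and> card S = m \<and> generate G S = carrier G"
    using finite_carrier generate_incl[OF subset_refl] generate.incl[of _ "carrier G" G] by blast
  then have "\<exists>S \<subseteq> carrier G. finite S \<and> card S = min_gens G \<and> generate G S = carrier G"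
    unfolding min_gens_def by (rule LeastI_ex)
  then obtain S where S: "S \<subseteq> carrier G" "card S = 2" "generate G S = carrier G" using gens by auto
  then obtain x y where "S = {x, y}" by (auto simp: card_2_iff)
  with S have xy: "x \<in> carrier G" "y \<in> carrier G" "generate G {x, y} = carrier G" by auto
  show ?thesis
    by (rule p_cover_of_maximal_subgroups[OF A(1,3) A' M'(1) M(2) M'(2,3) K *(1)[OF _ subgroup.subset] xy]) (simp_all add: that)
qed

section \<open>Isomorphism types\<close>

lemma iso_of_p_cover_labels:
  fixes G :: "('a, 'b) monoid_scheme"
  assumes "p_cover G p s t el" "prime p" "p > 2 \<Longrightarrow> \<not> QuadRes (int p) (int \<eta>)"
  obtains L where "L \<in> labels p \<eta>" "G \<cong> listed_group p L"
proof -
  obtain L s' t' el' where L: "L \<in> labels p \<eta>" "params p L s' t'" "p_cover G p s' t' el'"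
    by (rule p_cover_label[OF assms(1) assms(3)])
  obtain e where "p_cover (listed_group p L) p s' t' e"
    by (rule p_cover_listed_group[OF assms(2) L(2)])
  then obtain h where "h \<in> iso G (listed_group p L)" by (rule p_cover_iso[OF L(3)])
  then have "G \<cong> listed_group p L" by (rule is_isoI)
  with L(1) show ?thesis by (rule that)
qed

lemma p_cover_of_iso:
  fixes G :: "('a, 'b) monoid_scheme" and H :: "('c, 'd) monoid_scheme"
  assumes "p_cover H p s t el" "group G" "G \<cong> H"
  obtains el' where "p_cover G p s t el'"
proof -
  have "H \<cong> G" by (rule group.iso_sym[OF assms(2,3)])
  then obtain h where "h \<in> iso H G" by (auto simp: is_iso_def)
  with p_cover_transport[OF assms(1,2)] that show ?thesis by blast
qed

lemma abelian_maximal_and_two_generators_iff: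
  fixes G :: "('a, 'b) monoid_scheme"
  assumes p: "prime p" and \<eta>: "p > 2 \<Longrightarrow> \<not> QuadRes (int p) (int \<eta>)"
    and G: "A_group p 3 G" and M: "A_subgroup p 1 M G" "subgroup_index G M = p"
  shows "(\<exists>A. subgroup A G \<and> comm_group (subgroup_as_group G A) \<and> subgroup_index G A = p) \<and> min_gens G = 2
    \<longleftrightarrow> (\<exists>L \<in> labels p \<eta>. G \<cong> listed_group p L)"
proof
  assume "(\<exists>A. subgroup A G \<and> comm_group (subgroup_as_group G A) \<and> subgroup_index G A = p) \<and> min_gens G = 2"
  then obtain A where A: "subgroup A G" "comm_group (subgroup_as_group G A)" "subgroup_index G A = p"
    and gens: "min_gens G = 2" by blast
  obtain s t el where "p_cover G p s t el" by (rule p_cover_of_A3_group[OF G M A gens])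
  then obtain L where "L \<in> labels p \<eta>" "G \<cong> listed_group p L"
    by (rule iso_of_p_cover_labels[OF _ p \<eta>])
  then show "\<exists>L \<in> labels p \<eta>. G \<cong> listed_group p L" by blast
next
  assume "\<exists>L \<in> labels p \<eta>. G \<cong> listed_group p L"
  then obtain L where L: "L \<in> labels p \<eta>" "G \<cong> listed_group p L" by blast
  obtain s t where st: "params p L s t" by (rule params_exist[OF p \<eta> L(1)])
  obtain e where e: "p_cover (listed_group p L) p s t e" by (rule p_cover_listed_group[OF p st])
  have "group G" using G by (simp add: A_group_def finite_p_group_def)
  then obtain el where "p_cover G p s t el" by (rule p_cover_of_iso[OF e _ L(2)])
  then interpret p_cover G p s t el .
  have "subgroup_index G abel = p" by (rule index_line) (use not_dvd_one in simp)
  moreover have "comm_group (subgroup_as_group G abel)"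
    using comm_subgroup_iff[OF subgroup_line] commutes_abel by blast
  ultimately show "(\<exists>A. subgroup A G \<and> comm_group (subgroup_as_group G A) \<and> subgroup_index G A = p) \<and> min_gens G = 2"
    using subgroup_line min_gens_eq by blast
qed

text \<open>Through an isomorphism the first group carries covers for both parameter pairs, and
  \<open>label_unique\<close> compares them.\<close>

lemma listed_groups_not_iso:
  assumes p: "prime p" and \<eta>: "p > 2 \<Longrightarrow> \<not> QuadRes (int p) (int \<eta>)"
    and L: "L \<in> labels p \<eta>" "L' \<in> labels p \<eta>" and iso: "listed_group p L \<cong> listed_group p L'"
  shows "L = L'"
proof -
  obtain s t where st: "params p L s t" by (rule params_exist[OF p \<eta> L(1)])
  obtain s' t' where st': "params p L' s' t'" by (rule params_exist[OF p \<eta> L(2)])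
  obtain e where e: "p_cover (listed_group p L) p s t e" by (rule p_cover_listed_group[OF p st])
  obtain e' where e': "p_cover (listed_group p L') p s' t' e'" by (rule p_cover_listed_group[OF p st'])
  obtain e'' where "p_cover (listed_group p L) p s' t' e''"
    by (rule p_cover_of_iso[OF e' group_listed_group iso])
  then show ?thesis by (rule label_unique[OF e _ st st' L \<eta>])
qed

lemma listed_group_invariants:
  assumes p: "prime p" and \<eta>: "p > 2 \<Longrightarrow> \<not> QuadRes (int p) (int \<eta>)" and L: "L \<in> labels p \<eta>"
  shows "nilpotency_class (listed_group p L) = 3"
    and "p = 2 \<Longrightarrow> subgroup_as_group (listed_group p L) (derived_subgroup (listed_group p L)) \<cong> cyc 4"
    and "p > 2 \<Longrightarrow> subgroup_as_group (listed_group p L) (derived_subgroup (listed_group p L)) \<cong> cyc p \<times>\<times> cyc p"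
    and "mu p 0 (listed_group p L) = 1" "mu p 1 (listed_group p L) = p - 1" "mu p 2 (listed_group p L) = 1"
    and "alpha1 p (listed_group p L) = p ^ 2 + p - 1"
proof -
  obtain s t where st: "params p L s t" by (rule params_exist[OF p \<eta> L])
  obtain e where "p_cover (listed_group p L) p s t e" by (rule p_cover_listed_group[OF p st])
  then interpret P: p_cover "listed_group p L" p s t e .
  show "nilpotency_class (listed_group p L) = 3" by (rule P.nilpotency_class_eq)
  show "subgroup_as_group (listed_group p L) (derived_subgroup (listed_group p L)) \<cong> cyc 4" if "p = 2"
    unfolding P.derived_eq using that by (rule P.derv_iso_cyc)
  show "subgroup_as_group (listed_group p L) (derived_subgroup (listed_group p L)) \<cong> cyc p \<times>\<times> cyc p" if "p > 2"
    unfolding P.derived_eq using that by (intro P.derv_iso_prod) simp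
  show "mu p 0 (listed_group p L) = 1" "mu p 1 (listed_group p L) = p - 1" "mu p 2 (listed_group p L) = 1"
    "alpha1 p (listed_group p L) = p ^ 2 + p - 1"
    by (rule P.mu_0 P.mu_1 P.mu_2 P.alpha1_eq)+
qed

section \<open>Order, Frattini subgroup, derived subgroup and centre of each listed group\<close>

lemma structure_A1:
  defines "P \<equiv> listed_group 2 A1" and "a \<equiv> listed_gen 2 A1 La" and "c \<equiv> listed_gen 2 A1 Lc"
  shows "order P = 2 ^ 5 \<and> frattini P = generate P {a [^]\<^bsub>P\<^esub> (2::nat), c} \<and>
    subgroup_as_group P (frattini P) \<cong> cyc 4 \<times>\<times> cyc 2 \<and> derived_subgroup P = generate P {c} \<and>
    group_center P = generate P {a [^]\<^bsub>P\<^esub> (2::nat), c [^]\<^bsub>P\<^esub> (2::nat)} \<and>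
    subgroup_as_group P (group_center P) \<cong> cyc 2 \<times>\<times> cyc 2"
proof -
  obtain e where e: "p_cover P 2 0 0 e" "\<And>x. x \<in> alphabet A1 \<Longrightarrow> listed_gen 2 A1 x = letter_el e A1 x"
    unfolding P_def by (rule p_cover_listed_group[of 2 A1 0 0]) auto
  interpret p_cover P 2 0 0 e by (rule e(1))
  have ac: "a = e (- 1) 1 (- 1) 1" "c = e 0 0 1 (- 1)" using e(2) by (simp_all add: a_def c_def)
  show ?thesis
    unfolding ac letter_facts_2[OF refl]
    using order_eq structure_2[OF refl] frat_iso_cyc_4[OF refl] cent_iso_prod frattini_eq group_center_eq
    by simp
qed

lemma structure_A2:
  defines "P \<equiv> listed_group 2 A2" and "b \<equiv> listed_gen 2 A2 Lb" and "c \<equiv> listed_gen 2 A2 Lc"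
  shows "order P = 2 ^ 5 \<and> frattini P = generate P {b [^]\<^bsub>P\<^esub> (2::nat), c} \<and>
    subgroup_as_group P (frattini P) \<cong> cyc 4 \<times>\<times> cyc 2 \<and> derived_subgroup P = generate P {c} \<and>
    group_center P = generate P {b [^]\<^bsub>P\<^esub> (2::nat), c [^]\<^bsub>P\<^esub> (2::nat)} \<and>
    subgroup_as_group P (group_center P) \<cong> cyc 2 \<times>\<times> cyc 2"
proof -
  obtain e where e: "p_cover P 2 0 1 e" "\<And>x. x \<in> alphabet A2 \<Longrightarrow> listed_gen 2 A2 x = letter_el e A2 x"
    unfolding P_def by (rule p_cover_listed_group[of 2 A2 0 1]) auto
  interpret p_cover P 2 0 1 e by (rule e(1))
  have bc: "b = e (- 1) 1 (- 1) 1" "c = e 0 0 1 0"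
    using e(2) letter_facts_2(2) by (simp_all add: b_def c_def)
  show ?thesis
    unfolding bc letter_facts_2[OF refl]
    using order_eq structure_2[OF refl] frat_iso_cyc_4[OF refl] cent_iso_prod frattini_eq group_center_eq
    by simp
qed

lemma structure_A3:
  defines "P \<equiv> listed_group 2 A3" and "a \<equiv> listed_gen 2 A3 La" and "c \<equiv> listed_gen 2 A3 Lc"
  shows "order P = 2 ^ 5 \<and> frattini P = generate P {a [^]\<^bsub>P\<^esub> (2::nat), c} \<and>
    subgroup_as_group P (frattini P) \<cong> cyc 4 \<times>\<times> cyc 2 \<and> derived_subgroup P = generate P {c} \<and>
    group_center P = generate P {a [^]\<^bsub>P\<^esub> (2::nat)} \<and>
    subgroup_as_group P (group_center P) \<cong> cyc 4"
proof -
  obtain e where e: "p_cover P 2 1 0 e" "\<And>x. x \<in> alphabet A3 \<Longrightarrow> listed_gen 2 A3 x = letter_el e A3 x"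
    unfolding P_def by (rule p_cover_listed_group[of 2 A3 1 0]) auto
  interpret p_cover P 2 1 0 e by (rule e(1))
  have ac: "a = e (- 1) 1 (- 1) 1" "c = e 0 0 1 (- 1)" using e(2) by (simp_all add: a_def c_def)
  show ?thesis
    unfolding ac letter_facts_2[OF refl]
    using order_eq structure_2[OF refl] frat_iso_cyc_4[OF refl] cent_iso_cyc frattini_eq group_center_eq
    by simp
qed

lemma structure_A4:
  fixes p \<nu> :: nat
  assumes p: "prime p" "p > 2" and \<eta>: "\<not> QuadRes (int p) (int \<eta>)" and \<nu>: "\<nu> \<in> {1, \<eta>}"
  defines "P \<equiv> listed_group p (A4 \<nu>)" and "a \<equiv> listed_gen p (A4 \<nu>) La" and "c \<equiv> listed_gen p (A4 \<nu>) Lc"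
  shows "order P = p ^ 5 \<and> frattini P = generate P {a [^]\<^bsub>P\<^esub> p, c} \<and>
    subgroup_as_group P (frattini P) \<cong> cyc (p ^ 2) \<times>\<times> cyc p \<and>
    derived_subgroup P = generate P {a [^]\<^bsub>P\<^esub> (p ^ 2), c} \<and>
    group_center P = generate P {a [^]\<^bsub>P\<^esub> p} \<and>
    subgroup_as_group P (group_center P) \<cong> cyc (p ^ 2)"
proof -
  have p2: "p \<noteq> 2" using p by simp
  have "A4 \<nu> \<in> labels p \<eta>" using \<nu> p by (auto simp: labels_def)
  then obtain s t where st: "params p (A4 \<nu>) s t" using params_exist[OF p(1), of \<eta>] \<eta> by metis
  obtain e where e: "p_cover P p s t e" "\<And>x. x \<in> alphabet (A4 \<nu>) \<Longrightarrow> listed_gen p (A4 \<nu>) x = letter_el e (A4 \<nu>) x"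
    unfolding P_def using p_cover_listed_group[OF p(1) st] by metis
  interpret p_cover P p s t e by (rule e(1))
  have "int p dvd int \<nu> * s - 1" using st by simp
  then have s: "\<not> int p dvd s" using not_dvd_one dvd_diff[of "int p" "int \<nu> * s" "int \<nu> * s - 1"] by auto
  have ac: "a = e 0 1 0 0" "c = e 0 0 1 0" using e(2) by (simp_all add: a_def c_def)
  have ap: "a [^]\<^bsub>P\<^esub> p = e 0 (int p) 0 0" "a [^]\<^bsub>P\<^esub> (p ^ 2) = e 0 (int p * int p) 0 0"
    unfolding ac by (simp_all add: el_nat_pow power2_eq_square)
  show ?thesis
    unfolding ap ac(2)
    using order_eq structure_odd(4-6)[OF p2 s] frat_iso_cyc_p_squared[OF p2 s] cent_iso_cyc[OF s] frattini_eq group_center_eq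
    by simp
qed

lemma structure_A5:
  fixes p :: nat
  assumes p: "prime p" "p > 2"
  defines "P \<equiv> listed_group p A5" and "a \<equiv> listed_gen p A5 La" and "b \<equiv> listed_gen p A5 Lb"
    and "c \<equiv> listed_gen p A5 Lc"
  shows "order P = p ^ 5 \<and> frattini P = generate P {a [^]\<^bsub>P\<^esub> p, b [^]\<^bsub>P\<^esub> p, c} \<and>
    subgroup_as_group P (frattini P) \<cong> cyc p \<times>\<times> cyc p \<times>\<times> cyc p \<and>
    derived_subgroup P = generate P {b [^]\<^bsub>P\<^esub> p, c} \<and>
    group_center P = generate P {a [^]\<^bsub>P\<^esub> p, b [^]\<^bsub>P\<^esub> p} \<and>
    subgroup_as_group P (group_center P) \<cong> cyc p \<times>\<times> cyc p"
proof -
  have p2: "p \<noteq> 2" using p by simp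
  then have st: "params p A5 0 1" by simp
  obtain e where e: "p_cover P p 0 1 e" "\<And>x. x \<in> alphabet A5 \<Longrightarrow> listed_gen p A5 x = letter_el e A5 x"
    unfolding P_def using p_cover_listed_group[OF p(1) st] by metis
  interpret p_cover P p 0 1 e by (rule e(1))
  have abc: "a = e 0 1 0 0" "b = e 1 0 0 0" "c = e 0 0 1 0" using e(2) by (simp_all add: a_def b_def c_def)
  have ap: "a [^]\<^bsub>P\<^esub> p = e 0 (int p) 0 0" "b [^]\<^bsub>P\<^esub> p = e 0 0 0 1"
    unfolding abc using el_p_n[of 1 0 0 0] by (simp_all add: el_nat_pow)
  show ?thesis
    unfolding ap abc(3)
    using order_eq structure_odd(1-3)[OF p2] frat_iso_cyc_p[OF p2] cent_iso_prod frattini_eq group_center_eq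
    by simp
qed

lemma structure_A6:
  fixes p :: nat
  assumes p: "prime p" "p > 2"
  defines "P \<equiv> listed_group p A6" and "a \<equiv> listed_gen p A6 La" and "c \<equiv> listed_gen p A6 Lc"
    and "d \<equiv> listed_gen p A6 Ld"
  shows "order P = p ^ 5 \<and> frattini P = generate P {a [^]\<^bsub>P\<^esub> p, c, d} \<and>
    subgroup_as_group P (frattini P) \<cong> cyc p \<times>\<times> cyc p \<times>\<times> cyc p \<and>
    derived_subgroup P = generate P {c, d} \<and>
    group_center P = generate P {a [^]\<^bsub>P\<^esub> p, d} \<and>
    subgroup_as_group P (group_center P) \<cong> cyc p \<times>\<times> cyc p"
proof -
  have p2: "p \<noteq> 2" using p by simp
  then have st: "params p A6 0 0" by simp
  obtain e where e: "p_cover P p 0 0 e" "\<And>x. x \<in> alphabet A6 \<Longrightarrow> listed_gen p A6 x = letter_el e A6 x"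
    unfolding P_def using p_cover_listed_group[OF p(1) st] by metis
  interpret p_cover P p 0 0 e by (rule e(1))
  have acd: "a = e 0 1 0 0" "c = e 0 0 1 0" "d = e 0 0 0 1" using e(2) by (simp_all add: a_def c_def d_def)
  have ap: "a [^]\<^bsub>P\<^esub> p = e 0 (int p) 0 0" unfolding acd by (simp add: el_nat_pow)
  have swap: "{x, e 0 0 1 0, e 0 0 0 1} = {x, e 0 0 0 1, e 0 0 1 0}" "{e 0 0 1 0, e 0 0 0 1} = {e 0 0 0 1, e 0 0 1 0}" for x
    by auto
  show ?thesis
    unfolding ap acd(2,3) swap
    using order_eq structure_odd(1-3)[OF p2] frat_iso_cyc_p[OF p2] cent_iso_prod frattini_eq group_center_eq
    by simp
qed

theorem theorem4p1:
  fixes p \<eta> :: nat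
  assumes "prime p"
    and "p > 2 \<Longrightarrow> \<not> QuadRes (int p) (int \<eta>)"
  shows
   "(\<forall>G :: ('a, 'b) monoid_scheme.
      A_group p 3 G \<and> (\<exists>M. A_subgroup p 1 M G \<and> subgroup_index G M = p) \<longrightarrow>
      ((\<exists>A. subgroup A G \<and> comm_group (subgroup_as_group G A) \<and> subgroup_index G A = p) \<and>
         min_gens G = 2
       \<longleftrightarrow> (\<exists>L \<in> labels p \<eta>. G \<cong> listed_group p L))) \<and>
    (\<forall>L \<in> labels p \<eta>. \<forall>L' \<in> labels p \<eta>. L \<noteq> L' \<longrightarrow> \<not> listed_group p L \<cong> listed_group p L') \<and>
    (p = 2 \<longrightarrow>
      (\<forall>L \<in> labels p \<eta>. nilpotency_class (listed_group p L) = 3 \<and>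
        subgroup_as_group (listed_group p L) (derived_subgroup (listed_group p L)) \<cong> cyc 4) \<and>
      (let P = listed_group p A1; a = listed_gen p A1 La; c = listed_gen p A1 Lc in
        order P = 2 ^ 5 \<and>
        frattini P = generate P {a [^]\<^bsub>P\<^esub> (2::nat), c} \<and>
        subgroup_as_group P (frattini P) \<cong> cyc 4 \<times>\<times> cyc 2 \<and>
        derived_subgroup P = generate P {c} \<and>
        group_center P = generate P {a [^]\<^bsub>P\<^esub> (2::nat), c [^]\<^bsub>P\<^esub> (2::nat)} \<and>
        subgroup_as_group P (group_center P) \<cong> cyc 2 \<times>\<times> cyc 2) \<and>
      (let P = listed_group p A2; b = listed_gen p A2 Lb; c = listed_gen p A2 Lc in
        order P = 2 ^ 5 \<and>
        frattini P = generate P {b [^]\<^bsub>P\<^esub> (2::nat), c} \<and>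
        subgroup_as_group P (frattini P) \<cong> cyc 4 \<times>\<times> cyc 2 \<and>
        derived_subgroup P = generate P {c} \<and>
        group_center P = generate P {b [^]\<^bsub>P\<^esub> (2::nat), c [^]\<^bsub>P\<^esub> (2::nat)} \<and>
        subgroup_as_group P (group_center P) \<cong> cyc 2 \<times>\<times> cyc 2) \<and>
      (let P = listed_group p A3; a = listed_gen p A3 La; c = listed_gen p A3 Lc in
        order P = 2 ^ 5 \<and>
        frattini P = generate P {a [^]\<^bsub>P\<^esub> (2::nat), c} \<and>
        subgroup_as_group P (frattini P) \<cong> cyc 4 \<times>\<times> cyc 2 \<and>
        derived_subgroup P = generate P {c} \<and>
        group_center P = generate P {a [^]\<^bsub>P\<^esub> (2::nat)} \<and>
        subgroup_as_group P (group_center P) \<cong> cyc 4)) \<and>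
    (p > 2 \<longrightarrow>
      (\<forall>L \<in> labels p \<eta>. nilpotency_class (listed_group p L) = 3 \<and>
        subgroup_as_group (listed_group p L) (derived_subgroup (listed_group p L)) \<cong> cyc p \<times>\<times> cyc p) \<and>
      (\<forall>\<nu> \<in> {1, \<eta>}. (let P = listed_group p (A4 \<nu>); a = listed_gen p (A4 \<nu>) La; c = listed_gen p (A4 \<nu>) Lc in
        order P = p ^ 5 \<and>
        frattini P = generate P {a [^]\<^bsub>P\<^esub> p, c} \<and>
        subgroup_as_group P (frattini P) \<cong> cyc (p ^ 2) \<times>\<times> cyc p \<and>
        derived_subgroup P = generate P {a [^]\<^bsub>P\<^esub> (p ^ 2), c} \<and>
        group_center P = generate P {a [^]\<^bsub>P\<^esub> p} \<and>
        subgroup_as_group P (group_center P) \<cong> cyc (p ^ 2))) \<and>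
      (let P = listed_group p A5; a = listed_gen p A5 La; b = listed_gen p A5 Lb; c = listed_gen p A5 Lc in
        order P = p ^ 5 \<and>
        frattini P = generate P {a [^]\<^bsub>P\<^esub> p, b [^]\<^bsub>P\<^esub> p, c} \<and>
        subgroup_as_group P (frattini P) \<cong> cyc p \<times>\<times> cyc p \<times>\<times> cyc p \<and>
        derived_subgroup P = generate P {b [^]\<^bsub>P\<^esub> p, c} \<and>
        group_center P = generate P {a [^]\<^bsub>P\<^esub> p, b [^]\<^bsub>P\<^esub> p} \<and>
        subgroup_as_group P (group_center P) \<cong> cyc p \<times>\<times> cyc p) \<and>
      (let P = listed_group p A6; a = listed_gen p A6 La; c = listed_gen p A6 Lc; d = listed_gen p A6 Ld in
        order P = p ^ 5 \<and>
        frattini P = generate P {a [^]\<^bsub>P\<^esub> p, c, d} \<and>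
        subgroup_as_group P (frattini P) \<cong> cyc p \<times>\<times> cyc p \<times>\<times> cyc p \<and>
        derived_subgroup P = generate P {c, d} \<and>
        group_center P = generate P {a [^]\<^bsub>P\<^esub> p, d} \<and>
        subgroup_as_group P (group_center P) \<cong> cyc p \<times>\<times> cyc p)) \<and>
    (\<forall>L \<in> labels p \<eta>.
      mu p 0 (listed_group p L) = 1 \<and> mu p 1 (listed_group p L) = p - 1 \<and>
      mu p 2 (listed_group p L) = 1 \<and> alpha1 p (listed_group p L) = p ^ 2 + p - 1)"
proof -
  note p = assms(1) and \<eta> = assms(2)
  show ?thesis
  proof (intro conjI impI)
    show "\<forall>G :: ('a, 'b) monoid_scheme.
      A_group p 3 G \<and> (\<exists>M. A_subgroup p 1 M G \<and> subgroup_index G M = p) \<longrightarrow>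
      ((\<exists>A. subgroup A G \<and> comm_group (subgroup_as_group G A) \<and> subgroup_index G A = p) \<and>
         min_gens G = 2
       \<longleftrightarrow> (\<exists>L \<in> labels p \<eta>. G \<cong> listed_group p L))"
      using abelian_maximal_and_two_generators_iff[OF p \<eta>] by blast
    show "\<forall>L \<in> labels p \<eta>. \<forall>L' \<in> labels p \<eta>. L \<noteq> L' \<longrightarrow> \<not> listed_group p L \<cong> listed_group p L'"
      using listed_groups_not_iso[OF p \<eta>] by blast
  next
    assume "p = 2"
    then show "\<forall>L \<in> labels p \<eta>. nilpotency_class (listed_group p L) = 3 \<and>
        subgroup_as_group (listed_group p L) (derived_subgroup (listed_group p L)) \<cong> cyc 4"
      using listed_group_invariants(1,2)[OF p \<eta>] by blast
  next
    assume 2: "p > 2"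
    then show "\<forall>L \<in> labels p \<eta>. nilpotency_class (listed_group p L) = 3 \<and>
        subgroup_as_group (listed_group p L) (derived_subgroup (listed_group p L)) \<cong> cyc p \<times>\<times> cyc p"
      using listed_group_invariants(1,3)[OF p \<eta>] by blast
    show "\<forall>\<nu> \<in> {1, \<eta>}. (let P = listed_group p (A4 \<nu>); a = listed_gen p (A4 \<nu>) La; c = listed_gen p (A4 \<nu>) Lc in
        order P = p ^ 5 \<and>
        frattini P = generate P {a [^]\<^bsub>P\<^esub> p, c} \<and>
        subgroup_as_group P (frattini P) \<cong> cyc (p ^ 2) \<times>\<times> cyc p \<and>
        derived_subgroup P = generate P {a [^]\<^bsub>P\<^esub> (p ^ 2), c} \<and>
        group_center P = generate P {a [^]\<^bsub>P\<^esub> p} \<and>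
        subgroup_as_group P (group_center P) \<cong> cyc (p ^ 2))"
      unfolding Let_def using structure_A4[OF p 2 \<eta>[OF 2]] by blast
    show "let P = listed_group p A5; a = listed_gen p A5 La; b = listed_gen p A5 Lb; c = listed_gen p A5 Lc in
        order P = p ^ 5 \<and>
        frattini P = generate P {a [^]\<^bsub>P\<^esub> p, b [^]\<^bsub>P\<^esub> p, c} \<and>
        subgroup_as_group P (frattini P) \<cong> cyc p \<times>\<times> cyc p \<times>\<times> cyc p \<and>
        derived_subgroup P = generate P {b [^]\<^bsub>P\<^esub> p, c} \<and>
        group_center P = generate P {a [^]\<^bsub>P\<^esub> p, b [^]\<^bsub>P\<^esub> p} \<and>
        subgroup_as_group P (group_center P) \<cong> cyc p \<times>\<times> cyc p"
      unfolding Let_def by (rule structure_A5[OF p 2])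
    show "let P = listed_group p A6; a = listed_gen p A6 La; c = listed_gen p A6 Lc; d = listed_gen p A6 Ld in
        order P = p ^ 5 \<and>
        frattini P = generate P {a [^]\<^bsub>P\<^esub> p, c, d} \<and>
        subgroup_as_group P (frattini P) \<cong> cyc p \<times>\<times> cyc p \<times>\<times> cyc p \<and>
        derived_subgroup P = generate P {c, d} \<and>
        group_center P = generate P {a [^]\<^bsub>P\<^esub> p, d} \<and>
        subgroup_as_group P (group_center P) \<cong> cyc p \<times>\<times> cyc p"
      unfolding Let_def by (rule structure_A6[OF p 2])
  next
    show "\<forall>L \<in> labels p \<eta>.
      mu p 0 (listed_group p L) = 1 \<and> mu p 1 (listed_group p L) = p - 1 \<and>
      mu p 2 (listed_group p L) = 1 \<and> alpha1 p (listed_group p L) = p ^ 2 + p - 1"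
      using listed_group_invariants(4-7)[OF p \<eta>] by blast
  qed (unfold Let_def, (hypsubst, rule structure_A1 structure_A2 structure_A3)+)
qed

end
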